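(* Let $V$ be a complex vector space of finite dimension $n>0$ with a nonsingular symmetric bilinear form, and let $\Phi_{\mathrm{Spin}}:\mathrm{Spin}(V)\to\mathrm{Lie}\,\mathrm{Spin}(V)=\wedge^2V$ be the generalized Cayley mapping of the spin representation $\mathrm{Spin}:\mathrm{Spin}(V)\to\mathrm{Aut}(S)$. Let $g\in\mathrm{Spin}(V)^*=\{g\in\mathrm{Spin}(V):\det(1+T(g))\ne0\}$, and let the sign of the square root be chosen so that $\mathrm{pr}_0(g)=2^{-n/2}\sqrt{\det(1+T(g))}$. Then $$\Phi_{\mathrm{Spin}}(g)=-2\,\mathrm{pr}_0(g)\,\tau^{-1}(\Gamma(T(g)))\in\wedge^2V,\qquad \Gamma(b)=\frac{1-b}{1+b}.$$ Thus the generalized Cayley mapping $\Phi_{\mathrm{Spin}}:\mathrm{Spin}(V)\to\wedge^2V$ factors (on $\mathrm{Spin}(V)^*=T^{-1}(SO(V)^* )$) to the classical Cayley transform $\Gamma:SO(V)^*\to\mathrm{Lie}\,SO(V)^{( * )}$, up to multiplication by a regular function, via the natural identifications. The degree $\deg(\mathrm{Spin})=[Q(\mathrm{Spin}(V)):Q(\mathrm{Lie}\,\mathrm{Spin}(V))]$ (field extension via $\Phi_{\mathrm{Spin}}^*$) is $n$ if $n$ is even and $n-1$ if $n$ is odd. Let $\chi\in A(\mathrm{Spin}(V))$ be given by $\chi(a)=\sqrt{\det(1+T(a))}=2^{n/2}\mathrm{pr}_0(a)$. Then, identifying functions on $\mathrm{Lie}\,\mathrm{Spin}(V)$ with their pullbacks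 under $\Phi_{\mathrm{Spin}}$, $$Q(\mathrm{Spin}(V))^{\mathrm{Spin}(V)}=Q(\mathrm{Lie}\,\mathrm{Spin}(V))^{\mathrm{Spin}(V)}[\chi],\qquad Q(\mathrm{Spin}(V))=Q(\mathrm{Lie}\,\mathrm{Spin}(V))[\chi].$$
   Context: Let $(\ ,\ )$ be the form on $V$, extended naturally to $\wedge V$. For $x\in V$ let $\epsilon(x)$ be left exterior multiplication on $\wedge V$ and $\iota(x)$ its transpose (the degree $-1$ superderivation with $\iota(x)y=(x,y)$). The Clifford algebra $C(V)=T(V)/\langle x\otimes x-(x,x)\rangle$ (here $T(V)$ is the tensor algebra) acts on $\wedge V$ by $x\mapsto\gamma(x)=\epsilon(x)+\iota(x)$ and is identified with $\wedge V$ via $u\mapsto\gamma(u)1$; $uv$ denotes Clifford multiplication. $C^0(V)=\wedge^{\mathrm{even}}V$. $\mathrm{pr}_k:C(V)=\wedge V\to\wedge^kV$ is the projection, $\wedge^0V=\mathbb C$. $\alpha$ is the antiautomorphism of $\wedge V$ (and of $C(V)$) that is the identity on $V$. $\mathrm{Spin}(V)=\{g\in C^0(V): g\alpha(g)=1,\ gx\alpha(g)\in V\ \forall x\in V\}$, $T(g)x=gx\alpha(g)$ for $x\in V$; $T:\mathrm{Spin}(V)\to SO(V)$ is a double cover, and $\mathrm{Lie}\,\mathrm{Spin}(V)=\wedge^2V$ with Clifford commutator. The differential of $T$ is the isomorphism $\tau:\wedge^2V\to\mathrm{Lie}\,SO(V)$, $\tau(u)x=-2\iota(x)u=[u,x]$.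 $SO(V)^*=\{a\in SO(V):\det(1+a)\ne0\}$ and $\mathrm{Lie}\,SO(V)^{( * )}=\{s\in \mathrm{Lie}\,SO(V): 1+s \text{ and } 1-s\text{ invertible}\}$. Spin module: let $\mu\in\wedge^nV$ with $\mu^2=1$, $e_\pm=\frac12(1\pm\mu)$, and let $C^Z(V)$ be the centralizer of $Z=\wedge^0V+\wedge^nV$ in $C(V)$; it contains $C^0(V)$ and is the direct sum of the two simple ideals $e_\pm C^Z(V)$, each a matrix algebra of size $2^{n_1-1}$, $n_1=[\frac{n+1}2]$. $S=S_+\oplus S_-$ is the $C^Z(V)$-module of dimension $2^{n_1}$ with $S_\pm=e_\pm S$ irreducible; $\sigma:C^Z(V)\to\mathrm{End}(S)$ is this representation, and $\mathrm{Spin}=\sigma|_{\mathrm{Spin}(V)}$, with differential $\sigma|_{\wedge^2V}$. Generalized Cayley mapping: $\Phi_{\mathrm{Spin}}(g)\in\wedge^2V$ is determined by $\mathrm{tr}(\sigma(\Phi_{\mathrm{Spin}}(g))\sigma(y))=\mathrm{tr}(\sigma(g)\sigma(y))$ for all $y\in\wedge^2V$; it is a dominant morphism. $A(\cdot)$ denotes regular functions, $Q(\cdot)$ rational functions, and superscript $\mathrm{Spin}(V)$ denotes invariants under conjugation, resp. the adjoint action.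
   Formalization: The degree formula is stated only for n ≥ 2: for n = 1, Spin(V) = {1, −1} and ∧²V = 0, so Q(Spin(V)) = C × C has dimension 2 over C and the value n − 1 = 0 is false; all other claims are stated for every n > 0. *)

theory Defs
  imports "HOL-Analysis.Analysis" "HOL-Algebra.Finite_Extensions" "HOL-Algebra.QuotRing"
begin

text \<open>
  The vector space \<open>V\<close> is \<^typ>\<open>complex^'n\<close> with an arbitrary nonsingular symmetric bilinear
  form \<open>B\<close>; its dimension is \<open>n = CARD('n) > 0\<close>. The standard basis \<open>e\<^sub>i\<close> is only a basis of \<open>V\<close>,
  not assumed to be orthogonal for \<open>B\<close>. The linear order on the index type only serves to write
  down the basis \<open>e\<^sub>I = e\<^bsub>i\<^sub>1\<^esub> \<and> \<dots> \<and> e\<^bsub>i\<^sub>k\<^esub>\<close>, \<open>I = {i\<^sub>1 < \<dots> < i\<^sub>k}\<close>, of the exterior algebra.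
\<close>

type_synonym 'n cvec = "complex^'n"
type_synonym 'n cmat = "complex^'n^'n"
type_synonym 'n form = "'n cvec \<Rightarrow> 'n cvec \<Rightarrow> complex"

definition nonsingular_symmetric_form :: "'n::finite form \<Rightarrow> bool" where
  "nonsingular_symmetric_form B \<longleftrightarrow>
     (\<forall>x. Vector_Spaces.linear (*s) (*) (B x)) \<and> (\<forall>x y. B x y = B y x) \<and>
     (\<forall>x. (\<forall>y. B x y = 0) \<longrightarrow> x = 0)"


section \<open>The exterior algebra\<close>

text \<open>An element \<open>u\<close> of \<open>\<wedge>V\<close> is its family of coefficients \<open>u $ I\<close> in the basis \<open>e\<^sub>I\<close>.\<close>

type_synonym 'n ext = "complex^('n set)"

text \<open>\<open>e\<^sub>I \<and> e\<^sub>J = shuffle_sign I J e\<^bsub>I \<union> J\<^esub>\<close> for disjoint \<open>I\<close>, \<open>J\<close>.\<close>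

definition shuffle_sign :: "'n::{finite,linorder} set \<Rightarrow> 'n set \<Rightarrow> complex" where
  "shuffle_sign I J = (-1) ^ card {(i, j). i \<in> I \<and> j \<in> J \<and> j < i}"

definition wedge :: "'n::{finite,linorder} ext \<Rightarrow> 'n ext \<Rightarrow> 'n ext" where
  "wedge u v = (\<chi> K. \<Sum>I\<in>Pow K. shuffle_sign I (K - I) * u $ I * v $ (K - I))"

text \<open>The unit of \<open>\<wedge>V\<close>; the library's \<^term>\<open>1 :: 'n::finite ext\<close> is the all-ones vector.\<close>

definition ext_one :: "'n::finite ext" where
  "ext_one = axis {} 1"

definition ext_vec :: "'n::finite cvec \<Rightarrow> 'n ext" where
  "ext_vec x = (\<Sum>i\<in>UNIV. x $ i *s axis {i} 1)"

text \<open>The coordinates of \<open>pr\<^sub>1 u \<in> \<wedge>\<^sup>1V = V\<close>.\<close>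

definition ext_to_vec :: "'n::finite ext \<Rightarrow> 'n cvec" where
  "ext_to_vec u = (\<chi> i. u $ {i})"

definition ext_degree :: "nat \<Rightarrow> 'n::finite ext set" where
  "ext_degree k = {u. \<forall>I. card I \<noteq> k \<longrightarrow> u $ I = 0}"

definition ext_even :: "'n::finite ext set" where
  "ext_even = {u. \<forall>I. odd (card I) \<longrightarrow> u $ I = 0}"

definition pr0 :: "'n::finite ext \<Rightarrow> complex" where
  "pr0 u = u $ {}"

text \<open>The antiautomorphism \<open>\<alpha>\<close>: reversing the \<open>k\<close> factors of \<open>e\<^sub>I\<close> takes \<open>k choose 2\<close>
  transpositions (see \<open>ext_rev_wedge\<close> and \<open>ext_rev_vec\<close> below).\<close>

definition ext_rev :: "'n::finite ext \<Rightarrow> 'n ext" where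
  "ext_rev u = (\<chi> I. (-1) ^ (card I choose 2) * u $ I)"

definition eps :: "'n::{finite,linorder} cvec \<Rightarrow> 'n ext \<Rightarrow> 'n ext" where
  "eps x u = wedge (ext_vec x) u"

text \<open>\<open>\<iota>(x)\<close>, the superderivation of degree \<open>-1\<close> with \<open>\<iota>(x) y = (x, y)\<close>
  (see \<open>iota_wedge\<close> and \<open>iota_vec\<close> below).\<close>

definition iota :: "'n::{finite,linorder} form \<Rightarrow> 'n cvec \<Rightarrow> 'n ext \<Rightarrow> 'n ext" where
  "iota B x u = (\<chi> J. \<Sum>j\<in>- J. shuffle_sign {j} J * B x (axis j 1) * u $ insert j J)"

definition gam :: "'n::{finite,linorder} form \<Rightarrow> 'n cvec \<Rightarrow> 'n ext \<Rightarrow> 'n ext" where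
  "gam B x u = eps x u + iota B x u"


lemma shuffle_sign_union_right:
  assumes "J \<inter> K = {}"
  shows "shuffle_sign I (J \<union> K) = shuffle_sign I J * shuffle_sign I K"
proof -
  have "{(i, j). i \<in> I \<and> j \<in> J \<union> K \<and> j < i} =
        {(i, j). i \<in> I \<and> j \<in> J \<and> j < i} \<union> {(i, j). i \<in> I \<and> j \<in> K \<and> j < i}" by auto
  moreover have "{(i, j). i \<in> I \<and> j \<in> J \<and> j < i} \<inter> {(i, j). i \<in> I \<and> j \<in> K \<and> j < i} = {}"
    using assms by auto
  ultimately show ?thesis
    by (simp add: shuffle_sign_def card_Un_disjoint power_add)
qed

lemma shuffle_sign_union_left:
  assumes "I \<inter> J = {}"
  shows "shuffle_sign (I \<union> J) K = shuffle_sign I K * shuffle_sign J K"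
proof -
  have "{(i, j). i \<in> I \<union> J \<and> j \<in> K \<and> j < i} =
        {(i, j). i \<in> I \<and> j \<in> K \<and> j < i} \<union> {(i, j). i \<in> J \<and> j \<in> K \<and> j < i}" by auto
  moreover have "{(i, j). i \<in> I \<and> j \<in> K \<and> j < i} \<inter> {(i, j). i \<in> J \<and> j \<in> K \<and> j < i} = {}"
    using assms by auto
  ultimately show ?thesis
    by (simp add: shuffle_sign_def card_Un_disjoint power_add)
qed

lemma shuffle_sign_swap:
  assumes "I \<inter> J = {}"
  shows "shuffle_sign I J * shuffle_sign J I = (-1) ^ (card I * card J)"
proof -
  let ?A = "{(i, j). i \<in> I \<and> j \<in> J \<and> j < i}" and ?B = "{(i, j). i \<in> I \<and> j \<in> J \<and> i < j}"
  have "{(j, i). j \<in> J \<and> i \<in> I \<and> i < j} = prod.swap ` ?B" by auto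
  then have B: "card {(j, i). j \<in> J \<and> i \<in> I \<and> i < j} = card ?B"
    by (simp add: card_image)
  have "j < i \<or> i < j" if "i \<in> I" "j \<in> J" for i j
    using assms that by (metis disjoint_iff linorder_less_linear)
  then have "I \<times> J = ?A \<union> ?B" by auto
  moreover have "?A \<inter> ?B = {}" by auto
  ultimately have "card (I \<times> J) = card ?A + card ?B"
    by (simp only: card_Un_disjoint[OF finite finite])
  then have "card I * card J = card ?A + card ?B" by (simp add: card_cartesian_product)
  then show ?thesis
    unfolding shuffle_sign_def B by (simp add: power_add)
qed

lemma shuffle_sign_square: "shuffle_sign I J * shuffle_sign I J = 1"
  by (simp add: shuffle_sign_def flip: power_mult_distrib)

lemma choose_two_add: "(a + b) choose 2 = (a choose 2) + (b choose 2) + a * b"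
  by (induction b) (simp_all add: numeral_2_eq_2)

lemma ext_rev_wedge: "ext_rev (wedge u v) = wedge (ext_rev v) (ext_rev u)"
proof (rule vec_eq_iff[THEN iffD2], rule allI)
  fix K :: "'a set"
  have "ext_rev (wedge u v) $ K =
     (\<Sum>I\<in>Pow K. (-1) ^ (card K choose 2) * (shuffle_sign I (K - I) * u $ I * v $ (K - I)))"
    by (simp add: ext_rev_def wedge_def sum_distrib_left)
  also have "\<dots> = (\<Sum>J\<in>Pow K. (-1) ^ (card K choose 2) * (shuffle_sign (K - J) J * u $ (K - J) * v $ J))"
    by (rule sum.reindex_bij_witness[where i = "\<lambda>J. K - J" and j = "\<lambda>J. K - J"])
       (auto simp: double_diff)
  also have "\<dots> = (\<Sum>J\<in>Pow K. shuffle_sign J (K - J) * ((-1) ^ (card J choose 2) * v $ J) *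
                    ((-1) ^ (card (K - J) choose 2) * u $ (K - J)))"
  proof (rule sum.cong[OF refl])
    fix J assume "J \<in> Pow K"
    then have J: "J \<subseteq> K" by auto
    let ?a = "card J" and ?b = "card (K - J)"
    have c: "card K = ?a + ?b"
      by (metis J card_Diff_subset card_mono finite le_add_diff_inverse)
    have "shuffle_sign (K - J) J * (-1) ^ (?a * ?b)
        = shuffle_sign (K - J) J * (shuffle_sign (K - J) J * shuffle_sign J (K - J))"
      using shuffle_sign_swap[of "K - J" J] by (simp add: Diff_Int_distrib2 mult.commute)
    also have "\<dots> = shuffle_sign J (K - J)"
      by (metis mult.assoc mult_1 shuffle_sign_square)
    finally have s: "shuffle_sign J (K - J) = shuffle_sign (K - J) J * (-1) ^ (?a * ?b)" ..
    show "(-1) ^ (card K choose 2) * (shuffle_sign (K - J) J * u $ (K - J) * v $ J) =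
        shuffle_sign J (K - J) * ((-1) ^ (?a choose 2) * v $ J) * ((-1) ^ (?b choose 2) * u $ (K - J))"
      unfolding s c choose_two_add power_add by (simp add: mult_ac)
  qed
  also have "\<dots> = wedge (ext_rev v) (ext_rev u) $ K"
    by (simp add: ext_rev_def wedge_def)
  finally show "ext_rev (wedge u v) $ K = wedge (ext_rev v) (ext_rev u) $ K" .
qed

lemma ext_vec_nth: "ext_vec x $ I = (if is_singleton I then x $ the_elem I else 0)"
proof (cases "is_singleton I")
  case True
  then obtain i where I: "I = {i}" by (auto simp: is_singleton_def)
  show ?thesis by (simp add: I ext_vec_def axis_def if_distrib cong: if_cong)
next
  case False
  then have "I \<noteq> {i}" for i by auto
  then show ?thesis by (auto simp: False ext_vec_def axis_def intro!: sum.neutral)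
qed

lemma ext_rev_vec: "ext_rev (ext_vec x) = ext_vec x"
  by (auto simp: vec_eq_iff ext_rev_def ext_vec_nth is_singleton_def binomial_eq_0)

lemma iota_vec_sum: "iota B x (ext_vec y) = (\<Sum>j\<in>UNIV. B x (axis j 1) * y $ j) *s ext_one"
proof (rule vec_eq_iff[THEN iffD2], rule allI)
  fix J
  show "iota B x (ext_vec y) $ J = ((\<Sum>j\<in>UNIV. B x (axis j 1) * y $ j) *s ext_one) $ J"
  proof (cases "J = {}")
    case True
    then show ?thesis by (simp add: iota_def ext_vec_nth ext_one_def axis_def shuffle_sign_def)
  next
    case False
    then have "\<not> is_singleton (insert j J)" if "j \<notin> J" for j
      using that by (auto simp: is_singleton_def)
    then show ?thesis using False by (auto simp: iota_def ext_vec_nth ext_one_def axis_def intro!: sum.neutral)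
  qed
qed

lemma iota_vec:
  assumes "nonsingular_symmetric_form B"
  shows "iota B x (ext_vec y) = B x y *s ext_one"
proof -
  interpret Vector_Spaces.linear "(*s)" "(*)" "B x"
    using assms by (simp add: nonsingular_symmetric_form_def)
  have "B x y = B x (\<Sum>j\<in>UNIV. y $ j *s axis j 1)" by (simp add: basis_expansion)
  also have "\<dots> = (\<Sum>j\<in>UNIV. B x (axis j 1) * y $ j)" by (simp add: sum scale mult.commute)
  finally show ?thesis by (simp add: iota_vec_sum)
qed

lemma iota_wedge:
  assumes "u \<in> ext_degree k"
  shows "iota B x (wedge u v) = wedge (iota B x u) v + (-1) ^ k *s wedge u (iota B x v)"
proof (rule vec_eq_iff[THEN iffD2], rule allI)
  fix K :: "'a set"
  let ?s = shuffle_sign and ?b = "\<lambda>j. B x (axis j 1)"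
  let ?P = "\<lambda>j I. ?s {j} K * ?b j * (?s (insert j I) (K - I) * u $ insert j I * v $ (K - I))"
  let ?Q = "\<lambda>j I. ?s {j} K * ?b j * (?s I (insert j (K - I)) * u $ I * v $ insert j (K - I))"
  have split: "(\<Sum>I\<in>Pow (insert j K). ?s {j} K * ?b j * (?s I (insert j K - I) * u $ I * v $ (insert j K - I)))
      = (\<Sum>I\<in>Pow K. ?P j I) + (\<Sum>I\<in>Pow K. ?Q j I)" (is "(\<Sum>I\<in>_. ?f I) = _") if j: "j \<notin> K" for j
  proof -
    have "Pow (insert j K) = Pow K \<union> insert j ` Pow K" by (rule Pow_insert)
    moreover have "Pow K \<inter> insert j ` Pow K = {}" using j by auto
    ultimately have "(\<Sum>I\<in>Pow (insert j K). ?f I) = (\<Sum>I\<in>Pow K. ?f I) + (\<Sum>I\<in>insert j ` Pow K. ?f I)"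
      by (simp add: sum.union_disjoint)
    moreover have "(\<Sum>I\<in>insert j ` Pow K. ?f I) = (\<Sum>I\<in>Pow K. ?f (insert j I))"
    proof (subst sum.reindex)
      show "inj_on (insert j) (Pow K)" using j by (auto simp: inj_on_def)
    qed simp
    moreover have "(\<Sum>I\<in>Pow K. ?f (insert j I)) = (\<Sum>I\<in>Pow K. ?P j I)"
    proof (rule sum.cong[OF refl])
      fix I assume "I \<in> Pow K"
      then have "insert j K - insert j I = K - I" using j by auto
      then show "?f (insert j I) = ?P j I" by simp
    qed
    moreover have "(\<Sum>I\<in>Pow K. ?f I) = (\<Sum>I\<in>Pow K. ?Q j I)"
    proof (rule sum.cong[OF refl])
      fix I assume "I \<in> Pow K"
      then have "insert j K - I = insert j (K - I)" using j by auto
      then show "?f I = ?Q j I" by simp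
    qed
    ultimately show ?thesis by simp
  qed
  have "iota B x (wedge u v) $ K = (\<Sum>j\<in>-K. \<Sum>I\<in>Pow (insert j K).
      ?s {j} K * ?b j * (?s I (insert j K - I) * u $ I * v $ (insert j K - I)))"
    by (simp add: iota_def wedge_def sum_distrib_left)
  also have "\<dots> = (\<Sum>j\<in>-K. (\<Sum>I\<in>Pow K. ?P j I) + (\<Sum>I\<in>Pow K. ?Q j I))"
    by (rule sum.cong[OF refl], rule split) simp
  also have "\<dots> = (\<Sum>I\<in>Pow K. \<Sum>j\<in>-K. ?P j I) + (\<Sum>I\<in>Pow K. \<Sum>j\<in>-K. ?Q j I)"
    by (simp only: sum.distrib sum.swap[of _ "Pow K" "-K"])
  finally have lhs: "iota B x (wedge u v) $ K =
      (\<Sum>I\<in>Pow K. \<Sum>j\<in>-K. ?P j I) + (\<Sum>I\<in>Pow K. \<Sum>j\<in>-K. ?Q j I)" .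
  let ?F = "\<lambda>j I. ?s I (K - I) * (?s {j} I * ?b j * u $ insert j I) * v $ (K - I)"
  let ?G = "\<lambda>j I. (-1) ^ k * (?s I (K - I) * u $ I * (?s {j} (K - I) * ?b j * v $ insert j (K - I)))"
  have sF: "(\<Sum>j\<in>-I. ?F j I) = (\<Sum>j\<in>-K. ?F j I) + (\<Sum>j\<in>K - I. ?F j I)" if "I \<subseteq> K" for I
  proof -
    have "- I = - K \<union> (K - I)" "- K \<inter> (K - I) = {}" using that by auto
    then show ?thesis by (simp add: sum.union_disjoint)
  qed
  have sG: "(\<Sum>j\<in>-(K - I). ?G j I) = (\<Sum>j\<in>-K. ?G j I) + (\<Sum>j\<in>I. ?G j I)" if "I \<subseteq> K" for I
  proof -
    have "- (K - I) = - K \<union> I" "- K \<inter> I = {}" using that by auto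
    then show ?thesis by (simp add: sum.union_disjoint)
  qed
  have FP: "?F j I = ?P j I" if "I \<subseteq> K" "j \<notin> K" for I j
  proof -
    have "K = I \<union> (K - I)" using that by auto
    then have "?s {j} K = ?s {j} I * ?s {j} (K - I)"
      using shuffle_sign_union_right[of I "K - I" "{j}"] by auto
    moreover have "?s (insert j I) (K - I) = ?s {j} (K - I) * ?s I (K - I)"
      using shuffle_sign_union_left[of "{j}" I "K - I"] that by auto
    ultimately show ?thesis
      using shuffle_sign_square[of "{j}" "K - I"] by (simp add: mult_ac)
  qed
  have GQ: "?G j I = ?Q j I" if "I \<subseteq> K" "j \<notin> K" for I j
  proof (cases "card I = k")
    case True
    have "K = I \<union> (K - I)" using that by auto
    then have "?s {j} K = ?s {j} I * ?s {j} (K - I)"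
      using shuffle_sign_union_right[of I "K - I" "{j}"] by auto
    moreover have "?s I (insert j (K - I)) = ?s I {j} * ?s I (K - I)"
      using shuffle_sign_union_right[of "{j}" "K - I" I] that by auto
    moreover have "?s I {j} * ?s {j} I = (-1) ^ k"
      using shuffle_sign_swap[of I "{j}"] that True by auto
    ultimately show ?thesis by (simp add: mult_ac)
  next
    case False
    then show ?thesis using assms by (simp add: ext_degree_def)
  qed
  have FG: "?F j I = - ?G j (insert j I)" if "I \<subseteq> K" "j \<in> K" "j \<notin> I" for I j
  proof (cases "card (insert j I) = k")
    case True
    let ?R = "K - insert j I"
    have k: "k = Suc (card I)" using True that by simp
    have R: "insert j ?R = K - I" using that by auto
    have "?s I (K - I) = ?s I {j} * ?s I ?R"
      using shuffle_sign_union_right[of "{j}" ?R I] R by auto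
    moreover have "?s I {j} * ?s {j} I = (-1) ^ card I"
      using shuffle_sign_swap[of I "{j}"] that by auto
    moreover have "?s (insert j I) ?R = ?s {j} ?R * ?s I ?R"
      using shuffle_sign_union_left[of "{j}" I ?R] that by auto
    ultimately show ?thesis
      unfolding R k using shuffle_sign_square[of "{j}" ?R] by (simp add: mult_ac)
  next
    case False
    then show ?thesis using assms by (simp add: ext_degree_def)
  qed
  have "(\<Sum>I\<in>Pow K. \<Sum>j\<in>K - I. ?F j I) = (\<Sum>(I, j)\<in>(SIGMA I:Pow K. K - I). ?F j I)"
    by (simp add: sum.Sigma)
  also have "\<dots> = (\<Sum>(I, j)\<in>(SIGMA I:Pow K. I). - ?G j I)"
    by (rule sum.reindex_bij_witness[where i = "\<lambda>(I, j). (I - {j}, j)" and j = "\<lambda>(I, j). (insert j I, j)"])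
       (auto simp: FG insert_absorb)
  also have "\<dots> = - (\<Sum>I\<in>Pow K. \<Sum>j\<in>I. ?G j I)"
    by (simp add: sum.Sigma[symmetric] sum_negf)
  finally have extra: "(\<Sum>I\<in>Pow K. \<Sum>j\<in>K - I. ?F j I) = - (\<Sum>I\<in>Pow K. \<Sum>j\<in>I. ?G j I)" .
  have "(wedge (iota B x u) v + (-1) ^ k *s wedge u (iota B x v)) $ K
      = (\<Sum>I\<in>Pow K. \<Sum>j\<in>-I. ?F j I) + (\<Sum>I\<in>Pow K. \<Sum>j\<in>-(K - I). ?G j I)"
    by (simp add: wedge_def iota_def sum_distrib_left sum_distrib_right)
  also have "\<dots> = (\<Sum>I\<in>Pow K. (\<Sum>j\<in>-K. ?F j I) + (\<Sum>j\<in>K - I. ?F j I))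
                + (\<Sum>I\<in>Pow K. (\<Sum>j\<in>-K. ?G j I) + (\<Sum>j\<in>I. ?G j I))"
    by (intro arg_cong2[where f = "(+)"] sum.cong refl sF sG) auto
  also have "\<dots> = (\<Sum>I\<in>Pow K. \<Sum>j\<in>-K. ?F j I) + (\<Sum>I\<in>Pow K. \<Sum>j\<in>-K. ?G j I)"
    using extra by (simp add: sum.distrib)
  also have "\<dots> = (\<Sum>I\<in>Pow K. \<Sum>j\<in>-K. ?P j I) + (\<Sum>I\<in>Pow K. \<Sum>j\<in>-K. ?Q j I)"
    by (intro arg_cong2[where f = "(+)"] sum.cong refl FP GQ) auto
  finally show "iota B x (wedge u v) $ K = (wedge (iota B x u) v + (-1) ^ k *s wedge u (iota B x v)) $ K"
    using lhs by simp
qed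


section \<open>Clifford multiplication\<close>

text \<open>The tensor algebra \<open>T(V)\<close>: the coefficient of \<open>e\<^bsub>i\<^sub>1\<^esub> \<otimes> \<dots> \<otimes> e\<^bsub>i\<^sub>k\<^esub>\<close> in \<open>t\<close> is \<open>t [i\<^sub>1, \<dots>, i\<^sub>k]\<close>.\<close>

definition tensor_alg :: "('n list \<Rightarrow> complex) ring" where
  "tensor_alg =
     \<lparr> carrier = {t. finite {w. t w \<noteq> 0}},
       monoid.mult = (\<lambda>s t w. \<Sum>k\<le>length w. s (take k w) * t (drop k w)),
       one = (\<lambda>w. if w = [] then 1 else 0),
       zero = (\<lambda>w. 0),
       add = (\<lambda>s t w. s w + t w) \<rparr>"

definition tensor_vec :: "'n::finite cvec \<Rightarrow> 'n list \<Rightarrow> complex" where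
  "tensor_vec x w = (case w of [i] \<Rightarrow> x $ i | _ \<Rightarrow> 0)"

definition clifford_alg :: "'n::finite form \<Rightarrow> ('n list \<Rightarrow> complex) set ring" where
  "clifford_alg B = tensor_alg Quot
     (Idl\<^bsub>tensor_alg\<^esub> {t. \<exists>x. t = (\<lambda>w. (tensor_vec x \<otimes>\<^bsub>tensor_alg\<^esub> tensor_vec x) w
                                        - B x x * \<one>\<^bsub>tensor_alg\<^esub> w)})"

definition tensor_act :: "'n::{finite,linorder} form \<Rightarrow> ('n list \<Rightarrow> complex) \<Rightarrow> 'n ext \<Rightarrow> 'n ext" where
  "tensor_act B t u = (\<Sum>w\<in>{w. t w \<noteq> 0}. t w *s foldr (\<lambda>i. gam B (axis i 1)) w u)"

text \<open>The identification \<open>u \<mapsto> \<gamma>(u) 1\<close> of \<open>C(V)\<close> with \<open>\<wedge>V\<close>, on a coset \<open>c\<close> of tensors.\<close>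

definition clifford_symbol :: "'n::{finite,linorder} form \<Rightarrow> ('n list \<Rightarrow> complex) set \<Rightarrow> 'n ext" where
  "clifford_symbol B c = the_elem ((\<lambda>t. tensor_act B t ext_one) ` c)"

definition cmul :: "'n::{finite,linorder} form \<Rightarrow> 'n ext \<Rightarrow> 'n ext \<Rightarrow> 'n ext" where
  "cmul B u v =
     (let q = the_inv_into (carrier (clifford_alg B)) (clifford_symbol B)
      in clifford_symbol B (q u \<otimes>\<^bsub>clifford_alg B\<^esub> q v))"


section \<open>The spin group and the orthogonal group\<close>

definition spin_conj :: "'n::{finite,linorder} form \<Rightarrow> 'n ext \<Rightarrow> 'n ext \<Rightarrow> 'n ext" where
  "spin_conj B g u = cmul B (cmul B g u) (ext_rev g)"

definition Spin :: "'n::{finite,linorder} form \<Rightarrow> 'n ext set" where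
  "Spin B = {g \<in> ext_even. cmul B g (ext_rev g) = ext_one \<and>
                           (\<forall>x. spin_conj B g (ext_vec x) \<in> range ext_vec)}"

text \<open>Endomorphisms of \<open>V\<close> are given by their matrices.\<close>

definition spin_T :: "'n::{finite,linorder} form \<Rightarrow> 'n ext \<Rightarrow> 'n cmat" where
  "spin_T B g = matrix (\<lambda>x. ext_to_vec (spin_conj B g (ext_vec x)))"

text \<open>The differential of \<^const>\<open>spin_T\<close>, \<open>\<tau>(u) x = [u, x]\<close>.\<close>

definition tau :: "'n::{finite,linorder} form \<Rightarrow> 'n ext \<Rightarrow> 'n cmat" where
  "tau B u = matrix (\<lambda>x. ext_to_vec (cmul B u (ext_vec x) - cmul B (ext_vec x) u))"

definition SO :: "'n::finite form \<Rightarrow> 'n cmat set" where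
  "SO B = {a. (\<forall>x y. B (a *v x) (a *v y) = B x y) \<and> det a = 1}"

definition Lie_SO :: "'n::finite form \<Rightarrow> 'n cmat set" where
  "Lie_SO B = {s. \<forall>x y. B (s *v x) y + B x (s *v y) = 0}"

definition SO_star :: "'n::finite form \<Rightarrow> 'n cmat set" where
  "SO_star B = {a \<in> SO B. det (mat 1 + a) \<noteq> 0}"

definition Lie_SO_star :: "'n::finite form \<Rightarrow> 'n cmat set" where
  "Lie_SO_star B = {s \<in> Lie_SO B. invertible (mat 1 + s) \<and> invertible (mat 1 - s)}"

definition Spin_star :: "'n::{finite,linorder} form \<Rightarrow> 'n ext set" where
  "Spin_star B = {g \<in> Spin B. det (mat 1 + spin_T B g) \<noteq> 0}"

definition cayley :: "'n::finite cmat \<Rightarrow> 'n cmat" where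
  "cayley b = (mat 1 - b) ** matrix_inv (mat 1 + b)"


section \<open>The spin module and the generalized Cayley mapping\<close>

definition centralizer_Z :: "'n::{finite,linorder} form \<Rightarrow> 'n ext set" where
  "centralizer_Z B =
     {u. \<forall>z0\<in>ext_degree 0. \<forall>z1\<in>ext_degree CARD('n). cmul B u (z0 + z1) = cmul B (z0 + z1) u}"

definition irreducible_on :: "'a set \<Rightarrow> ('a \<Rightarrow> complex^'s::finite \<Rightarrow> complex^'s) \<Rightarrow> (complex^'s) set \<Rightarrow> bool" where
  "irreducible_on A \<sigma> S \<longleftrightarrow>
     vec.subspace S \<and> (\<forall>a\<in>A. \<sigma> a ` S \<subseteq> S) \<and> S \<noteq> {0} \<and>
     (\<forall>W. vec.subspace W \<and> W \<subseteq> S \<and> (\<forall>a\<in>A. \<sigma> a ` W \<subseteq> W) \<longrightarrow> W = {0} \<or> W = S)"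

text \<open>\<open>\<sigma>\<close> makes \<^typ>\<open>complex^'s\<close> a module \<open>S\<close> over the centralizer, with \<open>S\<^sub>\<plusminus> = e\<^sub>\<plusminus> S\<close>,
  \<open>e\<^sub>\<plusminus> = (1 \<plusminus> \<mu>) / 2\<close>. Only the values of \<open>\<sigma>\<close> on the centralizer matter.\<close>

definition spin_module ::
    "'n::{finite,linorder} form \<Rightarrow> 'n ext \<Rightarrow> ('n ext \<Rightarrow> complex^'s::finite \<Rightarrow> complex^'s) \<Rightarrow> bool" where
  "spin_module B \<mu> \<sigma> \<longleftrightarrow>
     CARD('s) = 2 ^ ((CARD('n) + 1) div 2) \<and>
     (\<forall>u\<in>centralizer_Z B. Vector_Spaces.linear (*s) (*s) (\<sigma> u)) \<and>
     (\<forall>u\<in>centralizer_Z B. \<forall>v\<in>centralizer_Z B. \<forall>s.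
        \<sigma> (u + v) s = \<sigma> u s + \<sigma> v s \<and> \<sigma> (cmul B u v) s = \<sigma> u (\<sigma> v s)) \<and>
     (\<forall>c. \<forall>u\<in>centralizer_Z B. \<forall>s. \<sigma> (c *s u) s = c *s \<sigma> u s) \<and>
     (\<forall>s. \<sigma> ext_one s = s) \<and>
     irreducible_on (centralizer_Z B) \<sigma> (range (\<sigma> ((1/2) *s (ext_one + \<mu>)))) \<and>
     irreducible_on (centralizer_Z B) \<sigma> (range (\<sigma> ((1/2) *s (ext_one - \<mu>))))"

definition gen_cayley :: "('n::finite ext \<Rightarrow> complex^'s::finite \<Rightarrow> complex^'s) \<Rightarrow> 'n ext \<Rightarrow> 'n ext" where
  "gen_cayley \<sigma> g = (THE u. u \<in> ext_degree 2 \<and>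
     (\<forall>y\<in>ext_degree 2. trace (matrix (\<sigma> u \<circ> \<sigma> y)) = trace (matrix (\<sigma> g \<circ> \<sigma> y))))"

text \<open>\<open>\<chi> = 2\<^sup>n\<^sup>/\<^sup>2 pr\<^sub>0\<close>\<close>

definition spin_chi :: "'n::finite ext \<Rightarrow> complex" where
  "spin_chi a = of_real (2 powr (real CARD('n) / 2)) * pr0 a"


section \<open>Regular and rational functions\<close>

inductive poly_fun :: "(complex^'m::finite \<Rightarrow> complex) \<Rightarrow> bool" where
  const: "poly_fun (\<lambda>_. c)"
| coord: "poly_fun (\<lambda>x. x $ i)"
| add: "poly_fun f \<Longrightarrow> poly_fun g \<Longrightarrow> poly_fun (\<lambda>x. f x + g x)"
| mult: "poly_fun f \<Longrightarrow> poly_fun g \<Longrightarrow> poly_fun (\<lambda>x. f x * g x)"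

text \<open>\<open>A(Y)\<close> for a Zariski closed set \<open>Y\<close>.\<close>

definition regular_funs :: "(complex^'m::finite) set \<Rightarrow> (complex^'m \<Rightarrow> complex) set" where
  "regular_funs Y = {restrict f Y | f. poly_fun f}"

definition denominators :: "(complex^'m::finite) set \<Rightarrow> (complex^'m \<Rightarrow> complex) set" where
  "denominators Y = {q \<in> regular_funs Y.
     \<forall>r\<in>regular_funs Y. (\<forall>x\<in>Y. r x * q x = 0) \<longrightarrow> (\<forall>x\<in>Y. r x = 0)}"

type_synonym 'm rat_fun = "((complex^'m \<Rightarrow> complex) \<times> (complex^'m \<Rightarrow> complex)) set"

text \<open>The rational function \<open>p / q\<close> on \<open>Y\<close>, as the class of all equal fractions. The functions \<open>p\<close>
  and \<open>q\<close> matter only through their values on \<open>Y\<close>.\<close>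

definition rat_frac ::
    "(complex^'m::finite) set \<Rightarrow> (complex^'m \<Rightarrow> complex) \<Rightarrow> (complex^'m \<Rightarrow> complex) \<Rightarrow> 'm rat_fun" where
  "rat_frac Y p q = {(p', q'). p' \<in> regular_funs Y \<and> q' \<in> denominators Y \<and>
                               (\<forall>x\<in>Y. p' x * q x = p x * q' x)}"

text \<open>\<open>Q(Y)\<close>, the total ring of fractions of \<open>A(Y)\<close>. It is the field of fractions of \<open>A(Y)\<close> when
  \<open>Y\<close> is irreducible.\<close>

definition rat_ring :: "(complex^'m::finite) set \<Rightarrow> 'm rat_fun ring" where
  "rat_ring Y =
     \<lparr> carrier = {rat_frac Y p q | p q. p \<in> regular_funs Y \<and> q \<in> denominators Y},
       monoid.mult = (\<lambda>F G. \<Union>(p, q)\<in>F. \<Union>(p', q')\<in>G. rat_frac Y (\<lambda>x. p x * p' x) (\<lambda>x. q x * q' x)),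
       one = rat_frac Y (\<lambda>_. 1) (\<lambda>_. 1),
       zero = rat_frac Y (\<lambda>_. 0) (\<lambda>_. 1),
       add = (\<lambda>F G. \<Union>(p, q)\<in>F. \<Union>(p', q')\<in>G.
                rat_frac Y (\<lambda>x. p x * q' x + p' x * q x) (\<lambda>x. q x * q' x)) \<rparr>"

text \<open>\<open>\<phi>\<^sup>* F\<close> for a morphism \<open>\<phi>\<close> with source \<open>Y\<close>.\<close>

definition rat_pullback ::
    "(complex^'m::finite) set \<Rightarrow> (complex^'m \<Rightarrow> complex^'k::finite) \<Rightarrow> 'k rat_fun \<Rightarrow> 'm rat_fun" where
  "rat_pullback Y \<phi> F = (\<Union>(p, q)\<in>F. rat_frac Y (p \<circ> \<phi>) (q \<circ> \<phi>))"

text \<open>The invariants of \<open>Spin(V)\<close>, acting on \<open>Y \<subseteq> \<wedge>V\<close> by \<open>u \<mapsto> h u \<alpha>(h) = h u h\<^sup>-\<^sup>1\<close>: this is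
  conjugation for \<open>Y = Spin(V)\<close> and the adjoint action for \<open>Y = \<wedge>\<^sup>2V\<close>.\<close>

definition rat_invariants :: "'n::{finite,linorder} form \<Rightarrow> 'n ext set \<Rightarrow> ('n set) rat_fun set" where
  "rat_invariants B Y =
     {F \<in> carrier (rat_ring Y). \<forall>h\<in>Spin B. rat_pullback Y (spin_conj B h) F = F}"

end

theory Submission
  imports Defs "HOL-Complex_Analysis.Complex_Analysis" "HOL-Computational_Algebra.Fundamental_Theorem_Algebra"
    "HOL-Library.Function_Algebras"
begin

text \<open>
  A trace on the even Clifford algebra is a multiple of \<open>pr\<^sub>0\<close>, so \<open>\<Phi>(g) = pr\<^sub>2 g\<close>. Let \<open>c = pr\<^sub>0 g\<close>, \<open>u = pr\<^sub>2 g\<close>,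
  \<open>T = T(g)\<close>. Comparing the components of degree 1 in \<open>g x = (T x) g\<close> gives \<open>\<tau>(u) (1 + T) = -2 c (1 - T)\<close>,
  and the trace of \<open>w \<mapsto> g w \<alpha>(g)\<close> on \<open>\<wedge>V\<close> gives \<open>2\<^sup>n c\<^sup>2 = det (1 + T)\<close>.

  If \<open>c \<noteq> 0\<close>, then \<open>g = c exp (u / c)\<close>, and conversely \<open>c exp (u / c)\<close> lies in \<open>Spin(V)\<close> as soon as its norm
  is 1. So the points with \<open>c \<noteq> 0\<close> over \<open>u\<close> correspond to the nonzero roots \<open>c\<close> of a monic polynomial
  of degree \<open>2m\<close>, \<open>m = [n/2]\<close>, whose coefficients are polynomials in \<open>u\<close>. On a maximal torus one finds a \<open>u\<close>
  with \<open>2m\<close> such points. As roots depend continuously on the coefficients, all nearby \<open>u\<close> have \<open>2m\<close> of them,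
  and by analytic continuation along lines \<open>1, c, \<dots>, c\<^sup>2\<^sup>m\<^sup>-\<^sup>1\<close> are linearly independent over the rational functions of \<open>u\<close>.
  The coordinates of \<open>g\<close> are rational in \<open>u\<close> and \<open>c\<close>, so \<open>\<chi>\<close> generates the field extension, whose degree
  is \<open>2m\<close>; uniqueness of the coefficients shows that those of an invariant are invariant. For \<open>n \<ge> 2\<close> the group is
  irreducible because, by Cartan--Dieudonne, an entire curve joins each element to 1. The case \<open>n = 1\<close>,
  where \<open>Spin(V) = {1, -1}\<close>, is done by hand.
\<close>

text \<open>Clifford multiplication is defined on cosets of tensors and transported by the symbol
  map, so nothing can be computed before that map is known to be bijective. The inverse is built
  explicitly: \<open>quantize\<close> is defined by recursion over index sets. Applied to the zero
  form, the same recursion yields the functorial map \<open>ext_map\<close> on the exterior algebra,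
  which is the source of \<open>det (1 + T)\<close>.

  The reduction of the trace to \<open>pr0\<close> meets one obstacle. For even n the even Clifford
  algebra has a nontrivial centre, so its traces form a two-dimensional space, and the volume
  element must be shown to have trace 0 on S. This amounts to dim S_+ = dim S_-. Instead of the
  structure theory of matrix algebras, integrality gives it: idempotents have natural numbers as
  traces, and neither summand is zero.

  No dimension theory enters either: irreducibility, density and independence all rest on the
  identity theorem for entire functions, applied along curves in the group or along lines of
  bivectors.\<close>

no_notation fps_nth (infixl "$" 75)

section \<open>The exterior algebra\<close>

abbreviation clin :: "('a::field^'m \<Rightarrow> 'a^'k) \<Rightarrow> bool" where
  "clin \<equiv> Vector_Spaces.linear (*s) (*s)"

abbreviation ax :: "'m \<Rightarrow> complex^'m" where
  "ax i \<equiv> axis i 1"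

lemma ax_nth: "ax i $ j = (if j = i then 1 else 0)"
  by (simp add: axis_def)

lemma vec_two_cancel: "2 *s x = 2 *s y \<longleftrightarrow> x = (y :: complex^'m)"
  by (simp add: vec.scale_cancel_left)

lemma sum_single:
  "finite S \<Longrightarrow> (\<Sum>I\<in>S. f I * (if I = A then 1 else 0) * g I) = (if A \<in> S then f A * g A else (0::complex))"
  by (subst sum.cong[OF refl, of _ _ "\<lambda>I. if I = A then f A * g A else 0"]) auto

lemma clinI:
  assumes "\<And>x y. f (x + y) = f x + f y" "\<And>c x. f (c *s x) = c *s f x"
  shows "clin f"
  using assms by (simp add: Vector_Spaces.linear_iff vec.vector_space_axioms)

lemma clin_add: "clin f \<Longrightarrow> f (x + y) = f x + f y" by (rule vec.linear_add)
lemma clin_scale: "clin f \<Longrightarrow> f (c *s x) = c *s f x" by (rule vec.linear_scale)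
lemma clin_diff: "clin f \<Longrightarrow> f (x - y) = f x - f y" by (rule vec.linear_diff)
lemma clin_neg: "clin f \<Longrightarrow> f (- x) = - f x" by (rule vec.linear_neg)
lemma clin_0: "clin f \<Longrightarrow> f 0 = 0" by (rule vec.linear_0)
lemma clin_sum: "clin f \<Longrightarrow> f (\<Sum>i\<in>A. g i) = (\<Sum>i\<in>A. f (g i))" by (rule vec.linear_sum)
lemmas clin_rules = clin_add clin_scale clin_diff clin_neg clin_0 clin_sum

lemma scale_sum_left: "(\<Sum>i\<in>A. c i) *s (x::complex^'m) = (\<Sum>i\<in>A. c i *s x)"
  by (rule vec.scale_sum_left)

lemma shuffle_sign_empty [simp]: "shuffle_sign {} J = 1" "shuffle_sign I {} = 1"
  by (simp_all add: shuffle_sign_def)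

lemma clin_wedge_left: "clin (\<lambda>u. wedge u v)"
  by (rule clinI) (auto simp: vec_eq_iff wedge_def algebra_simps sum.distrib sum_distrib_left)

lemma clin_wedge_right: "clin (wedge u)"
  by (rule clinI) (auto simp: vec_eq_iff wedge_def algebra_simps sum.distrib sum_distrib_left)

lemma clin_eps: "clin (eps x)"
  using clin_wedge_right[of "ext_vec x"] by (simp add: eps_def[abs_def])

lemma ext_vec_clin: "clin ext_vec"
  by (rule clinI) (auto simp: vec_eq_iff ext_vec_nth)

lemma clin_eps_vec: "clin (\<lambda>x. eps x u)"
  by (rule clinI) (simp_all add: eps_def clin_rules[OF ext_vec_clin] clin_rules[OF clin_wedge_left])

lemma clin_iota: "clin (iota B x)"
  by (rule clinI) (auto simp: vec_eq_iff iota_def algebra_simps sum.distrib sum_distrib_left)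

lemma clin_gam: "clin (gam B x)"
  by (rule clinI) (simp_all add: gam_def clin_rules[OF clin_eps] clin_rules[OF clin_iota] vec.scale_right_distrib)

lemma ext_vec_axis: "ext_vec (ax i) = ax {i}"
  by (auto simp: vec_eq_iff ext_vec_nth axis_def is_singleton_def)

lemma eps_axis: "eps (ax i) u $ K = (if i \<in> K then shuffle_sign {i} (K - {i}) * u $ (K - {i}) else 0)"
  unfolding eps_def wedge_def ext_vec_axis by (simp add: ax_nth sum_single)

lemma eps_axis_axis: "eps (ax i) (ax I) = (if i \<in> I then 0 else shuffle_sign {i} I *s ax (insert i I))"
  by (auto simp: vec_eq_iff eps_axis ax_nth)

text \<open>The index i already stands in front, so no transposition is counted. This is why the
  inductions over index sets split off \<open>Min I\<close>.\<close>

lemma shuffle_sign_min: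
  assumes "\<And>j. j \<in> I \<Longrightarrow> i < j" shows "shuffle_sign {i} I = 1"
proof -
  have "{(k, j). k \<in> {i} \<and> j \<in> I \<and> j < k} = {}" using assms less_asym by blast
  then show ?thesis unfolding shuffle_sign_def by (simp only: card.empty power_0)
qed

lemma eps_expand: "eps x u = (\<Sum>i\<in>UNIV. x $ i *s eps (ax i) u)"
proof -
  have "eps x u = eps (\<Sum>i\<in>UNIV. x $ i *s ax i) u" by (simp add: basis_expansion)
  then show ?thesis by (simp only: clin_rules[OF clin_eps_vec])
qed

lemma shuffle_sign_swap1:
  assumes "i \<noteq> j" shows "shuffle_sign {i} {j} = - shuffle_sign {j} {i}"
proof -
  have "shuffle_sign {i} {j} * shuffle_sign {j} {i} = -1"
    using shuffle_sign_swap[of "{i}" "{j}"] assms by simp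
  then have "shuffle_sign {i} {j} * (shuffle_sign {j} {i} * shuffle_sign {j} {i}) = - shuffle_sign {j} {i}"
    by (simp flip: mult.assoc)
  then show ?thesis by (simp add: shuffle_sign_square)
qed

lemma eps_axis_anti: "eps (ax i) (eps (ax j) u) = - eps (ax j) (eps (ax i) u)"
proof (cases "i = j")
  case True
  then show ?thesis by (simp add: vec_eq_iff eps_axis)
next
  case False
  have "eps (ax i) (eps (ax j) u) $ K = - eps (ax j) (eps (ax i) u) $ K" for K
  proof (cases "i \<in> K \<and> j \<in> K")
    case True
    obtain M where M: "K - {i} = insert j M" "K - {j} = insert i M" "i \<notin> M" "j \<notin> M"
      using True False that[of "K - {i} - {j}"] by auto
    have s: "shuffle_sign {i} (insert j M) = shuffle_sign {i} {j} * shuffle_sign {i} M"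
        "shuffle_sign {j} (insert i M) = shuffle_sign {j} {i} * shuffle_sign {j} M"
      using shuffle_sign_union_right[of "{j}" M "{i}"] shuffle_sign_union_right[of "{i}" M "{j}"]
      by (auto simp: M)
    have "eps (ax i) (eps (ax j) u) $ K = shuffle_sign {i} {j} * shuffle_sign {i} M * (shuffle_sign {j} M * u $ M)"
      using True False by (simp add: eps_axis M s)
    moreover have "eps (ax j) (eps (ax i) u) $ K = shuffle_sign {j} {i} * shuffle_sign {j} M * (shuffle_sign {i} M * u $ M)"
      using True False by (simp add: eps_axis M s)
    ultimately show ?thesis by (simp add: shuffle_sign_swap1[OF False])
  next
    case False
    then show ?thesis by (auto simp: eps_axis)
  qed
  then show ?thesis by (simp add: vec_eq_iff)
qed

lemma eps_anti: "eps x (eps y u) = - eps y (eps x u)"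
proof -
  have "eps x (eps y u) = (\<Sum>i\<in>UNIV. \<Sum>j\<in>UNIV. (x $ i * y $ j) *s eps (ax i) (eps (ax j) u))"
    by (subst eps_expand, subst (2) eps_expand)
      (simp only: clin_rules[OF clin_eps] vec.scale_sum_right vec.scale_scale)
  also have "\<dots> = (\<Sum>j\<in>UNIV. \<Sum>i\<in>UNIV. (x $ i * y $ j) *s eps (ax i) (eps (ax j) u))"
    by (rule sum.swap)
  also have "\<dots> = (\<Sum>j\<in>UNIV. \<Sum>i\<in>UNIV. - ((y $ j * x $ i) *s eps (ax j) (eps (ax i) u)))"
    by (intro sum.cong refl, subst eps_axis_anti) (simp add: vec.scale_minus_right mult.commute)
  also have "\<dots> = - eps y (eps x u)"
    by (subst (3) eps_expand, subst (4) eps_expand)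
      (simp only: clin_rules[OF clin_eps] vec.scale_sum_right vec.scale_scale sum_negf)
  finally show ?thesis .
qed

lemma eps_eps_same [simp]: "eps x (eps x u) = 0"
proof -
  have "2 *s eps x (eps x u) = 0" using eps_anti[of x x u] by (simp add: vec_eq_iff eq_neg_iff_add_eq_0)
  then show ?thesis by simp
qed

text \<open>The working induction principle for the exterior algebra: each \<open>ax I\<close>
  arises from 1 by multiplying in its smallest index, without sign, so an identity between linear
  maps need only be checked on 1 and across one \<open>eps\<close>.\<close>

lemma ext_gen_eps:
  assumes S: "vec.subspace S" and one: "ext_one \<in> S" and step: "\<And>i u. u \<in> S \<Longrightarrow> eps (ax i) u \<in> S"
  shows "(u :: 'n::{finite,linorder} ext) \<in> S"
proof -
  have ax: "ax I \<in> S" for I :: "'n set"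
  proof (induction "card I" arbitrary: I)
    case 0
    then show ?case using one by (simp add: ext_one_def)
  next
    case (Suc k)
    then have ne: "I \<noteq> {}" by auto
    define i where "i = Min I"
    have i: "i \<in> I" "\<And>j. j \<in> I - {i} \<Longrightarrow> i < j"
      using ne Min_le[of I] unfolding i_def by (auto simp: order.strict_iff_order)
    have "eps (ax i) (ax (I - {i})) = ax I"
      using i shuffle_sign_min[of "I - {i}" i] by (simp add: eps_axis_axis insert_absorb)
    moreover have "ax (I - {i}) \<in> S"
      using Suc(1)[of "I - {i}"] Suc(2) i(1) by simp
    ultimately show ?case using step by metis
  qed
  have "(\<Sum>I\<in>UNIV. u $ I *s ax I) \<in> S"
    by (intro vec.subspace_sum[OF S] vec.subspace_scale[OF S] ax)
  then show ?thesis by (simp add: basis_expansion)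
qed

lemma ext_vec_degree: "ext_vec x \<in> ext_degree 1"
  by (auto simp: ext_degree_def ext_vec_nth is_singleton_def)

lemma ext_degree_subspace: "vec.subspace (ext_degree k)"
  by (auto simp: vec.subspace_def ext_degree_def)

lemma wedge_one_left: "wedge ext_one u = u"
  unfolding wedge_def ext_one_def by (simp add: ax_nth sum_single vec_eq_iff)

lemma iota_one [simp]: "iota B x ext_one = 0"
  by (auto simp: vec_eq_iff iota_def ext_one_def axis_def intro!: sum.neutral)

lemma eps_one: "eps x ext_one = ext_vec x"
proof -
  have "eps (ax i) ext_one = ax {i}" for i :: 'a
    by (simp add: ext_one_def eps_axis_axis)
  then show ?thesis by (subst eps_expand) (simp add: ext_vec_def)
qed

section \<open>Contractions and the Clifford relations\<close>

locale sym_form =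
  fixes B :: "'n::{finite,linorder} form"
  assumes lin_B: "Vector_Spaces.linear (*s) (*) (B x)" and sym_B: "B x y = B y x"
begin

sublocale B: Vector_Spaces.linear "(*s)" "(*)" "B x" for x by (rule lin_B)

lemma B_left: "B (x + y) z = B x z + B y z" "B (x - y) z = B x z - B y z" "B (c *s x) z = c * B x z"
    "B (- x) z = - B x z" "B 0 z = 0" "B (\<Sum>i\<in>A. g i) z = (\<Sum>i\<in>A. B (g i) z)"
  by (simp_all add: sym_B[of _ z] B.add B.diff B.scale B.neg B.zero B.sum)

lemmas B_right = B.add B.diff B.scale B.neg B.zero B.sum
lemmas B_simps = B_left B_right

lemma iota_eps: "iota B x (eps y u) = B x y *s u - eps y (iota B x u)"
proof -
  have "B x y = B x (\<Sum>j\<in>UNIV. y $ j *s axis j 1)" by (simp add: basis_expansion)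
  also have "\<dots> = (\<Sum>j\<in>UNIV. B x (axis j 1) * y $ j)" by (simp add: B_simps mult.commute)
  finally have *: "iota B x (ext_vec y) = B x y *s ext_one" by (simp add: iota_vec_sum)
  show ?thesis unfolding eps_def iota_wedge[OF ext_vec_degree] *
    by (simp add: clin_rules[OF clin_wedge_left] wedge_one_left)
qed

lemma clin_iota_vec: "clin (\<lambda>x. iota B x u)"
  by (rule clinI) (auto simp: vec_eq_iff iota_def B_simps algebra_simps sum.distrib sum_distrib_left)

lemma clin_gam_vec: "clin (\<lambda>x. gam B x u)"
  by (rule clinI) (simp_all add: gam_def clin_rules[OF clin_eps_vec] clin_rules[OF clin_iota_vec] vec.scale_right_distrib)

lemma iota_anti: "iota B x (iota B y u) = - iota B y (iota B x u)"
proof -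
  let ?S = "{u. iota B x (iota B y u) = - iota B y (iota B x u)}"
  have "vec.subspace ?S" by (auto simp: vec.subspace_def clin_rules[OF clin_iota] vec.scale_minus_right)
  then have "u \<in> ?S"
  proof (rule ext_gen_eps)
    show "ext_one \<in> ?S" by (simp add: clin_rules[OF clin_iota])
    fix i u assume "u \<in> ?S"
    then show "eps (ax i) u \<in> ?S"
      by (simp add: iota_eps clin_rules[OF clin_iota] clin_rules[OF clin_eps] algebra_simps)
  qed
  then show ?thesis by simp
qed

text \<open>The terms with two \<open>eps\<close> cancel, and so do those with two
  \<open>iota\<close>; each of the two mixed brackets contributes \<open>B x y\<close>.\<close>

lemma gam_anticomm: "gam B x (gam B y u) + gam B y (gam B x u) = (2 * B x y) *s u"
proof -
  have e: "gam B x (gam B y u) = eps x (eps y u) + eps x (iota B y u) + (B x y *s u - eps y (iota B x u))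
      + iota B x (iota B y u)" for x y
    by (simp only: gam_def clin_add[OF clin_iota] clin_add[OF clin_eps] iota_eps add.assoc)
  have "gam B y (gam B x u) = - eps x (eps y u) + eps y (iota B x u) + (B x y *s u - eps x (iota B y u))
      - iota B x (iota B y u)"
    unfolding e eps_anti[of y x u] iota_anti[of y x u] sym_B[of y x] by simp
  then show ?thesis unfolding e[of x y] by (simp add: vec_eq_iff algebra_simps)
qed

lemma gam_sq: "gam B x (gam B x u) = B x x *s u"
proof -
  have "2 *s gam B x (gam B x u) = 2 *s (B x x *s u)" using gam_anticomm[of x x u]
    by (simp only: vec.scale_scale) (simp add: vec_eq_iff)
  then show ?thesis by (simp only: vec_two_cancel)
qed

end

lemma iota_ax: "iota B x (ax I) = (\<Sum>j\<in>I. (shuffle_sign {j} (I - {j}) * B x (ax j)) *s ax (I - {j}))"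
proof -
  have "iota B x (ax I) $ J = (\<Sum>j\<in>I. shuffle_sign {j} (I - {j}) * B x (ax j) * ax (I - {j}) $ J)" for J
  proof -
    let ?g = "\<lambda>j. if j \<in> I \<and> J = I - {j} then shuffle_sign {j} (I - {j}) * B x (ax j) else 0"
    have "insert j J = I \<longleftrightarrow> j \<in> I \<and> J = I - {j}" if "j \<notin> J" for j
      using that by auto
    then have "iota B x (ax I) $ J = (\<Sum>j\<in>-J. ?g j)"
      unfolding iota_def by (auto simp: ax_nth intro!: sum.cong)
    also have "\<dots> = (\<Sum>j\<in>UNIV. ?g j)" by (rule sum.mono_neutral_left) auto
    also have "\<dots> = (\<Sum>j\<in>I. ?g j)" by (rule sum.mono_neutral_right) auto
    also have "\<dots> = (\<Sum>j\<in>I. shuffle_sign {j} (I - {j}) * B x (ax j) * ax (I - {j}) $ J)"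
      by (rule sum.cong[OF refl]) (simp add: ax_nth)
    finally show ?thesis .
  qed
  then show ?thesis by (simp add: vec_eq_iff)
qed

text \<open>The Clifford counterpart of \<open>ext_gen_eps\<close>. Since \<open>gam\<close> differs
  from \<open>eps\<close> by a contraction, e_I comes with terms of lower degree, which the strong
  induction on \<open>card I\<close> absorbs.\<close>

lemma ext_gen_gam:
  assumes S: "vec.subspace S" and one: "ext_one \<in> S" and step: "\<And>i u. u \<in> S \<Longrightarrow> gam B (ax i) u \<in> S"
  shows "(u :: 'n::{finite,linorder} ext) \<in> S"
proof -
  have ax: "ax I \<in> S" for I :: "'n set"
  proof (induction "card I" arbitrary: I rule: less_induct)
    case less
    show ?case
    proof (cases "I = {}")
      case True
      then show ?thesis using one by (simp add: ext_one_def)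
    next
      case False
      define i J where "i = Min I" and "J = I - {i}"
      have i: "I = insert i J" "i \<notin> J" "\<And>j. j \<in> J \<Longrightarrow> i < j"
        using False Min_le[of I] unfolding i_def J_def by (auto simp: order.strict_iff_order insert_absorb)
      have "card J < card I" using i by simp
      moreover have "card (J - {j}) \<le> card J" for j by (intro card_mono) auto
      ultimately have "card (J - {j}) < card I" for j by (meson le_less_trans)
      then have "iota B (ax i) (ax J) \<in> S"
        unfolding iota_ax by (intro vec.subspace_sum[OF S] vec.subspace_scale[OF S] less)
      moreover have "gam B (ax i) (ax J) \<in> S" by (intro step less) fact
      moreover have "ax I = gam B (ax i) (ax J) - iota B (ax i) (ax J)"
        using shuffle_sign_min[of J i] i by (auto simp: gam_def eps_axis_axis)
      ultimately show ?thesis using vec.subspace_diff[OF S] by metis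
    qed
  qed
  have "(\<Sum>I\<in>UNIV. u $ I *s ax I) \<in> S"
    by (intro vec.subspace_sum[OF S] vec.subspace_scale[OF S] ax)
  then show ?thesis by (simp add: basis_expansion)
qed

section \<open>Universal property of the Clifford algebra\<close>

function quant :: "(complex \<Rightarrow> 'w \<Rightarrow> 'w) \<Rightarrow> ('n \<Rightarrow> 'w \<Rightarrow> 'w) \<Rightarrow> 'w \<Rightarrow> 'n form \<Rightarrow> 'n::{finite,linorder} set \<Rightarrow> 'w::ab_group_add"
  where "quant sm a w0 B I = (if I = {} then w0 else
     a (Min I) (quant sm a w0 B (I - {Min I})) -
       (\<Sum>j\<in>I - {Min I}. sm (shuffle_sign {j} (I - {Min I} - {j}) * B (ax (Min I)) (ax j))
          (if j \<in> I - {Min I} then quant sm a w0 B (I - {Min I} - {j}) else 0)))"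
  by pat_completeness (elim Pair_inject, hypsubst, rule refl)
termination
proof (relation "Wellfounded.measure (\<lambda>(sm, a, w0, B, I). card I)", goal_cases)
  case 1 then show ?case by simp
next
  case (2 sm a w0 B I)
  then show ?case by (simp add: card_gt_0_iff)
next
  case (3 sm a w0 B I j)
  then have "card (I - {Min I} - {j}) \<le> card (I - {Min I})" by (intro card_mono) auto
  moreover have "card (I - {Min I}) < card I" using 3 by (simp add: card_gt_0_iff)
  ultimately show ?case by simp
qed

declare quant.simps [simp del]

text \<open>With i the minimum of I and J the rest, e_I is gam(e_i) e_J minus the contraction of e_J
  by e_i. A linear map that turns gam(e_i) into \<open>a i\<close> is forced to satisfy exactly this
  recursion.\<close>

lemma quant_step:
  assumes "I \<noteq> {}"
  shows "quant sm a w0 B I = a (Min I) (quant sm a w0 B (I - {Min I})) -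
       (\<Sum>j\<in>I - {Min I}. sm (shuffle_sign {j} (I - {Min I} - {j}) * B (ax (Min I)) (ax j))
          (quant sm a w0 B (I - {Min I} - {j})))"
proof -
  have "(\<Sum>j\<in>I - {Min I}. sm (shuffle_sign {j} (I - {Min I} - {j}) * B (ax (Min I)) (ax j))
          (if j \<in> I - {Min I} then quant sm a w0 B (I - {Min I} - {j}) else 0)) =
      (\<Sum>j\<in>I - {Min I}. sm (shuffle_sign {j} (I - {Min I} - {j}) * B (ax (Min I)) (ax j))
          (quant sm a w0 B (I - {Min I} - {j})))"
    by (rule sum.cong) simp_all
  then show ?thesis using quant.simps[of sm a w0 B I] unfolding if_not_P[OF assms] by (simp only:)
qed

definition quantize where
  "quantize sm a w0 B u = (\<Sum>I\<in>UNIV. sm (u $ I) (quant sm a w0 B I))"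

text \<open>The relations are asked for only on a subspace \<open>W\<close> and only modulo a
  subspace \<open>N\<close>. For the tensor algebra, \<open>W\<close> singles out the finitely
  supported functions and \<open>N\<close> is the Clifford ideal, so the quotient never has to be
  made a vector space. For \<open>ext_map\<close> the form is zero, \<open>W\<close> is everything
  and \<open>N\<close> is zero.\<close>

locale clifford_rep = sym_form B + W: vector_space sm
  for B :: "'n::{finite,linorder} form" and sm :: "complex \<Rightarrow> 'w \<Rightarrow> 'w::ab_group_add" +
  fixes a :: "'n \<Rightarrow> 'w \<Rightarrow> 'w" and N W :: "'w set" and w0 :: 'w
  assumes N: "W.subspace N" and W: "W.subspace W"
    and a_lin: "Vector_Spaces.linear sm sm (a i)"
    and a_W: "w \<in> W \<Longrightarrow> a i w \<in> W" and a_N: "w \<in> N \<Longrightarrow> a i w \<in> N"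
    and a_rel: "w \<in> W \<Longrightarrow> a i (a j w) + a j (a i w) - sm (2 * B (ax i) (ax j)) w \<in> N"
    and w0: "w0 \<in> W"
begin

abbreviation "F \<equiv> quantize sm a w0 B"

sublocale a: Vector_Spaces.linear sm sm "a i" for i by (rule a_lin)

lemma F_linear: "Vector_Spaces.linear (*s) sm F"
  by (simp add: Vector_Spaces.linear_iff vec.vector_space_axioms W.vector_space_axioms quantize_def
     W.scale_left_distrib sum.distrib W.scale_sum_right)

sublocale F: Vector_Spaces.linear "(*s)" sm F by (rule F_linear)

lemma F_ax: "F (ax I) = quant sm a w0 B I"
proof -
  have "F (ax I) = (\<Sum>J\<in>UNIV. if J = I then quant sm a w0 B J else 0)"
    unfolding quantize_def by (rule sum.cong[OF refl]) (simp add: ax_nth)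
  then show ?thesis by simp
qed

lemma F_one: "F ext_one = w0"
  unfolding ext_one_def F_ax by (subst quant.simps) simp

lemma quant_W: "quant sm a w0 B I \<in> W"
proof (induction "card I" arbitrary: I rule: less_induct)
  case less
  show ?case
  proof (cases "I = {}")
    case True
    then show ?thesis by (subst quant.simps) (simp add: w0)
  next
    case False
    then have m: "card (I - {Min I}) < card I" by (simp add: card_gt_0_iff)
    moreover have "card (I - {Min I} - {j}) \<le> card (I - {Min I})" for j by (intro card_mono) auto
    ultimately have m2: "card (I - {Min I} - {j}) < card I" for j by (meson le_less_trans)
    show ?thesis unfolding quant_step[OF False]
      by (intro W.subspace_diff[OF W] W.subspace_sum[OF W] W.subspace_scale[OF W] a_W less m m2)
  qed
qed

lemma F_W: "F u \<in> W"
  unfolding quantize_def by (intro W.subspace_sum[OF W] W.subspace_scale[OF W] quant_W)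

text \<open>The recursion of \<^const>\<open>quant\<close> solves \<open>F (\<gamma>(e\<^sub>j) u) = a\<^sub>j (F u)\<close> for the top degree part
  of the left side, for \<open>j\<close> below the support of \<open>u\<close>; the Clifford relations give the rest.\<close>

lemma F_gam_min:
  assumes "\<And>i. i \<in> I \<Longrightarrow> j < i"
  shows "F (gam B (ax j) (ax I)) = a j (F (ax I))"
proof -
  have j: "Min (insert j I) = j" "insert j I - {j} = I"
    using assms by (auto intro!: Min_eqI intro: less_imp_le)
  have "F (ax (insert j I)) = a j (F (ax I)) - F (iota B (ax j) (ax I))"
    using quant_step[of "insert j I" sm a w0 B] unfolding F_ax iota_ax F.sum F.scale j by simp
  moreover have "eps (ax j) (ax I) = ax (insert j I)"
    using assms shuffle_sign_min[of I j] by (auto simp: eps_axis_axis)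
  ultimately show ?thesis by (simp add: gam_def F.add)
qed

lemma lin_extend_ax:
  assumes "\<And>I. u $ I \<noteq> 0 \<Longrightarrow> F (gam B (ax i) (ax I)) - a i (F (ax I)) \<in> N"
  shows "F (gam B (ax i) u) - a i (F u) \<in> N"
proof -
  have "F (gam B (ax i) (\<Sum>I\<in>UNIV. u $ I *s ax I)) - a i (F (\<Sum>I\<in>UNIV. u $ I *s ax I)) =
     (\<Sum>I\<in>UNIV. sm (u $ I) (F (gam B (ax i) (ax I)) - a i (F (ax I))))"
    by (simp only: clin_rules[OF clin_gam] F.sum F.scale a.sum a.scale W.scale_right_diff_distrib sum_subtractf)
  also have "\<dots> \<in> N"
    using assms by (intro W.subspace_sum[OF N]) (metis W.subspace_0[OF N] W.subspace_scale[OF N] W.scale_zero_left)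
  finally show ?thesis by (simp add: basis_expansion)
qed

lemma N_trans: "x - y \<in> N \<Longrightarrow> y - z \<in> N \<Longrightarrow> x - z \<in> N"
  using W.subspace_add[OF N, of "x - y" "y - z"] by simp

lemma N_add: "x - y \<in> N \<Longrightarrow> x' - y' \<in> N \<Longrightarrow> (x + x') - (y + y') \<in> N"
  using W.subspace_add[OF N, of "x - y" "x' - y'"] by (simp add: algebra_simps)

lemma N_diff: "x - y \<in> N \<Longrightarrow> x' - y' \<in> N \<Longrightarrow> (x - x') - (y - y') \<in> N"
  using W.subspace_diff[OF N, of "x - y" "x' - y'"] by (simp add: algebra_simps)

lemma N_refl: "x - x \<in> N" using W.subspace_0[OF N] by simp

lemma N_a: "x - y \<in> N \<Longrightarrow> a i x - a i y \<in> N"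
  using a_N[of "x - y" i] by (simp add: a.diff)

text \<open>With j = Min I and J the rest of I, replace e_I by gam(e_j) e_J minus a contraction. For
  j < i the anticommutation relation moves gam(e_j) to the outside, where \<open>F_gam_min\<close>
  and the induction hypothesis apply. For i = j the relation is halved.\<close>

lemma F_gam_ax: "F (gam B (ax i) (ax I)) - a i (F (ax I)) \<in> N"
proof (induction "card I" arbitrary: I i rule: less_induct)
  case less
  show ?case
  proof (cases "\<forall>k\<in>I. i < k")
    case True
    then show ?thesis by (simp add: F_gam_min W.subspace_0[OF N])
  next
    case False
    then have ne: "I \<noteq> {}" by auto
    define j where "j = Min I"
    define J where "J = I - {j}"
    have j: "j \<in> I" "\<And>k. k \<in> J \<Longrightarrow> j < k" "I = insert j J" "j \<notin> J"
      using ne Min_le[of I] unfolding j_def J_def by (auto simp: order.strict_iff_order insert_absorb)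
    have cJ: "card J < card I" using j by simp
    have ji: "j \<le> i" using False j by (metis insert_iff leI less_imp_le order_trans)
    \<comment> \<open>The induction hypothesis, extended linearly to combinations of e_J and basis
      elements of lower degree than J; the contractions of e_J are of this kind.\<close>
    have smaller: "F (gam B (ax l) u) - a l (F u) \<in> N" if "\<And>K. card J \<le> card K \<Longrightarrow> K \<noteq> J \<Longrightarrow> u $ K = 0" for l u
    proof (rule lin_extend_ax)
      fix K assume "u $ K \<noteq> 0"
      then have "card K < card J \<or> K = J" using that by (metis not_le)
      then show "F (gam B (ax l) (ax K)) - a l (F (ax K)) \<in> N" using less[of K] cJ by auto
    qed
    have iJ: "iota B x (ax J) $ K = 0" if "card J \<le> card K" for x K
    proof -
      have "ax (J - {k}) $ K = 0" if "k \<in> J" for k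
        using leD[OF \<open>card J \<le> card K\<close>] card_Diff1_less[OF finite that] by (metis ax_nth)
      then show ?thesis by (simp add: iota_ax)
    qed
    have smi: "F (gam B (ax l) (iota B x (ax J))) - a l (F (iota B x (ax J))) \<in> N" for l x
      by (rule smaller) (simp add: iJ)
    have eI: "ax I = gam B (ax j) (ax J) - iota B (ax j) (ax J)"
      using shuffle_sign_min[of J j] j by (auto simp: gam_def eps_axis_axis)
    have FI: "F (ax I) = a j (F (ax J)) - F (iota B (ax j) (ax J))"
      unfolding eI by (simp add: F.diff F_gam_min j)
    show ?thesis
    proof (cases "i = j")
      case True
      have g: "gam B (ax i) (ax I) = B (ax j) (ax j) *s ax J - gam B (ax j) (iota B (ax j) (ax J))"
        unfolding eI True by (simp only: clin_diff[OF clin_gam] gam_sq)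
      have "a j (a j (F (ax J))) + a j (a j (F (ax J))) - sm (2 * B (ax j) (ax j)) (F (ax J)) \<in> N"
        by (rule a_rel[OF F_W])
      then have "sm (1/2) (a j (a j (F (ax J))) + a j (a j (F (ax J))) - sm (2 * B (ax j) (ax j)) (F (ax J))) \<in> N"
        by (rule W.subspace_scale[OF N])
      moreover have "sm (1/2) (x + x) = x" for x
        using W.scale_left_distrib[of "1/2" "1/2" x] by (simp add: W.scale_right_distrib)
      ultimately have "a j (a j (F (ax J))) - sm (B (ax j) (ax j)) (F (ax J)) \<in> N"
        by (simp add: W.scale_right_diff_distrib)
      then have "sm (B (ax j) (ax j)) (F (ax J)) - a j (a j (F (ax J))) \<in> N"
        using W.subspace_neg[OF N] by fastforce
      then have "(sm (B (ax j) (ax j)) (F (ax J)) - F (gam B (ax j) (iota B (ax j) (ax J))))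
          - (a j (a j (F (ax J))) - a j (F (iota B (ax j) (ax J)))) \<in> N"
        by (rule N_diff) (rule smi)
      then show ?thesis unfolding True g[unfolded True] FI F.diff F.scale a.diff .
    next
      case ij: False
      have g: "gam B (ax i) (ax I) = (2 * B (ax i) (ax j)) *s ax J - gam B (ax j) (gam B (ax i) (ax J))
           - gam B (ax i) (iota B (ax j) (ax J))"
        using gam_anticomm[of "ax i" "ax j" "ax J"] unfolding eI clin_diff[OF clin_gam]
        by (simp add: algebra_simps)
      \<comment> \<open>\<open>eps (ax i) (ax J)\<close> has the degree of e_I, out of reach of the
        induction; but j lies below its support, so \<open>F_gam_min\<close> gives an exact
        equality.\<close>
      have e: "F (gam B (ax j) (eps (ax i) (ax J))) = a j (F (eps (ax i) (ax J)))"
      proof (cases "i \<in> J")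
        case True
        then show ?thesis by (simp add: eps_axis_axis clin_rules[OF clin_gam] F.zero a.zero)
      next
        case False
        have "F (gam B (ax j) (ax (insert i J))) = a j (F (ax (insert i J)))"
          by (rule F_gam_min) (use j ji ij in auto)
        then show ?thesis using False by (simp add: eps_axis_axis clin_rules[OF clin_gam] F.scale a.scale)
      qed
      have "F (gam B (ax j) (gam B (ax i) (ax J))) - a j (F (gam B (ax i) (ax J))) \<in> N"
        unfolding gam_def[of B "ax i"] clin_add[OF clin_gam] F.add a.add e
        by (rule N_add[OF N_refl smi])
      moreover have "a j (F (gam B (ax i) (ax J))) - a j (a i (F (ax J))) \<in> N"
        by (rule N_a, rule less[OF cJ])
      ultimately have 1: "F (gam B (ax j) (gam B (ax i) (ax J))) - a j (a i (F (ax J))) \<in> N"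
        by (rule N_trans)
      have "a i (a j (F (ax J))) + a j (a i (F (ax J))) - sm (2 * B (ax i) (ax j)) (F (ax J)) \<in> N"
        by (rule a_rel[OF F_W])
      then have "sm (2 * B (ax i) (ax j)) (F (ax J)) - (a i (a j (F (ax J))) + a j (a i (F (ax J)))) \<in> N"
        using W.subspace_neg[OF N] by fastforce
      from N_diff[OF N_diff[OF this 1] smi[of i "ax j"]]
      show ?thesis unfolding g FI F.diff F.scale a.diff by (simp add: algebra_simps)
    qed
  qed
qed

theorem F_gam: "F (gam B (ax i) u) - a i (F u) \<in> N"
  by (rule lin_extend_ax) (rule F_gam_ax)

end

section \<open>The tensor algebra and Clifford multiplication\<close>

lemma tensor_alg_simps:
  "carrier tensor_alg = {t. finite {w. t w \<noteq> 0}}"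
  "monoid.mult tensor_alg s t = (\<lambda>w. \<Sum>k\<le>length w. s (take k w) * t (drop k w))"
  "one tensor_alg = (\<lambda>w. if w = [] then 1 else 0)"
  "zero tensor_alg = (\<lambda>w. 0)"
  "add tensor_alg s t = (\<lambda>w. s w + t w)"
  by (simp_all add: tensor_alg_def)

text \<open>Cutting a word in two is the same as choosing two words that concatenate to it. A sum
  over a fixed finite rectangle, independent of w, can be exchanged with other sums.\<close>

lemma tensor_mult_sum:
  assumes "finite A" "finite C" "{w. s w \<noteq> 0} \<subseteq> A" "{w. t w \<noteq> 0} \<subseteq> C"
  shows "(\<Sum>k\<le>length w. s (take k w) * t (drop k w)) =
     (\<Sum>(v, v')\<in>A \<times> C. if v @ v' = w then s v * t v' else (0::complex))"
proof -
  let ?h = "\<lambda>k. (take k w, drop k w)"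
  have inj: "inj_on ?h {..length w}"
    by (rule inj_on_inverseI[of _ "\<lambda>p. length (fst p)"]) simp
  have img: "?h ` {..length w} = {(v, v'). v @ v' = w}"
  proof (intro subset_antisym subsetI)
    fix p assume "p \<in> {(v, v'). v @ v' = w}"
    then show "p \<in> ?h ` {..length w}" by (intro image_eqI[of _ _ "length (fst p)"]) auto
  qed auto
  then have fin: "finite {(v, v'). v @ v' = w}" by (metis finite_atMost finite_imageI)
  have "(\<Sum>k\<le>length w. s (take k w) * t (drop k w)) = (\<Sum>(v, v')\<in>{(v, v'). v @ v' = w}. s v * t v')"
    unfolding img[symmetric] by (subst sum.reindex[OF inj]) simp
  also have "\<dots> = (\<Sum>(v, v')\<in>{(v, v'). v @ v' = w}. if v @ v' = w then s v * t v' else 0)"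
    by (rule sum.cong) auto
  also have "\<dots> = (\<Sum>(v, v')\<in>A \<times> C. if v @ v' = w then s v * t v' else 0)"
    by (rule sum.mono_neutral_cong) (use assms fin in auto)
  finally show ?thesis .
qed

lemma tensor_mult_closed:
  assumes "finite {w. s w \<noteq> 0}" "finite {w. t w \<noteq> 0}"
  shows "finite {w. (\<Sum>k\<le>length w. s (take k w) * t (drop k w)) \<noteq> (0::complex)}"
proof (rule finite_subset)
  show "{w. (\<Sum>k\<le>length w. s (take k w) * t (drop k w)) \<noteq> 0} \<subseteq>
      (\<lambda>(v, v'). v @ v') ` ({w. s w \<noteq> 0} \<times> {w. t w \<noteq> 0})"
  proof
    fix w assume "w \<in> {w. (\<Sum>k\<le>length w. s (take k w) * t (drop k w)) \<noteq> 0}"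
    then obtain k where "s (take k w) * t (drop k w) \<noteq> 0"
      by (metis (mono_tags, lifting) mem_Collect_eq sum.neutral)
    then show "w \<in> (\<lambda>(v, v'). v @ v') ` ({w. s w \<noteq> 0} \<times> {w. t w \<noteq> 0})"
      by (intro image_eqI[of _ _ "(take k w, drop k w)"]) auto
  qed
qed (use assms in simp)

text \<open>Both sides sum over two cuts of w; the reindexing accounts for the right side measuring
  the later cut from the earlier one.\<close>

lemma tensor_assoc:
  "(\<Sum>k\<le>length w. (\<Sum>l\<le>length (take k w). r (take l (take k w)) * s (drop l (take k w))) * t (drop k w)) =
   (\<Sum>l\<le>length w. r (take l w) * (\<Sum>k\<le>length (drop l w). s (take k (drop l w)) * (t (drop k (drop l w)) :: complex)))"
  (is "?L = ?R")
proof -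
  have "?L = (\<Sum>k\<le>length w. \<Sum>l\<le>k. r (take l w) * s (take (k - l) (drop l w)) * t (drop k w))"
    by (rule sum.cong[OF refl]) (auto simp: sum_distrib_right min_def drop_take intro!: sum.cong)
  also have "\<dots> = (\<Sum>(k, l)\<in>(SIGMA k:{..length w}. {..k}). r (take l w) * s (take (k - l) (drop l w)) * t (drop k w))"
    by (rule sum.Sigma) auto
  also have "\<dots> = (\<Sum>(l, k)\<in>(SIGMA l:{..length w}. {..length w - l}).
      r (take l w) * s (take k (drop l w)) * t (drop k (drop l w)))"
    by (rule sum.reindex_bij_witness[where i = "\<lambda>(l, k). (l + k, l)" and j = "\<lambda>(k, l). (l, k - l)"])
      (auto simp: add.commute)
  also have "\<dots> = ?R"
    by (subst sum.Sigma[symmetric]) (auto simp: sum_distrib_left mult.assoc intro!: sum.cong)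
  finally show ?thesis .
qed

lemma tensor_ring: "ring (tensor_alg :: ('n list \<Rightarrow> complex) ring)"
proof (rule ringI)
  show "abelian_group (tensor_alg :: ('n list \<Rightarrow> complex) ring)"
  proof (rule abelian_groupI)
    fix x y :: "'n list \<Rightarrow> complex" assume xy: "x \<in> carrier tensor_alg" "y \<in> carrier tensor_alg"
    show "x \<oplus>\<^bsub>tensor_alg\<^esub> y \<in> carrier tensor_alg"
      using xy unfolding tensor_alg_simps
      by (auto intro: finite_subset[of _ "{w. x w \<noteq> 0} \<union> {w. y w \<noteq> 0}"])
  next
    fix x assume x: "x \<in> carrier (tensor_alg :: ('n list \<Rightarrow> complex) ring)"
    show "\<exists>y\<in>carrier tensor_alg. y \<oplus>\<^bsub>tensor_alg\<^esub> x = \<zero>\<^bsub>tensor_alg\<^esub>"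
      using x by (intro bexI[of _ "\<lambda>w. - x w"]) (auto simp: tensor_alg_simps)
  qed (auto simp: tensor_alg_simps algebra_simps)
  show "Group.monoid (tensor_alg :: ('n list \<Rightarrow> complex) ring)"
  proof (rule monoidI)
    fix x y :: "'n list \<Rightarrow> complex" assume xy: "x \<in> carrier tensor_alg" "y \<in> carrier tensor_alg"
    show "x \<otimes>\<^bsub>tensor_alg\<^esub> y \<in> carrier tensor_alg"
      using xy unfolding tensor_alg_simps by (auto intro: tensor_mult_closed)
  next
    fix x y z :: "'n list \<Rightarrow> complex"
    show "x \<otimes>\<^bsub>tensor_alg\<^esub> y \<otimes>\<^bsub>tensor_alg\<^esub> z = x \<otimes>\<^bsub>tensor_alg\<^esub> (y \<otimes>\<^bsub>tensor_alg\<^esub> z)"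
      unfolding tensor_alg_simps by (intro ext tensor_assoc)
  next
    fix x :: "'n list \<Rightarrow> complex"
    have "(\<Sum>k\<le>length w. (if take k w = [] then 1 else 0) * x (drop k w)) = x w" for w
    proof -
      have "(\<Sum>k\<le>length w. (if take k w = [] then 1 else 0) * x (drop k w)) =
          (\<Sum>k\<le>length w. if k = 0 then x w else 0)"
        by (intro sum.cong) auto
      then show ?thesis by simp
    qed
    then show "\<one>\<^bsub>tensor_alg\<^esub> \<otimes>\<^bsub>tensor_alg\<^esub> x = x" by (simp add: tensor_alg_simps)
    have "(\<Sum>k\<le>length w. x (take k w) * (if drop k w = [] then 1 else 0)) = x w" for w
    proof -
      have "(\<Sum>k\<le>length w. x (take k w) * (if drop k w = [] then 1 else 0)) =
          (\<Sum>k\<le>length w. if k = length w then x w else 0)"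
        by (intro sum.cong) auto
      then show ?thesis by simp
    qed
    then show "x \<otimes>\<^bsub>tensor_alg\<^esub> \<one>\<^bsub>tensor_alg\<^esub> = x" by (simp add: tensor_alg_simps)
  next
    have "{w. (if w = [] then 1 else 0 :: complex) \<noteq> 0} = {[]}" by auto
    then show "\<one>\<^bsub>tensor_alg\<^esub> \<in> carrier (tensor_alg :: ('n list \<Rightarrow> complex) ring)"
      by (simp add: tensor_alg_simps)
  qed
qed (auto simp: tensor_alg_simps algebra_simps sum.distrib)

lemma tensor_act_superset:
  assumes "finite A" "{w. t w \<noteq> 0} \<subseteq> A"
  shows "tensor_act B t u = (\<Sum>w\<in>A. t w *s foldr (\<lambda>i. gam B (ax i)) w u)"
  unfolding tensor_act_def by (rule sum.mono_neutral_left) (use assms in auto)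

lemma clin_foldr_gam: "clin (foldr (\<lambda>i. gam B (ax i)) w)"
  by (induction w) (auto simp: clin_rules[OF clin_gam] clin_rules intro!: clinI)

lemma clin_tensor_act: "clin (tensor_act B t)"
  unfolding tensor_act_def
  by (rule clinI) (simp_all add: clin_rules[OF clin_foldr_gam] vec.scale_right_distrib sum.distrib vec.scale_sum_right mult.commute)

lemma tensor_act_add:
  assumes "finite {w. s w \<noteq> 0}" "finite {w. t w \<noteq> 0}"
  shows "tensor_act B (\<lambda>w. s w + t w) u = tensor_act B s u + tensor_act B t u"
proof -
  let ?A = "{w. s w \<noteq> 0} \<union> {w. t w \<noteq> 0}"
  have A: "finite ?A" using assms by simp
  have 1: "tensor_act B s u = (\<Sum>w\<in>?A. s w *s foldr (\<lambda>i. gam B (ax i)) w u)"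
    by (rule tensor_act_superset[OF A]) auto
  have 2: "tensor_act B t u = (\<Sum>w\<in>?A. t w *s foldr (\<lambda>i. gam B (ax i)) w u)"
    by (rule tensor_act_superset[OF A]) auto
  have 3: "tensor_act B (\<lambda>w. s w + t w) u = (\<Sum>w\<in>?A. (s w + t w) *s foldr (\<lambda>i. gam B (ax i)) w u)"
    by (rule tensor_act_superset[OF A]) auto
  show ?thesis unfolding 1 2 3 by (simp only: sum.distrib vec.scale_left_distrib)
qed

lemma tensor_act_scale: "tensor_act B (\<lambda>w. c * t w) u = c *s tensor_act B t u"
  by (cases "c = 0") (simp_all add: tensor_act_def vec.scale_sum_right)

lemma tensor_act_zero: "tensor_act B (\<lambda>w. 0) u = 0"
  by (simp add: tensor_act_def)

lemma tensor_act_one: "tensor_act B (\<lambda>w. if w = [] then 1 else 0) u = u"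
proof -
  have "{w. (if w = [] then 1 else 0 :: complex) \<noteq> 0} = {[]}" by auto
  then show ?thesis by (simp add: tensor_act_def)
qed

lemma tensor_act_mult:
  assumes s: "finite {w. s w \<noteq> 0}" and t: "finite {w. t w \<noteq> 0}"
  shows "tensor_act B (\<lambda>w. \<Sum>k\<le>length w. s (take k w) * t (drop k w)) u = tensor_act B s (tensor_act B t u)"
proof -
  let ?S = "{w. s w \<noteq> 0}" and ?T = "{w. t w \<noteq> 0}" and ?f = "foldr (\<lambda>i. gam B (ax i))"
  let ?A = "(\<lambda>(v, v'). v @ v') ` (?S \<times> ?T)"
  have A: "finite ?A" using assms by simp
  define h where "h w = ?f w u" for w
  have m: "(\<Sum>k\<le>length w. s (take k w) * t (drop k w)) = (\<Sum>(v, v')\<in>?S \<times> ?T. if v @ v' = w then s v * t v' else 0)" for w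
    by (rule tensor_mult_sum[OF s t]) auto
  have sub: "{w. (\<Sum>k\<le>length w. s (take k w) * t (drop k w)) \<noteq> 0} \<subseteq> ?A"
  proof
    fix w assume "w \<in> {w. (\<Sum>k\<le>length w. s (take k w) * t (drop k w)) \<noteq> 0}"
    then obtain k where "s (take k w) * t (drop k w) \<noteq> 0"
      by (metis (mono_tags, lifting) mem_Collect_eq sum.neutral)
    then show "w \<in> ?A"
      by (intro image_eqI[of _ _ "(take k w, drop k w)"]) auto
  qed
  have "tensor_act B (\<lambda>w. \<Sum>k\<le>length w. s (take k w) * t (drop k w)) u =
      (\<Sum>w\<in>?A. (\<Sum>(v, v')\<in>?S \<times> ?T. if v @ v' = w then s v * t v' else 0) *s h w)"
    by (subst tensor_act_superset[OF A sub]) (simp only: m h_def)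
  also have "\<dots> = (\<Sum>w\<in>?A. \<Sum>(v, v')\<in>?S \<times> ?T. if w = v @ v' then (s v * t v') *s h (v @ v') else 0)"
    unfolding scale_sum_left by (rule sum.cong[OF refl], rule sum.cong[OF refl]) auto
  also have "\<dots> = (\<Sum>p\<in>?S \<times> ?T. \<Sum>w\<in>?A. case p of (v, v') \<Rightarrow> if w = v @ v' then (s v * t v') *s h (v @ v') else 0)"
    by (rule sum.swap)
  also have "\<dots> = (\<Sum>(v, v')\<in>?S \<times> ?T. (s v * t v') *s h (v @ v'))"
  proof (rule sum.cong[OF refl], clarify)
    fix v v' assume "s v \<noteq> 0" "t v' \<noteq> 0"
    then have "v @ v' \<in> ?A" by auto
    then show "(\<Sum>w\<in>?A. if w = v @ v' then (s v * t v') *s h (v @ v') else 0) = (s v * t v') *s h (v @ v')"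
      using A by (simp only: sum.delta) simp
  qed
  also have "\<dots> = (\<Sum>v\<in>?S. \<Sum>v'\<in>?T. (s v * t v') *s ?f v (?f v' u))"
    by (simp add: sum.cartesian_product h_def)
  also have "\<dots> = tensor_act B s (tensor_act B t u)"
    unfolding tensor_act_def by (simp add: clin_rules[OF clin_foldr_gam] vec.scale_sum_right)
  finally show ?thesis .
qed

lemma tensor_vec_nonzero: "tensor_vec x w \<noteq> 0 \<longleftrightarrow> (\<exists>i. w = [i] \<and> x $ i \<noteq> 0)"
  by (auto simp: tensor_vec_def split: list.split)

lemma (in sym_form) tensor_act_vec: "tensor_act B (tensor_vec x) u = gam B x u"
proof -
  have "tensor_act B (tensor_vec x) u = (\<Sum>w\<in>(\<lambda>i. [i]) ` UNIV. tensor_vec x w *s foldr (\<lambda>i. gam B (ax i)) w u)"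
    by (rule tensor_act_superset) (auto simp: tensor_vec_nonzero)
  also have "\<dots> = (\<Sum>i\<in>UNIV. x $ i *s gam B (ax i) u)"
    by (subst sum.reindex) (auto simp: inj_on_def tensor_vec_def)
  also have "\<dots> = gam B (\<Sum>i\<in>UNIV. x $ i *s ax i) u"
    by (simp only: clin_rules[OF clin_gam_vec])
  finally show ?thesis by (simp add: basis_expansion)
qed

lemma tensor_vec_carrier: "tensor_vec x \<in> carrier tensor_alg"
proof -
  have "{w. tensor_vec x w \<noteq> 0} \<subseteq> (\<lambda>i. [i]) ` UNIV" by (auto simp: tensor_vec_nonzero)
  then show ?thesis unfolding tensor_alg_simps by (auto intro: finite_subset)
qed

lemma the_elem_image_eq: "t \<in> C \<Longrightarrow> (\<And>s. s \<in> C \<Longrightarrow> f s = f t) \<Longrightarrow> the_elem (f ` C) = f t"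
  by (metis empty_iff image_is_empty the_elem_image_unique)

text \<open>Polarization of the Clifford generators, reduced to scalars: p and q stand for the mixed
  products of two vectors, xx and yy for their squares, r for a value of the unit tensor.\<close>

lemma polar_identity: "p + q - 2 * b * r = (xx + yy + p + q) - (k + 2 * b + l) * r - (xx - k * r) - (yy - l * (r :: complex))"
  by (simp add: algebra_simps)

section \<open>Bijectivity of the symbol map\<close>

context sym_form
begin

abbreviation "TA \<equiv> (tensor_alg :: ('n list \<Rightarrow> complex) ring)"

definition cliff_ideal :: "('n list \<Rightarrow> complex) set" where
  "cliff_ideal = Idl\<^bsub>tensor_alg\<^esub> {t. \<exists>x. t = (\<lambda>w. (tensor_vec x \<otimes>\<^bsub>tensor_alg\<^esub> tensor_vec x) w
                                        - B x x * \<one>\<^bsub>tensor_alg\<^esub> w)}"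

lemma TA_scale: "t \<in> carrier TA \<Longrightarrow> (\<lambda>w. c * t w) \<in> carrier TA"
  by (auto simp: tensor_alg_simps intro: finite_subset[of _ "{w. t w \<noteq> 0}"])

interpretation TA: ring TA by (rule tensor_ring)

lemma TA_diff: "s \<in> carrier TA \<Longrightarrow> t \<in> carrier TA \<Longrightarrow> (\<lambda>w. s w - c * t w) \<in> carrier TA"
  by (auto simp: tensor_alg_simps intro: finite_subset[of _ "{w. s w \<noteq> 0} \<union> {w. t w \<noteq> 0}"])

lemma cliff_gens: "{t. \<exists>x. t = (\<lambda>w. (tensor_vec x \<otimes>\<^bsub>tensor_alg\<^esub> tensor_vec x) w
                                        - B x x * \<one>\<^bsub>tensor_alg\<^esub> w)} \<subseteq> carrier TA"
  by (auto intro!: TA_diff TA.m_closed tensor_vec_carrier)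

lemma cliff_ideal: "ideal cliff_ideal TA"
  unfolding cliff_ideal_def by (rule TA.genideal_ideal[OF cliff_gens])

interpretation I: ideal cliff_ideal TA by (rule cliff_ideal)

lemma I_carrier: "t \<in> cliff_ideal \<Longrightarrow> t \<in> carrier TA" by (rule I.Icarr)

lemma I_add: "s \<in> cliff_ideal \<Longrightarrow> t \<in> cliff_ideal \<Longrightarrow> (\<lambda>w. s w + t w) \<in> cliff_ideal"
  using I.a_closed[of s t] by (simp add: tensor_alg_simps)

text \<open>Ring ideals carry no scalar action; a scalar c is realized as left multiplication by the
  tensor c 1.\<close>

lemma I_scale:
  assumes "t \<in> cliff_ideal" shows "(\<lambda>w. c * t w) \<in> cliff_ideal"
proof -
  have "(\<lambda>w. c * \<one>\<^bsub>TA\<^esub> w) \<otimes>\<^bsub>TA\<^esub> t = (\<lambda>w. c * (\<one>\<^bsub>TA\<^esub> \<otimes>\<^bsub>TA\<^esub> t) w)"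
    unfolding tensor_alg_simps by (simp only: sum_distrib_left mult.assoc)
  then show ?thesis using I.I_l_closed[OF assms TA_scale[OF TA.one_closed, of c]] I_carrier[OF assms] by simp
qed

lemma I_diff: "s \<in> cliff_ideal \<Longrightarrow> t \<in> cliff_ideal \<Longrightarrow> (\<lambda>w. s w - t w) \<in> cliff_ideal"
  using I_add[of s, OF _ I_scale[of t "-1"]] by simp

text \<open>The tensors that act as zero form a two-sided ideal, and \<open>gam_sq\<close> puts the
  generators into it.\<close>

lemma tensor_act_ideal:
  assumes "t \<in> cliff_ideal" shows "tensor_act B t u = 0"
proof -
  let ?K = "{t \<in> carrier TA. \<forall>u. tensor_act B t u = 0}"
  have zero: "tensor_act B (\<lambda>w. 0) u = 0" for u by (simp add: tensor_act_def)
  have "ideal ?K TA"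
  proof (rule idealI[OF tensor_ring])
    show "subgroup ?K (add_monoid TA)"
    proof (rule TA.add.subgroupI)
      fix s t assume st: "s \<in> ?K" "t \<in> ?K"
      then show "s \<oplus>\<^bsub>TA\<^esub> t \<in> ?K" using TA.add.m_closed[of s t] by (auto simp: tensor_alg_simps tensor_act_add)
    next
      fix s assume s: "s \<in> ?K"
      have "(\<lambda>w. - s w) \<in> carrier TA" using s by (auto simp: tensor_alg_simps)
      then have "\<ominus>\<^bsub>TA\<^esub> s = (\<lambda>w. (-1) * s w)"
        using s by (intro TA.minus_equality) (auto simp: tensor_alg_simps)
      then show "\<ominus>\<^bsub>TA\<^esub> s \<in> ?K" using s TA.add.inv_closed[of s] by (simp only: mem_Collect_eq tensor_act_scale) simp
    qed (auto intro!: exI[of _ "\<lambda>w. 0"] simp: zero tensor_alg_simps)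
  next
    fix a x assume "a \<in> ?K" "x \<in> carrier TA"
    then show "x \<otimes>\<^bsub>TA\<^esub> a \<in> ?K" "a \<otimes>\<^bsub>TA\<^esub> x \<in> ?K"
      using TA.m_closed[of x a] TA.m_closed[of a x]
      by (auto simp: tensor_alg_simps tensor_act_mult clin_rules[OF clin_tensor_act])
  qed
  moreover have "{t. \<exists>x. t = (\<lambda>w. (tensor_vec x \<otimes>\<^bsub>tensor_alg\<^esub> tensor_vec x) w
                                        - B x x * \<one>\<^bsub>tensor_alg\<^esub> w)} \<subseteq> ?K"
  proof clarify
    fix x
    let ?t = "\<lambda>w. (tensor_vec x \<otimes>\<^bsub>tensor_alg\<^esub> tensor_vec x) w - B x x * \<one>\<^bsub>tensor_alg\<^esub> w"
    have fin: "finite {w. tensor_vec x w \<noteq> 0}" "finite {w. (tensor_vec x \<otimes>\<^bsub>tensor_alg\<^esub> tensor_vec x) w \<noteq> 0}"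
        "finite {w. - B x x * \<one>\<^bsub>TA\<^esub> w \<noteq> 0}"
      using tensor_vec_carrier[of x] TA.m_closed[OF tensor_vec_carrier tensor_vec_carrier, of x x]
        TA_scale[OF TA.one_closed, of "- B x x"] by (simp_all add: tensor_alg_simps(1))
    have "tensor_act B ?t u = tensor_act B (\<lambda>w. (tensor_vec x \<otimes>\<^bsub>tensor_alg\<^esub> tensor_vec x) w + (- B x x) * \<one>\<^bsub>tensor_alg\<^esub> w) u" for u
      by simp
    also have "\<dots> u = gam B x (gam B x u) - B x x *s u" for u
      by (subst tensor_act_add[OF fin(2,3)], subst tensor_act_scale)
        (simp add: tensor_alg_simps(2,3) tensor_act_mult[OF fin(1) fin(1)] tensor_act_vec tensor_act_one)
    finally have "tensor_act B ?t u = 0" for u by (simp add: gam_sq)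
    then show "?t \<in> carrier TA \<and> (\<forall>u. tensor_act B ?t u = 0)"
      by (intro conjI allI TA_diff TA.m_closed tensor_vec_carrier TA.one_closed)
  qed
  ultimately have "cliff_ideal \<subseteq> ?K"
    unfolding cliff_ideal_def by (rule TA.genideal_minimal)
  then show ?thesis using assms by auto
qed

text \<open>The action on \<open>1\<close> has kernel exactly the Clifford ideal: \<^const>\<open>quantize\<close> inverts it.\<close>

lemma rep: "clifford_rep B (\<lambda>c t w. c * t w) (\<lambda>i t. tensor_vec (ax i) \<otimes>\<^bsub>TA\<^esub> t) cliff_ideal (carrier TA) \<one>\<^bsub>TA\<^esub>"
proof -
  interpret fv: vector_space "\<lambda>(c::complex) (t::'n list \<Rightarrow> complex) w. c * t w"
    by unfold_locales (rule ext, simp add: distrib_left distrib_right)+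
  have sq: "(\<lambda>w. (tensor_vec x \<otimes>\<^bsub>TA\<^esub> tensor_vec x) w - B x x * \<one>\<^bsub>TA\<^esub> w) \<in> cliff_ideal" for x
    using TA.genideal_self[OF cliff_gens] unfolding cliff_ideal_def by blast
  \<comment> \<open>The ideal is generated by squares of vectors, while \<open>clifford_rep\<close>
    asks for anticommutators: combine the generators for x + y, x and y.\<close>
  have polar: "(\<lambda>w. (tensor_vec x \<otimes>\<^bsub>TA\<^esub> tensor_vec y) w + (tensor_vec y \<otimes>\<^bsub>TA\<^esub> tensor_vec x) w
      - 2 * B x y * \<one>\<^bsub>TA\<^esub> w) \<in> cliff_ideal" for x y
  proof -
    have v: "tensor_vec (x + y) = (\<lambda>w. tensor_vec x w + tensor_vec y w)"
      by (auto simp: tensor_vec_def fun_eq_iff split: list.split)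
    have e: "(tensor_vec (x + y) \<otimes>\<^bsub>TA\<^esub> tensor_vec (x + y)) w = (tensor_vec x \<otimes>\<^bsub>TA\<^esub> tensor_vec x) w +
       (tensor_vec y \<otimes>\<^bsub>TA\<^esub> tensor_vec y) w + (tensor_vec x \<otimes>\<^bsub>TA\<^esub> tensor_vec y) w + (tensor_vec y \<otimes>\<^bsub>TA\<^esub> tensor_vec x) w" for w
      unfolding v tensor_alg_simps by (simp add: algebra_simps sum.distrib)
    have b: "B (x + y) (x + y) = B x x + 2 * B x y + B y y" by (simp add: B_left B_right sym_B[of y x])
    have "(\<lambda>w. (tensor_vec x \<otimes>\<^bsub>TA\<^esub> tensor_vec y) w + (tensor_vec y \<otimes>\<^bsub>TA\<^esub> tensor_vec x) w
      - 2 * B x y * \<one>\<^bsub>TA\<^esub> w) = (\<lambda>w. ((tensor_vec (x + y) \<otimes>\<^bsub>TA\<^esub> tensor_vec (x + y)) w - B (x + y) (x + y) * \<one>\<^bsub>TA\<^esub> w)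
       - ((tensor_vec x \<otimes>\<^bsub>TA\<^esub> tensor_vec x) w - B x x * \<one>\<^bsub>TA\<^esub> w) - ((tensor_vec y \<otimes>\<^bsub>TA\<^esub> tensor_vec y) w - B y y * \<one>\<^bsub>TA\<^esub> w))"
      by (rule ext) (simp only: e b, rule polar_identity)
    then show ?thesis using I_diff[OF I_diff[OF sq[of "x + y"] sq[of x]] sq[of y]] by simp
  qed
  show ?thesis
  proof unfold_locales
    show "fv.subspace cliff_ideal"
      using I_add I_scale I.zero_closed by (auto simp: fv.subspace_def plus_fun_def zero_fun_def tensor_alg_simps(4))
    show "fv.subspace (carrier TA)"
      using TA.a_closed TA_scale TA.zero_closed by (auto simp: fv.subspace_def plus_fun_def zero_fun_def tensor_alg_simps(4,5))
    show "\<one>\<^bsub>TA\<^esub> \<in> carrier TA" by (rule TA.one_closed)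
  next
    fix i :: 'n
    show "tensor_vec (ax i) \<otimes>\<^bsub>TA\<^esub> (b1 + b2) = tensor_vec (ax i) \<otimes>\<^bsub>TA\<^esub> b1 + tensor_vec (ax i) \<otimes>\<^bsub>TA\<^esub> b2" for b1 b2
      by (rule ext) (simp only: tensor_alg_simps plus_fun_apply distrib_left sum.distrib)
    show "tensor_vec (ax i) \<otimes>\<^bsub>TA\<^esub> (\<lambda>w. r * b w) = (\<lambda>w. r * (tensor_vec (ax i) \<otimes>\<^bsub>TA\<^esub> b) w)" for r b
      by (rule ext) (simp only: tensor_alg_simps sum_distrib_left mult.left_commute)
    show "tensor_vec (ax i) \<otimes>\<^bsub>TA\<^esub> w \<in> carrier TA" if "w \<in> carrier TA" for w
      using that by (intro TA.m_closed tensor_vec_carrier)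
    show "tensor_vec (ax i) \<otimes>\<^bsub>TA\<^esub> w \<in> cliff_ideal" if "w \<in> cliff_ideal" for w
      using that by (intro I.I_l_closed tensor_vec_carrier)
    fix j w assume w: "w \<in> carrier TA"
    let ?p = "\<lambda>w. (tensor_vec (ax i) \<otimes>\<^bsub>TA\<^esub> tensor_vec (ax j)) w + (tensor_vec (ax j) \<otimes>\<^bsub>TA\<^esub> tensor_vec (ax i)) w
      - 2 * B (ax i) (ax j) * \<one>\<^bsub>TA\<^esub> w"
    have "?p \<otimes>\<^bsub>TA\<^esub> w \<in> cliff_ideal" by (rule I.I_r_closed[OF polar w])
    moreover have lin: "(\<lambda>w. s w + t w - c * r w) \<otimes>\<^bsub>TA\<^esub> w = (\<lambda>v. (s \<otimes>\<^bsub>TA\<^esub> w) v + (t \<otimes>\<^bsub>TA\<^esub> w) v - c * (r \<otimes>\<^bsub>TA\<^esub> w) v)" for s t r c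
      by (rule ext) (simp only: tensor_alg_simps distrib_right left_diff_distrib sum.distrib sum_subtractf sum_distrib_left mult.assoc)
    ultimately show "tensor_vec (ax i) \<otimes>\<^bsub>TA\<^esub> (tensor_vec (ax j) \<otimes>\<^bsub>TA\<^esub> w) + tensor_vec (ax j) \<otimes>\<^bsub>TA\<^esub> (tensor_vec (ax i) \<otimes>\<^bsub>TA\<^esub> w)
         - (\<lambda>v. 2 * B (ax i) (ax j) * w v) \<in> cliff_ideal"
      using w by (simp add: lin TA.m_assoc tensor_vec_carrier TA.l_one plus_fun_def fun_diff_def)
  qed
qed

text \<open>Reading the word from its end, \<open>F_gam\<close> turns each \<open>gam\<close> into
  multiplication by the corresponding letter, modulo the ideal. Hence \<open>quantize\<close> after
  the symbol is the identity modulo the ideal, which is what injectivity needs.\<close>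

lemma tensor_word_act:
  assumes F: "Q = quantize (\<lambda>c t w. c * t w) (\<lambda>i t. tensor_vec (ax i) \<otimes>\<^bsub>TA\<^esub> t) \<one>\<^bsub>TA\<^esub> B"
  shows "Q (foldr (\<lambda>i. gam B (ax i)) w ext_one) - (\<lambda>v. if v = w then 1 else 0) \<in> cliff_ideal"
proof -
  interpret clifford_rep B "\<lambda>c t w. c * t w" "\<lambda>i t. tensor_vec (ax i) \<otimes>\<^bsub>TA\<^esub> t" cliff_ideal "carrier TA" "\<one>\<^bsub>TA\<^esub>"
    by (rule rep)
  show ?thesis unfolding F
  proof (induction w)
    case Nil
    have "F ext_one - (\<lambda>v. if v = [] then 1 else 0) = \<zero>\<^bsub>TA\<^esub>"
      unfolding F_one by (simp add: fun_eq_iff tensor_alg_simps)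
    then show ?case using I.zero_closed by (simp only: foldr.simps id_apply)
  next
    case (Cons i w)
    have e: "tensor_vec (ax i) \<otimes>\<^bsub>TA\<^esub> (\<lambda>v. if v = w then 1 else 0) = (\<lambda>v. if v = i # w then 1 else 0)"
    proof
      fix v :: "'n list"
      have "(\<Sum>k\<le>length v. tensor_vec (ax i) (take k v) * (if drop k v = w then 1 else 0)) =
        (\<Sum>(a, b)\<in>{[i]} \<times> {w}. if a @ b = v then tensor_vec (ax i) a * (if b = w then 1 else 0) else 0)"
        by (rule tensor_mult_sum) (auto simp: tensor_vec_nonzero ax_nth split: if_splits)
      then show "(tensor_vec (ax i) \<otimes>\<^bsub>TA\<^esub> (\<lambda>v. if v = w then 1 else 0)) v = (if v = i # w then 1 else 0)"
        by (auto simp: tensor_alg_simps tensor_vec_def)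
    qed
    from N_trans[OF F_gam N_a[OF Cons.IH, of i]]
    show ?case by (simp only: e foldr.simps comp_apply)
  qed
qed

lemma tensor_act_kernel:
  assumes t: "t \<in> carrier TA" and "tensor_act B t ext_one = 0"
  shows "t \<in> cliff_ideal"
proof -
  interpret clifford_rep B "\<lambda>c t w. c * t w" "\<lambda>i t. tensor_vec (ax i) \<otimes>\<^bsub>TA\<^esub> t" cliff_ideal "carrier TA" "\<one>\<^bsub>TA\<^esub>"
    by (rule rep)
  let ?A = "{w. t w \<noteq> 0}"
  have A: "finite ?A" using t by (simp add: tensor_alg_simps)
  have tv: "(\<Sum>w\<in>?A. (\<lambda>v. t w * (if v = w then 1 else 0))) = t"
  proof
    fix v
    have "(\<Sum>w\<in>?A. (\<lambda>v. t w * (if v = w then 1 else 0))) v = (\<Sum>w\<in>?A. if v = w then t w else 0)"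
      by (induction rule: finite_induct[OF A]) (auto simp: zero_fun_def)
    then show "(\<Sum>w\<in>?A. (\<lambda>v. t w * (if v = w then 1 else 0))) v = t v" using A by simp
  qed
  have "F (tensor_act B t ext_one) - t = (\<Sum>w\<in>?A. (\<lambda>v. t w * (F (foldr (\<lambda>i. gam B (ax i)) w ext_one) - (\<lambda>v. if v = w then 1 else 0)) v))"
  proof -
    have "F (tensor_act B t ext_one) = (\<Sum>w\<in>?A. (\<lambda>v. t w * F (foldr (\<lambda>i. gam B (ax i)) w ext_one) v))"
      unfolding tensor_act_def F.sum F.scale ..
    then have "F (tensor_act B t ext_one) - t = (\<Sum>w\<in>?A. (\<lambda>v. t w * F (foldr (\<lambda>i. gam B (ax i)) w ext_one) v))
        - (\<Sum>w\<in>?A. (\<lambda>v. t w * (if v = w then 1 else 0)))" unfolding tv by simp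
    also have "\<dots> = (\<Sum>w\<in>?A. (\<lambda>v. t w * F (foldr (\<lambda>i. gam B (ax i)) w ext_one) v) - (\<lambda>v. t w * (if v = w then 1 else 0)))"
      by (rule sum_subtractf[symmetric])
    also have "\<dots> = (\<Sum>w\<in>?A. (\<lambda>v. t w * (F (foldr (\<lambda>i. gam B (ax i)) w ext_one) - (\<lambda>v. if v = w then 1 else 0)) v))"
      by (rule sum.cong[OF refl], rule ext) (simp add: right_diff_distrib)
    finally show ?thesis .
  qed
  also have "\<dots> \<in> cliff_ideal"
    by (intro W.subspace_sum[OF N] I_scale tensor_word_act refl)
  finally have "- t \<in> cliff_ideal" using assms(2) by (simp add: F.zero)
  then show ?thesis using W.subspace_neg[OF N, of "- t"] by simp
qed

lemma clifford_alg_eq: "clifford_alg B = TA Quot cliff_ideal"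
  unfolding clifford_alg_def cliff_ideal_def ..

lemma carrier_clifford: "carrier (clifford_alg B) = {cliff_ideal +>\<^bsub>TA\<^esub> t | t. t \<in> carrier TA}"
  unfolding clifford_alg_eq FactRing_def A_RCOSETS_def' by auto

lemma symbol_coset:
  assumes t: "t \<in> carrier TA"
  shows "clifford_symbol B (cliff_ideal +>\<^bsub>TA\<^esub> t) = tensor_act B t ext_one"
proof -
  have "tensor_act B s ext_one = tensor_act B t ext_one" if s: "s \<in> cliff_ideal +>\<^bsub>TA\<^esub> t" for s
  proof -
    obtain h where "h \<in> cliff_ideal" "s = h \<oplus>\<^bsub>TA\<^esub> t"
      using s unfolding a_r_coset_def' by auto
    then have h: "h \<in> cliff_ideal" "s = (\<lambda>w. h w + t w)" by (simp_all only: tensor_alg_simps(5))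
    then show ?thesis using I_carrier[OF h(1)] t tensor_act_ideal[OF h(1)]
      by (simp add: tensor_act_add tensor_alg_simps(1))
  qed
  then show ?thesis unfolding clifford_symbol_def by (rule the_elem_image_eq[OF I.a_rcos_self[OF t]])
qed

lemma symbol_inj: "inj_on (clifford_symbol B) (carrier (clifford_alg B))"
proof (rule inj_onI)
  fix c d assume "c \<in> carrier (clifford_alg B)" "d \<in> carrier (clifford_alg B)"
    and eq: "clifford_symbol B c = clifford_symbol B d"
  then obtain s t where st: "s \<in> carrier TA" "t \<in> carrier TA" "c = cliff_ideal +>\<^bsub>TA\<^esub> s" "d = cliff_ideal +>\<^bsub>TA\<^esub> t"
    by (auto simp: carrier_clifford)
  have m: "(\<lambda>w. (-1) * t w) \<in> carrier TA" by (rule TA_scale[OF st(2)])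
  have "tensor_act B (\<lambda>w. s w + (-1) * t w) ext_one = 0"
    using eq st m by (subst tensor_act_add) (auto simp: symbol_coset tensor_alg_simps(1) tensor_act_scale[of _ "-1", simplified])
  then have I: "(\<lambda>w. s w + (-1) * t w) \<in> cliff_ideal"
    using TA.a_closed[OF st(1) m] by (intro tensor_act_kernel) (simp_all add: tensor_alg_simps(5))
  have "s \<in> cliff_ideal +>\<^bsub>TA\<^esub> t"
    unfolding a_r_coset_def' tensor_alg_simps(5) by (rule UN_I[OF I]) (simp add: fun_eq_iff)
  then show "c = d" using I.a_repr_independence'[OF _ st(2), of s] st by simp
qed

text \<open>\<open>F u\<close> itself is a preimage of u: the identity holds for 1 and persists
  under every \<open>gam\<close>, since the ideal acts as zero.\<close>

lemma tensor_surj: "\<exists>t\<in>carrier TA. tensor_act B t ext_one = u"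
proof -
  interpret clifford_rep B "\<lambda>c t w. c * t w" "\<lambda>i t. tensor_vec (ax i) \<otimes>\<^bsub>TA\<^esub> t" cliff_ideal "carrier TA" "\<one>\<^bsub>TA\<^esub>"
    by (rule rep)
  let ?S = "{u. tensor_act B (F u) ext_one = u}"
  have add: "tensor_act B (F u + F v) x = tensor_act B (F u) x + tensor_act B (F v) x" for u v x
    using tensor_act_add[of "F u" "F v"] F_W[of u] F_W[of v] by (simp add: plus_fun_def tensor_alg_simps(1))
  have S: "vec.subspace ?S"
    using tensor_act_zero by (auto simp: vec.subspace_def F.add F.scale F.zero add tensor_act_scale zero_fun_def)
  have "tensor_act B (F (gam B (ax i) u)) v = gam B (ax i) (tensor_act B (F u) v)" for i u v
  proof -
    let ?d = "F (gam B (ax i) u) - tensor_vec (ax i) \<otimes>\<^bsub>TA\<^esub> F u"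
    have d: "?d \<in> cliff_ideal" by (rule F_gam)
    have c: "tensor_vec (ax i) \<otimes>\<^bsub>TA\<^esub> F u \<in> carrier TA" by (rule a_W[OF F_W])
    have "tensor_act B (F (gam B (ax i) u)) v = tensor_act B (\<lambda>w. ?d w + (tensor_vec (ax i) \<otimes>\<^bsub>TA\<^esub> F u) w) v" by simp
    also have "\<dots> = tensor_act B (tensor_vec (ax i) \<otimes>\<^bsub>TA\<^esub> F u) v"
      using I_carrier[OF d] c tensor_act_ideal[OF d] by (subst tensor_act_add) (simp_all add: tensor_alg_simps(1))
    also have "\<dots> = gam B (ax i) (tensor_act B (F u) v)"
      using tensor_vec_carrier[of "ax i"] F_W[of u] by (simp add: tensor_alg_simps(1,2) tensor_act_mult tensor_act_vec)
    finally show ?thesis .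
  qed
  note step = this
  have "u \<in> ?S"
  proof (rule ext_gen_gam[OF S, of B])
    have "tensor_act B \<one>\<^bsub>TA\<^esub> ext_one = ext_one" by (simp only: tensor_alg_simps(3) tensor_act_one)
    then show "ext_one \<in> ?S" by (simp only: mem_Collect_eq F_one)
    show "gam B (ax i) u \<in> ?S" if "u \<in> ?S" for i u
      using that by (simp only: mem_Collect_eq step)
  qed
  then show ?thesis using F_W by blast
qed

lemma cmul_act:
  assumes s: "s \<in> carrier TA" and t: "t \<in> carrier TA"
  shows "cmul B (tensor_act B s ext_one) (tensor_act B t ext_one) = tensor_act B s (tensor_act B t ext_one)"
proof -
  have q: "the_inv_into (carrier (clifford_alg B)) (clifford_symbol B) (tensor_act B t ext_one) = cliff_ideal +>\<^bsub>TA\<^esub> t"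
    if "t \<in> carrier TA" for t
    by (rule the_inv_into_f_eq[OF symbol_inj symbol_coset[OF that]]) (use that in \<open>auto simp: carrier_clifford\<close>)
  have "(cliff_ideal +>\<^bsub>TA\<^esub> s) \<otimes>\<^bsub>clifford_alg B\<^esub> (cliff_ideal +>\<^bsub>TA\<^esub> t) = cliff_ideal +>\<^bsub>TA\<^esub> (s \<otimes>\<^bsub>TA\<^esub> t)"
    unfolding clifford_alg_eq FactRing_def using I.rcoset_mult_add[OF s t] by simp
  then show ?thesis unfolding cmul_def Let_def q[OF s] q[OF t]
    using s t by (simp add: symbol_coset TA.m_closed) (simp add: tensor_alg_simps(1,2) tensor_act_mult)
qed

text \<open>Left Clifford multiplication by u is the action of any tensor with symbol u. Linearity
  and associativity of \<open>cmul\<close> are now inherited from composition of operators, without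
  going back to cosets.\<close>

lemma cmul_op: "\<exists>t\<in>carrier TA. (\<forall>v. cmul B u v = tensor_act B t v) \<and> tensor_act B t ext_one = u"
proof -
  obtain t where t: "t \<in> carrier TA" "tensor_act B t ext_one = u" using tensor_surj by blast
  have "cmul B u v = tensor_act B t v" for v
    using tensor_surj[of v] cmul_act[OF t(1)] t(2) by auto
  then show ?thesis using t by blast
qed

lemma cmul_act_left: "t \<in> carrier TA \<Longrightarrow> cmul B (tensor_act B t ext_one) v = tensor_act B t v"
  using tensor_surj[of v] cmul_act by auto

lemma clin_cmul: "clin (cmul B u)"
proof -
  obtain t where "\<And>v. cmul B u v = tensor_act B t v" using cmul_op by blast
  then have "cmul B u = tensor_act B t" by auto
  then show ?thesis by (simp only: clin_tensor_act)
qed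

lemma cmul_one_right: "cmul B u ext_one = u"
  using cmul_op[of u] by auto

lemma cmul_one_left: "cmul B ext_one v = v"
  using cmul_act_left[OF TA.one_closed, of v] by (simp add: tensor_alg_simps(3) tensor_act_one)

lemma gam_one: "gam B x ext_one = ext_vec x"
  by (simp add: gam_def eps_one)

lemma cmul_vec: "cmul B (ext_vec x) v = gam B x v"
  using cmul_act_left[OF tensor_vec_carrier, of x v] by (simp add: tensor_act_vec gam_one)

lemma cmul_assoc: "cmul B (cmul B u v) w = cmul B u (cmul B v w)"
proof -
  obtain s where s: "s \<in> carrier TA" "\<And>v. cmul B u v = tensor_act B s v" "tensor_act B s ext_one = u"
    using cmul_op[of u] by blast
  obtain t where t: "t \<in> carrier TA" "\<And>w. cmul B v w = tensor_act B t w" "tensor_act B t ext_one = v"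
    using cmul_op[of v] by blast
  have m: "tensor_act B (s \<otimes>\<^bsub>TA\<^esub> t) x = tensor_act B s (tensor_act B t x)" for x
    using s(1) t(1) by (simp add: tensor_alg_simps(1,2) tensor_act_mult)
  show ?thesis using cmul_act_left[OF TA.m_closed[OF s(1) t(1)], of w]
    by (simp add: m s(2) t(2,3))
qed

lemma clin_cmul_left: "clin (\<lambda>u. cmul B u v)"
proof (rule clinI)
  fix x y c
  obtain s where s: "s \<in> carrier TA" "\<And>v. cmul B x v = tensor_act B s v" "tensor_act B s ext_one = x"
    using cmul_op[of x] by blast
  obtain t where t: "t \<in> carrier TA" "\<And>w. cmul B y w = tensor_act B t w" "tensor_act B t ext_one = y"
    using cmul_op[of y] by blast
  have m: "tensor_act B (s \<oplus>\<^bsub>TA\<^esub> t) v = tensor_act B s v + tensor_act B t v" for v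
    using s(1) t(1) by (simp add: tensor_alg_simps(1,5) tensor_act_add)
  show "cmul B (x + y) v = cmul B x v + cmul B y v"
    using cmul_act_left[OF TA.a_closed[OF s(1) t(1)], of v] by (simp add: m s(3) t(3) s(2) t(2))
  show "cmul B (c *s x) v = c *s cmul B x v"
    using cmul_act_left[OF TA_scale[OF s(1), of c], of v] by (simp add: tensor_act_scale s(3) s(2))
qed

end

section \<open>The spin group\<close>

text \<open>The grading involution. Evenness becomes the equation \<open>gr_inv u = u\<close>, which
  is stable under Clifford products because \<open>gr_inv\<close> is multiplicative
  (\<open>gr_inv_cm\<close>).\<close>

definition gr_inv :: "'n::finite ext \<Rightarrow> 'n ext" where
  "gr_inv u = (\<chi> I. (-1) ^ card I * u $ I)"

definition pr2 :: "'n::finite ext \<Rightarrow> 'n ext" where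
  "pr2 u = (\<chi> I. if card I = 2 then u $ I else 0)"

lemma clin_gr_inv: "clin gr_inv"
  by (rule clinI) (auto simp: vec_eq_iff gr_inv_def algebra_simps)

lemma clin_ext_rev: "clin ext_rev"
  by (rule clinI) (auto simp: vec_eq_iff ext_rev_def algebra_simps)

lemma clin_pr2: "clin pr2"
  by (rule clinI) (auto simp: vec_eq_iff pr2_def)

lemma clin_ext_to_vec: "clin ext_to_vec"
  by (rule clinI) (auto simp: vec_eq_iff ext_to_vec_def)

lemma ext_rev_rev [simp]: "ext_rev (ext_rev u) = u"
  by (simp add: vec_eq_iff ext_rev_def flip: mult.assoc power_mult_distrib)

lemma gr_inv_one [simp]: "gr_inv ext_one = ext_one"
  by (simp add: vec_eq_iff gr_inv_def ext_one_def ax_nth)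

lemma ext_rev_one [simp]: "ext_rev ext_one = ext_one"
  by (simp add: vec_eq_iff ext_rev_def ext_one_def ax_nth binomial_eq_0)

lemma pr0_rev [simp]: "pr0 (ext_rev u) = pr0 u"
  by (simp add: pr0_def ext_rev_def binomial_eq_0)

lemma pr0_simps: "pr0 (u + v) = pr0 u + pr0 v" "pr0 (u - v) = pr0 u - pr0 v" "pr0 (c *s u) = c * pr0 u"
    "pr0 (- u) = - pr0 u" "pr0 0 = 0" "pr0 (\<Sum>i\<in>A. g i) = (\<Sum>i\<in>A. pr0 (g i))" "pr0 ext_one = 1"
  by (simp_all add: pr0_def ext_one_def ax_nth)

lemma ext_even_iff: "u \<in> ext_even \<longleftrightarrow> gr_inv u = u"
proof
  assume "u \<in> ext_even"
  then have "gr_inv u $ I = u $ I" for I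
    by (cases "odd (card I)") (auto simp: gr_inv_def ext_even_def)
  then show "gr_inv u = u" by (simp add: vec_eq_iff)
next
  assume a: "gr_inv u = u"
  have "u $ I = 0" if "odd (card I)" for I
    using arg_cong[OF a, of "\<lambda>u. u $ I"] that by (simp add: gr_inv_def)
  then show "u \<in> ext_even" by (simp add: ext_even_def)
qed

lemma ext_even_subspace: "vec.subspace ext_even"
  by (auto simp: vec.subspace_def ext_even_def)

lemma even_one: "ext_one \<in> ext_even" by (simp add: ext_even_iff)

lemma even_rev: "u \<in> ext_even \<Longrightarrow> ext_rev u \<in> ext_even"
  by (simp add: ext_even_def ext_rev_def)

lemma degree2_even: "u \<in> ext_degree 2 \<Longrightarrow> u \<in> ext_even"
proof -
  assume u: "u \<in> ext_degree 2"
  have "card I \<noteq> 2" if "odd (card I)" for I :: "'a set" using that by auto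
  then show ?thesis using u by (simp add: ext_even_def ext_degree_def)
qed

lemma pr2_degree: "pr2 u \<in> ext_degree 2"
  by (simp add: pr2_def ext_degree_def)

lemma pr2_id: "u \<in> ext_degree 2 \<Longrightarrow> pr2 u = u"
  by (simp add: pr2_def ext_degree_def vec_eq_iff)

lemma eps_nth: "eps x u $ K = (\<Sum>i\<in>K. x $ i * (shuffle_sign {i} (K - {i}) * u $ (K - {i})))"
proof -
  have "eps x u $ K = (\<Sum>i\<in>UNIV. x $ i * eps (ax i) u $ K)"
    by (subst eps_expand) simp
  also have "\<dots> = (\<Sum>i\<in>K. x $ i * (shuffle_sign {i} (K - {i}) * u $ (K - {i})))"
    by (rule sum.mono_neutral_cong_right) (auto simp: eps_axis)
  finally show ?thesis .
qed

lemma iota_nth: "iota B x u $ J = (\<Sum>j\<in>-J. shuffle_sign {j} J * B x (ax j) * u $ insert j J)"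
  by (simp add: iota_def)

lemma gr_inv_eps: "gr_inv (eps x u) = - eps x (gr_inv u)"
proof -
  have "gr_inv (eps x u) $ K = (- eps x (gr_inv u)) $ K" for K
  proof -
    have c: "(-1 :: complex) ^ card K = - ((-1) ^ card (K - {i}))" if "i \<in> K" for i
      using card_Suc_Diff1[OF finite that] by (metis power_Suc mult_minus1)
    have "gr_inv (eps x u) $ K = (\<Sum>i\<in>K. x $ i * (shuffle_sign {i} (K - {i}) * ((-1) ^ card K * u $ (K - {i}))))"
      by (simp add: gr_inv_def eps_nth sum_distrib_left mult_ac)
    also have "\<dots> = (\<Sum>i\<in>K. - (x $ i * (shuffle_sign {i} (K - {i}) * ((-1) ^ card (K - {i}) * u $ (K - {i})))))"
      by (rule sum.cong[OF refl]) (simp add: c)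
    finally show ?thesis by (simp add: gr_inv_def eps_nth sum_negf)
  qed
  then show ?thesis by (simp add: vec_eq_iff)
qed

lemma gr_inv_iota: "gr_inv (iota B x u) = - iota B x (gr_inv u)"
proof -
  have "gr_inv (iota B x u) $ K = (- iota B x (gr_inv u)) $ K" for K
    by (auto simp: gr_inv_def iota_nth sum_distrib_left mult_ac sum_negf[symmetric] intro!: sum.cong)
  then show ?thesis by (simp add: vec_eq_iff)
qed

lemma gr_inv_gam: "gr_inv (gam B x u) = - gam B x (gr_inv u)"
  by (simp add: gam_def gr_inv_eps gr_inv_iota clin_rules[OF clin_gr_inv])

text \<open>Reversal sends the leading factor x to the far right; bringing it back past a product of
  degree k costs (-1)^k, which is \<open>gr_inv\<close>.\<close>

lemma ext_rev_eps: "ext_rev (eps x u) = eps x (gr_inv (ext_rev u))"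
proof -
  have "ext_rev (eps x u) $ K = eps x (gr_inv (ext_rev u)) $ K" for K
  proof -
    have c: "(-1 :: complex) ^ (card K choose 2) = (-1) ^ card (K - {i}) * (-1) ^ (card (K - {i}) choose 2)" if "i \<in> K" for i
    proof -
      have "card K = Suc (card (K - {i}))" using card_Suc_Diff1[OF finite that] by simp
      then show ?thesis by (simp add: numeral_2_eq_2 power_add)
    qed
    have "ext_rev (eps x u) $ K = (\<Sum>i\<in>K. x $ i * (shuffle_sign {i} (K - {i}) * ((-1) ^ (card K choose 2) * u $ (K - {i}))))"
      by (simp add: ext_rev_def eps_nth sum_distrib_left mult_ac)
    also have "\<dots> = eps x (gr_inv (ext_rev u)) $ K"
      unfolding eps_nth by (rule sum.cong[OF refl]) (simp add: c gr_inv_def ext_rev_def)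
    finally show ?thesis .
  qed
  then show ?thesis by (simp add: vec_eq_iff)
qed

text \<open>Contraction lowers the degree where \<open>eps\<close> raises it, which reverses the
  sign. Together the two rules say that reversal turns left into right Clifford multiplication,
  compare \<open>cm_vec_right\<close>.\<close>

lemma ext_rev_iota: "ext_rev (iota B x u) = - iota B x (gr_inv (ext_rev u))"
proof -
  have "ext_rev (iota B x u) $ K = (- iota B x (gr_inv (ext_rev u))) $ K" for K
  proof -
    have c: "(-1 :: complex) ^ (card K choose 2) = - ((-1) ^ card (insert i K) * (-1) ^ (card (insert i K) choose 2))" if "i \<notin> K" for i
      using that by (simp add: numeral_2_eq_2 power_add flip: mult.assoc power_mult_distrib)
    have "ext_rev (iota B x u) $ K = (\<Sum>j\<in>-K. shuffle_sign {j} K * B x (ax j) * ((-1) ^ (card K choose 2) * u $ insert j K))"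
      by (simp add: ext_rev_def iota_nth sum_distrib_left mult_ac)
    also have "\<dots> = (\<Sum>j\<in>-K. - (shuffle_sign {j} K * B x (ax j) * gr_inv (ext_rev u) $ insert j K))"
    proof (rule sum.cong[OF refl])
      fix j assume "j \<in> -K"
      then have "j \<notin> K" by simp
      show "shuffle_sign {j} K * B x (ax j) * ((-1) ^ (card K choose 2) * u $ insert j K) =
        - (shuffle_sign {j} K * B x (ax j) * gr_inv (ext_rev u) $ insert j K)"
        unfolding c[OF \<open>j \<notin> K\<close>] gr_inv_def ext_rev_def by (simp only: vec_lambda_beta) (simp add: mult_ac)
    qed
    finally show ?thesis by (simp add: iota_nth sum_negf)
  qed
  then show ?thesis by (simp add: vec_eq_iff)
qed

lemma eps_degree: "u \<in> ext_degree k \<Longrightarrow> eps x u \<in> ext_degree (Suc k)"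
  unfolding ext_degree_def by (auto simp: eps_nth intro!: sum.neutral) (metis card_Suc_Diff1 finite)

lemma iota_degree: "u \<in> ext_degree (Suc k) \<Longrightarrow> iota B x u \<in> ext_degree k"
  unfolding ext_degree_def by (auto simp: iota_nth intro!: sum.neutral)

lemma ext_degree_top: "u \<in> ext_degree CARD('n) \<Longrightarrow> u = u $ UNIV *s ax (UNIV :: 'n::finite set)"
  by (auto simp: ext_degree_def vec_eq_iff ax_nth) (metis UNIV_I card_eq_UNIV_imp_eq_UNIV finite)

lemma ext_degree_0: "u \<in> ext_degree 0 \<longleftrightarrow> u = pr0 u *s ext_one"
  by (auto simp: ext_degree_def vec_eq_iff ax_nth pr0_def ext_one_def)

lemma ext_to_vec_vec [simp]: "ext_to_vec (ext_vec x) = x"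
  by (simp add: vec_eq_iff ext_to_vec_def ext_vec_nth)

lemma ext_vec_to_vec: "u \<in> ext_degree 1 \<Longrightarrow> ext_vec (ext_to_vec u) = u"
  by (auto simp: vec_eq_iff ext_to_vec_def ext_vec_nth ext_degree_def is_singleton_def card_1_singleton_iff)

lemma ext_vec_inj: "ext_vec x = ext_vec y \<longleftrightarrow> x = y"
  by (metis ext_to_vec_vec)

lemma pr0_eps [simp]: "pr0 (eps x u) = 0"
  by (simp add: pr0_def eps_nth)

lemma ext_to_vec_eps: "ext_to_vec (eps x u) = pr0 u *s x"
  by (simp add: vec_eq_iff ext_to_vec_def eps_nth pr0_def)

lemma ext_to_vec_iota_pr2: "ext_to_vec (iota B x u) = ext_to_vec (iota B x (pr2 u))"
  by (auto simp: vec_eq_iff ext_to_vec_def iota_nth pr2_def intro!: sum.cong)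

lemma group_rearrange: "p - a = q + b \<Longrightarrow> a + b = p - (q :: 'a::ab_group_add)"
  by (simp add: diff_eq_eq eq_diff_eq add_ac)

section \<open>Right multiplication, the cyclic functional \<open>pr0\<close>, and the group\<close>

context sym_form
begin

abbreviation cm (infixl "\<star>" 70) where "cm \<equiv> cmul B"

lemmas cm_simps = clin_rules[OF clin_cmul] clin_rules[OF clin_cmul_left]
lemmas eps_simps = clin_rules[OF clin_eps] clin_rules[OF clin_eps_vec]
lemmas iota_simps = clin_rules[OF clin_iota] clin_rules[OF clin_iota_vec]

lemma cm_gam: "gam B x u \<star> v = gam B x (u \<star> v)"
  by (metis cmul_vec cmul_assoc)

lemma pr0_iota: "pr0 (iota B x u) = B x (ext_to_vec u)"
proof -
  have "B x (ext_to_vec u) = B x (\<Sum>j\<in>UNIV. ext_to_vec u $ j *s ax j)" by (simp add: basis_expansion)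
  also have "\<dots> = (\<Sum>j\<in>UNIV. B x (ax j) * u $ {j})" by (simp add: B_simps mult.commute ext_to_vec_def)
  finally show ?thesis by (simp add: pr0_def iota_nth)
qed

lemma pr0_gam: "pr0 (gam B x u) = B x (ext_to_vec u)"
  by (simp add: gam_def pr0_simps pr0_iota)

text \<open>Right multiplication by x is the operator that commutes with all left multiplications
  and sends 1 to x. The right side has both properties: \<open>eps x - iota x\<close> anticommutes
  with every \<open>gam\<close>, and so does \<open>gr_inv\<close>.\<close>

lemma cm_vec_right: "u \<star> ext_vec x = eps x (gr_inv u) - iota B x (gr_inv u)"
proof -
  let ?S = "{u. u \<star> ext_vec x = eps x (gr_inv u) - iota B x (gr_inv u)}"
  have S: "vec.subspace ?S"
    by (auto simp: vec.subspace_def cm_simps clin_rules[OF clin_gr_inv] eps_simps iota_simps vec.scale_right_diff_distrib)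
  have "u \<in> ?S"
  proof (rule ext_gen_gam[OF S, of B])
    show "ext_one \<in> ?S" by (simp add: cmul_one_left eps_one)
    fix i u assume "u \<in> ?S"
    then have u: "u \<star> ext_vec x = eps x (gr_inv u) - iota B x (gr_inv u)" by simp
    have "gam B (ax i) (eps x w - iota B x w) = - (eps x (gam B (ax i) w) - iota B x (gam B (ax i) w))" for w
      unfolding gam_def eps_simps iota_simps iota_eps eps_anti[of "ax i" x w] iota_anti[of "ax i" x w] sym_B[of "ax i" x]
      by (simp add: vec_eq_iff)
    then show "gam B (ax i) u \<in> ?S"
      by (simp add: cm_gam u gr_inv_gam eps_simps iota_simps)
  qed
  then show ?thesis by simp
qed

lemma pr0_vec_right: "pr0 (u \<star> ext_vec x) = pr0 (ext_vec x \<star> u)"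
proof -
  have "ext_to_vec (gr_inv u) = - ext_to_vec u" by (simp add: vec_eq_iff ext_to_vec_def gr_inv_def)
  then show ?thesis unfolding cm_vec_right cmul_vec by (simp add: pr0_simps pr0_iota pr0_gam B_simps)
qed

lemma cm_gen_induct:
  assumes "vec.subspace {u. P u}" "P ext_one" "\<And>x u. P u \<Longrightarrow> P (ext_vec x \<star> u)"
  shows "P u"
  using ext_gen_gam[OF assms(1), of B u] assms(2,3) by (simp add: cmul_vec)

text \<open>For a vector factor this is \<open>pr0_vec_right\<close>; it passes to products because
  the factors can be rotated one at a time.\<close>

lemma pr0_cyclic: "pr0 (u \<star> v) = pr0 (v \<star> u)"
proof -
  have "\<forall>v. pr0 (u \<star> v) = pr0 (v \<star> u)"
  proof (rule cm_gen_induct[of "\<lambda>u. \<forall>v. pr0 (u \<star> v) = pr0 (v \<star> u)" u])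
    show "vec.subspace {u. \<forall>v. pr0 (u \<star> v) = pr0 (v \<star> u)}"
      by (auto simp: vec.subspace_def cm_simps pr0_simps)
    fix x u assume IH: "\<forall>v. pr0 (u \<star> v) = pr0 (v \<star> u)"
    show "\<forall>v. pr0 (ext_vec x \<star> u \<star> v) = pr0 (v \<star> (ext_vec x \<star> u))"
      by (metis IH cmul_assoc pr0_vec_right)
  qed (simp add: cmul_one_left cmul_one_right)
  then show ?thesis ..
qed

lemma gr_inv_cm: "gr_inv (u \<star> v) = gr_inv u \<star> gr_inv v"
proof (rule cm_gen_induct[of "\<lambda>u. gr_inv (u \<star> v) = gr_inv u \<star> gr_inv v"])
  show "vec.subspace {u. gr_inv (u \<star> v) = gr_inv u \<star> gr_inv v}"
    by (auto simp: vec.subspace_def cm_simps clin_rules[OF clin_gr_inv])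
  show "gr_inv (ext_vec x \<star> u \<star> v) = gr_inv (ext_vec x \<star> u) \<star> gr_inv v"
    if "gr_inv (u \<star> v) = gr_inv u \<star> gr_inv v" for x u
    using that by (simp add: cmul_assoc) (simp add: cmul_vec gr_inv_gam cm_gam cm_simps)
qed (simp add: cmul_one_left)

lemma ext_rev_cm: "ext_rev (u \<star> v) = ext_rev v \<star> ext_rev u"
proof (rule cm_gen_induct[of "\<lambda>u. ext_rev (u \<star> v) = ext_rev v \<star> ext_rev u"])
  show "vec.subspace {u. ext_rev (u \<star> v) = ext_rev v \<star> ext_rev u}"
    by (auto simp: vec.subspace_def cm_simps clin_rules[OF clin_ext_rev])
  have r: "ext_rev (ext_vec x \<star> u) = ext_rev u \<star> ext_vec x" for x u
    by (simp add: cmul_vec cm_vec_right gam_def clin_rules[OF clin_ext_rev] ext_rev_eps ext_rev_iota)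
  show "ext_rev (ext_vec x \<star> u \<star> v) = ext_rev v \<star> ext_rev (ext_vec x \<star> u)"
    if "ext_rev (u \<star> v) = ext_rev v \<star> ext_rev u" for x u
    using that by (simp add: cmul_assoc r)
qed (simp add: cmul_one_left cmul_one_right)

lemma even_cm: "u \<in> ext_even \<Longrightarrow> v \<in> ext_even \<Longrightarrow> u \<star> v \<in> ext_even"
  by (simp add: ext_even_iff gr_inv_cm)

lemma vec_sq: "ext_vec x \<star> ext_vec x = B x x *s ext_one"
  using gam_sq[of x ext_one] by (simp add: cmul_vec gam_one)

lemma vec_anticomm: "ext_vec x \<star> ext_vec y + ext_vec y \<star> ext_vec x = (2 * B x y) *s ext_one"
  using gam_anticomm[of x y ext_one] by (simp add: cmul_vec gam_one)

lemma gr_inv_vec: "gr_inv (ext_vec x) = - ext_vec (x :: 'n cvec)"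
  using gr_inv_gam[of B x ext_one] by (simp add: gam_one)

lemma vec_vec_even: "ext_vec x \<star> ext_vec y \<in> ext_even"
  by (simp add: ext_even_iff gr_inv_cm gr_inv_vec cm_simps)

lemma even_vec_right: "u \<in> ext_even \<Longrightarrow> u \<star> ext_vec x = eps x u - iota B x u"
  by (simp add: cm_vec_right ext_even_iff)

lemma vec_left: "ext_vec x \<star> u = eps x u + iota B x u"
  by (simp add: cmul_vec gam_def)

lemma even_commutator: "u \<in> ext_even \<Longrightarrow> u \<star> ext_vec x - ext_vec x \<star> u = (-2) *s iota B x u"
  by (simp add: even_vec_right vec_left vec_eq_iff)

lemma matrix_works: "clin F \<Longrightarrow> matrix F *v x = F x"
  by (rule matrix_works)

lemma tau_mult:
  assumes "u \<in> ext_even" shows "tau B u *v x = (-2) *s ext_to_vec (iota B x u)"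
proof -
  have "clin (\<lambda>x. ext_to_vec (u \<star> ext_vec x - ext_vec x \<star> u))"
    by (rule clinI) (simp_all only: clin_rules[OF ext_vec_clin] cm_simps clin_rules[OF clin_ext_to_vec]
       vec.scale_right_diff_distrib[symmetric] add_diff_add)
  from matrix_works[OF this] show ?thesis
    unfolding tau_def even_commutator[OF assms] clin_rules[OF clin_ext_to_vec] .
qed

lemma tau_pr2: "u \<in> ext_even \<Longrightarrow> tau B u = tau B (pr2 u)"
  unfolding matrix_eq using tau_mult ext_to_vec_iota_pr2 degree2_even[OF pr2_degree] by metis

text \<open>Pairing \<open>iota B x u\<close> with y is a second contraction, so skewness is the
  anticommutativity of contractions.\<close>

lemma tau_skew:
  assumes u: "u \<in> ext_even" shows "tau B u \<in> Lie_SO B"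
proof -
  have "B (tau B u *v x) y + B x (tau B u *v y) = 0" for x y
  proof -
    have "B (ext_to_vec (iota B x u)) y = pr0 (iota B y (iota B x u))" by (simp add: pr0_iota sym_B)
    moreover have "B x (ext_to_vec (iota B y u)) = pr0 (iota B x (iota B y u))" by (simp add: pr0_iota)
    ultimately show ?thesis using iota_anti[of x y u] by (simp add: tau_mult[OF u] B_simps pr0_simps)
  qed
  then show ?thesis by (simp add: Lie_SO_def)
qed

text \<open>These are the multiples \<open>c g\<close> of elements \<open>g\<close> of the spin group, with \<open>T = T(g)\<close> and \<open>N = c\<^sup>2\<close>, and elements with \<open>N = 0\<close>.\<close>

definition twists :: "'n ext \<Rightarrow> 'n cmat \<Rightarrow> complex \<Rightarrow> bool" where
  "twists g T N \<longleftrightarrow> g \<in> ext_even \<and> (\<forall>x. g \<star> ext_vec x = ext_vec (T *v x) \<star> g) \<and> g \<star> ext_rev g = N *s ext_one"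

lemma twists_vec:
  assumes "twists g T N"
  shows "pr0 g *s x - ext_to_vec (iota B x g) = pr0 g *s (T *v x) + ext_to_vec (iota B (T *v x) g)"
proof -
  have "eps x g - iota B x g = eps (T *v x) g + iota B (T *v x) g"
    using assms unfolding twists_def by (metis even_vec_right vec_left)
  from arg_cong[OF this, of ext_to_vec] show ?thesis
    by (simp add: clin_rules[OF clin_ext_to_vec] ext_to_vec_eps)
qed

lemma twists_cayley:
  assumes "twists g T N"
  shows "tau B (pr2 g) *v (x + T *v x) = (-2 * pr0 g) *s (x - T *v x)"
proof -
  have g: "g \<in> ext_even" using assms by (simp add: twists_def)
  have t: "tau B (pr2 g) *v y = (-2) *s ext_to_vec (iota B y g)" for y
    unfolding tau_pr2[OF g, symmetric] by (rule tau_mult[OF g])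
  have "ext_to_vec (iota B x g) + ext_to_vec (iota B (T *v x) g) = pr0 g *s x - pr0 g *s (T *v x)"
    by (rule group_rearrange[OF twists_vec[OF assms, of x]])
  then show ?thesis unfolding t iota_simps clin_rules[OF clin_ext_to_vec]
    by (simp only: vec.scale_right_diff_distrib[symmetric] vec.scale_scale)
qed

text \<open>Left multiplications are endomorphisms of a finite-dimensional space, where a one-sided
  inverse is two-sided.\<close>

lemma cm_inverse:
  assumes "u \<star> v = ext_one" shows "v \<star> u = ext_one"
proof -
  have "matrix (cm u) ** matrix (cm v) = mat 1"
    using assms by (simp add: matrix_eq matrix_vector_mul_assoc[symmetric] matrix_works[OF clin_cmul] cmul_assoc[symmetric] cmul_one_left)
  then have "matrix (cm v) ** matrix (cm u) = mat 1" by (rule matrix_left_right_inverse[THEN iffD1])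
  then have "matrix (cm v) *v (matrix (cm u) *v ext_one) = ext_one" by (simp add: matrix_vector_mul_assoc)
  then show ?thesis by (simp add: matrix_works[OF clin_cmul] cmul_one_right)
qed

lemma Spin_iff:
  "g \<in> Spin B \<longleftrightarrow> g \<in> ext_even \<and> g \<star> ext_rev g = ext_one \<and> (\<forall>x. \<exists>y. g \<star> ext_vec x = ext_vec y \<star> g)"
proof -
  have "spin_conj B g (ext_vec x) = ext_vec y \<longleftrightarrow> g \<star> ext_vec x = ext_vec y \<star> g" if g: "g \<star> ext_rev g = ext_one" for x y
  proof -
    have g': "ext_rev g \<star> g = ext_one" by (rule cm_inverse[OF g])
    show ?thesis unfolding spin_conj_def
      by (metis cmul_assoc cmul_one_right g g')
  qed
  then show ?thesis unfolding Spin_def by (auto simp: image_iff)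
qed

lemma clin_spin_conj: "clin (spin_conj B g)"
  unfolding spin_conj_def by (rule clinI) (simp_all add: cm_simps)

lemma spin_T_works: "spin_T B g *v x = ext_to_vec (spin_conj B g (ext_vec x))"
proof -
  have "clin (\<lambda>x. ext_to_vec (spin_conj B g (ext_vec x)))"
    by (rule clinI) (simp_all add: clin_rules[OF ext_vec_clin] clin_rules[OF clin_spin_conj] clin_rules[OF clin_ext_to_vec])
  then show ?thesis unfolding spin_T_def by (rule matrix_works)
qed

lemma Spin_rev: "g \<in> Spin B \<Longrightarrow> ext_rev g \<star> g = ext_one"
  by (rule cm_inverse) (simp add: Spin_iff)

lemma spin_T_vec:
  assumes "g \<in> Spin B" shows "ext_vec (spin_T B g *v x) = spin_conj B g (ext_vec x)"
proof -
  obtain y where "spin_conj B g (ext_vec x) = ext_vec y" using assms by (auto simp: Spin_def image_iff)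
  then show ?thesis by (simp add: spin_T_works)
qed

lemma Spin_twists:
  assumes "g \<in> Spin B" shows "twists g (spin_T B g) 1"
proof -
  have "ext_vec (spin_T B g *v x) \<star> g = g \<star> ext_vec x" for x
    using Spin_rev[OF assms] by (simp add: spin_T_vec[OF assms] spin_conj_def cmul_assoc cmul_one_right)
  then show ?thesis using assms by (simp add: twists_def Spin_iff)
qed

lemma spin_T_B:
  assumes "g \<in> Spin B" shows "B (spin_T B g *v x) (spin_T B g *v y) = B x y"
proof -
  have q: "B (spin_T B g *v x) (spin_T B g *v x) = B x x" for x
  proof -
    have "B (spin_T B g *v x) (spin_T B g *v x) *s ext_one = spin_conj B g (ext_vec x) \<star> spin_conj B g (ext_vec x)"
      by (simp add: vec_sq[symmetric] spin_T_vec[OF assms])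
    also have "\<dots> = g \<star> (ext_vec x \<star> (ext_rev g \<star> g) \<star> ext_vec x) \<star> ext_rev g"
      by (simp add: spin_conj_def cmul_assoc)
    also have "\<dots> = B x x *s ext_one"
      using Spin_rev[OF assms] assms by (simp add: cmul_one_right vec_sq cm_simps Spin_iff)
    finally have "pr0 (B (spin_T B g *v x) (spin_T B g *v x) *s (ext_one :: 'n ext)) = pr0 (B x x *s (ext_one :: 'n ext))" by (rule arg_cong)
    then show ?thesis by (simp add: pr0_simps)
  qed
  have "B (spin_T B g *v (x + y)) (spin_T B g *v (x + y)) = B (x + y) (x + y)" by (rule q)
  then show ?thesis using q[of x] q[of y] sym_B[of y x] sym_B[of "spin_T B g *v y" "spin_T B g *v x"]
    by (simp add: matrix_vector_right_distrib B_simps)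
qed

lemma Spin_cm: "g \<in> Spin B \<Longrightarrow> h \<in> Spin B \<Longrightarrow> g \<star> h \<in> Spin B"
proof -
  assume g: "g \<in> Spin B" and h: "h \<in> Spin B"
  have "g \<star> h \<star> ext_rev (g \<star> h) = g \<star> (h \<star> ext_rev h) \<star> ext_rev g"
    by (simp add: ext_rev_cm cmul_assoc)
  then have 1: "g \<star> h \<star> ext_rev (g \<star> h) = ext_one" using g h by (simp add: Spin_iff cmul_one_right)
  have 2: "g \<star> h \<star> ext_vec x = ext_vec (spin_T B g *v (spin_T B h *v x)) \<star> (g \<star> h)" for x
    using Spin_twists[OF g] Spin_twists[OF h] unfolding twists_def by (metis cmul_assoc)
  show ?thesis using 1 2 g h by (auto simp: Spin_iff even_cm)
qed

lemma spin_T_cm: "g \<in> Spin B \<Longrightarrow> h \<in> Spin B \<Longrightarrow> spin_T B (g \<star> h) *v x = spin_T B g *v (spin_T B h *v x)"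
proof -
  assume g: "g \<in> Spin B" and h: "h \<in> Spin B"
  have "ext_vec (spin_T B (g \<star> h) *v x) = ext_vec (spin_T B g *v (spin_T B h *v x))"
    unfolding spin_T_vec[OF Spin_cm[OF g h]] spin_T_vec[OF g] spin_T_vec[OF h]
    by (simp add: spin_conj_def ext_rev_cm cmul_assoc)
  then show ?thesis by (simp add: ext_vec_inj)
qed

text \<open>T(g) is injective, hence surjective, so every x is g y alpha(g) for some y; multiplying
  by alpha(g) from the left gives alpha(g) x = y alpha(g).\<close>

lemma Spin_ext_rev: "g \<in> Spin B \<Longrightarrow> ext_rev g \<in> Spin B"
proof -
  assume g: "g \<in> Spin B"
  have "\<exists>y. ext_rev g \<star> ext_vec x = ext_vec y \<star> ext_rev g" for x
  proof -
    have "inj (\<lambda>x. spin_T B g *v x)"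
    proof (rule injI)
      fix x y assume "spin_T B g *v x = spin_T B g *v y"
      then have "spin_conj B g (ext_vec x) = spin_conj B g (ext_vec y)" by (metis spin_T_vec[OF g])
      then have "ext_rev g \<star> spin_conj B g (ext_vec x) \<star> g = ext_rev g \<star> spin_conj B g (ext_vec y) \<star> g" by simp
      moreover have "ext_rev g \<star> spin_conj B g u \<star> g = (ext_rev g \<star> g) \<star> u \<star> (ext_rev g \<star> g)" for u
        by (simp add: spin_conj_def cmul_assoc)
      ultimately show "x = y" using Spin_rev[OF g] by (simp add: cmul_one_left cmul_one_right ext_vec_inj)
    qed
    then have "surj (\<lambda>x. spin_T B g *v x)" by (simp add: vec.linear_injective_imp_surjective matrix_vector_mul_linear_gen)
    then obtain y where "x = spin_T B g *v y" by (metis surjD)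
    then have "ext_vec x = g \<star> ext_vec y \<star> ext_rev g" by (simp add: spin_T_vec[OF g] spin_conj_def)
    then have "ext_rev g \<star> ext_vec x = (ext_rev g \<star> g) \<star> ext_vec y \<star> ext_rev g" by (simp add: cmul_assoc)
    then show ?thesis using Spin_rev[OF g] by (auto simp: cmul_one_left)
  qed
  then show ?thesis using g Spin_rev[OF g] by (auto simp: Spin_iff even_rev)
qed

lemma Spin_one: "ext_one \<in> Spin B"
  by (auto simp: Spin_iff even_one cmul_one_left cmul_one_right)

lemma Spin_neg_one: "- ext_one \<in> Spin B"
  by (auto simp: Spin_iff ext_even_iff clin_rules[OF clin_gr_inv] clin_rules[OF clin_ext_rev] cm_simps cmul_one_left cmul_one_right)

end

section \<open>Orthonormal bases\<close>

locale nondeg_form = sym_form B for B :: "'n::{finite,linorder} form" +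
  assumes nondeg: "(\<And>y. B x y = 0) \<Longrightarrow> x = 0"

lemma nonsingular_nondeg:
  assumes "nonsingular_symmetric_form B" shows "nondeg_form B"
  using assms unfolding nonsingular_symmetric_form_def
  by (intro nondeg_form.intro sym_form.intro nondeg_form_axioms.intro) blast+

context sym_form
begin

lemma gam_polar_vec: "B x y = 0 \<Longrightarrow> ext_vec x \<star> ext_vec y = - (ext_vec y \<star> ext_vec x)"
  using vec_anticomm[of x y] by (simp add: eq_neg_iff_add_eq_0)

end

context nondeg_form
begin

text \<open>The dual basis of the standard basis with respect to B. It makes contraction a
  coordinate operation (\<open>iota_dual\<close>) although the standard basis is not assumed
  orthogonal.\<close>

definition dvec :: "'n \<Rightarrow> 'n cvec" where
  "dvec i = (SOME d. \<forall>j. B d (ax j) = (if j = i then 1 else 0))"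

lemma dvec: "B (dvec i) (ax j) = (if j = i then 1 else 0)"
proof -
  have "clin (\<lambda>x. \<chi> j. B x (ax j))" by (rule clinI) (simp_all add: vec_eq_iff B_simps)
  moreover have "inj (\<lambda>x. \<chi> j. B x (ax j))"
  proof (rule injI)
    fix x y assume "(\<chi> j. B x (ax j)) = (\<chi> j. B y (ax j))"
    then have e: "B (x - y) (ax j) = 0" for j by (simp add: vec_eq_iff B_simps)
    have "B (x - y) z = B (x - y) (\<Sum>j\<in>UNIV. z $ j *s ax j)" for z by (simp add: basis_expansion)
    then have "B (x - y) z = 0" for z by (simp add: B_right e)
    then show "x = y" using nondeg[of "x - y"] by simp
  qed
  ultimately have "surj (\<lambda>x. \<chi> j. B x (ax j))" by (rule vec.linear_inj_imp_surj)
  from surjD[OF this, of "ax i"] obtain d where "ax i = (\<chi> j. B d (ax j))" by blast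
  then have "\<forall>j. B d (ax j) = (if j = i then 1 else 0)" by (simp add: vec_eq_iff ax_nth)
  then have "\<forall>j. B (dvec i) (ax j) = (if j = i then 1 else 0)" unfolding dvec_def by (rule someI)
  then show ?thesis by blast
qed

lemma B_dual: "B (dvec i) x = x $ i"
proof -
  have "B (dvec i) x = B (dvec i) (\<Sum>j\<in>UNIV. x $ j *s ax j)" by (simp add: basis_expansion)
  also have "\<dots> = x $ i" unfolding B_right dvec by (simp add: mult_delta_right)
  finally show ?thesis .
qed

lemma B_ext: "(\<And>z. B x z = B y z) \<Longrightarrow> x = y"
  using nondeg[of "x - y"] by (simp add: B_left)

lemma dual_expand: "(\<Sum>i\<in>UNIV. B x (ax i) *s dvec i) = x" "(\<Sum>i\<in>UNIV. B x (dvec i) *s ax i) = x"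
proof -
  show 2: "(\<Sum>i\<in>UNIV. B x (dvec i) *s ax i) = x"
    using basis_expansion[of x] by (simp add: sym_B[of x] B_dual)
  show "(\<Sum>i\<in>UNIV. B x (ax i) *s dvec i) = x"
  proof (rule B_ext)
    fix z
    have "B x z = B x (\<Sum>j\<in>UNIV. z $ j *s ax j)" by (simp add: basis_expansion)
    then show "B (\<Sum>i\<in>UNIV. B x (ax i) *s dvec i) z = B x z"
      by (simp add: B_left B_right B_dual mult.commute)
  qed
qed

lemma iota_dual: "iota B (dvec i) u $ J = (if i \<in> J then 0 else shuffle_sign {i} J * u $ insert i J)"
proof -
  have "iota B (dvec i) u $ J = (\<Sum>j\<in>-J. if j = i then shuffle_sign {j} J * u $ insert j J else 0)"
    unfolding iota_nth dvec by (rule sum.cong) auto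
  then show ?thesis by simp
qed

lemma iota_zero: assumes "\<And>x. iota B x u = 0" shows "u = pr0 u *s ext_one"
proof -
  have "u $ I = 0" if ne: "I \<noteq> {}" for I
  proof -
    obtain i where i: "i \<in> I" using ne by blast
    have "shuffle_sign {i} (I - {i}) * u $ I = 0"
      using arg_cong[OF assms[of "dvec i"], of "\<lambda>u. u $ (I - {i})"] i by (simp add: iota_dual insert_absorb)
    moreover have "shuffle_sign {i} (I - {i}) \<noteq> 0" by (simp add: shuffle_sign_def)
    ultimately show ?thesis by simp
  qed
  then show ?thesis by (simp add: vec_eq_iff pr0_def ext_one_def ax_nth)
qed

lemma degree2_zero: assumes "u \<in> ext_degree 2" "\<And>x. iota B x u = 0" shows "u = 0"
proof -
  have "pr0 u = 0" using assms(1) by (simp add: pr0_def ext_degree_def)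
  then show ?thesis using iota_zero[OF assms(2)] by simp
qed

text \<open>Contracting with \<open>dvec i\<close> removes the index i and \<open>eps (ax i)\<close>
  puts it back with the same sign, so each i in K contributes once. In degree 2 this recovers a
  bivector from its contractions (\<open>degree2_expand\<close>).\<close>

lemma euler: "(\<Sum>i\<in>UNIV. eps (ax i) (iota B (dvec i) u)) $ K = of_nat (card K) * u $ K"
proof -
  have "eps (ax i) (iota B (dvec i) u) $ K = (if i \<in> K then u $ K else 0)" for i
    using shuffle_sign_square[of "{i}" "K - {i}"] by (simp add: eps_axis iota_dual insert_absorb flip: mult.assoc)
  then have "(\<Sum>i\<in>UNIV. eps (ax i) (iota B (dvec i) u)) $ K = (\<Sum>i\<in>UNIV. if i \<in> K then u $ K else 0)"
    by simp
  also have "\<dots> = of_nat (card K) * u $ K" by (simp add: sum.If_cases)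
  finally show ?thesis .
qed

lemma tau_inj: "inj_on (tau B) (ext_degree 2)"
proof (rule inj_onI)
  fix u v assume uv: "u \<in> ext_degree 2" "v \<in> ext_degree 2" and e: "tau B u = tau B v"
  have d: "u - v \<in> ext_degree 2" using uv vec.subspace_diff[OF ext_degree_subspace] by blast
  have "iota B x (u - v) = 0" for x
  proof -
    have "iota B x (u - v) \<in> ext_degree 1" using iota_degree[of "u - v" 1 B x] d by (simp add: numeral_2_eq_2)
    moreover have "(-2) *s ext_to_vec (iota B x u) = (-2) *s ext_to_vec (iota B x v)"
      unfolding tau_mult[OF degree2_even[OF uv(1)], symmetric] tau_mult[OF degree2_even[OF uv(2)], symmetric] e ..
    then have "ext_to_vec (iota B x (u - v)) = 0"
      by (simp add: iota_simps clin_rules[OF clin_ext_to_vec])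
    ultimately show ?thesis using ext_vec_to_vec[of "iota B x (u - v)"] by (simp add: clin_rules[OF ext_vec_clin])
  qed
  then show "u = v" using degree2_zero[OF d] by simp
qed

lemma tau_surj:
  assumes s: "s \<in> Lie_SO B"
  shows "\<exists>u\<in>ext_degree 2. tau B u = s"
proof -
  \<comment> \<open>Contraction by x meets each term twice; by skewness of s both halves sum to s x,
    hence 2 s x in all. As tau(u) x = -2 iota(x) u, the constant must be -1/4.\<close>
  define u where "u = (-1/4) *s (\<Sum>i\<in>UNIV. eps (dvec i) (ext_vec (s *v ax i)))"
  have d: "u \<in> ext_degree 2" unfolding u_def
    using eps_degree[OF ext_vec_degree] by (intro vec.subspace_scale[OF ext_degree_subspace] vec.subspace_sum[OF ext_degree_subspace])
      (simp add: numeral_2_eq_2)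
  have "tau B u *v x = s *v x" for x
  proof -
    have sk: "B x (s *v y) = - B (s *v x) y" for x y using s by (simp add: Lie_SO_def eq_neg_iff_add_eq_0 add.commute)
    have "iota B x (\<Sum>i\<in>UNIV. eps (dvec i) (ext_vec (s *v ax i))) =
       (\<Sum>i\<in>UNIV. B x (dvec i) *s ext_vec (s *v ax i) + B (s *v x) (ax i) *s ext_vec (dvec i))"
      by (simp add: iota_simps iota_eps) (simp add: eps_one[symmetric] iota_eps eps_simps sk vec.scale_minus_left)
    also have "\<dots> = ext_vec (s *v (\<Sum>i\<in>UNIV. B x (dvec i) *s ax i)) + ext_vec (\<Sum>i\<in>UNIV. B (s *v x) (ax i) *s dvec i)"
      by (simp add: clin_rules[OF ext_vec_clin] clin_rules[OF matrix_vector_mul_linear_gen[of s]] sum.distrib)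
    also have "\<dots> = 2 *s ext_vec (s *v x)" unfolding dual_expand by (simp add: vec_eq_iff)
    finally have "iota B x u = (-1/4) *s (2 *s ext_vec (s *v x))" unfolding u_def iota_simps by simp
    then show ?thesis unfolding tau_mult[OF degree2_even[OF d]]
      by (simp add: clin_rules[OF clin_ext_to_vec])
  qed
  then show ?thesis using d by (auto simp: matrix_eq)
qed

lemma tau_bij: "bij_betw (tau B) (ext_degree 2) (Lie_SO B)"
  unfolding bij_betw_def using tau_inj tau_surj tau_skew degree2_even by (auto simp: image_iff)

text \<open>\<open>P\<close> projects onto the orthogonal complement of S, on which the form does
  not vanish by nondegeneracy. By polarization some \<open>P p\<close> is then not isotropic, and a
  complex square root normalizes it.\<close>

lemma orthonormal_extend:
  assumes S: "finite S" "\<And>x y. x \<in> S \<Longrightarrow> y \<in> S \<Longrightarrow> B x y = (if x = y then 1 else 0)" and span: "vec.span S \<noteq> UNIV"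
  shows "\<exists>z. z \<notin> S \<and> B z z = 1 \<and> (\<forall>x\<in>S. B x z = 0)"
proof -
  define P where "P v = v - (\<Sum>x\<in>S. B x v *s x)" for v
  have P: "B y (P v) = 0" if "y \<in> S" for y v
  proof -
    have "B y (\<Sum>x\<in>S. B x v *s x) = (\<Sum>x\<in>S. if x = y then B x v else 0)"
      unfolding B_right by (rule sum.cong) (use S that in auto)
    then show ?thesis using S that by (simp add: P_def B_right)
  qed
  have PS: "B (P v) (P w) = B (P v) w" for v w
  proof -
    have "B (P v) (\<Sum>x\<in>S. B x w *s x) = 0" unfolding B_right by (rule sum.neutral) (simp add: P sym_B[of "P v"])
    then show ?thesis unfolding P_def[of w] B_right by simp
  qed
  obtain v where v: "v \<notin> vec.span S" using span by blast
  have "P v \<noteq> 0"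
  proof
    assume "P v = 0"
    then have "v = (\<Sum>x\<in>S. B x v *s x)" by (simp add: P_def)
    also have "\<dots> \<in> vec.span S" by (intro vec.span_sum vec.span_scale vec.span_base)
    finally show False using v by simp
  qed
  then obtain w where w: "B (P v) w \<noteq> 0" using nondeg by blast
  have "\<exists>p. B (P p) (P p) \<noteq> 0"
  proof (rule ccontr)
    assume "\<nexists>p. B (P p) (P p) \<noteq> 0"
    then have z: "B (P p) (P p) = 0" for p by blast
    have add: "P (v + w) = P v + P w" by (simp add: P_def B_right vec.scale_left_distrib sum.distrib)
    show False using z[of "v + w"] z[of v] z[of w] w PS[of v w] sym_B[of "P w" "P v"] unfolding add
      by (simp add: B_simps)
  qed
  then obtain p where p: "B (P p) (P p) \<noteq> 0" by blast
  define z where "z = (1 / csqrt (B (P p) (P p))) *s P p"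
  have "csqrt (B (P p) (P p)) * csqrt (B (P p) (P p)) = B (P p) (P p)"
    using power2_csqrt[of "B (P p) (P p)"] by (simp add: power2_eq_square)
  then have zz: "B z z = 1" using p by (simp add: z_def B_simps field_simps)
  have zS: "B x z = 0" if "x \<in> S" for x using P[OF that] by (simp add: z_def B_simps)
  have "z \<notin> S" using zS[of z] zz by auto
  then show ?thesis using zz zS by blast
qed

lemma orthonormal_exists: "\<exists>f :: 'n \<Rightarrow> 'n cvec. \<forall>i j. B (f i) (f j) = (if i = j then 1 else 0)"
proof -
  let ?O = "\<lambda>S. finite S \<and> (\<forall>x\<in>S. \<forall>y\<in>S. B x y = (if x = y then 1 else 0))"
  have "\<exists>S. ?O S \<and> card S = k" if "k \<le> CARD('n)" for k
    using that
  proof (induction k)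
    case 0
    then show ?case by (intro exI[of _ "{}"]) auto
  next
    case (Suc k)
    then obtain S where S: "?O S" "card S = k" by auto
    have "vec.span S \<noteq> UNIV"
    proof
      assume "vec.span S = UNIV"
      then have "vec.dim (UNIV :: 'n cvec set) \<le> card S" using S by (intro vec.span_card_ge_dim) auto
      then show False using Suc S by (simp add: vec.dim_UNIV card_cart_basis)
    qed
    then obtain z where z: "z \<notin> S" "B z z = 1" "\<forall>x\<in>S. B x z = 0" using orthonormal_extend[of S] S by blast
    have "B z x = 0" if "x \<in> S" for x using bspec[OF z(3) that] sym_B[of z x] by simp
    then have "?O (insert z S)" using S z by auto
    then show ?case using S z by (intro exI[of _ "insert z S"]) auto
  qed
  from this[OF order_refl] obtain S where S: "?O S" "card S = CARD('n)" by (elim exE conjE) simp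
  then have "finite S" "card (UNIV :: 'n set) = card S" by simp_all
  then obtain h where h: "bij_betw h (UNIV :: 'n set) S" using finite_same_card_bij[of "UNIV :: 'n set" S] by auto
  then have "B (h i) (h j) = (if i = j then 1 else 0)" for i j
  proof -
    have "h i \<in> S" "h j \<in> S" "h i = h j \<longleftrightarrow> i = j" using h by (auto simp: bij_betw_def inj_eq)
    then show ?thesis using S by simp
  qed
  then show ?thesis by blast
qed

definition ob :: "'n \<Rightarrow> 'n cvec" where
  "ob = (SOME f. \<forall>i j. B (f i) (f j) = (if i = j then 1 else 0))"

lemma ob: "B (ob i) (ob j) = (if i = j then 1 else 0)"
  unfolding ob_def using someI_ex[OF orthonormal_exists] by blast

lemma ob_expand: "(\<Sum>i\<in>UNIV. B (ob i) x *s ob i) = x"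
proof -
  have inj: "inj ob"
  proof (rule injI)
    fix i j assume e: "ob i = ob j"
    show "i = j" using ob[of i j] ob[of j j] unfolding e by (metis one_neq_zero)
  qed
  have span: "vec.span (range ob) = UNIV"
  proof (rule ccontr)
    assume "vec.span (range ob) \<noteq> UNIV"
    then obtain z where z: "z \<notin> range ob" "B z z = 1" "\<forall>x\<in>range ob. B x z = 0"
      using orthonormal_extend[of "range ob"] ob inj by (fastforce simp: inj_eq)
    have z': "B z x = 0" if "x \<in> range ob" for x using bspec[OF z(3) that] sym_B[of z x] by simp
    have "vec.independent (insert z (range ob))"
    proof (rule vec.independent_if_scalars_zero)
      fix c x assume c: "(\<Sum>x\<in>insert z (range ob). c x *s x) = 0" and x: "x \<in> insert z (range ob)"
      have "0 = B x (\<Sum>y\<in>insert z (range ob). c y *s y)" by (simp add: c B_right)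
      also have "\<dots> = (\<Sum>y\<in>insert z (range ob). if y = x then c y else 0)" unfolding B_right
      proof (rule sum.cong[OF refl])
        fix y assume y: "y \<in> insert z (range ob)"
        have "B x y = (if y = x then 1 else 0)"
          using x y z z' ob inj by (auto simp: inj_eq)
        then show "c y * B x y = (if y = x then c y else 0)" by simp
      qed
      finally show "c x = 0" using x by simp
    qed simp
    then have "card (insert z (range ob)) \<le> vec.dim (UNIV :: 'n cvec set)"
      by (intro vec.independent_card_le_dim) auto
    then show False using z inj by (simp add: card_image vec.dim_UNIV card_cart_basis)
  qed
  let ?S = "{x. (\<Sum>i\<in>UNIV. B (ob i) x *s ob i) = x}"
  have "vec.subspace ?S"
  proof (rule vec.subspaceI)
    show "0 \<in> ?S" by (simp add: B_right)
    fix x y c assume x: "x \<in> ?S"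
    show "x + y \<in> ?S" if "y \<in> ?S" using x that by (simp add: B_right vec.scale_left_distrib sum.distrib)
    have "(\<Sum>i\<in>UNIV. B (ob i) (c *s x) *s ob i) = c *s (\<Sum>i\<in>UNIV. B (ob i) x *s ob i)"
      by (simp only: B_right vec.scale_sum_right vec.scale_scale)
    then show "c *s x \<in> ?S" using x by simp
  qed
  moreover have "ob j \<in> ?S" for j
  proof -
    have "(\<Sum>i\<in>UNIV. B (ob i) (ob j) *s ob i) = (\<Sum>i\<in>UNIV. if i = j then ob i else 0)"
      by (rule sum.cong) (auto simp: ob)
    then show ?thesis by simp
  qed
  ultimately have "vec.span (range ob) \<subseteq> ?S" by (intro vec.span_minimal) auto
  then show ?thesis using span by blast
qed

section \<open>Orthonormal monomials and traces on the even algebra\<close>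

definition mono :: "'n list \<Rightarrow> 'n ext" where
  "mono L = foldr (\<lambda>i. cm (ext_vec (ob i))) L ext_one"

lemma mono_simps [simp]: "mono [] = ext_one" "mono (i # L) = ext_vec (ob i) \<star> mono L"
  by (simp_all add: mono_def)

lemma ob_sq: "ext_vec (ob i) \<star> (ext_vec (ob i) \<star> u) = u"
  using vec_sq[of "ob i"] by (simp add: ob cmul_assoc[symmetric] cmul_one_left)

lemma ob_anti: "i \<noteq> j \<Longrightarrow> ext_vec (ob i) \<star> (ext_vec (ob j) \<star> u) = - (ext_vec (ob j) \<star> (ext_vec (ob i) \<star> u))"
  using gam_polar_vec[of "ob i" "ob j"] by (simp add: ob cmul_assoc[symmetric] cm_simps)

lemma mono_iota: "i \<notin> set L \<Longrightarrow> iota B (ob i) (mono L) = 0"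
  by (induction L) (auto simp: vec_left iota_simps iota_eps ob eps_simps iota_anti[of "ob i"])

text \<open>Contraction by a new orthonormal vector kills the rest of the product, so Clifford and
  exterior multiplication agree; hence monomials without repetition are homogeneous.\<close>

lemma mono_eps: "i \<notin> set L \<Longrightarrow> mono (i # L) = eps (ob i) (mono L)"
  by (simp add: vec_left mono_iota)

lemma mono_degree: "distinct L \<Longrightarrow> mono L \<in> ext_degree (length L)"
proof (induction L)
  case Nil
  then show ?case by (simp add: ext_degree_0 pr0_simps)
next
  case (Cons i L)
  then show ?case unfolding mono_eps[OF distinct.simps(2)[THEN iffD1, OF Cons.prems, THEN conjunct1]]
    by (simp add: eps_degree)
qed

lemma mono_remove: "j \<in> set L \<Longrightarrow> distinct L \<Longrightarrow> ext_vec (ob j) \<star> mono L = mono (remove1 j L) \<or> ext_vec (ob j) \<star> mono L = - mono (remove1 j L)"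
proof (induction L)
  case (Cons i L)
  show ?case
  proof (cases "i = j")
    case True
    then show ?thesis by (simp add: ob_sq)
  next
    case False
    then show ?thesis using Cons by (auto simp: ob_anti[of j i] cm_simps)
  qed
qed simp

lemma mono_span: "u \<in> vec.span {mono L | L. distinct L}"
proof -
  let ?M = "{mono L | L. distinct L}"
  have g: "ext_vec x \<star> u \<in> vec.span ?M" if u: "u \<in> vec.span ?M" for x u
  proof -
    have b: "ext_vec (ob j) \<star> u \<in> vec.span ?M" for j
    proof (rule vec.span_induct[OF u])
      show "vec.subspace {u. ext_vec (ob j) \<star> u \<in> vec.span ?M}"
        by (auto simp: vec.subspace_def cm_simps vec.span_zero vec.span_add vec.span_scale)
      fix w assume "w \<in> ?M"
      then obtain L where L: "w = mono L" "distinct L" by blast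
      show "ext_vec (ob j) \<star> w \<in> vec.span ?M"
      proof (cases "j \<in> set L")
        case True
        have m: "mono (remove1 j L) \<in> vec.span ?M" using L by (intro vec.span_base) auto
        show ?thesis using mono_remove[OF True L(2)] m vec.span_neg[OF m] unfolding L(1) by auto
      next
        case False
        then show ?thesis using L by (intro vec.span_base) (auto intro!: exI[of _ "j # L"])
      qed
    qed
    have "ext_vec x \<star> u = (\<Sum>i\<in>UNIV. B (ob i) x *s (ext_vec (ob i) \<star> u))"
      by (subst ob_expand[symmetric]) (simp only: clin_rules[OF ext_vec_clin] cm_simps)
    then show ?thesis using b by (simp add: vec.span_sum vec.span_scale)
  qed
  show ?thesis
  proof (rule cm_gen_induct[of "\<lambda>u. u \<in> vec.span ?M"])
    show "vec.subspace {u. u \<in> vec.span ?M}" by (simp add: vec.subspace_span)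
    show "ext_one \<in> vec.span ?M" by (intro vec.span_base) (auto intro!: exI[of _ "[]"])
  qed (rule g)
qed

lemma gr_inv_mono: "gr_inv (mono L) = (-1) ^ length L *s mono L"
  by (induction L) (simp_all add: gr_inv_cm gr_inv_vec cm_simps)

text \<open>Averaging with \<open>gr_inv\<close> keeps the monomials of even length, kills the odd
  ones and fixes u.\<close>

lemma even_span:
  assumes "u \<in> ext_even" shows "u \<in> vec.span {mono L | L. distinct L \<and> even (length L)}"
proof -
  let ?E = "vec.span {mono L | L. distinct L \<and> even (length L)}"
  have "u + gr_inv u \<in> ?E"
  proof (rule vec.span_induct[OF mono_span[of u]])
    show "vec.subspace {u. u + gr_inv u \<in> ?E}"
    proof (rule vec.subspaceI)
      fix x y assume "x \<in> {u. u + gr_inv u \<in> ?E}" "y \<in> {u. u + gr_inv u \<in> ?E}"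
      then have "(x + gr_inv x) + (y + gr_inv y) \<in> ?E" by (simp add: vec.span_add)
      then show "x + y \<in> {u. u + gr_inv u \<in> ?E}" by (simp add: clin_rules[OF clin_gr_inv] add_ac)
    next
      fix c x assume "x \<in> {u. u + gr_inv u \<in> ?E}"
      then have "c *s (x + gr_inv x) \<in> ?E" by (simp only: mem_Collect_eq vec.span_scale)
      then show "c *s x \<in> {u. u + gr_inv u \<in> ?E}"
        by (simp only: mem_Collect_eq clin_rules[OF clin_gr_inv] vec.scale_right_distrib)
    qed (simp add: clin_rules[OF clin_gr_inv] vec.span_zero)
    fix w assume "w \<in> {mono L | L. distinct L}"
    then obtain L where L: "w = mono L" "distinct L" by blast
    show "w + gr_inv w \<in> ?E"
    proof (cases "even (length L)")
      case True
      then have "w \<in> ?E" using L by (intro vec.span_base) auto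
      moreover have "gr_inv w = w" using True by (simp add: L gr_inv_mono)
      ultimately show ?thesis by (simp only: vec.span_add)
    next
      case False
      then show ?thesis by (simp add: L gr_inv_mono vec.span_zero)
    qed
  qed
  then have "(1/2) *s (u + gr_inv u) \<in> ?E" by (rule vec.span_scale)
  moreover have "(1/2) *s (u + gr_inv u) = u" using assms by (simp add: ext_even_iff vec_eq_iff)
  ultimately show ?thesis by simp
qed

lemma mono_commute:
  "ext_vec (ob i) \<star> mono L = (-1) ^ (length (filter (\<lambda>j. j \<noteq> i) L)) *s (mono L \<star> ext_vec (ob i))"
proof (induction L)
  case (Cons j L)
  show ?case
  proof (cases "i = j")
    case True
    have "ext_vec (ob i) \<star> mono (i # L) = ext_vec (ob i) \<star> ((-1) ^ (length (filter (\<lambda>j. j \<noteq> i) L)) *s (mono L \<star> ext_vec (ob i)))"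
      unfolding Cons.IH[symmetric] by simp
    then show ?thesis using True by (simp add: cmul_assoc cm_simps)
  next
    case False
    have "ext_vec (ob i) \<star> mono (j # L) = - (ext_vec (ob j) \<star> ((-1) ^ (length (filter (\<lambda>j. j \<noteq> i) L)) *s (mono L \<star> ext_vec (ob i))))"
      unfolding Cons.IH[symmetric] by (simp add: ob_anti[OF False])
    then show ?thesis using False by (auto simp: cmul_assoc cm_simps)
  qed
qed (simp add: cmul_one_left cmul_one_right)

lemma pr0_mono: "distinct L \<Longrightarrow> L \<noteq> [] \<Longrightarrow> pr0 (mono L) = 0"
  using mono_degree[of L] by (auto simp: ext_degree_def pr0_def)

text \<open>A basis element \<open>e\<^sub>I\<close> of even degree \<open>0 < |I| < n\<close> anticommutes with \<open>e\<^sub>i e\<^sub>j\<close> for \<open>i \<in> I\<close>, \<open>j \<notin> I\<close>,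
  so that a trace vanishes on it.\<close>

lemma even_trace:
  assumes add: "\<And>a b. a \<in> ext_even \<Longrightarrow> b \<in> ext_even \<Longrightarrow> \<phi> (a + b) = \<phi> a + \<phi> b"
    and scale: "\<And>c a. a \<in> ext_even \<Longrightarrow> \<phi> (c *s a) = c * (\<phi> a :: complex)"
    and tracial: "\<And>a b. a \<in> ext_even \<Longrightarrow> b \<in> ext_even \<Longrightarrow> \<phi> (a \<star> b) = \<phi> (b \<star> a)"
    and top: "\<And>L. distinct L \<Longrightarrow> length L = CARD('n) \<Longrightarrow> even CARD('n) \<Longrightarrow> \<phi> (mono L) = 0"
    and a: "a \<in> ext_even"
  shows "\<phi> a = pr0 a * \<phi> ext_one"
proof -
  let ?P = "\<lambda>a. a \<in> ext_even \<and> \<phi> a = pr0 a * \<phi> ext_one"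
  have "?P a"
  proof (rule vec.span_induct[OF even_span[OF a]])
    have "\<phi> 0 = 0" using scale[OF even_one, of 0] by simp
    show "vec.subspace {a. ?P a}"
    proof (rule vec.subspaceI)
      show "0 \<in> {a. ?P a}" using vec.subspace_0[OF ext_even_subspace] \<open>\<phi> 0 = 0\<close> by (simp add: pr0_simps)
      fix x y c assume x: "x \<in> {a. ?P a}"
      show "x + y \<in> {a. ?P a}" if "y \<in> {a. ?P a}"
        using x that vec.subspace_add[OF ext_even_subspace, of x y] add[of x y] by (simp add: pr0_simps distrib_right)
      show "c *s x \<in> {a. ?P a}"
        using x vec.subspace_scale[OF ext_even_subspace, of x c] scale[of x c] by (simp add: pr0_simps)
    qed
    fix w assume "w \<in> {mono L | L. distinct L \<and> even (length L)}"
    then obtain L where L: "w = mono L" "distinct L" "even (length L)" by blast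
    have ev: "w \<in> ext_even" using L by (simp add: ext_even_iff gr_inv_mono)
    show "?P w"
    proof (cases "L = []")
      case True
      then show ?thesis using L by (simp add: even_one pr0_simps)
    next
      case ne: False
      have "\<phi> w = 0"
      \<comment> \<open>The full monomial has even length only for even n. It then commutes with the
        whole even algebra, so the sign argument below cannot reach it; \<open>top\<close> supplies
        the value.\<close>
      proof (cases "set L = UNIV")
        case True
        then have "length L = CARD('n)" using L distinct_card by fastforce
        then show ?thesis using top L by simp
      next
        case False
        then obtain j where j: "j \<notin> set L" by blast
        define i where "i = hd L"
        have i: "i \<in> set L" using ne by (simp add: i_def)
        have fi: "filter (\<lambda>k. k \<noteq> i) L = tl L" unfolding i_def using ne L(2) by (cases L) (auto intro!: filter_True)
        have fj: "filter (\<lambda>k. k \<noteq> j) L = L" using j by (auto intro!: filter_True)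
        let ?p = "ext_vec (ob i) \<star> ext_vec (ob j)" and ?q = "ext_vec (ob j) \<star> ext_vec (ob i)"
        have odd: "odd (length (tl L))" using L(3) ne by simp
        have ci: "ext_vec (ob i) \<star> w = - (w \<star> ext_vec (ob i))"
          using mono_commute[of i L] odd by (simp add: fi L(1))
        have cj: "ext_vec (ob j) \<star> w = w \<star> ext_vec (ob j)"
          using mono_commute[of j L] by (simp only: fj L(1)) (simp add: L(3))
        have "?p \<star> w = - (w \<star> ?p)" by (simp add: cmul_assoc cj) (simp add: cmul_assoc[symmetric] ci cm_simps)
        \<comment> \<open>\<open>?p\<close> and \<open>?q\<close> are inverse to each other, so w is
          conjugate to - w, and a trace takes equal values on conjugates.\<close>
        then have "w = - (?q \<star> w \<star> ?p)"
          by (metis cmul_assoc ob_sq clin_neg[OF clin_cmul])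
        moreover have "\<phi> (?q \<star> w \<star> ?p) = \<phi> w"
        proof -
          have "\<phi> (?q \<star> w \<star> ?p) = \<phi> (?p \<star> (?q \<star> w))"
            by (intro tracial even_cm vec_vec_even ev)
          then show ?thesis by (simp add: cmul_assoc ob_sq)
        qed
        ultimately have "\<phi> w = - \<phi> w" using scale[of "?q \<star> w \<star> ?p" "-1"] even_cm vec_vec_even ev
          by (metis mult_minus1 vec.scale_minus_left vec.scale_one)
        then show ?thesis by simp
      qed
      then show ?thesis using L ne ev by (simp add: pr0_mono)
    qed
  qed
  then show ?thesis by blast
qed

end

section \<open>Functoriality of the exterior algebra\<close>

lemma wedge_eps_left: "wedge (eps x u) w = eps x (wedge u w)"
proof -
  have b: "wedge (eps (ax i) u) w = eps (ax i) (wedge u w)" for i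
  proof -
    have "wedge (eps (ax i) u) w $ K = eps (ax i) (wedge u w) $ K" for K
    proof (cases "i \<in> K")
      case False
      then show ?thesis by (auto simp: wedge_def eps_axis intro!: sum.neutral)
    next
      case True
      let ?f = "\<lambda>I. shuffle_sign I (K - I) * (eps (ax i) u $ I) * w $ (K - I)"
      have "wedge (eps (ax i) u) w $ K = sum ?f (Pow K)" by (simp add: wedge_def)
      also have "\<dots> = sum ?f (insert i ` Pow (K - {i}))"
      proof (rule sum.mono_neutral_right)
        show "insert i ` Pow (K - {i}) \<subseteq> Pow K" using True by auto
        show "\<forall>I\<in>Pow K - insert i ` Pow (K - {i}). ?f I = 0"
        proof
          fix I assume I: "I \<in> Pow K - insert i ` Pow (K - {i})"
          have "i \<notin> I"
          proof
            assume "i \<in> I"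
            then have "I = insert i (I - {i})" "I - {i} \<in> Pow (K - {i})" using I by auto
            then show False using I by blast
          qed
          then show "?f I = 0" by (simp add: eps_axis)
        qed
      qed simp
      also have "\<dots> = (\<Sum>J\<in>Pow (K - {i}). ?f (insert i J))"
        by (subst sum.reindex) (auto simp: inj_on_def)
      also have "\<dots> = (\<Sum>J\<in>Pow (K - {i}). shuffle_sign {i} (K - {i}) * (shuffle_sign J (K - {i} - J) * u $ J * w $ (K - {i} - J)))"
      proof (rule sum.cong[OF refl])
        fix J assume J: "J \<in> Pow (K - {i})"
        define M where "M = K - {i} - J"
        have M: "K - insert i J = M" "K - {i} = J \<union> M" "J \<inter> M = {}" "i \<notin> J" "insert i J - {i} = J" "J \<union> M - J = M"
          using J by (auto simp: M_def)
        have "shuffle_sign (insert i J) M = shuffle_sign {i} M * shuffle_sign J M"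
          using shuffle_sign_union_left[of "{i}" J M] M by simp
        moreover have "shuffle_sign {i} (J \<union> M) = shuffle_sign {i} J * shuffle_sign {i} M"
          by (rule shuffle_sign_union_right) (rule M)
        ultimately show "?f (insert i J) = shuffle_sign {i} (K - {i}) * (shuffle_sign J (K - {i} - J) * u $ J * w $ (K - {i} - J))"
          unfolding M_def[symmetric] M(1) M(2) by (simp add: eps_axis M)
      qed
      finally show ?thesis using True by (simp add: eps_axis wedge_def sum_distrib_left)
    qed
    then show ?thesis by (simp add: vec_eq_iff)
  qed
  show ?thesis
    by (subst eps_expand, subst (2) eps_expand) (simp add: clin_rules[OF clin_wedge_left] b)
qed

lemma eps_wedge_right: "eps x (wedge u w) = wedge (gr_inv u) (eps x w)"
proof -
  let ?S = "{u. eps x (wedge u w) = wedge (gr_inv u) (eps x w)}"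
  have "u \<in> ?S"
  proof (rule ext_gen_eps)
    show "vec.subspace ?S"
      by (auto simp: vec.subspace_def clin_rules[OF clin_wedge_left] clin_rules[OF clin_gr_inv] clin_rules[OF clin_eps])
    show "ext_one \<in> ?S" by (simp add: wedge_one_left)
    fix i u assume "u \<in> ?S"
    then show "eps (ax i) u \<in> ?S"
      by (simp add: wedge_eps_left eps_anti[of x "ax i"] gr_inv_eps clin_rules[OF clin_wedge_left])
  qed
  then show ?thesis by simp
qed

text \<open>The endomorphism of the exterior algebra induced by A. For the zero form
  \<open>gam\<close> is \<open>eps\<close>, so the universal property of \<open>clifford_rep\<close>
  becomes that of the exterior algebra.\<close>

definition ext_map :: "'n::{finite,linorder} cmat \<Rightarrow> 'n ext \<Rightarrow> 'n ext" where
  "ext_map A = quantize (*s) (\<lambda>i. eps (A *v ax i)) ext_one (\<lambda>_ _. 0)"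

lemma zero_form: "sym_form (\<lambda>_ _. 0)"
  by (simp add: sym_form_def Vector_Spaces.linear_iff vec.vector_space_axioms vector_space_over_itself.vector_space_axioms)

lemma gam_zero: "gam (\<lambda>_ _. 0) x u = eps x u"
  by (simp add: gam_def vec_eq_iff iota_nth)

lemma ext_map_rep:
  fixes A :: "'n::{finite,linorder} cmat"
  shows "clifford_rep (\<lambda>_ _. 0) (*s) (\<lambda>i. eps (A *v ax i)) {0} UNIV ext_one"
proof -
  have e: "eps a (eps b w) + eps b (eps a w) = 0" for a b and w :: "'n ext"
    using eps_anti[of a b w] by simp
  show ?thesis
    by (intro clifford_rep.intro zero_form vec.vector_space_axioms clifford_rep_axioms.intro)
      (simp_all add: e clin_eps vec.subspace_UNIV vec.subspace_0 vec.subspace_def clin_rules[OF clin_eps])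
qed

lemma clin_ext_map: "clin (ext_map A)"
  unfolding ext_map_def by (rule clifford_rep.F_linear[OF ext_map_rep])

lemma ext_map_one: "ext_map A ext_one = ext_one"
  unfolding ext_map_def by (rule clifford_rep.F_one[OF ext_map_rep])

lemma clin_mv: "clin ((*v) (A :: complex^'n^'m))"
  by (rule matrix_vector_mul_linear_gen)

lemma mv_expand: "(A :: complex^'n^'m) *v x = (\<Sum>i\<in>UNIV. x $ i *s (A *v ax i))"
proof -
  have "A *v x = A *v (\<Sum>i\<in>UNIV. x $ i *s ax i)" by (simp add: basis_expansion)
  then show ?thesis by (simp only: clin_rules[OF clin_mv])
qed

lemma ext_map_eps: "ext_map A (eps x u) = eps (A *v x) (ext_map A u)"
proof -
  have b: "ext_map A (eps (ax i) u) = eps (A *v ax i) (ext_map A u)" for i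
    using clifford_rep.F_gam[OF ext_map_rep, of A i u] by (simp add: ext_map_def gam_zero)
  show ?thesis
    by (subst eps_expand, subst mv_expand)
      (simp only: clin_rules[OF clin_ext_map] clin_rules[OF clin_eps_vec] b)
qed

lemma ext_map_comp: "ext_map A (ext_map C u) = ext_map (A ** C) u"
proof -
  let ?S = "{u. ext_map A (ext_map C u) = ext_map (A ** C) u}"
  have "u \<in> ?S"
  proof (rule ext_gen_eps)
    show "vec.subspace ?S"
      by (auto simp: vec.subspace_def clin_rules[OF clin_ext_map])
  qed (simp_all add: ext_map_one ext_map_eps matrix_vector_mul_assoc)
  then show ?thesis by simp
qed

lemma ext_map_gr_inv: "ext_map A (gr_inv u) = gr_inv (ext_map A u)"
proof -
  let ?S = "{u. ext_map A (gr_inv u) = gr_inv (ext_map A u)}"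
  have "u \<in> ?S"
  proof (rule ext_gen_eps)
    show "vec.subspace ?S"
      by (auto simp: vec.subspace_def clin_rules[OF clin_ext_map] clin_rules[OF clin_gr_inv])
  qed (simp_all add: ext_map_one ext_map_eps gr_inv_eps clin_rules[OF clin_ext_map])
  then show ?thesis by simp
qed

section \<open>Determinants and the trace of the exterior powers\<close>

definition wlist :: "('n::{finite,linorder} \<Rightarrow> 'n cvec) \<Rightarrow> 'n list \<Rightarrow> 'n ext" where
  "wlist v L = foldr (\<lambda>i. eps (v i)) L ext_one"

lemma wlist_simps [simp]: "wlist v [] = ext_one" "wlist v (i # L) = eps (v i) (wlist v L)"
  by (simp_all add: wlist_def)

lemma wlist_ax: "distinct L \<Longrightarrow> \<exists>s. s \<noteq> 0 \<and> wlist ax L = s *s ax (set L)"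
proof (induction L)
  case Nil
  then show ?case by (intro exI[of _ 1]) (simp add: ext_one_def)
next
  case (Cons i L)
  then obtain s where s: "s \<noteq> 0" "wlist ax L = s *s ax (set L)" by auto
  have "shuffle_sign {i} (set L) \<noteq> 0" by (simp add: shuffle_sign_def)
  then show ?case using s Cons.prems
    by (intro exI[of _ "s * shuffle_sign {i} (set L)"]) (simp add: clin_rules[OF clin_eps] eps_axis_axis)
qed

lemma ext_map_wlist: "ext_map A (wlist v L) = wlist (\<lambda>i. A *v v i) L"
  by (induction L) (simp_all add: ext_map_one ext_map_eps)

lemma wlist_repeat: "x \<in> v ` set L \<Longrightarrow> eps x (wlist v L) = 0"
proof (induction L)
  case (Cons i L)
  show ?case
  proof (cases "x = v i")
    case False
    then have "eps x (wlist v L) = 0" using Cons by auto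
    then show ?thesis using eps_anti[of x "v i" "wlist v L"] by (simp add: clin_rules[OF clin_eps])
  qed simp
qed simp

lemma wlist_not_inj: "distinct L \<Longrightarrow> \<not> inj_on v (set L) \<Longrightarrow> wlist v L = 0"
proof (induction L)
  case (Cons i L)
  show ?case
  proof (cases "inj_on v (set L)")
    case True
    then have "v i \<in> v ` set L" using Cons.prems by auto
    then show ?thesis by (simp add: wlist_repeat)
  next
    case False
    then show ?thesis using Cons by (simp add: clin_rules[OF clin_eps])
  qed
qed simp

lemma wlist_cong: "(\<And>i. i \<in> set L \<Longrightarrow> v i = w i) \<Longrightarrow> wlist v L = wlist w L"
  by (induction L) auto

text \<open>Multilinearity gives one summand for each choice h of an index for every factor.
  Extensional functions on \<open>set L\<close> count each choice once.\<close>

lemma wlist_expand: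
  assumes "distinct L"
  shows "wlist (\<lambda>i. \<Sum>j\<in>UNIV. c i j *s ax j) L =
    (\<Sum>h\<in>PiE (set L) (\<lambda>_. UNIV). (\<Prod>i\<in>set L. c i (h i)) *s wlist (\<lambda>i. ax (h i)) L)"
  using assms
proof (induction L)
  case (Cons a L)
  let ?S = "set L"
  have a: "a \<notin> ?S" using Cons.prems by simp
  let ?g = "\<lambda>h. (\<Prod>i\<in>insert a ?S. c i (h i)) *s wlist (\<lambda>i. ax (h i)) (a # L)"
  have inj: "inj_on (\<lambda>(y, g). g(a := y)) (UNIV \<times> PiE ?S (\<lambda>_. UNIV))"
    using inj_combinator[OF a, of "\<lambda>_. UNIV"] by simp
  have "(\<Sum>h\<in>PiE (set (a # L)) (\<lambda>_. UNIV). ?g h) = (\<Sum>(y, h)\<in>UNIV \<times> PiE ?S (\<lambda>_. UNIV). ?g (h(a := y)))"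
    unfolding list.set PiE_insert_eq by (subst sum.reindex[OF inj]) (simp add: case_prod_unfold)
  also have "\<dots> = (\<Sum>(y, h)\<in>UNIV \<times> PiE ?S (\<lambda>_. UNIV). (c a y * (\<Prod>i\<in>?S. c i (h i))) *s eps (ax y) (wlist (\<lambda>i. ax (h i)) L))"
  proof (rule sum.cong[OF refl], clarify)
    fix y and h :: "'a \<Rightarrow> 'a"
    have "(\<Prod>i\<in>?S. c i ((h(a := y)) i)) = (\<Prod>i\<in>?S. c i (h i))" using a by (intro prod.cong) auto
    moreover have "wlist (\<lambda>i. ax ((h(a := y)) i)) L = wlist (\<lambda>i. ax (h i)) L" using a by (intro wlist_cong) auto
    ultimately show "?g (h(a := y)) = (c a y * (\<Prod>i\<in>?S. c i (h i))) *s eps (ax y) (wlist (\<lambda>i. ax (h i)) L)"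
      using a by simp
  qed
  also have "\<dots> = (\<Sum>y\<in>UNIV. \<Sum>h\<in>PiE ?S (\<lambda>_. UNIV). (c a y * (\<Prod>i\<in>?S. c i (h i))) *s eps (ax y) (wlist (\<lambda>i. ax (h i)) L))"
    by (rule sum.cartesian_product[symmetric])
  also have "\<dots> = eps (\<Sum>y\<in>UNIV. c a y *s ax y) (\<Sum>h\<in>PiE ?S (\<lambda>_. UNIV). (\<Prod>i\<in>?S. c i (h i)) *s wlist (\<lambda>i. ax (h i)) L)"
    by (subst sum.swap, simp only: clin_rules[OF clin_eps_vec] clin_rules[OF clin_eps] vec.scale_sum_right vec.scale_scale)
      (simp only: mult.commute)
  also have "\<dots> = wlist (\<lambda>i. \<Sum>j\<in>UNIV. c i j *s ax j) (a # L)"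
    using Cons by simp
  finally show ?case by simp
qed simp

definition perm_mat :: "('n \<Rightarrow> 'n) \<Rightarrow> 'n::finite cmat" where
  "perm_mat h = (\<chi> i j. if i = h j then 1 else 0)"

lemma perm_mat_ax: "perm_mat h *v ax j = ax (h j)"
  by (simp add: vec_eq_iff perm_mat_def matrix_vector_mult_def ax_nth mult_delta_right)

text \<open>Listing the full product with a and b in front turns the effect of the transposition
  into a single use of anticommutativity.\<close>

lemma ext_map_swap:
  assumes "a \<noteq> b"
  shows "ext_map (perm_mat (Transposition.transpose a b)) (ax UNIV) = - ax (UNIV :: 'n::{finite,linorder} set)"
proof -
  obtain L where L: "set L = UNIV - {a, b}" "distinct L" using finite_distinct_list[of "UNIV - {a, b}"] by auto
  have "distinct (a # b # L)" "set (a # b # L) = UNIV" using L assms by auto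
  then obtain s where s: "s \<noteq> 0" "wlist ax (a # b # L) = s *s ax (UNIV :: 'n set)" using wlist_ax by metis
  have "wlist (\<lambda>i. perm_mat (Transposition.transpose a b) *v ax i) L = wlist ax L"
    using L by (intro wlist_cong) (auto simp: perm_mat_ax transpose_def)
  then have "ext_map (perm_mat (Transposition.transpose a b)) (wlist ax (a # b # L)) = eps (ax b) (eps (ax a) (wlist ax L))"
    by (simp add: ext_map_wlist ext_map_eps perm_mat_ax)
  also have "\<dots> = - wlist ax (a # b # L)" by (simp add: eps_anti[of "ax b" "ax a"])
  finally have "s *s ext_map (perm_mat (Transposition.transpose a b)) (ax UNIV) = s *s (- ax (UNIV :: 'n set))"
    unfolding s(2) clin_rules[OF clin_ext_map] by (simp add: vec.scale_minus_right)
  then show ?thesis using s(1) by (simp only: vec.scale_cancel_left) simp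
qed

lemma ext_map_perm:
  assumes "p permutes (UNIV :: 'n::{finite,linorder} set)"
  shows "ext_map (perm_mat p) (ax UNIV) = of_int (sign p) *s ax (UNIV :: 'n set)"
  using assms finite
proof (induction p rule: permutes_induct)
  case id
  have "perm_mat id = (mat 1 :: 'n cmat)" by (simp add: vec_eq_iff perm_mat_def mat_def)
  moreover have "ext_map (mat 1) (wlist ax L) = wlist ax (L :: 'n list)" for L by (simp add: ext_map_wlist)
  moreover obtain L :: "'n list" where L: "set L = UNIV" "distinct L" using finite_distinct_list[of "UNIV :: 'n set"] by auto
  moreover obtain s where s: "s \<noteq> 0" "wlist ax L = s *s ax (UNIV :: 'n set)" using wlist_ax[OF L(2)] L by metis
  ultimately have "s *s ext_map (perm_mat id) (ax UNIV) = s *s ax (UNIV :: 'n set)"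
    by (metis clin_scale[OF clin_ext_map])
  then show ?case using s(1) by (simp only: vec.scale_cancel_left sign_id of_int_1 vec.scale_one) blast
next
  case (swap a b p)
  have "perm_mat (Transposition.transpose a b \<circ> p) = perm_mat (Transposition.transpose a b) ** (perm_mat p :: 'n cmat)"
    by (simp add: vec_eq_iff perm_mat_def matrix_matrix_mult_def mult_delta_right)
  then have "ext_map (perm_mat (Transposition.transpose a b \<circ> p)) (ax UNIV) = of_int (sign p) *s (- ax (UNIV :: 'n set))"
    using swap by (simp add: ext_map_comp[symmetric] clin_rules[OF clin_ext_map] ext_map_swap)
  moreover have "sign (Transposition.transpose a b \<circ> p) = - sign p"
    using swap by (simp add: sign_compose permutation_swap_id sign_swap_id permutation_permutes[THEN iffD2, OF exI])
  ultimately show ?case by (simp only: vec.scale_minus_right vec.scale_minus_left of_int_minus)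
qed

text \<open>Expanding the product of the columns gives the Leibniz sum: choices with a repeated
  index vanish, and a permutation contributes its sign.\<close>

lemma ext_map_det: "ext_map A (ax UNIV) = det A *s ax (UNIV :: 'n::{finite,linorder} set)"
proof -
  obtain L :: "'n list" where L: "set L = UNIV" "distinct L" using finite_distinct_list[of "UNIV :: 'n set"] by auto
  obtain s where s: "s \<noteq> 0" "wlist ax L = s *s ax (UNIV :: 'n set)" using wlist_ax[OF L(2)] L by metis
  have col: "A *v ax i = (\<Sum>j\<in>UNIV. A $ j $ i *s ax j)" for i
    by (simp add: vec_eq_iff matrix_vector_mult_def ax_nth mult_delta_right)
  have p: "wlist (\<lambda>i. ax (h i)) L = s *s (of_int (sign h) *s ax UNIV)" if "h permutes UNIV" for h
  proof -
    have "wlist (\<lambda>i. ax (h i)) L = ext_map (perm_mat h) (wlist ax L)" by (simp add: ext_map_wlist perm_mat_ax)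
    then show ?thesis by (simp add: s clin_rules[OF clin_ext_map] ext_map_perm[OF that])
  qed
  have "s *s ext_map A (ax UNIV) = wlist (\<lambda>i. A *v ax i) L"
    unfolding ext_map_wlist[symmetric] s clin_rules[OF clin_ext_map] ..
  also have "\<dots> = (\<Sum>h\<in>UNIV. (\<Prod>i\<in>UNIV. A $ h i $ i) *s wlist (\<lambda>i. ax (h i)) L)"
    unfolding col wlist_expand[OF L(2), of "\<lambda>i j. A $ j $ i"] L(1) by (simp add: PiE_UNIV_domain)
  also have "\<dots> = (\<Sum>h\<in>{h. h permutes UNIV}. (\<Prod>i\<in>UNIV. A $ h i $ i) *s wlist (\<lambda>i. ax (h i)) L)"
  proof (rule sum.mono_neutral_right)
    show "\<forall>h\<in>UNIV - {h. h permutes UNIV}. (\<Prod>i\<in>UNIV. A $ h i $ i) *s wlist (\<lambda>i. ax (h i)) L = 0"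
    proof
      fix h :: "'n \<Rightarrow> 'n" assume h: "h \<in> UNIV - {h. h permutes UNIV}"
      have "\<not> inj h"
      proof
        assume "inj h"
        then have "bij h" by (simp add: bij_def finite_UNIV_inj_surj)
        then show False using h by (auto simp: permutes_def bij_iff)
      qed
      then have "\<not> inj_on (\<lambda>i. ax (h i) :: 'n cvec) (set L)" unfolding L(1) by (auto simp: inj_def axis_eq_axis)
      then show "(\<Prod>i\<in>UNIV. A $ h i $ i) *s wlist (\<lambda>i. ax (h i)) L = 0" by (simp add: wlist_not_inj[OF L(2)])
    qed
  qed auto
  also have "\<dots> = (\<Sum>h\<in>{h. h permutes UNIV}. s *s ((of_int (sign h) * (\<Prod>i\<in>UNIV. A $ h i $ i)) *s ax UNIV))"
    by (rule sum.cong[OF refl]) (simp add: p mult_ac)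
  \<comment> \<open>The choice function runs over columns, while \<open>det_def\<close> runs over
    rows; the transpose is removed by \<open>det_transpose\<close>.\<close>
  also have "\<dots> = s *s (det (Finite_Cartesian_Product.transpose A) *s ax UNIV)"
    by (simp only: det_def vec.scale_sum_right[symmetric] scale_sum_left[symmetric]) (simp add: Finite_Cartesian_Product.transpose_def)
  finally show ?thesis using s(1) by (simp only: vec.scale_cancel_left det_transpose) simp
qed

lemma wedge_ax_top: "wedge u (ax (- I)) $ UNIV = shuffle_sign I (- I) * u $ I"
proof -
  have "wedge u (ax (- I)) $ UNIV = (\<Sum>J\<in>UNIV. if J = I then shuffle_sign I (- I) * u $ I else 0)"
    unfolding wedge_def by (simp add: ax_nth Compl_eq_Diff_UNIV[symmetric] mult_delta_right)
  then show ?thesis by simp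
qed

text \<open>The product of the vectors e_k + A e_k is expanded by choosing the set I of positions
  where A e_k is taken; the shuffle sign sorts these factors to the front. The induction splits off
  the smallest index.\<close>

lemma ext_map_plus_one:
  "ext_map (mat 1 + A) (ax K) = (\<Sum>I\<in>Pow K. shuffle_sign I (K - I) *s wedge (ext_map A (ax I)) (ax (K - I)))"
proof (induction "card K" arbitrary: K)
  case 0
  then show ?case by (simp add: ext_one_def[symmetric] ext_map_one wedge_one_left)
next
  case (Suc n)
  then have ne: "K \<noteq> {}" by auto
  define k J where "k = Min K" and "J = K - {k}"
  have k: "K = insert k J" "k \<notin> J" "\<And>j. j \<in> J \<Longrightarrow> k < j"
    using ne Min_le[of K] unfolding k_def J_def by (auto simp: order.strict_iff_order insert_absorb)
  have eK: "ax (insert k I) = eps (ax k) (ax I)" if "I \<subseteq> J" for I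
  proof -
    have "shuffle_sign {k} I = 1" using k that by (intro shuffle_sign_min) auto
    then show ?thesis using k that by (auto simp: eps_axis_axis)
  qed
  let ?t = "\<lambda>I M. shuffle_sign I M *s wedge (ext_map A (ax I)) (ax M)"
  have cJ: "n = card J" using Suc(2) k by simp
  have "ext_map (mat 1 + A) (ax K) = eps (ax k + A *v ax k) (ext_map (mat 1 + A) (ax J))"
    unfolding k(1) eK[OF order_refl] ext_map_eps by (simp add: matrix_vector_mult_add_rdistrib)
  also have "\<dots> = (\<Sum>I\<in>Pow J. eps (ax k) (?t I (J - I))) + (\<Sum>I\<in>Pow J. eps (A *v ax k) (?t I (J - I)))"
    unfolding Suc(1)[OF cJ] by (simp only: clin_rules[OF clin_eps_vec] clin_sum[OF clin_eps] sum.distrib)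
  also have "(\<Sum>I\<in>Pow J. eps (ax k) (?t I (J - I))) = (\<Sum>I\<in>Pow J. ?t I (K - I))"
  proof (rule sum.cong[OF refl])
    fix I assume I: "I \<in> Pow J"
    have KI: "K - I = insert k (J - I)" using I k by auto
    have g: "gr_inv (ext_map A (ax I)) = (-1) ^ card I *s ext_map A (ax I)"
    proof -
      have "gr_inv (ax I) = (-1) ^ card I *s ax I" by (simp add: vec_eq_iff gr_inv_def ax_nth)
      then show ?thesis by (simp add: ext_map_gr_inv[symmetric] clin_rules[OF clin_ext_map])
    qed
    have s1: "shuffle_sign {k} I = 1" using I k by (intro shuffle_sign_min) auto
    have "shuffle_sign I {k} * shuffle_sign {k} I = (-1) ^ (card I * card {k})"
      using I k by (intro shuffle_sign_swap) auto
    then have s: "shuffle_sign I {k} = (-1) ^ card I" using s1 by simp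
    have "shuffle_sign I (K - I) = shuffle_sign I {k} * shuffle_sign I (J - I)"
      unfolding KI using shuffle_sign_union_right[of "{k}" "J - I" I] k(2) by simp
    moreover have "eps (ax k) (wedge (ext_map A (ax I)) (ax (J - I))) = (-1) ^ card I *s wedge (ext_map A (ax I)) (ax (K - I))"
      unfolding KI eps_wedge_right g clin_rules[OF clin_wedge_left] by (simp add: eK)
    ultimately show "eps (ax k) (?t I (J - I)) = ?t I (K - I)"
      by (simp add: clin_rules[OF clin_eps] s mult.commute)
  qed
  also have "(\<Sum>I\<in>Pow J. eps (A *v ax k) (?t I (J - I))) = (\<Sum>I\<in>insert k ` Pow J. ?t I (K - I))"
  proof -
    have "(\<Sum>I\<in>insert k ` Pow J. ?t I (K - I)) = (\<Sum>I\<in>Pow J. ?t (insert k I) (K - insert k I))"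
      using k(2) by (subst sum.reindex) (auto simp: inj_on_def)
    also have "\<dots> = (\<Sum>I\<in>Pow J. eps (A *v ax k) (?t I (J - I)))"
    proof (rule sum.cong[OF refl])
      fix I assume I: "I \<in> Pow J"
      have KI: "K - insert k I = J - I" using I k by auto
      have s1: "shuffle_sign {k} (J - I) = 1" using k by (intro shuffle_sign_min) auto
      have "shuffle_sign (insert k I) (J - I) = shuffle_sign I (J - I)"
        using shuffle_sign_union_left[of "{k}" I "J - I"] I k s1 by auto
      then show "?t (insert k I) (K - insert k I) = eps (A *v ax k) (?t I (J - I))"
        unfolding KI using I by (simp add: clin_rules[OF clin_eps] wedge_eps_left[symmetric] ext_map_eps[symmetric] eK)
    qed
    finally show ?thesis ..
  qed
  also have "(\<Sum>I\<in>Pow J. ?t I (K - I)) + (\<Sum>I\<in>insert k ` Pow J. ?t I (K - I)) = (\<Sum>I\<in>Pow K. ?t I (K - I))"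
    unfolding k(1) Pow_insert using k(2) by (subst sum.union_disjoint) auto
  finally show ?case .
qed

text \<open>Take the top coefficient in the preceding expansion: wedging with the complementary
  basis element reads off the diagonal coefficient at I, and the shuffle sign appears twice.\<close>

lemma trace_ext_map: "(\<Sum>I\<in>UNIV. ext_map A (ax I) $ I) = det (mat 1 + A)"
proof -
  have "det (mat 1 + A) = ext_map (mat 1 + A) (ax UNIV) $ UNIV"
    by (simp add: ext_map_det ax_nth)
  also have "\<dots> = (\<Sum>I\<in>UNIV. shuffle_sign I (- I) * (wedge (ext_map A (ax I)) (ax (- I)) $ UNIV))"
    unfolding ext_map_plus_one by (simp add: Compl_eq_Diff_UNIV)
  also have "\<dots> = (\<Sum>I\<in>UNIV. ext_map A (ax I) $ I)"
    unfolding wedge_ax_top by (simp add: shuffle_sign_square flip: mult.assoc)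
  finally show ?thesis ..
qed

section \<open>The determinant formula and the Cayley transform\<close>

definition Tr :: "(complex^'m \<Rightarrow> complex^'m) \<Rightarrow> complex" where
  "Tr F = trace (matrix F)"

lemma Tr_sum: "Tr F = (\<Sum>i\<in>UNIV. F (ax i) $ i)"
  by (simp add: Tr_def trace_def matrix_def)

lemma Tr_simps: "Tr (\<lambda>x. F x + G x) = Tr F + Tr G" "Tr (\<lambda>x. c *s F x) = c * Tr F" "Tr (\<lambda>x. - F x) = - Tr F"
  by (simp_all add: Tr_sum sum.distrib sum_distrib_left sum_negf)

lemma Tr_comm: "clin F \<Longrightarrow> clin G \<Longrightarrow> Tr (\<lambda>x. F (G x)) = Tr (\<lambda>x. G (F x))"
  using matrix_compose_gen[of F G] matrix_compose_gen[of G F] trace_mul_sym[of "matrix F" "matrix G"]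
  by (simp add: Tr_def comp_def)

text \<open>Conjugation by the involution H preserves the trace and turns K into - K.\<close>

lemma Tr_anti:
  assumes "clin H" "clin K" "\<And>u. H (H u) = u" "\<And>u. H (K u) = - K (H u)"
  shows "Tr K = 0"
proof -
  have c: "clin (\<lambda>u. K (H u))"
    by (rule clinI) (simp_all add: clin_rules[OF assms(1)] clin_rules[OF assms(2)])
  have "Tr K = Tr (\<lambda>u. H (- K (H u)))" by (simp only: assms(3) assms(4)[symmetric])
  also have "\<dots> = - Tr (\<lambda>u. H (K (H u)))" by (simp add: clin_rules[OF assms(1)] Tr_simps)
  also have "Tr (\<lambda>u. H (K (H u))) = Tr (\<lambda>u. K (H (H u)))" by (rule Tr_comm[OF assms(1) c])
  finally show ?thesis by (simp add: assms(3))
qed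

text \<open>Induction on the rank: splitting off an idempotent of rank one lowers the trace by 1.
  This integrality is what later forces the two halves of the spin module to have equal
  dimension.\<close>

lemma idempotent_trace:
  fixes P :: "complex^'m^'m"
  assumes "P ** P = P"
  shows "\<exists>k::nat. trace P = of_nat k \<and> (P \<noteq> 0 \<longrightarrow> k > 0)"
  using assms
proof (induction "vec.dim (range ((*v) P))" arbitrary: P rule: less_induct)
  case less
  show ?case
  proof (cases "P = 0")
    case True
    then show ?thesis by (intro exI[of _ 0]) (simp add: trace_def)
  next
    case False
    then obtain a b where ab: "P $ a $ b \<noteq> 0" by (auto simp: vec_eq_iff)
    have PP: "(\<Sum>k\<in>UNIV. P $ i $ k * P $ k $ j) = P $ i $ j" for i j
      using arg_cong[OF less.prems, of "\<lambda>M. M $ i $ j"] by (simp add: matrix_matrix_mult_def)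
    \<comment> \<open>\<open>v\<close> is column b scaled to have entry 1 at a. With r the row a of
      P, one has P v = v, r P = r and r v = 1, so v r is an idempotent of rank one below P and the
      difference \<open>P'\<close> is again idempotent.\<close>
    define v where "v = (\<chi> i. P $ i $ b / P $ a $ b)"
    define P' where "P' = (\<chi> i j. P $ i $ j - v $ i * P $ a $ j)"
    have Pv: "(\<Sum>k\<in>UNIV. P $ i $ k * v $ k) = v $ i" for i
      using PP[of i b] by (simp add: v_def sum_divide_distrib[symmetric])
    have va: "v $ a = 1" using ab by (simp add: v_def)
    have "P' ** P' = P'"
    proof -
      have "(\<Sum>k\<in>UNIV. (P $ i $ k - v $ i * P $ a $ k) * (P $ k $ j - v $ k * P $ a $ j)) = P $ i $ j - v $ i * P $ a $ j" for i j
      proof -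
        have "(\<Sum>k\<in>UNIV. (P $ i $ k - v $ i * P $ a $ k) * (P $ k $ j - v $ k * P $ a $ j)) =
          (\<Sum>k\<in>UNIV. P $ i $ k * P $ k $ j) - (\<Sum>k\<in>UNIV. P $ i $ k * v $ k) * P $ a $ j
          - v $ i * (\<Sum>k\<in>UNIV. P $ a $ k * P $ k $ j) + v $ i * (\<Sum>k\<in>UNIV. P $ a $ k * v $ k) * P $ a $ j"
          by (simp add: sum_distrib_left sum_distrib_right sum.distrib[symmetric] sum_subtractf[symmetric] algebra_simps)
        then show ?thesis unfolding PP Pv va by simp
      qed
      then show ?thesis by (simp add: vec_eq_iff P'_def matrix_matrix_mult_def)
    qed
    moreover have "vec.dim (range ((*v) P')) < vec.dim (range ((*v) P))"
    proof (rule vec.dim_psubset)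
      have sp: "vec.span (range ((*v) M)) = range ((*v) M)" for M :: "complex^'m^'m"
      proof -
        have "vec.subspace (range ((*v) M))"
        proof (rule vec.subspaceI)
          show "0 \<in> range ((*v) M)" by (rule image_eqI[of _ _ 0]) simp_all
          fix x y c assume "x \<in> range ((*v) M)"
          then obtain x' where x: "x = M *v x'" by auto
          show "x + y \<in> range ((*v) M)" if "y \<in> range ((*v) M)"
            using x that by (auto simp: matrix_vector_right_distrib[symmetric])
          show "c *s x \<in> range ((*v) M)"
            unfolding x clin_scale[OF clin_mv, symmetric] by simp
        qed
        then show ?thesis by (simp only: vec.span_eq_iff)
      qed
      have P'w: "P' *v w = P *v w - (P *v w) $ a *s v" for w
        by (simp add: vec_eq_iff matrix_vector_mult_def P'_def sum_subtractf left_diff_distrib right_diff_distrib sum_distrib_left mult_ac)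
      have Pvv: "P *v v = v" using Pv by (simp add: vec_eq_iff matrix_vector_mult_def)
      have "P' *v w = P *v (w - (P *v w) $ a *s v)" for w
        by (simp add: P'w clin_rules[OF clin_mv[of P]] Pvv)
      then have "range ((*v) P') \<subseteq> range ((*v) P)" by (auto simp del: range_eqI)
      moreover have "v \<notin> range ((*v) P')"
      proof
        assume "v \<in> range ((*v) P')"
        then obtain w where w: "v = P' *v w" by auto
        have "v $ a = (P' *v w) $ a" by (rule arg_cong[OF w])
        then have "v $ a = 0" unfolding P'w by (simp add: va)
        then show False using va by simp
      qed
      moreover have "v \<in> range ((*v) P)" using Pvv by (metis rangeI)
      ultimately show "vec.span (range ((*v) P')) \<subset> vec.span (range ((*v) P))" unfolding sp by blast
    qed
    ultimately obtain k where k: "trace P' = of_nat k" using less.hyps by blast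
    have "trace P' = trace P - (\<Sum>i\<in>UNIV. P $ a $ i * v $ i)"
      by (simp add: trace_def P'_def sum_subtractf mult.commute)
    then have "trace P = of_nat (Suc k)" using k unfolding Pv va by simp
    then show ?thesis by blast
  qed
qed

context nondeg_form
begin

lemma clin_sandwich: "clin (\<lambda>u. a \<star> u \<star> b)"
  by (rule clinI) (simp_all add: cm_simps)

lemma mono_full_commute:
  assumes "distinct L" "length L = CARD('n)"
  shows "ext_vec (ob i) \<star> mono L = (-1) ^ (CARD('n) - 1) *s (mono L \<star> ext_vec (ob i))"
proof -
  have "set L = UNIV" using assms distinct_card[of L] by (metis card_subset_eq finite subset_UNIV)
  then have "filter (\<lambda>j. j \<noteq> i) L = remove1 i L" using assms(1)
    by (simp add: distinct_remove1_removeAll removeAll_filter_not_eq) (metis (mono_tags, lifting))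
  moreover have "length (remove1 i L) = CARD('n) - 1"
    using \<open>set L = UNIV\<close> assms by (simp add: length_remove1)
  ultimately show ?thesis using mono_commute[of i L] by simp
qed

text \<open>For fixed b the expression is a trace in a on the even algebra, and for a = 1 it is one
  in b, so \<open>even_trace\<close> applies twice; what remains is the dimension of the exterior
  algebra. For even n the volume element has trace 0 because it anticommutes with vectors, which
  also act on the whole exterior algebra.\<close>

lemma trace_sandwich:
  assumes a: "a \<in> ext_even" and b: "b \<in> ext_even"
  shows "Tr (\<lambda>u. a \<star> u \<star> b) = 2 ^ CARD('n) * pr0 a * pr0 b"
proof -
  have 1: "Tr (\<lambda>u. a \<star> u \<star> b) = pr0 a * Tr (\<lambda>u. ext_one \<star> u \<star> b)"
  proof (rule even_trace[of "\<lambda>a. Tr (\<lambda>u. a \<star> u \<star> b)"])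
    fix a c :: "'n ext" assume "a \<in> ext_even" "c \<in> ext_even"
    have "Tr (\<lambda>u. a \<star> (c \<star> u \<star> b)) = Tr (\<lambda>u. c \<star> (a \<star> u) \<star> b)"
      by (rule Tr_comm[OF clin_cmul clin_sandwich])
    then show "Tr (\<lambda>u. a \<star> c \<star> u \<star> b) = Tr (\<lambda>u. c \<star> a \<star> u \<star> b)" by (simp add: cmul_assoc)
  next
    fix L :: "'n list" assume L: "distinct L" "length L = CARD('n)" "even CARD('n)"
    then have "odd (CARD('n) - 1)" by simp
    then have m: "ext_vec (ob i) \<star> mono L = - (mono L \<star> ext_vec (ob i))" for i
      using mono_full_commute[OF L(1,2), of i] by simp
    show "Tr (\<lambda>u. mono L \<star> u \<star> b) = 0"
    proof (rule Tr_anti[of "cm (ext_vec (ob undefined))"])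
      fix u
      show "ext_vec (ob undefined) \<star> (mono L \<star> u \<star> b) = - (mono L \<star> (ext_vec (ob undefined) \<star> u) \<star> b)"
        by (simp only: cmul_assoc[symmetric] m cm_simps)
    qed (rule clin_cmul clin_sandwich ob_sq)+
  next
    fix a c :: "'n ext" and k
    show "Tr (\<lambda>u. (a + c) \<star> u \<star> b) = Tr (\<lambda>u. a \<star> u \<star> b) + Tr (\<lambda>u. c \<star> u \<star> b)"
      by (simp only: cm_simps Tr_simps)
    show "Tr (\<lambda>u. (k *s a) \<star> u \<star> b) = k * Tr (\<lambda>u. a \<star> u \<star> b)"
      by (simp only: cm_simps Tr_simps)
  qed (rule a)
  have 2: "Tr (\<lambda>u. ext_one \<star> u \<star> b) = pr0 b * Tr (\<lambda>u. ext_one \<star> u \<star> ext_one)"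
  proof (rule even_trace[of "\<lambda>b. Tr (\<lambda>u. ext_one \<star> u \<star> b)"])
    fix a c :: "'n ext" assume "a \<in> ext_even" "c \<in> ext_even"
    have "Tr (\<lambda>u. u \<star> c \<star> a) = Tr (\<lambda>u. u \<star> a \<star> c)"
      by (rule Tr_comm[OF clin_cmul_left clin_cmul_left])
    then show "Tr (\<lambda>u. ext_one \<star> u \<star> (a \<star> c)) = Tr (\<lambda>u. ext_one \<star> u \<star> (c \<star> a))"
      by (simp add: cmul_assoc cmul_one_left)
  next
    fix L :: "'n list" assume L: "distinct L" "length L = CARD('n)" "even CARD('n)"
    then have "odd (CARD('n) - 1)" by simp
    then have m: "mono L \<star> ext_vec (ob i) = - (ext_vec (ob i) \<star> mono L)" for i
      using mono_full_commute[OF L(1,2), of i] by simp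
    have sq: "u \<star> ext_vec (ob i) \<star> ext_vec (ob i) = u" for u i
      using vec_sq[of "ob i"] by (simp add: ob cmul_assoc cmul_one_right)
    show "Tr (\<lambda>u. ext_one \<star> u \<star> mono L) = 0"
    proof (rule Tr_anti[of "\<lambda>u. u \<star> ext_vec (ob undefined)"])
      fix u
      show "ext_one \<star> u \<star> mono L \<star> ext_vec (ob undefined) = - (ext_one \<star> (u \<star> ext_vec (ob undefined)) \<star> mono L)"
        by (simp add: cmul_assoc m cm_simps)
    qed (rule clin_cmul_left clin_sandwich sq)+
  next
    fix a c :: "'n ext" and k
    show "Tr (\<lambda>u. ext_one \<star> u \<star> (a + c)) = Tr (\<lambda>u. ext_one \<star> u \<star> a) + Tr (\<lambda>u. ext_one \<star> u \<star> c)"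
      by (simp only: cm_simps Tr_simps)
    show "Tr (\<lambda>u. ext_one \<star> u \<star> (k *s a)) = k * Tr (\<lambda>u. ext_one \<star> u \<star> a)"
      by (simp only: cm_simps Tr_simps)
  qed (rule b)
  have 3: "Tr (\<lambda>u. ext_one \<star> u \<star> ext_one) = 2 ^ CARD('n)"
    by (simp add: cmul_one_left cmul_one_right Tr_sum ax_nth card_UNIV_set)
  show ?thesis using 1 2 3 by simp
qed

lemma ext_map_iota:
  assumes T: "\<And>x y. B (T *v x) (T *v y) = B x y"
  shows "ext_map T (iota B x u) = iota B (T *v x) (ext_map T u)"
proof -
  let ?S = "{u. ext_map T (iota B x u) = iota B (T *v x) (ext_map T u)}"
  have "u \<in> ?S"
  proof (rule ext_gen_eps)
    show "vec.subspace ?S" by (auto simp: vec.subspace_def clin_rules[OF clin_ext_map] clin_rules[OF clin_iota])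
  qed (simp_all add: clin_rules[OF clin_ext_map] ext_map_one ext_map_eps iota_eps T)
  then show ?thesis by simp
qed

text \<open>When T is an isometry, \<open>ext_map T\<close> commutes with contractions as well and
  is multiplicative for the Clifford product, so the relation for vectors propagates to
  products.\<close>

lemma twists_ext_map:
  assumes g: "twists g T N" and T: "\<And>x y. B (T *v x) (T *v y) = B x y"
  shows "g \<star> u = ext_map T u \<star> g"
proof (rule cm_gen_induct[of "\<lambda>u. g \<star> u = ext_map T u \<star> g"])
  show "vec.subspace {u. g \<star> u = ext_map T u \<star> g}"
    by (auto simp: vec.subspace_def cm_simps clin_rules[OF clin_ext_map])
  show "g \<star> ext_one = ext_map T ext_one \<star> g" by (simp add: ext_map_one cmul_one_left cmul_one_right)
  fix x u assume IH: "g \<star> u = ext_map T u \<star> g"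
  have "g \<star> (ext_vec x \<star> u) = ext_vec (T *v x) \<star> (g \<star> u)"
    using g unfolding twists_def by (metis cmul_assoc)
  also have "\<dots> = ext_vec (T *v x) \<star> ext_map T u \<star> g" by (simp add: IH cmul_assoc)
  also have "ext_vec (T *v x) \<star> ext_map T u = ext_map T (ext_vec x \<star> u)"
    by (simp add: vec_left clin_rules[OF clin_ext_map] ext_map_eps ext_map_iota[OF T])
  finally show "g \<star> (ext_vec x \<star> u) = ext_map T (ext_vec x \<star> u) \<star> g" .
qed

lemma twists_det:
  assumes g: "twists g T N" and T: "\<And>x y. B (T *v x) (T *v y) = B x y"
  shows "2 ^ CARD('n) * pr0 g ^ 2 = N * det (mat 1 + T)"
proof -
  have ge: "g \<in> ext_even" "g \<star> ext_rev g = N *s ext_one" using g by (auto simp: twists_def)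
  have "g \<star> u \<star> ext_rev g = ext_map T u \<star> (g \<star> ext_rev g)" for u
    by (simp only: twists_ext_map[OF g T, of u] cmul_assoc)
  then have "g \<star> u \<star> ext_rev g = N *s ext_map T u" for u
    by (simp add: ge cm_simps cmul_one_right)
  then have "Tr (\<lambda>u. g \<star> u \<star> ext_rev g) = Tr (\<lambda>u. N *s ext_map T u)" by (simp only:)
  also have "\<dots> = N * Tr (ext_map T)" by (rule Tr_simps(2))
  also have "\<dots> = N * det (mat 1 + T)" unfolding Tr_sum trace_ext_map ..
  finally have "Tr (\<lambda>u. g \<star> u \<star> ext_rev g) = N * det (mat 1 + T)" .
  then show ?thesis using trace_sandwich[OF ge(1) even_rev[OF ge(1)]] by (simp only: pr0_rev power2_eq_square mult.assoc)
qed

lemma pr0_det: "g \<in> Spin B \<Longrightarrow> 2 ^ CARD('n) * pr0 g ^ 2 = det (mat 1 + spin_T B g)"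
  using twists_det[OF Spin_twists spin_T_B] by simp

lemma mono_inverse: "\<exists>s. s \<noteq> 0 \<and> mono L \<star> ext_rev (mono L) = s *s ext_one"
proof (induction L)
  case (Cons i L)
  then obtain s where s: "s \<noteq> 0" "mono L \<star> ext_rev (mono L) = s *s ext_one" by blast
  have "mono (i # L) \<star> ext_rev (mono (i # L)) = ext_vec (ob i) \<star> (mono L \<star> ext_rev (mono L)) \<star> ext_vec (ob i)"
    by (simp add: ext_rev_cm ext_rev_vec cmul_assoc)
  also have "\<dots> = s *s ext_one" using vec_sq[of "ob i"] by (simp add: s cm_simps cmul_one_right ob)
  finally show ?case using s by blast
qed (auto simp: cmul_one_left intro!: exI[of _ 1])

lemma full_list: obtains L :: "'n list" where "distinct L" "set L = UNIV" "length L = CARD('n)"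
proof -
  obtain L :: "'n list" where "set L = UNIV" "distinct L" using finite_distinct_list[of "UNIV :: 'n set"] by auto
  then show ?thesis using that distinct_card[of L] by simp
qed

lemma mono_top:
  assumes "distinct L" "length L = CARD('n)"
  obtains c where "c \<noteq> 0" "mono L = c *s ax (UNIV :: 'n set)"
proof -
  have e: "mono L = mono L $ UNIV *s ax (UNIV :: 'n set)"
    using mono_degree[OF assms(1)] assms(2) by (intro ext_degree_top) simp
  have "mono L \<noteq> 0"
  proof
    assume z: "mono L = 0"
    obtain s where s: "s \<noteq> 0" "mono L \<star> ext_rev (mono L) = s *s ext_one" using mono_inverse by blast
    have "pr0 (mono L \<star> ext_rev (mono L)) = 0" by (simp add: z cm_simps pr0_simps)
    then show False using s by (simp add: pr0_simps)
  qed
  then have "mono L $ UNIV \<noteq> 0" using e by (metis vec.scale_zero_left)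
  then show ?thesis using e that by blast
qed

text \<open>Moving the full monomial past one vector costs (-1)^(n-1); past an even number of
  vectors the signs cancel.\<close>

lemma top_commute:
  assumes a: "a \<in> ext_even" shows "a \<star> ax UNIV = ax (UNIV :: 'n set) \<star> a"
proof -
  obtain L :: "'n list" where L: "distinct L" "length L = CARD('n)" using full_list by metis
  obtain c where c: "c \<noteq> 0" "mono L = c *s ax (UNIV :: 'n set)" using mono_top[OF L] .
  have m: "mono L' \<star> mono L = ((-1) ^ (CARD('n) - 1)) ^ length L' *s (mono L \<star> mono L')" for L' :: "'n list"
  proof (induction L')
    case (Cons i L')
    have "mono (i # L') \<star> mono L = ext_vec (ob i) \<star> (mono L' \<star> mono L)" by (simp add: cmul_assoc)
    also have "\<dots> = ((-1) ^ (CARD('n) - 1)) ^ length L' *s (ext_vec (ob i) \<star> mono L \<star> mono L')"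
      by (simp add: Cons.IH cm_simps cmul_assoc)
    also have "\<dots> = ((-1) ^ (CARD('n) - 1)) ^ length (i # L') *s (mono L \<star> mono (i # L'))"
      unfolding mono_full_commute[OF L] by (simp add: cm_simps cmul_assoc mult.commute)
    finally show ?case .
  qed (simp add: cmul_one_left cmul_one_right)
  have "a \<star> mono L = mono L \<star> a"
  proof (rule vec.span_induct[OF even_span[OF a]])
    show "vec.subspace {a. a \<star> mono L = mono L \<star> a}" by (auto simp: vec.subspace_def cm_simps)
    fix w assume "w \<in> {mono L | L. distinct L \<and> even (length L)}"
    then obtain L' where L': "w = mono L'" "even (length L')" by blast
    have "((-1) ^ (CARD('n) - 1)) ^ length L' = (1 :: complex)"
      using L'(2) by (simp add: power_mult[symmetric])
    then show "w \<star> mono L = mono L \<star> w" using m[of L'] L'(1) by simp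
  qed
  then have "c *s (a \<star> ax UNIV) = c *s (ax (UNIV :: 'n set) \<star> a)" by (simp add: c cm_simps)
  then show ?thesis using c(1) by (simp only: vec.scale_cancel_left) simp
qed

text \<open>The volume element commutes with the even element g, but conjugation by g multiplies it
  by the determinant.\<close>

lemma spin_T_det: assumes g: "g \<in> Spin B" shows "det (spin_T B g) = 1"
proof -
  have e: "g \<in> ext_even" "g \<star> ext_rev g = ext_one" using g by (auto simp: Spin_iff)
  have "ax (UNIV :: 'n set) \<star> g = det (spin_T B g) *s (ax (UNIV :: 'n set) \<star> g)"
    using twists_ext_map[OF Spin_twists[OF g] spin_T_B[OF g], of "ax UNIV"] top_commute[OF e(1)]
    by (simp add: ext_map_det cm_simps)
  then have "ax (UNIV :: 'n set) \<star> g \<star> ext_rev g = (det (spin_T B g) *s (ax (UNIV :: 'n set) \<star> g)) \<star> ext_rev g" by simp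
  then have "ax (UNIV :: 'n set) = det (spin_T B g) *s (ax UNIV :: 'n ext)"
    by (simp add: cmul_assoc e cmul_one_right cm_simps)
  from arg_cong[OF this, of "\<lambda>u. u $ UNIV"] show ?thesis by (simp add: ax_nth)
qed

lemma spin_T_SO: "g \<in> Spin B \<Longrightarrow> spin_T B g \<in> SO B"
  by (simp add: SO_def spin_T_B spin_T_det)

lemma even_centralizer: assumes a: "a \<in> ext_even" shows "a \<in> centralizer_Z B"
proof -
  have "a \<star> (z0 + z1) = (z0 + z1) \<star> a" if "z0 \<in> ext_degree 0" "z1 \<in> ext_degree CARD('n)" for z0 z1
  proof -
    have "z0 = pr0 z0 *s ext_one" using that(1) by (simp add: ext_degree_0)
    moreover have "z1 = z1 $ UNIV *s ax UNIV" by (rule ext_degree_top[OF that(2)])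
    ultimately show ?thesis using top_commute[OF a]
      by (metis cm_simps(1,2,7,8) cmul_one_left cmul_one_right)
  qed
  then show ?thesis by (simp add: centralizer_Z_def)
qed

lemma mat_invertible: "det (M :: complex^'m^'m) \<noteq> 0 \<Longrightarrow> M ** matrix_inv M = mat 1 \<and> matrix_inv M ** M = mat 1"
  unfolding invertible_det_nz[symmetric] invertible_def matrix_inv_def by (rule someI_ex)

text \<open>The substitution x = (1 + b) p removes the inverse: Gamma(b) x = (1 - b) p. Skewness
  then follows from b being an isometry, and 1 + Gamma(b), 1 - Gamma(b) send x to 2 p and 2 b p,
  which shows that their kernels are trivial.\<close>

lemma cayley_Lie:
  assumes b: "b \<in> SO_star B" shows "cayley b \<in> Lie_SO_star B"
proof -
  have d: "det (mat 1 + b) \<noteq> 0" and O: "B (b *v x) (b *v y) = B x y" and d1: "det b = 1" for x y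
    using b by (auto simp: SO_star_def SO_def)
  define c where "c = matrix_inv (mat 1 + b)"
  have c: "(mat 1 + b) ** c = mat 1" "c ** (mat 1 + b) = mat 1" using mat_invertible[OF d] by (auto simp: c_def)
  have cay: "cayley b = (mat 1 - b) ** c" by (simp add: cayley_def c_def)
  have cx: "x = c *v x + b *v (c *v x)" for x
    using arg_cong[OF c(1), of "\<lambda>M. M *v x"] by (simp add: matrix_vector_mul_assoc[symmetric] matrix_vector_mult_add_rdistrib)
  have sx: "cayley b *v x = c *v x - b *v (c *v x)" for x
    by (simp add: cay matrix_vector_mul_assoc[symmetric] matrix_vector_mult_diff_rdistrib)
  have "B (cayley b *v x) y + B x (cayley b *v y) = 0" for x y
  proof -
    define p q where "p = c *v x" and "q = c *v y"
    have x: "x = p + b *v p" and y: "y = q + b *v q" using cx[of x] cx[of y] by (auto simp: p_def q_def)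
    have s: "cayley b *v x = p - b *v p" "cayley b *v y = q - b *v q" by (auto simp: sx p_def q_def)
    have "B (cayley b *v x) y + B x (cayley b *v y) = B (p - b *v p) (q + b *v q) + B (p + b *v p) (q - b *v q)"
      unfolding s x[symmetric] y[symmetric] ..
    then show ?thesis by (simp add: B_simps O)
  qed
  moreover have "invertible (mat 1 + cayley b)"
  proof -
    have "y = 0" if "(mat 1 + cayley b) *v y = 0" for y
    proof -
      have "c *v y + b *v (c *v y) + (c *v y - b *v (c *v y)) = 0"
        using that cx[of y] sx[of y] by (simp add: matrix_vector_mult_add_rdistrib)
      then have "2 *s (c *v y) = 2 *s 0" by (simp add: vec_eq_iff)
      then show ?thesis using cx[of y] by (simp only: vec_two_cancel) simp
    qed
    then show ?thesis using matrix_left_invertible_ker[of "mat 1 + cayley b"] by (auto simp: invertible_left_inverse)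
  qed
  moreover have "invertible (mat 1 - cayley b)"
  proof -
    have "y = 0" if "(mat 1 - cayley b) *v y = 0" for y
    proof -
      have "(c *v y + b *v (c *v y)) - (c *v y - b *v (c *v y)) = 0"
        using that cx[of y] sx[of y] by (simp add: matrix_vector_mult_diff_rdistrib)
      then have "2 *s (b *v (c *v y)) = 2 *s 0" by (simp add: vec_eq_iff)
      then have z: "b *v (c *v y) = 0" by (simp only: vec_two_cancel)
      have "c *v y = 0" by (rule nondeg) (metis O z B_left(5))
      then show ?thesis using cx[of y] z by simp
    qed
    then show ?thesis using matrix_left_invertible_ker[of "mat 1 - cayley b"] by (auto simp: invertible_left_inverse)
  qed
  ultimately show ?thesis unfolding Lie_SO_star_def Lie_SO_def by blast
qed

lemma spin_cayley:
  assumes g: "g \<in> Spin B" and d: "det (mat 1 + spin_T B g) \<noteq> 0"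
  shows "pr2 g = (-2 * pr0 g) *s the_inv_into (ext_degree 2) (tau B) (cayley (spin_T B g))"
proof -
  let ?b = "spin_T B g"
  define c where "c = matrix_inv (mat 1 + ?b)"
  have c: "(mat 1 + ?b) ** c = mat 1" using mat_invertible[OF d] by (auto simp: c_def)
  have b: "?b \<in> SO_star B" using spin_T_SO[OF g] d by (simp add: SO_star_def)
  define u where "u = the_inv_into (ext_degree 2) (tau B) (cayley ?b)"
  have L: "cayley ?b \<in> Lie_SO B" using cayley_Lie[OF b] by (simp add: Lie_SO_star_def)
  have u: "u \<in> ext_degree 2" "tau B u = cayley ?b" unfolding u_def
    using the_inv_into_into[OF tau_inj, of "cayley ?b" "ext_degree 2"] f_the_inv_into_f_bij_betw[OF tau_bij, of "cayley ?b"]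
      L tau_bij by (auto simp: bij_betw_def)
  have s: "(-2 * pr0 g) *s u \<in> ext_degree 2" by (rule vec.subspace_scale[OF ext_degree_subspace u(1)])
  have "tau B (pr2 g) *v y = tau B ((-2 * pr0 g) *s u) *v y" for y
  proof -
    define x where "x = c *v y"
    have y: "y = x + ?b *v x"
      using arg_cong[OF c, of "\<lambda>M. M *v y"] by (simp add: x_def matrix_vector_mul_assoc[symmetric] matrix_vector_mult_add_rdistrib)
    have "tau B (pr2 g) *v y = (-2 * pr0 g) *s (x - ?b *v x)"
      unfolding y by (rule twists_cayley[OF Spin_twists[OF g]])
    also have "x - ?b *v x = cayley ?b *v y"
      by (simp add: cayley_def x_def c_def matrix_vector_mul_assoc[symmetric] matrix_vector_mult_diff_rdistrib)
    also have "(-2 * pr0 g) *s (cayley ?b *v y) = tau B ((-2 * pr0 g) *s u) *v y"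
      unfolding u(2)[symmetric] tau_mult[OF degree2_even[OF u(1)]] tau_mult[OF degree2_even[OF s]] iota_simps clin_rules[OF clin_ext_to_vec]
      by (simp only: vec.scale_scale mult.commute)
    finally show ?thesis .
  qed
  then have "tau B (pr2 g) = tau B ((-2 * pr0 g) *s u)" by (simp add: matrix_eq)
  then show ?thesis using tau_inj pr2_degree s unfolding u_def[symmetric] by (meson inj_onD)
qed

end

section \<open>The trace of the spin module\<close>

context nondeg_form
begin

text \<open>The right side involves only the degree 2 part of g, which is why pairing g with
  bivectors sees \<open>pr2 g\<close> alone (\<open>pr0_pr2\<close>).\<close>

lemma pr0_even_bivector:
  assumes "g \<in> ext_even"
  shows "pr0 (g \<star> eps x (ext_vec z)) = - B z (ext_to_vec (iota B x g))"
proof -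
  have "ext_vec x \<star> ext_vec z = eps x (ext_vec z) + B x z *s ext_one"
    by (simp add: vec_left) (simp add: eps_one[symmetric] iota_eps eps_simps)
  then have e: "eps x (ext_vec z) = ext_vec x \<star> ext_vec z - B x z *s ext_one" by simp
  have "pr0 (g \<star> ext_vec x \<star> ext_vec z) = B z (ext_to_vec (g \<star> ext_vec x))"
    unfolding pr0_vec_right by (simp add: cmul_vec pr0_gam)
  also have "\<dots> = B z (ext_to_vec (eps x g - iota B x g))" by (simp only: even_vec_right[OF assms])
  finally have "pr0 (g \<star> (ext_vec x \<star> ext_vec z)) = pr0 g * B z x - B z (ext_to_vec (iota B x g))"
    by (simp only: cmul_assoc clin_rules[OF clin_ext_to_vec] ext_to_vec_eps B_right)
  then show ?thesis unfolding e by (simp add: cm_simps pr0_simps cmul_one_right sym_B[of z x])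
qed

lemma degree2_expand:
  assumes "y \<in> ext_degree 2"
  shows "2 *s y = (\<Sum>i\<in>UNIV. eps (ax i) (ext_vec (ext_to_vec (iota B (dvec i) y))))"
proof -
  have "ext_vec (ext_to_vec (iota B (dvec i) y)) = iota B (dvec i) y" for i
    using iota_degree[of y 1] assms by (intro ext_vec_to_vec) (simp add: numeral_2_eq_2)
  then have "(\<Sum>i\<in>UNIV. eps (ax i) (ext_vec (ext_to_vec (iota B (dvec i) y)))) = (\<Sum>i\<in>UNIV. eps (ax i) (iota B (dvec i) y))"
    by simp
  moreover have "(\<Sum>i\<in>UNIV. eps (ax i) (iota B (dvec i) y)) $ K = (2 *s y) $ K" for K
    unfolding euler using assms by (cases "card K = 2") (auto simp: ext_degree_def)
  ultimately show ?thesis by (simp add: vec_eq_iff)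
qed

lemma pr0_pr2:
  assumes g: "g \<in> ext_even" and y: "y \<in> ext_degree 2"
  shows "pr0 (g \<star> y) = pr0 (pr2 g \<star> y)"
proof -
  have "2 * pr0 (g \<star> y) = pr0 (g \<star> (2 *s y))" by (simp add: cm_simps pr0_simps)
  also have "\<dots> = pr0 (pr2 g \<star> (2 *s y))"
    unfolding degree2_expand[OF y] cm_simps pr0_simps
    by (rule sum.cong[OF refl])
      (simp only: pr0_even_bivector[OF g] pr0_even_bivector[OF degree2_even[OF pr2_degree]] ext_to_vec_iota_pr2[of B _ g])
  also have "\<dots> = 2 * pr0 (pr2 g \<star> y)" by (simp add: cm_simps pr0_simps)
  finally show ?thesis by simp
qed

lemma degree2_nondeg:
  assumes u: "u \<in> ext_degree 2" and z: "\<And>y. y \<in> ext_degree 2 \<Longrightarrow> pr0 (u \<star> y) = 0"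
  shows "u = 0"
proof (rule degree2_zero[OF u])
  fix x
  have "B (ext_to_vec (iota B x u)) z = 0" for z
  proof -
    have "eps x (ext_vec z) \<in> ext_degree 2" using eps_degree[OF ext_vec_degree] by (simp add: numeral_2_eq_2)
    from assms(2)[OF this] show ?thesis
      by (simp add: pr0_even_bivector[OF degree2_even[OF u]] sym_B[of z])
  qed
  then have "ext_to_vec (iota B x u) = 0" by (rule nondeg)
  moreover have "iota B x u \<in> ext_degree 1" using iota_degree[of u 1 B x] u by (simp add: numeral_2_eq_2)
  ultimately show "iota B x u = 0" using ext_vec_to_vec clin_0[OF ext_vec_clin] by metis
qed

text \<open>For even \<open>n\<close>, write \<open>J = i e\<^sub>a e\<^sub>b\<close>, an involution. The product \<open>cpx\<close> of the \<open>J\<close>'s over disjoint pairs is a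
  normalized volume element, and \<open>prj\<close> is a primitive idempotent of the even Clifford algebra.\<close>

fun cpx :: "'n list \<Rightarrow> 'n ext" where
  "cpx (a # b # L) = (\<i> *s (ext_vec (ob a) \<star> ext_vec (ob b))) \<star> cpx L"
| "cpx L = ext_one"

fun prj :: "complex \<Rightarrow> 'n list \<Rightarrow> 'n ext" where
  "prj s (a # b # L) = ((1/2) *s (ext_one + s *s (\<i> *s (ext_vec (ob a) \<star> ext_vec (ob b))))) \<star> prj 1 L"
| "prj s L = ext_one"

lemma ob_anti': "i \<noteq> j \<Longrightarrow> ext_vec (ob i) \<star> ext_vec (ob j) = - (ext_vec (ob j) \<star> ext_vec (ob i))"
  using gam_polar_vec[of "ob i" "ob j"] by (simp add: ob)

lemma ob_pair_commute:
  assumes "c \<noteq> a" "c \<noteq> b"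
  shows "ext_vec (ob c) \<star> (ext_vec (ob a) \<star> ext_vec (ob b)) = (ext_vec (ob a) \<star> ext_vec (ob b)) \<star> ext_vec (ob c)"
  by (simp add: ob_anti[OF assms(1)] ob_anti'[OF assms(2)] cmul_assoc cm_simps)

lemma commute_mult: "c \<star> u = u \<star> c \<Longrightarrow> c \<star> v = v \<star> c \<Longrightarrow> c \<star> (u \<star> v) = (u \<star> v) \<star> c"
  by (metis cmul_assoc)

lemma cpx_commute: "c \<notin> set L \<Longrightarrow> ext_vec (ob c) \<star> cpx L = cpx L \<star> ext_vec (ob c)"
proof (induction L rule: cpx.induct)
  case (1 a b L)
  have "ext_vec (ob c) \<star> (\<i> *s (ext_vec (ob a) \<star> ext_vec (ob b))) = (\<i> *s (ext_vec (ob a) \<star> ext_vec (ob b))) \<star> ext_vec (ob c)"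
    using 1 ob_pair_commute[of c a b] by (simp add: cm_simps)
  then show ?case using 1 by (simp only: cpx.simps) (rule commute_mult, simp_all)
qed (simp_all add: cmul_one_left cmul_one_right)

lemma prj_commute: "c \<notin> set L \<Longrightarrow> ext_vec (ob c) \<star> prj s L = prj s L \<star> ext_vec (ob c)"
proof (induction s L rule: prj.induct)
  case (1 s a b L)
  have "ext_vec (ob c) \<star> ((1/2) *s (ext_one + s *s (\<i> *s (ext_vec (ob a) \<star> ext_vec (ob b))))) =
     ((1/2) *s (ext_one + s *s (\<i> *s (ext_vec (ob a) \<star> ext_vec (ob b))))) \<star> ext_vec (ob c)"
    using 1 ob_pair_commute[of c a b] by (simp add: cm_simps cmul_one_left cmul_one_right)
  then show ?case using 1 by (simp only: prj.simps) (rule commute_mult, simp_all)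
qed (simp_all add: cmul_one_left cmul_one_right)

lemma pair_commute:
  assumes "ext_vec (ob a) \<star> u = u \<star> ext_vec (ob a)" "ext_vec (ob b) \<star> u = u \<star> ext_vec (ob b)"
  shows "(\<i> *s (ext_vec (ob a) \<star> ext_vec (ob b))) \<star> u = u \<star> (\<i> *s (ext_vec (ob a) \<star> ext_vec (ob b)))"
    "((1/2) *s (ext_one + s *s (\<i> *s (ext_vec (ob a) \<star> ext_vec (ob b))))) \<star> u =
     u \<star> ((1/2) *s (ext_one + s *s (\<i> *s (ext_vec (ob a) \<star> ext_vec (ob b)))))"
proof -
  have "ext_vec (ob a) \<star> ext_vec (ob b) \<star> u = u \<star> (ext_vec (ob a) \<star> ext_vec (ob b))"
    by (metis assms cmul_assoc)
  then show "(\<i> *s (ext_vec (ob a) \<star> ext_vec (ob b))) \<star> u = u \<star> (\<i> *s (ext_vec (ob a) \<star> ext_vec (ob b)))"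
    "((1/2) *s (ext_one + s *s (\<i> *s (ext_vec (ob a) \<star> ext_vec (ob b))))) \<star> u =
     u \<star> ((1/2) *s (ext_one + s *s (\<i> *s (ext_vec (ob a) \<star> ext_vec (ob b)))))"
    by (simp_all only: cm_simps cmul_one_left cmul_one_right)
qed

lemma pair_sq:
  assumes "a \<noteq> b"
  shows "(\<i> *s (ext_vec (ob a) \<star> ext_vec (ob b))) \<star> (\<i> *s (ext_vec (ob a) \<star> ext_vec (ob b))) = ext_one"
proof -
  have "ext_vec (ob a) \<star> ext_vec (ob b) \<star> (ext_vec (ob a) \<star> ext_vec (ob b)) = - ext_one"
    using ob_sq[of b ext_one] ob_sq[of a ext_one]
    by (simp add: cmul_assoc ob_anti[OF assms[symmetric]] cm_simps ob_sq cmul_one_right)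
  then show ?thesis by (simp add: cm_simps)
qed

lemma pair_idem:
  assumes "j \<star> j = ext_one" "s * s = 1"
  shows "((1/2) *s (ext_one + s *s j)) \<star> ((1/2) *s (ext_one + s *s j)) = (1/2) *s (ext_one + s *s j)"
    "j \<star> ((1/2) *s (ext_one + s *s j)) = s *s ((1/2) *s (ext_one + s *s j))"
proof -
  have ss: "s *s (s *s u) = u" for u :: "'n ext" using assms by simp
  have "(ext_one + s *s j) \<star> (ext_one + s *s j) = 2 *s (ext_one + s *s j)"
    by (simp only: cm_simps cmul_one_left cmul_one_right assms(1) vec.scale_scale assms(2) vec.scale_one vec.scale_right_distrib) (simp add: vec_eq_iff)
  then show "((1/2) *s (ext_one + s *s j)) \<star> ((1/2) *s (ext_one + s *s j)) = (1/2) *s (ext_one + s *s j)"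
    unfolding clin_scale[OF clin_cmul] clin_scale[OF clin_cmul_left] by simp
  have "j \<star> (ext_one + s *s j) = s *s (ext_one + s *s j)"
    by (simp only: cm_simps cmul_one_left cmul_one_right assms(1) ss vec.scale_right_distrib add.commute)
  then show "j \<star> ((1/2) *s (ext_one + s *s j)) = s *s ((1/2) *s (ext_one + s *s j))"
    unfolding clin_scale[OF clin_cmul] by simp
qed

lemma cpx_sq: "distinct L \<Longrightarrow> cpx L \<star> cpx L = ext_one"
proof (induction L rule: cpx.induct)
  case (1 a b L)
  let ?j = "\<i> *s (ext_vec (ob a) \<star> ext_vec (ob b))"
  have c: "?j \<star> cpx L = cpx L \<star> ?j" using 1 by (intro pair_commute(1) cpx_commute) auto
  have "cpx (a # b # L) \<star> cpx (a # b # L) = ?j \<star> (cpx L \<star> ?j) \<star> cpx L" by (simp only: cpx.simps cmul_assoc)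
  also have "\<dots> = (?j \<star> ?j) \<star> (cpx L \<star> cpx L)" unfolding c[symmetric] by (simp only: cmul_assoc)
  finally show ?case using 1 pair_sq[of a b] by (simp add: cmul_one_left)
qed (simp_all add: cmul_one_left)

lemma prj_idem: "distinct L \<Longrightarrow> s * s = 1 \<Longrightarrow> prj s L \<star> prj s L = prj s L"
proof (induction s L rule: prj.induct)
  case (1 s a b L)
  let ?q = "(1/2) *s (ext_one + s *s (\<i> *s (ext_vec (ob a) \<star> ext_vec (ob b))))"
  have c: "?q \<star> prj 1 L = prj 1 L \<star> ?q" using 1 by (intro pair_commute(2) prj_commute) auto
  have q: "?q \<star> ?q = ?q" using 1 by (intro pair_idem(1) pair_sq) auto
  have IH: "prj 1 L \<star> prj 1 L = prj 1 L" using 1 by simp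
  have "prj s (a # b # L) \<star> prj s (a # b # L) = ?q \<star> (prj 1 L \<star> ?q) \<star> prj 1 L" by (simp only: prj.simps cmul_assoc)
  also have "\<dots> = (?q \<star> ?q) \<star> (prj 1 L \<star> prj 1 L)" unfolding c[symmetric] by (simp only: cmul_assoc)
  finally show ?case by (simp only: q IH prj.simps)
qed (simp_all add: cmul_one_left)

text \<open>The sign sits in the first factor of \<open>prj\<close> only, so s is the eigenvalue of
  the whole product \<open>cpx L\<close> and selects one of the two simple ideals.\<close>

lemma cpx_prj: "distinct L \<Longrightarrow> even (length L) \<Longrightarrow> s * s = 1 \<Longrightarrow> (L = [] \<Longrightarrow> s = 1) \<Longrightarrow> cpx L \<star> prj s L = s *s prj s L"
proof (induction s L rule: prj.induct)
  case (1 s a b L)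
  let ?j = "\<i> *s (ext_vec (ob a) \<star> ext_vec (ob b))"
  let ?q = "(1/2) *s (ext_one + s *s ?j)"
  have c: "?q \<star> cpx L = cpx L \<star> ?q" using 1 by (intro pair_commute(2) cpx_commute) auto
  have q: "?j \<star> ?q = s *s ?q" using 1 by (intro pair_idem(2) pair_sq) auto
  have IH: "cpx L \<star> prj 1 L = prj 1 L" using 1 by simp
  have "cpx (a # b # L) \<star> prj s (a # b # L) = ?j \<star> (cpx L \<star> ?q) \<star> prj 1 L" by (simp only: prj.simps cpx.simps cmul_assoc)
  also have "\<dots> = (?j \<star> ?q) \<star> (cpx L \<star> prj 1 L)" unfolding c[symmetric] by (simp only: cmul_assoc)
  also have "\<dots> = s *s prj s (a # b # L)" unfolding q IH by (simp only: cm_simps prj.simps)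
  finally show ?case .
qed (simp_all add: cmul_one_left)

lemma prj_even: "prj s L \<in> ext_even"
proof (induction s L rule: prj.induct)
  case (1 s a b L)
  then show ?case unfolding prj.simps
    by (intro even_cm vec.subspace_scale[OF ext_even_subspace] vec.subspace_add[OF ext_even_subspace] even_one vec_vec_even)
qed (simp_all add: even_one)

text \<open>Anticommutation and cyclicity kill each term that contains a pair e_a e_b, so every pair
  contributes just the factor 1/2.\<close>

lemma pr0_prj: "distinct L \<Longrightarrow> pr0 (prj s L) = (1/2) ^ (length L div 2)"
proof (induction s L rule: prj.induct)
  case (1 s a b L)
  let ?a = "ext_vec (ob a)" and ?b = "ext_vec (ob b)"
  have c: "?a \<star> prj 1 L = prj 1 L \<star> ?a" "?b \<star> prj 1 L = prj 1 L \<star> ?b" using 1 by (auto intro: prj_commute)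
  have "pr0 (?a \<star> (?b \<star> prj 1 L)) = pr0 (?b \<star> prj 1 L \<star> ?a)" by (rule pr0_cyclic)
  also have "\<dots> = pr0 (?b \<star> ?a \<star> prj 1 L)" unfolding cmul_assoc c(1) ..
  also have "\<dots> = pr0 (- (?a \<star> ?b) \<star> prj 1 L)" using ob_anti'[of b a] 1 by auto
  finally have "pr0 (?a \<star> ?b \<star> prj 1 L) = 0" by (simp add: cm_simps pr0_simps cmul_assoc)
  then show ?case using 1 by (simp add: cm_simps pr0_simps cmul_one_left)
qed (simp_all add: pr0_simps)

lemma cpx_mono: "even (length L) \<Longrightarrow> cpx L = \<i> ^ (length L div 2) *s mono L"
proof (induction L rule: cpx.induct)
  case (1 a b L)
  then have "cpx L = \<i> ^ (length L div 2) *s mono L" by simp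
  moreover have "length (a # b # L) div 2 = Suc (length L div 2)" by simp
  ultimately show ?case by (simp only: cpx.simps mono_simps cm_simps vec.scale_scale power_Suc cmul_assoc mult.commute)
qed simp_all

lemma cpx_even: "cpx L \<in> ext_even"
proof (induction L rule: cpx.induct)
  case (1 a b L)
  then show ?case unfolding cpx.simps
    by (intro even_cm vec.subspace_scale[OF ext_even_subspace] vec_vec_even)
qed (simp_all add: even_one)

end

section \<open>The character of the spin module\<close>

locale spin_rep = nondeg_form B for B :: "'n::{finite,linorder} form" +
  fixes \<mu> :: "'n ext" and \<sigma> :: "'n ext \<Rightarrow> complex^'s::finite \<Rightarrow> complex^'s"
  assumes \<mu>: "\<mu> \<in> ext_degree CARD('n)" "cmul B \<mu> \<mu> = ext_one"
    and \<sigma>: "spin_module B \<mu> \<sigma>"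
begin

definition chr :: "'n ext \<Rightarrow> complex" where "chr a = trace (matrix (\<sigma> a))"

lemma \<sigma>_clin: "a \<in> ext_even \<Longrightarrow> clin (\<sigma> a)"
  using \<sigma> even_centralizer unfolding spin_module_def by blast

lemma \<sigma>_add: "a \<in> ext_even \<Longrightarrow> b \<in> ext_even \<Longrightarrow> \<sigma> (a + b) x = \<sigma> a x + \<sigma> b x"
  using \<sigma> even_centralizer unfolding spin_module_def by blast

lemma \<sigma>_mult: "a \<in> ext_even \<Longrightarrow> b \<in> ext_even \<Longrightarrow> \<sigma> (a \<star> b) x = \<sigma> a (\<sigma> b x)"
  using \<sigma> even_centralizer unfolding spin_module_def by blast

lemma \<sigma>_scale: "a \<in> ext_even \<Longrightarrow> \<sigma> (c *s a) x = c *s \<sigma> a x"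
  using \<sigma> even_centralizer unfolding spin_module_def by blast

lemma \<sigma>_one: "\<sigma> ext_one x = x"
  using \<sigma> unfolding spin_module_def by blast

lemma card_s: "CARD('s) = 2 ^ ((CARD('n) + 1) div 2)"
  using \<sigma> unfolding spin_module_def by blast

lemma matrix_\<sigma>_mult: "a \<in> ext_even \<Longrightarrow> b \<in> ext_even \<Longrightarrow> matrix (\<sigma> (a \<star> b)) = matrix (\<sigma> a) ** matrix (\<sigma> b)"
proof -
  assume a: "a \<in> ext_even" and b: "b \<in> ext_even"
  have "\<sigma> (a \<star> b) = \<sigma> a \<circ> \<sigma> b" by (rule ext) (simp add: \<sigma>_mult[OF a b])
  then show ?thesis using matrix_compose_gen[OF \<sigma>_clin[OF b] \<sigma>_clin[OF a]] by simp
qed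

lemma chr_add: "a \<in> ext_even \<Longrightarrow> b \<in> ext_even \<Longrightarrow> chr (a + b) = chr a + chr b"
  by (simp add: chr_def trace_def matrix_def \<sigma>_add sum.distrib)

lemma chr_scale: "a \<in> ext_even \<Longrightarrow> chr (c *s a) = c * chr a"
  by (simp add: chr_def trace_def matrix_def \<sigma>_scale sum_distrib_left)

lemma chr_tracial: "a \<in> ext_even \<Longrightarrow> b \<in> ext_even \<Longrightarrow> chr (a \<star> b) = chr (b \<star> a)"
  unfolding chr_def by (simp only: matrix_\<sigma>_mult) (rule trace_mul_sym)

lemma chr_one: "chr ext_one = 2 ^ ((CARD('n) + 1) div 2)"
proof -
  have "\<sigma> ext_one = id" by (rule ext) (simp add: \<sigma>_one)
  then show ?thesis by (simp add: chr_def matrix_id_mat_1 trace_I card_s)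
qed

lemma chr_idempotent:
  assumes a: "a \<in> ext_even" "a \<star> a = a"
  shows "\<exists>k::nat. chr a = of_nat k \<and> (matrix (\<sigma> a) \<noteq> 0 \<longrightarrow> k > 0)"
  unfolding chr_def using assms matrix_\<sigma>_mult[OF a(1) a(1)] by (intro idempotent_trace) simp

text \<open>The normalized volume element w is central in the even algebra, so a trace there has two
  parameters, its values at 1 and at w. On the primitive idempotents \<open>prj 1 L\<close> and
  \<open>prj (-1) L\<close> the character takes the values 1 + z and 1 - z, natural numbers with sum
  2, so z is -1, 0 or 1. The values -1 and 1 would make e_+ or e_- act as zero, but both images are
  irreducible modules and hence nonzero.\<close>

lemma spin_trace_top:
  assumes L: "distinct L" "length L = CARD('n)" and n: "even CARD('n)"
  shows "chr (mono L) = 0"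
proof -
  define m where "m = CARD('n) div 2"
  have n2: "CARD('n) = 2 * m" using n by (simp add: m_def)
  have ne: "L \<noteq> []" using L by auto
  have eL: "even (length L)" using L n by simp
  define w where "w = cpx L"
  have ww: "w \<star> w = ext_one" unfolding w_def by (rule cpx_sq[OF L(1)])
  have we: "w \<in> ext_even" unfolding w_def by (rule cpx_even)
  have wm: "w = \<i> ^ m *s mono L" unfolding w_def cpx_mono[OF eL] by (simp add: m_def L)
  obtain c where c: "c \<noteq> 0" "mono L = c *s ax (UNIV :: 'n set)" using mono_top[OF L] .
  have wt: "w = (\<i> ^ m * c) *s ax UNIV" unfolding wm c by simp
  have scal: "\<exists>k. u = k *s w" if "u \<in> ext_degree CARD('n)" for u
  proof -
    have "u = (u $ UNIV / (\<i> ^ m * c)) *s w" using ext_degree_top[OF that] c(1) unfolding wt by simp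
    then show ?thesis ..
  qed
  have wc: "w \<star> a = a \<star> w" if "a \<in> ext_even" for a
    unfolding wt using top_commute[OF that] by (simp add: cm_simps)
  have pw: "pr0 w = 0" unfolding wm by (simp add: pr0_simps pr0_mono[OF L(1) ne])
  \<comment> \<open>Subtracting the trace \<open>pr0 (w a)\<close>, scaled to agree with
    \<open>chr\<close> at w, makes the value at the volume element vanish, which is the hypothesis
    \<open>top\<close> of \<open>even_trace\<close>.\<close>
  have dec: "chr a = pr0 a * 2 ^ m + pr0 (w \<star> a) * chr w" if a: "a \<in> ext_even" for a
  proof -
    have "chr a - pr0 (w \<star> a) * chr w = pr0 a * (chr ext_one - pr0 (w \<star> ext_one) * chr w)"
    proof (rule even_trace[of "\<lambda>a. chr a - pr0 (w \<star> a) * chr w", OF _ _ _ _ a])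
      fix a b :: "'n ext" and k assume ab: "a \<in> ext_even" "b \<in> ext_even"
      show "chr (a + b) - pr0 (w \<star> (a + b)) * chr w = chr a - pr0 (w \<star> a) * chr w + (chr b - pr0 (w \<star> b) * chr w)"
        using ab by (simp add: chr_add cm_simps pr0_simps algebra_simps)
      have "pr0 (w \<star> (a \<star> b)) = pr0 (b \<star> (w \<star> a))" by (metis cmul_assoc pr0_cyclic)
      also have "\<dots> = pr0 (w \<star> (b \<star> a))" by (metis cmul_assoc wc ab)
      finally show "chr (a \<star> b) - pr0 (w \<star> (a \<star> b)) * chr w = chr (b \<star> a) - pr0 (w \<star> (b \<star> a)) * chr w"
        using ab by (simp add: chr_tracial)
    next
      fix a :: "'n ext" and k assume "a \<in> ext_even"
      then show "chr (k *s a) - pr0 (w \<star> (k *s a)) * chr w = k * (chr a - pr0 (w \<star> a) * chr w)"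
        by (simp only: chr_scale cm_simps pr0_simps right_diff_distrib mult.assoc)
    next
      fix L' :: "'n list" assume L': "distinct L'" "length L' = CARD('n)"
      then obtain k where k: "mono L' = k *s w" using scal[of "mono L'"] mono_degree[of L'] by auto
      show "chr (mono L') - pr0 (w \<star> mono L') * chr w = 0"
        unfolding k by (simp add: chr_scale[OF we] cm_simps ww pr0_simps)
    qed
    then show ?thesis by (simp add: chr_one n2 cmul_one_right pw diff_eq_eq)
  qed
  \<comment> \<open>With this scaling the factor \<open>pr0 (prj s L) = (1/2)^m\<close> cancels and
    a primitive idempotent has trace 1 + s z.\<close>
  define z where "z = chr w / 2 ^ m"
  have pz: "chr (prj s L) = 1 + s * z" if s: "s * s = 1" for s
  proof -
    have "cpx L \<star> prj s L = s *s prj s L" by (rule cpx_prj[OF L(1) eL s]) (use ne in simp)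
    then have "pr0 (w \<star> prj s L) = s * pr0 (prj s L)"
      by (simp add: w_def pr0_simps)
    moreover have "pr0 (prj s L) = (1/2) ^ m" using pr0_prj[OF L(1)] by (simp add: L m_def)
    ultimately show ?thesis using dec[OF prj_even, of s L] by (simp add: z_def power_divide)
  qed
  obtain k1 where k1: "1 + z = of_nat k1" using chr_idempotent[OF prj_even prj_idem[OF L(1)], of 1] pz[of 1] by auto
  obtain k2 where k2: "1 - z = of_nat k2" using chr_idempotent[OF prj_even prj_idem[OF L(1)], of "-1"] pz[of "-1"] by auto
  have "of_nat (k1 + k2) = (of_nat 2 :: complex)" using k1 k2 by (simp flip: k1 k2)
  then have k12: "k1 + k2 = 2" by (simp only: of_nat_eq_iff)
  obtain k where k: "\<mu> = k *s w" using scal[OF \<mu>(1)] by blast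
  have "(k * k) *s ext_one = (ext_one :: 'n ext)" using \<mu>(2) unfolding k by (simp add: cm_simps ww)
  from arg_cong[OF this, of pr0] have kk: "k * k = 1" by (simp add: pr0_simps)
  \<comment> \<open>mu equals w or - w, so these numbers are the traces of e_+ and e_- divided by
    2^(m-1); the traces are positive because S_+ and S_- are nonzero.\<close>
  have e: "1 + t * k * z \<noteq> 0" if t: "t = 1 \<or> t = -1" for t
  proof -
    let ?e = "(1/2) *s (ext_one + (t * k) *s w)"
    have tk: "(t * k) * (t * k) = 1" using kk t by auto
    have ev: "?e \<in> ext_even"
      by (intro vec.subspace_scale[OF ext_even_subspace] vec.subspace_add[OF ext_even_subspace] even_one we)
    have "?e = (1/2) *s (ext_one + \<mu>) \<or> ?e = (1/2) *s (ext_one - \<mu>)" using t by (auto simp: k)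
    then have "irreducible_on (centralizer_Z B) \<sigma> (range (\<sigma> ?e))" using \<sigma> unfolding spin_module_def by metis
    then have r: "range (\<sigma> ?e) \<noteq> {0}" by (simp add: irreducible_on_def)
    have "matrix (\<sigma> ?e) \<noteq> 0"
    proof
      assume "matrix (\<sigma> ?e) = 0"
      then have "\<sigma> ?e x = 0" for x using matrix_works[OF \<sigma>_clin[OF ev], of x] by simp
      then show False using r by auto
    qed
    then obtain j :: nat where "chr ?e = of_nat j" "j > 0"
      using chr_idempotent[OF ev pair_idem(1)[OF ww tk]] by auto
    moreover have "chr ?e = (1/2) * (2 ^ m + t * k * chr w)"
    proof -
      have tw: "(t * k) *s w \<in> ext_even" by (rule vec.subspace_scale[OF ext_even_subspace we])
      have "chr ?e = (1/2) * chr (ext_one + (t * k) *s w)"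
        by (rule chr_scale) (intro vec.subspace_add[OF ext_even_subspace] even_one tw)
      also have "\<dots> = (1/2) * (chr ext_one + (t * k) * chr w)"
        unfolding chr_add[OF even_one tw] chr_scale[OF we] ..
      finally show ?thesis by (simp add: chr_one n2)
    qed
    moreover have "2 ^ m + t * k * chr w = 2 ^ m * (1 + t * k * z)" by (simp add: z_def distrib_left)
    ultimately show ?thesis by auto
  qed
  have kv: "k = 1 \<or> k = -1" using kk by (simp add: square_eq_1_iff)
  have "z = 0"
  proof (rule ccontr)
    assume "z \<noteq> 0"
    then have "k1 \<noteq> 1" using k1 by auto
    then have "k1 = 0 \<or> k1 = 2" using k12 by auto
    then have "z = -1 \<or> z = 1" using k1 by (auto simp: add_eq_0_iff)
    then show False using e[of 1] e[of "-1"] kv by auto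
  qed
  then have "chr w = 0" by (simp add: z_def)
  moreover have "chr w = \<i> ^ m * chr (mono L)"
    unfolding wm by (rule chr_scale) (simp add: ext_even_iff gr_inv_mono eL)
  ultimately show ?thesis by simp
qed

lemma spin_trace: "a \<in> ext_even \<Longrightarrow> chr a = pr0 a * 2 ^ ((CARD('n) + 1) div 2)"
  using even_trace[of chr a] by (simp add: chr_add chr_scale chr_tracial spin_trace_top chr_one)

lemma gen_cayley_eq:
  assumes g: "g \<in> ext_even" shows "gen_cayley \<sigma> g = pr2 g"
proof -
  have t: "trace (matrix (\<sigma> u \<circ> \<sigma> y)) = pr0 (u \<star> y) * 2 ^ ((CARD('n) + 1) div 2)"
    if "u \<in> ext_even" "y \<in> ext_degree 2" for u y
  proof -
    have y: "y \<in> ext_even" by (rule degree2_even[OF that(2)])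
    have "\<sigma> (u \<star> y) = \<sigma> u \<circ> \<sigma> y" by (rule ext) (simp add: \<sigma>_mult[OF that(1) y])
    then show ?thesis using spin_trace[OF even_cm[OF that(1) y]] by (simp add: chr_def)
  qed
  show ?thesis unfolding gen_cayley_def
  proof (rule the_equality)
    show "pr2 g \<in> ext_degree 2 \<and> (\<forall>y\<in>ext_degree 2. trace (matrix (\<sigma> (pr2 g) \<circ> \<sigma> y)) = trace (matrix (\<sigma> g \<circ> \<sigma> y)))"
      using t[OF g] t[OF degree2_even[OF pr2_degree]] pr0_pr2[OF g] pr2_degree by simp
  next
    fix u assume u: "u \<in> ext_degree 2 \<and> (\<forall>y\<in>ext_degree 2. trace (matrix (\<sigma> u \<circ> \<sigma> y)) = trace (matrix (\<sigma> g \<circ> \<sigma> y)))"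
    have "u - pr2 g = 0"
    proof (rule degree2_nondeg)
      show "u - pr2 g \<in> ext_degree 2" using u pr2_degree vec.subspace_diff[OF ext_degree_subspace] by blast
      fix y :: "'n ext" assume y: "y \<in> ext_degree 2"
      have "pr0 (u \<star> y) = pr0 (g \<star> y)" using u y t[OF g y] t[OF degree2_even y, of u] by simp
      then show "pr0 ((u - pr2 g) \<star> y) = 0" using pr0_pr2[OF g y] by (simp add: cm_simps pr0_simps)
    qed
    then show "u = pr2 g" by simp
  qed
qed

end

section \<open>Irreducibility of the spin group\<close>

lemma poly_fun_sum: "(\<And>i. i \<in> A \<Longrightarrow> poly_fun (f i)) \<Longrightarrow> poly_fun (\<lambda>x. \<Sum>i\<in>A. f i x)"
  by (induction A rule: infinite_finite_induct) (auto intro: poly_fun.intros)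

lemma poly_fun_power: "poly_fun f \<Longrightarrow> poly_fun (\<lambda>x. f x ^ k)"
  by (induction k) (auto intro: poly_fun.intros)

lemma poly_fun_diff: "poly_fun f \<Longrightarrow> poly_fun g \<Longrightarrow> poly_fun (\<lambda>x. f x - g x)"
  using poly_fun.add[of f "\<lambda>x. (-1) * g x"] poly_fun.mult[OF poly_fun.const[of "-1"]] by fastforce

definition poly_map :: "(complex^'m::finite \<Rightarrow> complex^'k::finite) \<Rightarrow> bool" where
  "poly_map \<phi> \<longleftrightarrow> (\<forall>i. poly_fun (\<lambda>x. \<phi> x $ i))"

lemma poly_fun_comp: "poly_fun f \<Longrightarrow> poly_map \<phi> \<Longrightarrow> poly_fun (\<lambda>x. f (\<phi> x))"
  by (induction rule: poly_fun.induct) (auto intro: poly_fun.intros simp: poly_map_def)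

lemma clin_nth: "clin F \<Longrightarrow> F x $ i = (\<Sum>j\<in>UNIV. x $ j * F (ax j) $ i)"
proof -
  assume F: "clin F"
  have "F x = F (\<Sum>j\<in>UNIV. x $ j *s ax j)" by (simp add: basis_expansion)
  then show ?thesis by (simp add: clin_rules[OF F])
qed

lemma poly_map_clin: "clin F \<Longrightarrow> poly_map \<phi> \<Longrightarrow> poly_map (\<lambda>x. F (\<phi> x))"
  unfolding poly_map_def by (subst clin_nth) (auto intro!: poly_fun_sum poly_fun.mult poly_fun.const)

lemma poly_map_id: "poly_map (\<lambda>x. x)" by (simp add: poly_map_def poly_fun.coord)

lemma poly_map_scale: "poly_fun f \<Longrightarrow> poly_map \<phi> \<Longrightarrow> poly_map (\<lambda>x. f x *s \<phi> x)"
  by (simp add: poly_map_def poly_fun.mult)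

lemma poly_map_sum: "(\<And>i. i \<in> A \<Longrightarrow> poly_map (f i)) \<Longrightarrow> poly_map (\<lambda>x. \<Sum>i\<in>A. f i x)"
  by (simp add: poly_map_def poly_fun_sum)

section \<open>Entire curves and irreducible sets\<close>

definition holo_curve :: "(complex \<Rightarrow> complex^'m) \<Rightarrow> bool" where
  "holo_curve \<gamma> \<longleftrightarrow> (\<forall>i. (\<lambda>t. \<gamma> t $ i) holomorphic_on UNIV)"

lemma holo_curve_poly: "poly_fun f \<Longrightarrow> holo_curve \<gamma> \<Longrightarrow> (\<lambda>t. f (\<gamma> t)) holomorphic_on UNIV"
  by (induction rule: poly_fun.induct) (auto intro!: holomorphic_intros simp: holo_curve_def)

lemma holo_curve_clin: "clin F \<Longrightarrow> holo_curve \<gamma> \<Longrightarrow> holo_curve (\<lambda>t. F (\<gamma> t))"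
  unfolding holo_curve_def by (subst clin_nth) (auto intro!: holomorphic_intros)

lemma holo_curve_add: "holo_curve \<gamma> \<Longrightarrow> holo_curve \<delta> \<Longrightarrow> holo_curve (\<lambda>t. \<gamma> t + \<delta> t)"
  by (auto simp: holo_curve_def intro!: holomorphic_intros)

lemma holo_curve_scale: "f holomorphic_on UNIV \<Longrightarrow> holo_curve (\<lambda>t. f t *s v)"
  by (auto simp: holo_curve_def intro!: holomorphic_intros)

text \<open>Irreducibility in the form needed for fields of fractions: the polynomial functions on Y
  have no zero divisors.\<close>

definition irred_set :: "(complex^'m::finite) set \<Rightarrow> bool" where
  "irred_set Y \<longleftrightarrow> (\<forall>f g. poly_fun f \<longrightarrow> poly_fun g \<longrightarrow> (\<forall>x\<in>Y. f x * g x = 0) \<longrightarrow> (\<forall>x\<in>Y. f x = 0) \<or> (\<forall>x\<in>Y. g x = 0))"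

lemma entire_mult_zero:
  assumes f: "f holomorphic_on UNIV" and g: "g holomorphic_on UNIV" and fg: "\<And>t. f t * g t = 0" and a: "f a \<noteq> 0"
  shows "g b = (0 :: complex)"
proof -
  have "continuous_on UNIV f" using f by (rule holomorphic_on_imp_continuous_on)
  then have "open (f -` (- {0}))" by (intro open_vimage) auto
  then show ?thesis
    using analytic_continuation_open[of "f -` (- {0})" UNIV g "\<lambda>_. 0" b] a g fg by force
qed

text \<open>If f(a) and g(b) were nonzero, a curve through a and b would carry two entire functions,
  neither of them zero, with product zero.\<close>

lemma irred_curves:
  assumes "\<And>a b. a \<in> Y \<Longrightarrow> b \<in> Y \<Longrightarrow> \<exists>\<gamma>. holo_curve \<gamma> \<and> range \<gamma> \<subseteq> Y \<and> \<gamma> 0 = a \<and> \<gamma> 1 = b"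
  shows "irred_set Y"
  unfolding irred_set_def
proof (intro allI impI)
  fix f g assume f: "poly_fun f" and g: "poly_fun g" and fg: "\<forall>x\<in>Y. f x * g x = 0"
  show "(\<forall>x\<in>Y. f x = 0) \<or> (\<forall>x\<in>Y. g x = 0)"
  proof (rule disjCI, rule ballI)
    fix a assume a: "a \<in> Y" and "\<not> (\<forall>x\<in>Y. g x = 0)"
    then obtain b where b: "b \<in> Y" "g b \<noteq> 0" by blast
    obtain \<gamma> where \<gamma>: "holo_curve \<gamma>" "range \<gamma> \<subseteq> Y" "\<gamma> 0 = a" "\<gamma> 1 = b" using assms[OF a b(1)] by blast
    have "f (\<gamma> 0) = 0"
      using entire_mult_zero[OF holo_curve_poly[OF g \<gamma>(1)] holo_curve_poly[OF f \<gamma>(1)], of 1 0] fg \<gamma> b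
      by (auto simp: mult.commute)
    then show "f a = 0" using \<gamma> by simp
  qed
qed

lemma irred_subspace:
  assumes "vec.subspace Y" shows "irred_set Y"
proof (rule irred_curves)
  fix a b assume ab: "a \<in> Y" "b \<in> Y"
  let ?\<gamma> = "\<lambda>t. a + t *s (b - a)"
  have "holo_curve ?\<gamma>" by (auto simp: holo_curve_def intro!: holomorphic_intros)
  moreover have "range ?\<gamma> \<subseteq> Y"
    using ab vec.subspace_add[OF assms] vec.subspace_scale[OF assms] vec.subspace_diff[OF assms] by blast
  ultimately show "\<exists>\<gamma>. holo_curve \<gamma> \<and> range \<gamma> \<subseteq> Y \<and> \<gamma> 0 = a \<and> \<gamma> 1 = b"
    by (intro exI[of _ ?\<gamma>]) auto
qed

context sym_form
begin

lemma cm_nth: "(u \<star> v) $ K = (\<Sum>I\<in>UNIV. \<Sum>J\<in>UNIV. u $ I * v $ J * (ax I \<star> ax J) $ K)"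
proof -
  have "(u \<star> v) $ K = (\<Sum>I\<in>UNIV. u $ I * (ax I \<star> v) $ K)"
    by (rule clin_nth[OF clin_cmul_left])
  also have "\<dots> = (\<Sum>I\<in>UNIV. u $ I * (\<Sum>J\<in>UNIV. v $ J * (ax I \<star> ax J) $ K))"
    by (rule sum.cong[OF refl], rule arg_cong, rule clin_nth[OF clin_cmul])
  finally show ?thesis by (simp only: sum_distrib_left mult.assoc)
qed

lemma cm_fun_nth: "(\<lambda>x. (\<phi> x \<star> \<psi> x) $ K) = (\<lambda>x. \<Sum>I\<in>UNIV. \<Sum>J\<in>UNIV. \<phi> x $ I * \<psi> x $ J * (ax I \<star> ax J) $ K)"
  by (rule ext) (rule cm_nth)

lemma poly_map_cm:
  assumes "poly_map \<phi>" "poly_map \<psi>" shows "poly_map (\<lambda>x. \<phi> x \<star> \<psi> x)"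
proof -
  have *: "poly_fun (\<lambda>x. \<Sum>I\<in>UNIV. \<Sum>J\<in>UNIV. \<phi> x $ I * \<psi> x $ J * c I J)" for c
    using assms unfolding poly_map_def by (intro poly_fun_sum poly_fun.mult poly_fun.const) auto
  show ?thesis unfolding poly_map_def cm_fun_nth by (rule allI, rule *)
qed

lemma holo_curve_cm:
  assumes "holo_curve \<gamma>" "holo_curve \<delta>" shows "holo_curve (\<lambda>t. \<gamma> t \<star> \<delta> t)"
proof -
  have *: "(\<lambda>t. \<Sum>I\<in>UNIV. \<Sum>J\<in>UNIV. \<gamma> t $ I * \<delta> t $ J * c I J) holomorphic_on UNIV" for c
    using assms unfolding holo_curve_def by (intro holomorphic_intros) auto
  show ?thesis unfolding holo_curve_def cm_fun_nth by (rule allI, rule *)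
qed

text \<open>For B y y = 1 this map fixes y and negates its orthogonal complement: it is the negative
  of a reflection, and the effect of multiplying by y on both sides in the Clifford algebra
  (\<open>vec_sandwich\<close>).\<close>

definition refl :: "'n cvec \<Rightarrow> 'n cvec \<Rightarrow> 'n cvec" where
  "refl y v = (2 * B y v) *s y - B y y *s v"

lemma vec_sandwich: "ext_vec y \<star> ext_vec v \<star> ext_vec y = ext_vec (refl y v)"
proof -
  have "ext_vec y \<star> ext_vec v = (2 * B y v) *s ext_one - ext_vec v \<star> ext_vec y"
    using vec_anticomm[of y v] by (simp add: eq_diff_eq)
  then have "ext_vec y \<star> ext_vec v \<star> ext_vec y = (2 * B y v) *s ext_vec y - ext_vec v \<star> (ext_vec y \<star> ext_vec y)"
    by (simp add: cm_simps cmul_one_left cmul_assoc)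
  then show ?thesis by (simp add: vec_sq cm_simps cmul_one_right refl_def clin_rules[OF ext_vec_clin])
qed

text \<open>Even elements of arbitrary norm N, including 0, since the condition involves g x
  alpha(g) rather than an inverse. Products can thus be formed first and normalized afterwards
  (\<open>cgroup_scale\<close>).\<close>

definition cgroup :: "'n ext \<Rightarrow> complex \<Rightarrow> bool" where
  "cgroup g N \<longleftrightarrow> g \<in> ext_even \<and> g \<star> ext_rev g = N *s ext_one \<and> (\<forall>x. spin_conj B g (ext_vec x) \<in> range ext_vec)"

lemma cgroup_Spin: "cgroup g 1 \<Longrightarrow> g \<in> Spin B"
  by (simp add: cgroup_def Spin_def)

lemma cgroup_mult:
  assumes "cgroup g N" "cgroup h M" shows "cgroup (g \<star> h) (N * M)"
proof -
  have "g \<star> h \<star> ext_rev (g \<star> h) = g \<star> (h \<star> ext_rev h) \<star> ext_rev g" by (simp add: ext_rev_cm cmul_assoc)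
  then have 1: "g \<star> h \<star> ext_rev (g \<star> h) = (N * M) *s ext_one"
    using assms by (simp add: cgroup_def cm_simps cmul_one_right mult.commute)
  have "spin_conj B (g \<star> h) (ext_vec x) \<in> range ext_vec" for x
  proof -
    obtain y where y: "spin_conj B h (ext_vec x) = ext_vec y" using assms(2) by (auto simp: cgroup_def image_iff)
    have "spin_conj B (g \<star> h) (ext_vec x) = spin_conj B g (spin_conj B h (ext_vec x))"
      by (simp add: spin_conj_def ext_rev_cm cmul_assoc)
    then show ?thesis using assms(1) by (simp add: y cgroup_def)
  qed
  then show ?thesis using 1 assms by (simp add: cgroup_def even_cm)
qed

lemma cgroup_scale:
  assumes "cgroup g N" shows "cgroup (c *s g) (c * c * N)"
proof -
  have "spin_conj B (c *s g) (ext_vec x) = (c * c) *s spin_conj B g (ext_vec x)" for x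
    by (simp add: spin_conj_def cm_simps clin_rules[OF clin_ext_rev])
  moreover have "k *s u \<in> range ext_vec" if "u \<in> range ext_vec" for k and u :: "'n ext"
    using that by (auto simp: clin_rules[OF ext_vec_clin, symmetric])
  ultimately have "spin_conj B (c *s g) (ext_vec x) \<in> range ext_vec" for x
    using assms by (simp add: cgroup_def)
  moreover have "c *s g \<in> ext_even" using assms by (intro vec.subspace_scale[OF ext_even_subspace]) (simp add: cgroup_def)
  ultimately show ?thesis using assms
    by (simp add: cgroup_def cm_simps clin_rules[OF clin_ext_rev])
qed

lemma cgroup_one: "cgroup ext_one 1"
  by (simp add: cgroup_def even_one spin_conj_def cmul_one_left cmul_one_right)

lemma cgroup_pair: "cgroup (ext_vec x \<star> ext_vec y) (B x x * B y y)"
proof -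
  have "ext_vec x \<star> ext_vec y \<star> ext_rev (ext_vec x \<star> ext_vec y) = ext_vec x \<star> (ext_vec y \<star> ext_vec y) \<star> ext_vec x"
    by (simp add: ext_rev_cm ext_rev_vec cmul_assoc)
  then have 1: "ext_vec x \<star> ext_vec y \<star> ext_rev (ext_vec x \<star> ext_vec y) = (B x x * B y y) *s ext_one"
    by (simp add: vec_sq cm_simps cmul_one_right mult.commute)
  have "spin_conj B (ext_vec x \<star> ext_vec y) (ext_vec v) = ext_vec x \<star> (ext_vec y \<star> ext_vec v \<star> ext_vec y) \<star> ext_vec x" for v
    by (simp add: spin_conj_def ext_rev_cm ext_rev_vec cmul_assoc)
  then have "spin_conj B (ext_vec x \<star> ext_vec y) (ext_vec v) = ext_vec (refl x (refl y v))" for v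
    by (simp add: vec_sandwich)
  then show ?thesis using 1 by (simp add: cgroup_def vec_vec_even)
qed

lemma pair_Spin: "B x x = 1 \<Longrightarrow> B y y = 1 \<Longrightarrow> ext_vec x \<star> ext_vec y \<in> Spin B"
  using cgroup_pair[of x y] by (intro cgroup_Spin) simp

lemma pair_spin_T: "spin_T B (ext_vec x \<star> ext_vec y) *v v = refl x (refl y v)"
proof -
  have "spin_conj B (ext_vec x \<star> ext_vec y) (ext_vec v) = ext_vec x \<star> (ext_vec y \<star> ext_vec v \<star> ext_vec y) \<star> ext_vec x"
    by (simp add: spin_conj_def ext_rev_cm ext_rev_vec cmul_assoc)
  then show ?thesis by (simp add: spin_T_works vec_sandwich)
qed

section \<open>Curves in the spin group\<close>

definition joined :: "'n ext \<Rightarrow> bool" where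
  "joined g \<longleftrightarrow> (\<exists>\<gamma>. holo_curve \<gamma> \<and> range \<gamma> \<subseteq> Spin B \<and> \<gamma> 0 = ext_one \<and> \<gamma> 1 = g)"

lemma joined_cm: assumes "joined g" "joined h" shows "joined (g \<star> h)"
proof -
  obtain \<gamma> where \<gamma>: "holo_curve \<gamma>" "range \<gamma> \<subseteq> Spin B" "\<gamma> 0 = ext_one" "\<gamma> 1 = g" using assms by (auto simp: joined_def)
  obtain \<delta> where \<delta>: "holo_curve \<delta>" "range \<delta> \<subseteq> Spin B" "\<delta> 0 = ext_one" "\<delta> 1 = h" using assms by (auto simp: joined_def)
  show ?thesis unfolding joined_def
    using \<gamma> \<delta> by (intro exI[of _ "\<lambda>t. \<gamma> t \<star> \<delta> t"]) (auto simp: holo_curve_cm cmul_one_left intro!: Spin_cm)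
qed

text \<open>The product of y(0) with y(t) is a pair of unit vectors for every t, and it starts at
  y(0) y(0) = 1.\<close>

lemma joined_curve:
  assumes y: "holo_curve y" "\<And>t. B (y t) (y t) = 1"
  shows "joined (ext_vec (y 0) \<star> ext_vec (y 1))"
proof -
  have "holo_curve (\<lambda>t. ext_vec (y 0) \<star> ext_vec (y t))"
    by (intro holo_curve_clin[OF clin_cmul] holo_curve_clin[OF ext_vec_clin] y)
  then show ?thesis unfolding joined_def
    using y(2) by (intro exI[of _ "\<lambda>t. ext_vec (y 0) \<star> ext_vec (y t)"]) (auto simp: vec_sq pair_Spin)
qed

end

context nondeg_form
begin

lemma joined_neg_one:
  assumes n: "CARD('n) \<ge> 2" shows "joined (- ext_one)"
proof -
  obtain i j :: 'n where ij: "i \<noteq> j"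
    using n card_le_Suc0_iff_eq[of "UNIV :: 'n set"] by auto
  \<comment> \<open>Half a rotation from \<open>ob i\<close> to \<open>- ob i\<close>, whose product
    is -1. The second orthonormal vector is indispensable: in dimension 1 the group consists of 1
    and -1.\<close>
  let ?y = "\<lambda>t. cos (of_real pi * t) *s ob i + sin (of_real pi * t) *s ob j"
  have "holo_curve ?y" by (intro holo_curve_add holo_curve_scale holomorphic_intros)
  moreover have "B (?y t) (?y t) = 1" for t
    using ij sin_cos_squared_add2[of "of_real pi * t"] by (simp add: B_simps ob power2_eq_square)
  ultimately have "joined (ext_vec (?y 0) \<star> ext_vec (?y 1))" by (rule joined_curve)
  moreover have "cos (of_real pi :: complex) = -1" "sin (of_real pi :: complex) = 0"
    by (metis cos_of_real cos_pi of_real_1 of_real_minus) (metis sin_of_real sin_pi of_real_0)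
  ultimately show ?thesis by (simp add: clin_rules[OF ext_vec_clin] cm_simps vec_sq ob)
qed

text \<open>y is reached from x through unit vectors: along a complex circle in the plane of x and
  y, or along a line if B x y = 1, when y - x is isotropic. For B x y = -1 neither formula applies,
  and y is replaced by - y at the price of a factor -1.\<close>

lemma joined_pair:
  assumes n: "CARD('n) \<ge> 2" and x: "B x x = 1" and y: "B y y = 1"
  shows "joined (ext_vec x \<star> ext_vec y)"
proof -
  have main: "joined (ext_vec x \<star> ext_vec y)" if y: "B y y = 1" and ne: "B x y \<noteq> -1" for y
  proof -
    define z where "z = y - B x y *s x"
    have zz: "B z z = 1 - B x y * B x y" "B x z = 0" "B z x = 0" using x y sym_B[of y x]
      by (simp_all add: z_def B_simps algebra_simps)
    show ?thesis
    proof (cases "B x y = 1")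
      case True
      let ?y = "\<lambda>t. x + t *s z"
      have "holo_curve ?y" by (auto simp: holo_curve_def intro!: holomorphic_intros)
      moreover have "B (?y t) (?y t) = 1" for t using True zz x by (simp add: B_simps)
      ultimately have "joined (ext_vec (?y 0) \<star> ext_vec (?y 1))" by (rule joined_curve)
      then show ?thesis using True by (simp add: z_def)
    next
      case False
      define \<theta> where "\<theta> = Arccos (B x y)"
      have c: "cos \<theta> = B x y" by (simp add: \<theta>_def)
      have s2: "sin \<theta> * sin \<theta> = 1 - B x y * B x y"
        using sin_cos_squared_add[of \<theta>] by (simp add: power2_eq_square c eq_diff_eq)
      have s: "sin \<theta> \<noteq> 0"
      proof
        assume "sin \<theta> = 0"
        then have "B x y * B x y = 1" using s2 by simp
        then show False using False ne by (simp add: square_eq_1_iff)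
      qed
      let ?y = "\<lambda>t. cos (t * \<theta>) *s x + (sin (t * \<theta>) / sin \<theta>) *s z"
      have "holo_curve ?y" using s by (intro holo_curve_add holo_curve_scale holomorphic_intros)
      moreover have "B (?y t) (?y t) = 1" for t
      proof -
        have "B (?y t) (?y t) = cos (t * \<theta>) * cos (t * \<theta>) + (sin (t * \<theta>) / sin \<theta>) * (sin (t * \<theta>) / sin \<theta>) * (sin \<theta> * sin \<theta>)"
          unfolding s2 by (simp add: B_simps zz x)
        also have "\<dots> = cos (t * \<theta>) * cos (t * \<theta>) + sin (t * \<theta>) * sin (t * \<theta>)" using s by simp
        also have "\<dots> = 1" using sin_cos_squared_add[of "t * \<theta>"] by (simp add: power2_eq_square add.commute)
        finally show ?thesis .
      qed
      ultimately have "joined (ext_vec (?y 0) \<star> ext_vec (?y 1))" by (rule joined_curve)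
      then show ?thesis using s by (simp add: c z_def)
    qed
  qed
  show ?thesis
  proof (cases "B x y = -1")
    case True
    have "joined (ext_vec x \<star> ext_vec (- y))" using y True by (intro main) (simp_all add: B_simps)
    then have "joined (- ext_one \<star> (ext_vec x \<star> ext_vec (- y)))" by (rule joined_cm[OF joined_neg_one[OF n]])
    then show ?thesis by (simp add: clin_rules[OF ext_vec_clin] cm_simps cmul_one_left)
  qed (rule main[OF y])
qed

text \<open>All contractions by orthonormal vectors except e_j vanish, so g lies in the span of 1
  and e_j; evenness leaves the scalars.\<close>

lemma even_commuting:
  assumes g: "g \<in> ext_even" and c: "\<And>i. i \<noteq> j \<Longrightarrow> g \<star> ext_vec (ob i) = ext_vec (ob i) \<star> g"
  shows "g = pr0 g *s ext_one"
proof -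
  have i: "iota B (ob i) g = 0" if "i \<noteq> j" for i
  proof -
    have "(-2) *s iota B (ob i) g = 0" using even_commutator[OF g, of "ob i"] c[OF that] by simp
    then show ?thesis by simp
  qed
  have x: "iota B x g = B (ob j) x *s iota B (ob j) g" for x
  proof -
    have "iota B x g = (\<Sum>i\<in>UNIV. B (ob i) x *s iota B (ob i) g)"
      by (subst ob_expand[symmetric]) (simp only: iota_simps)
    also have "\<dots> = (\<Sum>i\<in>UNIV. if i = j then B (ob i) x *s iota B (ob i) g else 0)"
      by (rule sum.cong) (auto simp: i)
    finally show ?thesis by simp
  qed
  have "iota B y (iota B (ob j) g) = 0" for y
  proof -
    have "iota B (ob j) (iota B (ob j) g) = 0"
    proof -
      have "2 *s iota B (ob j) (iota B (ob j) g) = 2 *s 0" using iota_anti[of "ob j" "ob j" g] by (simp add: vec_eq_iff)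
      then show ?thesis by (simp only: vec_two_cancel)
    qed
    then show ?thesis using iota_anti[of y "ob j" g] by (simp add: x[of y] iota_simps)
  qed
  then have h: "iota B (ob j) g = pr0 (iota B (ob j) g) *s ext_one" by (rule iota_zero)
  have "gr_inv (iota B (ob j) g) = - iota B (ob j) g" using g by (simp add: gr_inv_iota ext_even_iff)
  moreover have "gr_inv (iota B (ob j) g) = iota B (ob j) g"
    by (subst (1 2) h) (simp only: clin_scale[OF clin_gr_inv] gr_inv_one)
  ultimately have "pr0 (iota B (ob j) g) = pr0 (- iota B (ob j) g)" by (simp only:)
  then have "pr0 (iota B (ob j) g) = - pr0 (iota B (ob j) g)" by (simp only: pr0_simps)
  then have "iota B (ob j) g = 0" using h by simp
  then have "iota B y g = 0" for y using x[of y] by simp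
  then show ?thesis by (rule iota_zero)
qed

text \<open>x + e has square 2 + 2 B x e and is normalized by the root, which is where B x e = -1 is
  excluded. The map \<open>refl v\<close> fixes v and negates x - e, hence interchanges x and
  e.\<close>

lemma refl_swap:
  assumes "B x x = 1" "B e e = 1" "B x e \<noteq> -1"
  defines "v \<equiv> (1 / csqrt (2 + 2 * B x e)) *s (x + e)"
  shows "B v v = 1" "refl v x = e" "B v w = (B x w + B e w) / csqrt (2 + 2 * B x e)"
proof -
  define r where "r = csqrt (2 + 2 * B x e)"
  have r: "r * r = 2 + 2 * B x e" unfolding r_def using power2_csqrt[of "2 + 2 * B x e"] by (simp add: power2_eq_square)
  have ne: "2 + 2 * B x e \<noteq> 0"
  proof
    assume "2 + 2 * B x e = 0"
    then have "2 * (1 + B x e) = 0" by (simp add: distrib_left)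
    then show False using assms(3) by (simp add: add_eq_0_iff)
  qed
  then have r0: "r \<noteq> 0" using r by auto
  have v: "v = (1 / r) *s (x + e)" by (simp add: v_def r_def)
  have xe: "B x x = 1" "B e e = 1" "B e x = B x e" using assms(1,2) sym_B[of e x] by auto
  have "B v v = (1 / r) * (1 / r) * (2 + 2 * B x e)" unfolding v B_simps xe by (simp only: distrib_left distrib_right mult_1_right) simp
  then show vv: "B v v = 1" using r0 by (simp add: r[symmetric])
  show "B v w = (B x w + B e w) / csqrt (2 + 2 * B x e)" by (simp add: v B_simps r_def add_divide_distrib)
  have "(2 * B v x) *s v = x + e"
  proof -
    have "2 * B v x * (1 / r) = (1 / r) * (1 / r) * (2 + 2 * B x e)" unfolding v B_simps xe by (simp only: distrib_left distrib_right mult_1_right) simp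
    then have "2 * B v x * (1 / r) = 1" using r0 by (simp add: r[symmetric])
    then show ?thesis unfolding v by (simp only: vec.scale_scale vec.scale_one)
  qed
  then show "refl v x = e" by (simp add: refl_def vv)
qed

lemma refl_orth: "B v w = 0 \<Longrightarrow> B v v = 1 \<Longrightarrow> refl v w = - w"
  by (simp add: refl_def)

lemma refl_neg: "refl v (- w) = - refl v w"
  by (simp add: refl_def B_simps)

lemma refl_self: "B v v = 1 \<Longrightarrow> refl v v = v"
  by (simp add: refl_def vec_eq_iff)

text \<open>Rotate \<open>T(g) e\<^sub>i\<close> back to \<open>e\<^sub>i\<close>, fixing the basis vectors fixed so far.\<close>

lemma Spin_joined:
  assumes n: "CARD('n) \<ge> 2" and g: "g \<in> Spin B"
  shows "joined g"
proof -
  have "joined g" if "g \<in> Spin B" "\<And>k. k \<notin> S \<Longrightarrow> spin_T B g *v ob k = ob k" for g and S :: "'n set"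
    using that
  proof (induction "card S" arbitrary: g S rule: less_induct)
    case (less S g)
    have ge: "g \<in> ext_even" "g \<star> ext_rev g = ext_one" using less.prems(1) by (auto simp: Spin_iff)
    have com: "g \<star> ext_vec (ob k) = ext_vec (ob k) \<star> g" if "k \<notin> S" for k
      using Spin_twists[OF less.prems(1)] less.prems(2)[OF that] by (simp add: twists_def)
    show ?case
    \<comment> \<open>S contains the indices of the basis vectors that may still move. If at most
      one is left, g commutes with all the others and is a scalar of square 1.\<close>
    proof (cases "\<exists>j. S \<subseteq> {j}")
      case True
      then obtain j where j: "S \<subseteq> {j}" by blast
      have s: "g = pr0 g *s ext_one" by (rule even_commuting[OF ge(1), of j]) (use com j in auto)
      have "(pr0 g *s ext_one) \<star> ext_rev (pr0 g *s ext_one) = ext_one" using ge(2) s by simp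
      then have "(pr0 g * pr0 g) *s ext_one = (ext_one :: 'n ext)"
        by (simp add: cm_simps clin_rules[OF clin_ext_rev] cmul_one_left)
      from arg_cong[OF this, of pr0] have "pr0 g * pr0 g = 1" by (simp add: pr0_simps)
      then have "pr0 g = 1 \<or> pr0 g = -1" by (simp add: square_eq_1_iff)
      then have "g = ext_one \<or> g = - ext_one" using s by (metis vec.scale_one vec.scale_minus_left)
      moreover have "joined ext_one" unfolding joined_def
        by (intro exI[of _ "\<lambda>_. ext_one"]) (auto simp: holo_curve_def Spin_one)
      ultimately show ?thesis using joined_neg_one[OF n] by auto
    next
      case False
      then obtain i where i: "i \<in> S" by blast
      obtain j where j: "j \<in> S" "j \<noteq> i" using False i by blast
      define x where "x = spin_T B g *v ob i"
      have xx: "B x x = 1" by (simp add: x_def spin_T_B[OF less.prems(1)] ob)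
      have xk: "B x (ob k) = 0" if "k \<notin> S" for k
      proof -
        have "B x (ob k) = B (spin_T B g *v ob i) (spin_T B g *v ob k)" by (simp add: x_def less.prems(2)[OF that])
        then show ?thesis using i that by (auto simp: spin_T_B[OF less.prems(1)] ob)
      qed
      have "\<exists>a v. B a a = 1 \<and> B v v = 1 \<and> refl a (refl v x) = ob i \<and> (\<forall>k. k \<notin> S \<longrightarrow> refl a (refl v (ob k)) = ob k)"
      proof (cases "B x (ob i) = -1")
        case False
        define v where "v = (1 / csqrt (2 + 2 * B x (ob i))) *s (x + ob i)"
        have oo: "B (ob i) (ob i) = 1" by (simp add: ob)
        note v = refl_swap[OF xx oo False, folded v_def]
        have "refl (ob i) (refl v (ob k)) = ob k" if "k \<notin> S" for k
        proof -
          have ik: "B (ob i) (ob k) = 0" using that i by (auto simp: ob)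
          have "refl v (ob k) = - ob k" using v(3)[of "ob k"] xk[OF that] ik by (intro refl_orth v(1)) simp
          then show ?thesis using refl_orth[OF ik oo] by (simp add: refl_neg)
        qed
        then show ?thesis using v(1,2) refl_self[OF oo] oo by (intro exI[of _ "ob i"] exI[of _ v]) simp
      next
        \<comment> \<open>Here x + \<open>ob i\<close> is isotropic and cannot be normalized. So x
          is sent to \<open>- ob i\<close> first, and a further vector \<open>ob j\<close> with j in
          S different from i corrects the sign.\<close>
        case True
        have mo: "B (- ob i) (- ob i) = 1" and ne: "B x (- ob i) \<noteq> -1" using True by (simp_all add: ob B_simps)
        define v where "v = (1 / csqrt (2 + 2 * B x (- ob i))) *s (x + - ob i)"
        note v = refl_swap[OF xx mo ne, folded v_def]
        have oo: "B (ob j) (ob j) = 1" by (simp add: ob)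
        have r: "refl (ob j) (ob k) = - ob k" if "k \<noteq> j" for k
          using that by (intro refl_orth oo) (simp add: ob)
        have "refl (ob j) (refl v (ob k)) = ob k" if "k \<notin> S" for k
        proof -
          have ik: "B (- ob i) (ob k) = 0" using that i by (auto simp: ob B_simps)
          have "refl v (ob k) = - ob k" using v(3)[of "ob k"] xk[OF that] ik by (intro refl_orth v(1)) simp
          moreover have "k \<noteq> j" using that j by auto
          ultimately show ?thesis using r[of k] by (simp add: refl_neg)
        qed
        moreover have "refl (ob j) (refl v x) = ob i" using r[of i] j by (simp add: v(2) refl_neg)
        ultimately show ?thesis using v(1) oo by (intro exI[of _ "ob j"] exI[of _ v]) simp
      qed
      then obtain a v where av: "B a a = 1" "B v v = 1" "refl a (refl v x) = ob i"
          "\<And>k. k \<notin> S \<Longrightarrow> refl a (refl v (ob k)) = ob k" by blast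
      \<comment> \<open>The basis vectors outside S are negated twice, so \<open>?h\<close> times g
        fixes one more of them; g is recovered by multiplying with the inverse of \<open>?h\<close>,
        the same pair in reverse order.\<close>
      let ?h = "ext_vec a \<star> ext_vec v"
      have h: "?h \<in> Spin B" using av by (intro pair_Spin)
      have hg: "?h \<star> g \<in> Spin B" by (rule Spin_cm[OF h less.prems(1)])
      have "joined (?h \<star> g)"
      proof (rule less.hyps[OF _ hg])
        show "card (S - {i}) < card S" using i by (intro card_Diff1_less) auto
        fix k assume k: "k \<notin> S - {i}"
        have "spin_T B (?h \<star> g) *v ob k = refl a (refl v (spin_T B g *v ob k))"
          by (simp only: spin_T_cm[OF h less.prems(1)] pair_spin_T)
        then show "spin_T B (?h \<star> g) *v ob k = ob k"
          using k av(3,4) less.prems(2)[of k] x_def by (cases "k = i") auto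
      qed
      moreover have "joined (ext_vec v \<star> ext_vec a)" by (rule joined_pair[OF n av(2,1)])
      ultimately have "joined (ext_vec v \<star> ext_vec a \<star> (?h \<star> g))" by (simp only: joined_cm)
      moreover have "ext_vec v \<star> ext_vec a \<star> (?h \<star> g) = ext_vec v \<star> (ext_vec a \<star> ext_vec a) \<star> ext_vec v \<star> g"
        by (simp only: cmul_assoc)
      ultimately show ?thesis using av by (simp add: vec_sq cm_simps cmul_one_right cmul_one_left)
    qed
  qed
  from this[of g UNIV] show ?thesis using g by simp
qed

theorem Spin_irred:
  assumes n: "CARD('n) \<ge> 2" shows "irred_set (Spin B)"
proof (rule irred_curves)
  fix a b assume a: "a \<in> Spin B" and b: "b \<in> Spin B"
  have "joined (ext_rev a \<star> b)" by (intro Spin_joined[OF n] Spin_cm Spin_ext_rev a b)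
  then obtain \<gamma> where \<gamma>: "holo_curve \<gamma>" "range \<gamma> \<subseteq> Spin B" "\<gamma> 0 = ext_one" "\<gamma> 1 = ext_rev a \<star> b"
    by (auto simp: joined_def)
  have "a \<star> (ext_rev a \<star> b) = b" using a by (simp add: cmul_assoc[symmetric] Spin_iff cmul_one_left)
  then show "\<exists>\<gamma>. holo_curve \<gamma> \<and> range \<gamma> \<subseteq> Spin B \<and> \<gamma> 0 = a \<and> \<gamma> 1 = b"
    using \<gamma> a by (intro exI[of _ "\<lambda>t. a \<star> \<gamma> t"])
      (auto simp: cmul_one_right holo_curve_clin[OF clin_cmul] intro!: Spin_cm)
qed

end

section \<open>The fibres of the generalized Cayley mapping\<close>

definition prd :: "nat \<Rightarrow> 'n::finite ext \<Rightarrow> 'n ext" where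
  "prd k u = (\<chi> I. if card I = k then u $ I else 0)"

lemma clin_prd: "clin (prd k)"
  by (rule clinI) (auto simp: vec_eq_iff prd_def)

lemma prd_degree: "prd k u \<in> ext_degree k" by (simp add: prd_def ext_degree_def)

lemma prd_id: "u \<in> ext_degree k \<Longrightarrow> prd k u = u"
  by (auto simp: prd_def ext_degree_def vec_eq_iff)

lemma prd_other: "u \<in> ext_degree j \<Longrightarrow> j \<noteq> k \<Longrightarrow> prd k u = 0"
  by (auto simp: prd_def ext_degree_def vec_eq_iff)

lemma prd_0: "prd 0 u = pr0 u *s ext_one"
  by (auto simp: prd_def vec_eq_iff pr0_def ext_one_def ax_nth)

lemma prd_one: "prd 2 ext_one = 0"
  by (auto simp: prd_def vec_eq_iff ext_one_def ax_nth)

lemma pr2_prd: "pr2 u = prd 2 u" by (simp add: pr2_def prd_def)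

lemma prd_eps: "prd (Suc k) (eps x u) = eps x (prd k u)"
proof -
  have "prd (Suc k) (eps x u) $ K = eps x (prd k u) $ K" for K
  proof -
    have "card K = Suc k \<longleftrightarrow> card (K - {i}) = k" if "i \<in> K" for i
      using card_Suc_Diff1[OF finite that] by linarith
    then have "eps x (prd k u) $ K = (\<Sum>i\<in>K. if card K = Suc k then x $ i * (shuffle_sign {i} (K - {i}) * u $ (K - {i})) else 0)"
      unfolding eps_nth by (intro sum.cong refl) (simp add: prd_def)
    then show ?thesis by (simp add: prd_def eps_nth)
  qed
  then show ?thesis by (simp add: vec_eq_iff)
qed

lemma prd_iota: "prd k (iota B x u) = iota B x (prd (Suc k) u)"
proof -
  have "prd k (iota B x u) $ K = iota B x (prd (Suc k) u) $ K" for K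
    by (auto simp: prd_def iota_nth intro!: sum.cong sum.neutral)
  then show ?thesis by (simp add: vec_eq_iff)
qed

lemma ext_degree_large: "u \<in> ext_degree k \<Longrightarrow> k > CARD('n::finite) \<Longrightarrow> u = (0 :: 'n ext)"
proof -
  assume u: "u \<in> ext_degree k" and k: "k > CARD('n)"
  have "card I \<noteq> k" for I :: "'n set" using card_mono[of UNIV I] k by auto
  then show "u = 0" using u by (simp add: ext_degree_def vec_eq_iff)
qed

context nondeg_form
begin

lemma degree_eq:
  assumes "u \<in> ext_degree (Suc k)" "v \<in> ext_degree (Suc k)" "\<And>y. iota B y u = iota B y v"
  shows "u = v"
proof -
  have d: "u - v \<in> ext_degree (Suc k)" using assms vec.subspace_diff[OF ext_degree_subspace] by blast
  then have "pr0 (u - v) = 0" by (simp add: pr0_def ext_degree_def)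
  moreover have "u - v = pr0 (u - v) *s ext_one" by (rule iota_zero) (simp add: iota_simps assms(3))
  ultimately show ?thesis by simp
qed

text \<open>\<open>Uop u\<close> is exterior multiplication by \<open>u \<in> \<wedge>\<^sup>2V\<close>, so that \<open>G u k = u\<^sup>k / k!\<close>.\<close>

definition Uop :: "'n ext \<Rightarrow> 'n ext \<Rightarrow> 'n ext" where
  "Uop u w = (1/2) *s (\<Sum>i\<in>UNIV. eps (ax i) (eps (ext_to_vec (iota B (dvec i) u)) w))"

lemma clin_Uop: "clin (Uop u)"
  by (rule clinI) (simp_all add: Uop_def eps_simps sum.distrib vec.scale_right_distrib vec.scale_sum_right mult.commute)

lemma Uop_eps: "Uop u (eps x w) = eps x (Uop u w)"
proof -
  have "eps (ax i) (eps v (eps x w)) = eps x (eps (ax i) (eps v w))" for i v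
    using eps_anti[of v x w] eps_anti[of "ax i" x "eps v w"] by (simp add: eps_simps)
  then show ?thesis by (simp add: Uop_def eps_simps)
qed

text \<open>Contraction meets each of the two vector factors of a summand of u once; by skewness
  both contributions sum to the same vector, which the factor 1/2 in \<open>Uop\<close>
  compensates.\<close>

lemma iota_Uop: "iota B y (Uop u w) = eps (ext_to_vec (iota B y u)) w + Uop u (iota B y w)"
proof -
  let ?s = "\<lambda>i. ext_to_vec (iota B (dvec i) u)" and ?v = "ext_to_vec (iota B y u)"
  have 1: "iota B y (eps (ax i) (eps (?s i) w)) =
      eps (B y (ax i) *s ?s i) w + eps (- B y (?s i) *s ax i) w + eps (ax i) (eps (?s i) (iota B y w))" for i
    by (simp add: iota_eps eps_simps)
  have 2: "(\<Sum>i\<in>UNIV. B y (ax i) *s ?s i) = ?v"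
  proof -
    have "(\<Sum>i\<in>UNIV. B y (ax i) *s ?s i) = ext_to_vec (iota B (\<Sum>i\<in>UNIV. B y (ax i) *s dvec i) u)"
      by (simp only: iota_simps clin_rules[OF clin_ext_to_vec])
    then show ?thesis by (simp add: dual_expand)
  qed
  have "- B y (?s i) = ?v $ i" for i
  proof -
    have "B y (?s i) = pr0 (iota B y (iota B (dvec i) u))" by (simp add: pr0_iota)
    also have "\<dots> = - pr0 (iota B (dvec i) (iota B y u))" by (subst iota_anti) (simp add: pr0_simps)
    also have "\<dots> = - (?v $ i)" by (simp add: pr0_iota B_dual)
    finally show ?thesis by simp
  qed
  then have 3: "(\<Sum>i\<in>UNIV. - B y (?s i) *s ax i) = ?v" by (simp add: basis_expansion)
  have "iota B y (Uop u w) = (1/2) *s (eps (\<Sum>i\<in>UNIV. B y (ax i) *s ?s i) w + eps (\<Sum>i\<in>UNIV. - B y (?s i) *s ax i) w) + Uop u (iota B y w)"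
    unfolding Uop_def iota_simps 1 sum.distrib vec.scale_right_distrib by (simp only: clin_sum[OF clin_eps_vec])
  then show ?thesis unfolding 2 3 by (simp add: vec_eq_iff)
qed

primrec G :: "'n ext \<Rightarrow> nat \<Rightarrow> 'n ext" where
  "G u 0 = ext_one"
| "G u (Suc k) = (1 / of_nat (Suc k)) *s Uop u (G u k)"

text \<open>The derivation rule for divided powers: contracting u^(k+1) / (k+1)! produces one factor
  iota(y) u and leaves u^k / k!.\<close>

lemma iota_G: "iota B y (G u (Suc k)) = eps (ext_to_vec (iota B y u)) (G u k)"
proof (induction k)
  case 0
  then show ?case by (simp add: iota_simps iota_Uop clin_rules[OF clin_Uop])
next
  case (Suc k)
  let ?v = "ext_to_vec (iota B y u)"
  have "iota B y (G u (Suc (Suc k))) = (1 / of_nat (Suc (Suc k))) *s (eps ?v (G u (Suc k)) + Uop u (eps ?v (G u k)))"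
    unfolding G.simps(2)[of u "Suc k"] iota_simps iota_Uop Suc.IH ..
  also have "Uop u (eps ?v (G u k)) = of_nat (Suc k) *s eps ?v (G u (Suc k))"
    unfolding Uop_eps G.simps(2)[of u k] clin_rules[OF clin_eps] vec.scale_scale by (simp del: of_nat_Suc)
  also have "eps ?v (G u (Suc k)) + of_nat (Suc k) *s eps ?v (G u (Suc k)) = of_nat (Suc (Suc k)) *s eps ?v (G u (Suc k))"
    by (simp add: vec_eq_iff algebra_simps)
  finally show ?case by (simp del: of_nat_Suc G.simps)
qed

lemma G_degree: "G u k \<in> ext_degree (2 * k)"
proof (induction k)
  case 0
  then show ?case by (simp add: ext_degree_0 pr0_simps)
next
  case (Suc k)
  then show ?case unfolding G.simps Uop_def
    using eps_degree[OF eps_degree[OF Suc]]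
    by (intro vec.subspace_scale[OF ext_degree_subspace] vec.subspace_sum[OF ext_degree_subspace]) simp
qed

lemma G_even: "G u k \<in> ext_even"
proof -
  have "card I \<noteq> 2 * k" if "odd (card I)" for I :: "'n set" using that by auto
  then show ?thesis using G_degree[of u k] by (simp add: ext_even_def ext_degree_def)
qed

lemma G_large: "2 * k > CARD('n) \<Longrightarrow> G u k = 0"
  using G_degree ext_degree_large by blast

lemma G_one: "u \<in> ext_degree 2 \<Longrightarrow> G u 1 = u"
  using degree2_expand[of u] by (simp add: Uop_def eps_one flip: degree2_expand)

lemma poly_map_Uop: "poly_map \<phi> \<Longrightarrow> poly_map \<psi> \<Longrightarrow> poly_map (\<lambda>x. Uop (\<phi> x) (\<psi> x))"
proof -
  assume p: "poly_map \<phi>" "poly_map \<psi>"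
  have e: "poly_map (\<lambda>x. eps (v x) (\<psi> x))" if v: "poly_map v" for v
  proof -
    have "poly_map (\<lambda>x. v x $ i *s eps (ax i) (\<psi> x))" for i
      using v by (intro poly_map_scale poly_map_clin[OF clin_eps] p) (simp add: poly_map_def)
    then show ?thesis by (subst eps_expand) (rule poly_map_sum)
  qed
  show ?thesis unfolding Uop_def
    by (intro poly_map_scale poly_fun.const poly_map_sum poly_map_clin[OF clin_eps] e
        poly_map_clin[OF clin_ext_to_vec] poly_map_clin[OF clin_iota] p)
qed

lemma poly_map_G: "poly_map \<phi> \<Longrightarrow> poly_map (\<lambda>x. G (\<phi> x) k)"
proof (induction k)
  case 0
  then show ?case by (simp add: poly_map_def poly_fun.const)
next
  case (Suc k)
  then show ?case unfolding G.simps by (intro poly_map_scale poly_fun.const poly_map_Uop)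
qed

text \<open>Write y = (1 + T) x, possible because \<open>pr0 g\<close> is nonzero. The full relation
  g x = (T x) g then says that contracting g by y is exterior multiplication by some vector, and the
  degree 1 part identifies that vector. This is the first order equation solved by c exp(u /
  c).\<close>

lemma Spin_iota:
  assumes g: "g \<in> Spin B" and c: "pr0 g \<noteq> 0"
  shows "iota B y g = (1 / pr0 g) *s eps (ext_to_vec (iota B y (pr2 g))) g"
proof -
  let ?T = "spin_T B g"
  have tw: "twists g ?T 1" by (rule Spin_twists[OF g])
  have ge: "g \<in> ext_even" using g by (simp add: Spin_iff)
  have "det (mat 1 + ?T) \<noteq> 0" using pr0_det[OF g] c by (metis mult_eq_0_iff power_eq_0_iff zero_neq_numeral)
  then obtain C where C: "(mat 1 + ?T) ** C = mat 1" using mat_invertible by blast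
  define x where "x = C *v y"
  have y: "y = x + ?T *v x"
    using arg_cong[OF C, of "\<lambda>M. M *v y"] by (simp add: x_def matrix_vector_mul_assoc[symmetric] matrix_vector_mult_add_rdistrib)
  have "eps x g - iota B x g = eps (?T *v x) g + iota B (?T *v x) g"
    using tw unfolding twists_def by (metis even_vec_right vec_left)
  then have "iota B x g + iota B (?T *v x) g = eps x g - eps (?T *v x) g" by (rule group_rearrange)
  then have 1: "iota B y g = eps (x - ?T *v x) g" unfolding y iota_simps eps_simps .
  have "ext_to_vec (iota B y g) = pr0 g *s (x - ?T *v x)" unfolding 1 ext_to_vec_eps ..
  then have "x - ?T *v x = (1 / pr0 g) *s ext_to_vec (iota B y (pr2 g))"
    using c by (simp add: ext_to_vec_iota_pr2[symmetric])
  then show ?thesis unfolding 1 by (simp add: eps_simps)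
qed

text \<open>Comparing the equation \<open>Spin_iota\<close> degree by degree gives the recursion of
  \<open>G\<close>. The denominators are cleared so that the identity is polynomial in g and extends
  to \<open>pr0 g = 0\<close> in \<open>Spin_parts_all\<close>.\<close>

lemma Spin_parts:
  assumes g: "g \<in> Spin B" and c: "pr0 g \<noteq> 0"
  shows "pr0 g ^ k *s prd (2 * k) g = pr0 g *s G (pr2 g) k"
proof (induction k)
  case 0
  then show ?case by (simp add: prd_0)
next
  case (Suc k)
  have "pr0 g ^ Suc k *s prd (Suc (Suc (2 * k))) g = pr0 g *s G (pr2 g) (Suc k)"
  proof (rule degree_eq)
    show "pr0 g ^ Suc k *s prd (Suc (Suc (2 * k))) g \<in> ext_degree (Suc (Suc (2 * k)))"
      by (intro vec.subspace_scale[OF ext_degree_subspace] prd_degree)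
    show "pr0 g *s G (pr2 g) (Suc k) \<in> ext_degree (Suc (Suc (2 * k)))"
      using G_degree[of "pr2 g" "Suc k"] by (intro vec.subspace_scale[OF ext_degree_subspace]) simp
    fix y
    let ?v = "ext_to_vec (iota B y (pr2 g))"
    have "iota B y (prd (Suc (Suc (2 * k))) g) = prd (Suc (2 * k)) (iota B y g)" by (rule prd_iota[symmetric])
    also have "\<dots> = (1 / pr0 g) *s eps ?v (prd (2 * k) g)"
      unfolding Spin_iota[OF g c, of y] clin_rules[OF clin_prd] prd_eps ..
    finally have "pr0 g ^ Suc k *s iota B y (prd (Suc (Suc (2 * k))) g) = eps ?v (pr0 g ^ k *s prd (2 * k) g)"
      using c by (simp add: eps_simps)
    also have "\<dots> = pr0 g *s iota B y (G (pr2 g) (Suc k))" unfolding Suc.IH iota_G by (simp add: eps_simps)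
    finally show "iota B y (pr0 g ^ Suc k *s prd (Suc (Suc (2 * k))) g) = iota B y (pr0 g *s G (pr2 g) (Suc k))"
      by (simp add: iota_simps)
  qed
  then show ?case by simp
qed

definition half_dim :: nat where "half_dim = CARD('n) div 2"

text \<open>The element \<open>c exp(u / c)\<close> of the exterior algebra.\<close>

definition gexp :: "'n ext \<Rightarrow> complex \<Rightarrow> 'n ext" where
  "gexp u c = (\<Sum>k\<le>half_dim. (c * (1 / c) ^ k) *s G u k)"

lemma even_sum_prd: "(g :: 'n ext) \<in> ext_even \<Longrightarrow> g = (\<Sum>k\<le>half_dim. prd (2 * k) g)"
proof -
  assume g: "g \<in> ext_even"
  have "g $ I = (\<Sum>k\<le>half_dim. prd (2 * k) g) $ I" for I
  proof (cases "even (card I)")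
    case True
    then obtain j where j: "card I = 2 * j" by blast
    have "card I \<le> CARD('n)" using card_mono[of "UNIV :: 'n set" I] by simp
    then have "j \<le> half_dim" using j by (simp add: half_dim_def)
    moreover have "(\<Sum>k\<le>half_dim. prd (2 * k) g) $ I = (\<Sum>k\<le>half_dim. if k = j then g $ I else 0)"
      unfolding sum_component by (rule sum.cong) (auto simp: prd_def j)
    ultimately show ?thesis by simp
  next
    case False
    then have "card I \<noteq> 2 * k" for k by auto
    then have "(\<Sum>k\<le>half_dim. prd (2 * k) g) $ I = 0" unfolding sum_component by (simp add: prd_def)
    then show ?thesis using g False by (simp add: ext_even_def)
  qed
  then show ?thesis by (simp add: vec_eq_iff)
qed

lemma Spin_gexp:
  assumes g: "g \<in> Spin B" and c: "pr0 g \<noteq> 0"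
  shows "g = gexp (pr2 g) (pr0 g)"
proof -
  have "prd (2 * k) g = (pr0 g * (1 / pr0 g) ^ k) *s G (pr2 g) k" for k
  proof -
    have "(1 / pr0 g) ^ k *s (pr0 g ^ k *s prd (2 * k) g) = (1 / pr0 g) ^ k *s (pr0 g *s G (pr2 g) k)"
      unfolding Spin_parts[OF assms] ..
    moreover have "(1 / pr0 g) ^ k * pr0 g ^ k = 1" using c by (simp add: power_mult_distrib[symmetric])
    ultimately show ?thesis by (simp add: mult.commute)
  qed
  then show ?thesis unfolding gexp_def using even_sum_prd[of g] g by (simp add: Spin_iff)
qed

lemma gexp_even: "gexp u c \<in> ext_even"
  unfolding gexp_def by (intro vec.subspace_sum[OF ext_even_subspace] vec.subspace_scale[OF ext_even_subspace] G_even)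

lemma pr0_gexp: "pr0 (gexp u c) = c"
proof -
  have "pr0 (gexp u c) = (\<Sum>k\<le>half_dim. if k = 0 then c else 0)"
    unfolding gexp_def pr0_simps
  proof (rule sum.cong[OF refl])
    fix k show "c * (1 / c) ^ k * pr0 (G u k) = (if k = 0 then c else 0)"
      using G_degree[of u k] by (cases "k = 0") (auto simp: pr0_simps pr0_def[of "G u k"] ext_degree_def)
  qed
  then show ?thesis by simp
qed

lemma pr2_gexp:
  assumes u: "u \<in> ext_degree 2" and c: "c \<noteq> 0" and n: "CARD('n) \<ge> 2"
  shows "pr2 (gexp u c) = u"
proof -
  have "pr2 (gexp u c) = (\<Sum>k\<le>half_dim. if k = 1 then u else 0)"
    unfolding gexp_def pr2_prd clin_rules[OF clin_prd]
  proof (rule sum.cong[OF refl])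
    fix k show "(c * (1 / c) ^ k) *s prd 2 (G u k) = (if k = 1 then u else 0)"
    proof (cases "k = 1")
      case True
      then show ?thesis using c G_one[OF u] prd_id[OF u] by simp
    next
      case False
      then have "prd 2 (G u k) = 0" by (intro prd_other[OF G_degree]) auto
      then show ?thesis using False by simp
    qed
  qed
  moreover have "half_dim \<ge> 1" using n by (simp add: half_dim_def)
  ultimately show ?thesis by simp
qed

lemma iota_gexp:
  assumes c: "c \<noteq> 0"
  shows "iota B y (gexp u c) = (1 / c) *s eps (ext_to_vec (iota B y u)) (gexp u c)"
proof -
  let ?v = "ext_to_vec (iota B y u)"
  \<comment> \<open>The term beyond the truncation is zero by degree, so shifting the index loses
    nothing.\<close>
  have big: "G u (Suc half_dim) = 0" by (rule G_large) (simp add: half_dim_def)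
  have "iota B y (gexp u c) = (\<Sum>k\<le>Suc half_dim. (c * (1 / c) ^ k) *s iota B y (G u k))"
    unfolding gexp_def iota_simps by (simp only: sum.atMost_Suc big) (simp add: iota_simps)
  also have "\<dots> = (\<Sum>k\<le>half_dim. (c * (1 / c) ^ Suc k) *s iota B y (G u (Suc k)))"
    by (subst sum.atMost_Suc_shift) simp
  also have "\<dots> = (1 / c) *s eps ?v (gexp u c)"
    unfolding gexp_def eps_simps vec.scale_sum_right iota_G by (rule sum.cong[OF refl]) (simp add: mult_ac)
  finally show ?thesis .
qed

text \<open>For nonzero g, y y g = 0 makes y isotropic. With z chosen so that y z + z y = 1 one gets
  g = y z g, and cyclicity brings y behind alpha(g), where alpha(g) y = 0. In
  \<open>gexp_Spin\<close> this excludes a kernel of 1 + S.\<close>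

lemma rev_pr0_isotropic:
  assumes y: "y \<noteq> 0" and yg: "ext_vec y \<star> g = 0"
  shows "pr0 (g \<star> ext_rev g) = 0"
proof (cases "g = 0")
  case True
  then show ?thesis by (simp add: cm_simps pr0_simps)
next
  case False
  have "B y y *s g = ext_vec y \<star> (ext_vec y \<star> g)" by (simp add: cmul_assoc[symmetric] vec_sq cm_simps cmul_one_left)
  then have iso: "B y y = 0" using yg False by (simp add: cm_simps)
  obtain z0 where z0: "B y z0 \<noteq> 0" using nondeg[of y] y by blast
  define z where "z = (1 / (2 * B y z0)) *s z0"
  have yz: "2 * B y z = 1" using z0 by (simp add: z_def B_simps)
  have "ext_vec y \<star> ext_vec z + ext_vec z \<star> ext_vec y = ext_one" using vec_anticomm[of y z] yz by simp
  then have "(ext_vec y \<star> ext_vec z + ext_vec z \<star> ext_vec y) \<star> g = g" by (simp add: cmul_one_left)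
  then have g: "g = ext_vec y \<star> (ext_vec z \<star> g)" using yg by (simp add: cm_simps cmul_assoc)
  have r: "ext_rev g \<star> ext_vec y = 0"
    using arg_cong[OF yg, of ext_rev] by (simp add: ext_rev_cm ext_rev_vec clin_rules[OF clin_ext_rev])
  have "pr0 (g \<star> ext_rev g) = pr0 (ext_vec y \<star> (ext_vec z \<star> g \<star> ext_rev g))" by (subst g) (simp add: cmul_assoc)
  also have "\<dots> = pr0 (ext_vec z \<star> g \<star> ext_rev g \<star> ext_vec y)" by (rule pr0_cyclic)
  also have "\<dots> = 0" by (simp add: cmul_assoc r cm_simps pr0_simps)
  finally show ?thesis .
qed

text \<open>The converse of \<open>Spin_iota\<close>. With S y the vector iota(y) u / c, contraction
  of g by y is exterior multiplication by S y, and T = (1 - S) / (1 + S) satisfies g x = (T x) g.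
  The norm of g then commutes with all vectors, so it is a scalar, and its scalar part is 1 by
  assumption.\<close>

lemma gexp_Spin:
  assumes c: "c \<noteq> 0" and N: "pr0 (gexp u c \<star> ext_rev (gexp u c)) = 1" and u: "u \<in> ext_even"
  shows "gexp u c \<in> Spin B"
proof -
  let ?g = "gexp u c"
  define S where "S = matrix (\<lambda>y. (1 / c) *s ext_to_vec (iota B y u))"
  have S: "S *v y = (1 / c) *s ext_to_vec (iota B y u)" for y
    unfolding S_def by (rule matrix_works, rule clinI) (simp_all add: iota_simps clin_rules[OF clin_ext_to_vec] vec.scale_right_distrib mult.commute)
  have ig: "iota B y ?g = eps (S *v y) ?g" for y
    unfolding iota_gexp[OF c] S by (simp add: eps_simps)
  have skew: "B (S *v x) y + B x (S *v y) = 0" for x y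
  proof -
    have "B (ext_to_vec (iota B x u)) y = pr0 (iota B y (iota B x u))" by (simp add: pr0_iota sym_B)
    moreover have "B x (ext_to_vec (iota B y u)) = pr0 (iota B x (iota B y u))" by (simp add: pr0_iota)
    ultimately show ?thesis using iota_anti[of x y u] by (simp add: S B_simps pr0_simps)
  qed
  \<comment> \<open>A kernel vector satisfies S y = - y, so exterior multiplication and contraction
    by y cancel on g, the Clifford product y g is 0, and g would have norm 0.\<close>
  have "y = 0" if "(mat 1 + S) *v y = 0" for y
  proof (rule ccontr)
    assume "y \<noteq> 0"
    have Sy: "S *v y = - y" using that by (simp add: matrix_vector_mult_add_rdistrib add_eq_0_iff)
    have "ext_vec y \<star> ?g = 0" by (simp add: vec_left ig Sy eps_simps)
    then show False using rev_pr0_isotropic[OF \<open>y \<noteq> 0\<close>] N by simp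
  qed
  then obtain C where "C ** (mat 1 + S) = mat 1" using matrix_left_invertible_ker[of "mat 1 + S"] by auto
  then have C: "(mat 1 + S) ** C = mat 1" by (simp add: matrix_left_right_inverse)
  define T where "T = (mat 1 - S) ** C"
  have xT: "x = C *v x + S *v (C *v x)" "T *v x = C *v x - S *v (C *v x)" for x
    using arg_cong[OF C, of "\<lambda>M. M *v x"]
    by (simp_all add: T_def matrix_vector_mul_assoc[symmetric] matrix_vector_mult_add_rdistrib matrix_vector_mult_diff_rdistrib)
  have gx: "?g \<star> ext_vec x = ext_vec (T *v x) \<star> ?g" for x
  proof -
    define p where "p = C *v x"
    have x: "x = p + S *v p" "T *v x = p - S *v p" using xT[of x] by (simp_all add: p_def)
    have "?g \<star> ext_vec x = eps x ?g - iota B x ?g" by (rule even_vec_right[OF gexp_even])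
    also have "\<dots> = eps (p + S *v p) ?g - iota B (p + S *v p) ?g" by (simp only: x(1)[symmetric])
    also have "\<dots> = eps (p - S *v p) ?g + iota B (p - S *v p) ?g"
      by (simp only: iota_simps eps_simps ig clin_rules[OF clin_mv]) (simp add: vec_eq_iff)
    also have "\<dots> = eps (T *v x) ?g + iota B (T *v x) ?g" by (simp only: x(2)[symmetric])
    finally show ?thesis by (simp add: vec_left)
  qed
  have TB: "B (T *v x) (T *v y) = B x y" for x y
  proof -
    define p q where "p = C *v x" and "q = C *v y"
    have x: "x = p + S *v p" "T *v x = p - S *v p" using xT[of x] by (simp_all add: p_def)
    have y: "y = q + S *v q" "T *v y = q - S *v q" using xT[of y] by (simp_all add: q_def)
    have "B (p - S *v p) (q - S *v q) = B (p + S *v p) (q + S *v q)"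
      using skew[of p q] by (simp add: B_simps add_eq_0_iff2)
    then show ?thesis using x y by metis
  qed
  have "inj ((*v) T)"
  proof (rule injI)
    fix x y assume e: "T *v x = T *v y"
    show "x = y"
    proof (rule B_ext)
      fix z show "B x z = B y z" using TB[of x z] TB[of y z] e by simp
    qed
  qed
  then have surj: "surj ((*v) T)" by (intro vec.linear_inj_imp_surj clin_mv)
  let ?h = "?g \<star> ext_rev ?g"
  have he: "?h \<in> ext_even" by (intro even_cm even_rev gexp_even)
  have com: "?h \<star> ext_vec x = ext_vec x \<star> ?h" for x
  proof -
    from surjD[OF surj, of x] obtain y where y: "x = T *v y" by blast
    have r: "ext_rev ?g \<star> ext_vec (T *v y) = ext_vec y \<star> ext_rev ?g"
      using arg_cong[OF gx[of y], of ext_rev] by (simp add: ext_rev_cm ext_rev_vec)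
    have "?h \<star> ext_vec x = ?g \<star> (ext_rev ?g \<star> ext_vec (T *v y))" by (simp add: y cmul_assoc)
    also have "\<dots> = (?g \<star> ext_vec y) \<star> ext_rev ?g" unfolding r by (simp add: cmul_assoc)
    also have "\<dots> = ext_vec x \<star> ?h" unfolding gx y by (simp add: cmul_assoc)
    finally show ?thesis .
  qed
  have "?h = pr0 ?h *s ext_one"
    by (rule even_commuting[OF he, of undefined]) (rule com)
  then have "?h = ext_one" using N by simp
  then show ?thesis using gx gexp_even by (auto simp: Spin_iff)
qed

lemma mult_cancel_inverses:
  fixes c d e :: complex
  assumes "d * d' = 1" "e * e' = 1"
  shows "(a * d * e) * (c * e' * (c * d') * b) = c ^ 2 * (b * a)"
proof -
  have "(a * d * e) * (c * e' * (c * d') * b) = (c * c * (b * a)) * ((d * d') * (e * e'))" by (simp only: mult_ac)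
  then show ?thesis by (simp only: assms power2_eq_square mult_1_right)
qed

text \<open>Its nonzero roots are the nonzero values of \<^const>\<open>pr0\<close> on the fibre of \<^const>\<open>pr2\<close> over \<open>u\<close>.\<close>

definition fibre_poly :: "'n ext \<Rightarrow> complex poly" where
  "fibre_poly u = (\<Sum>k\<le>half_dim. \<Sum>l\<le>half_dim. Polynomial.monom (pr0 (G u k \<star> ext_rev (G u l))) (2 * half_dim - k - l)) - Polynomial.monom 1 (2 * half_dim - 2)"

text \<open>The norm of \<open>gexp u c\<close> is c^2 times a polynomial in 1/c of degree at most
  2m; multiplying the equation "norm = 1" by c^(2m-2) clears the denominators, which explains the
  exponents in \<open>fibre_poly\<close>.\<close>

lemma poly_fibre_poly:
  assumes c: "c \<noteq> 0" and n: "CARD('n) \<ge> 2"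
  shows "c ^ 2 * poly (fibre_poly u) c = c ^ (2 * half_dim) * (pr0 (gexp u c \<star> ext_rev (gexp u c)) - 1)"
proof -
  have m: "half_dim \<ge> 1" using n by (simp add: half_dim_def)
  have "gexp u c \<star> ext_rev (gexp u c) = (\<Sum>l\<le>half_dim. \<Sum>k\<le>half_dim. (c * (1 / c) ^ l * (c * (1 / c) ^ k)) *s (G u k \<star> ext_rev (G u l)))"
    unfolding gexp_def clin_rules[OF clin_ext_rev] cm_simps vec.scale_sum_right vec.scale_scale ..
  then have "c ^ (2 * half_dim) * pr0 (gexp u c \<star> ext_rev (gexp u c)) =
      (\<Sum>l\<le>half_dim. \<Sum>k\<le>half_dim. c ^ (2 * half_dim) * (c * (1 / c) ^ l * (c * (1 / c) ^ k) * pr0 (G u k \<star> ext_rev (G u l))))"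
    by (simp only: pr0_simps sum_distrib_left)
  also have "\<dots> = (\<Sum>l\<le>half_dim. \<Sum>k\<le>half_dim. c ^ 2 * (pr0 (G u k \<star> ext_rev (G u l)) * c ^ (2 * half_dim - k - l)))"
  proof (intro sum.cong refl)
    fix l k assume "l \<in> {..half_dim}" "k \<in> {..half_dim}"
    then have "2 * half_dim = (2 * half_dim - k - l) + k + l" by auto
    then have "c ^ (2 * half_dim) = c ^ (2 * half_dim - k - l) * c ^ k * c ^ l" by (metis power_add)
    moreover have "c ^ k * (1 / c) ^ k = 1" "c ^ l * (1 / c) ^ l = 1" using c by (simp_all add: power_mult_distrib[symmetric])
    ultimately show "c ^ (2 * half_dim) * (c * (1 / c) ^ l * (c * (1 / c) ^ k) * pr0 (G u k \<star> ext_rev (G u l))) =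
        c ^ 2 * (pr0 (G u k \<star> ext_rev (G u l)) * c ^ (2 * half_dim - k - l))" by (simp only: mult_cancel_inverses)
  qed
  also have "\<dots> = c ^ 2 * (\<Sum>k\<le>half_dim. \<Sum>l\<le>half_dim. pr0 (G u k \<star> ext_rev (G u l)) * c ^ (2 * half_dim - k - l))"
    by (subst sum.swap) (simp only: sum_distrib_left)
  finally have e: "c ^ (2 * half_dim) * pr0 (gexp u c \<star> ext_rev (gexp u c)) =
      c ^ 2 * (\<Sum>k\<le>half_dim. \<Sum>l\<le>half_dim. pr0 (G u k \<star> ext_rev (G u l)) * c ^ (2 * half_dim - k - l))" .
  have "2 + (2 * half_dim - 2) = 2 * half_dim" using m by simp
  then have "c ^ (2 * half_dim) = c ^ 2 * c ^ (2 * half_dim - 2)" by (simp only: power_add[symmetric])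
  then show ?thesis unfolding fibre_poly_def right_diff_distrib e
    by (simp add: poly_sum poly_monom right_diff_distrib)
qed

lemma coeff_fibre_poly:
  "poly.coeff (fibre_poly u) j = (\<Sum>k\<le>half_dim. \<Sum>l\<le>half_dim. if 2 * half_dim - k - l = j then pr0 (G u k \<star> ext_rev (G u l)) else 0)
     - (if 2 * half_dim - 2 = j then 1 else 0)"
  by (simp add: fibre_poly_def coeff_sum)

lemma fibre_poly_monic:
  assumes n: "CARD('n) \<ge> 2"
  shows "Polynomial.degree (fibre_poly u) = 2 * half_dim" "poly.coeff (fibre_poly u) (2 * half_dim) = 1"
proof -
  have m: "half_dim \<ge> 1" using n by (simp add: half_dim_def)
  have top: "poly.coeff (fibre_poly u) (2 * half_dim) = 1"
  proof -
    have "(if 2 * half_dim - k - l = 2 * half_dim then pr0 (G u k \<star> ext_rev (G u l)) else 0) = (if k = 0 then (if l = 0 then 1 else 0) else 0)" for k l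
    proof (cases "k = 0 \<and> l = 0")
      case True
      then show ?thesis by (simp add: cmul_one_left pr0_simps pr0_rev)
    next
      case False
      then show ?thesis using m by auto
    qed
    then have "poly.coeff (fibre_poly u) (2 * half_dim) = (\<Sum>k\<le>half_dim. \<Sum>l\<le>half_dim. if k = 0 then (if l = 0 then 1 else 0) else 0)"
      using m unfolding coeff_fibre_poly by simp
    also have "\<dots> = (\<Sum>k\<le>half_dim. if k = 0 then (\<Sum>l\<le>half_dim. if l = 0 then 1 else 0) else 0)"
      by (rule sum.cong) auto
    finally show ?thesis by simp
  qed
  have "poly.coeff (fibre_poly u) j = 0" if "j > 2 * half_dim" for j
  proof -
    have "2 * half_dim - k - l \<noteq> j" for k l using that by linarith
    then show ?thesis using that by (simp add: coeff_fibre_poly)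
  qed
  then have "Polynomial.degree (fibre_poly u) \<le> 2 * half_dim" by (intro degree_le) auto
  moreover have "Polynomial.degree (fibre_poly u) \<ge> 2 * half_dim" using top by (intro le_degree) simp
  ultimately show "Polynomial.degree (fibre_poly u) = 2 * half_dim" by simp
  show "poly.coeff (fibre_poly u) (2 * half_dim) = 1" by (rule top)
qed

lemma fibre_poly_Spin:
  assumes n: "CARD('n) \<ge> 2" and g: "g \<in> Spin B" and c: "pr0 g \<noteq> 0"
  shows "poly (fibre_poly (pr2 g)) (pr0 g) = 0"
proof -
  have "gexp (pr2 g) (pr0 g) \<star> ext_rev (gexp (pr2 g) (pr0 g)) = ext_one"
    using g unfolding Spin_gexp[OF g c, symmetric] by (simp add: Spin_iff)
  then have "pr0 g ^ 2 * poly (fibre_poly (pr2 g)) (pr0 g) = 0" using poly_fibre_poly[OF c n, of "pr2 g"] by (simp add: pr0_simps)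
  then show ?thesis using c by simp
qed

lemma fibre_poly_root:
  assumes n: "CARD('n) \<ge> 2" and u: "u \<in> ext_degree 2" and c: "c \<noteq> 0" and r: "poly (fibre_poly u) c = 0"
  shows "gexp u c \<in> Spin B"
proof (rule gexp_Spin[OF c _ degree2_even[OF u]])
  have "c ^ (2 * half_dim) * (pr0 (gexp u c \<star> ext_rev (gexp u c)) - 1) = 0" using poly_fibre_poly[OF c n, of u] r by simp
  then show "pr0 (gexp u c \<star> ext_rev (gexp u c)) = 1" using c by simp
qed

text \<open>A point of \<open>\<wedge>\<^sup>2V\<close> with a full fibre, all of whose points lie on a maximal torus.\<close>

fun torus_elem :: "complex list \<Rightarrow> 'n list \<Rightarrow> 'n ext" where
  "torus_elem (t # ts) (a # b # L) = (ext_one + t *s (ext_vec (ob a) \<star> ext_vec (ob b))) \<star> torus_elem ts L"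
| "torus_elem ts L = ext_one"

fun torus_bivector :: "complex list \<Rightarrow> 'n list \<Rightarrow> 'n ext" where
  "torus_bivector (t # ts) (a # b # L) = t *s (ext_vec (ob a) \<star> ext_vec (ob b)) + torus_bivector ts L"
| "torus_bivector ts L = 0"

text \<open>Each factor 1 + t e_a e_b is the product of e_a and e_a + t e_b, with norm 1 +
  t^2.\<close>

lemma cgroup_torus_elem:
  "distinct L \<Longrightarrow> length L = 2 * length ts \<Longrightarrow> cgroup (torus_elem ts L) (\<Prod>t\<leftarrow>ts. 1 + t * t)"
proof (induction ts L rule: torus_elem.induct)
  case (1 t ts a b L)
  have "ext_vec (ob a) \<star> ext_vec (ob a + t *s ob b) = ext_one + t *s (ext_vec (ob a) \<star> ext_vec (ob b))"
    by (simp add: clin_rules[OF ext_vec_clin] cm_simps vec_sq ob)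
  moreover have "B (ob a) (ob a) * B (ob a + t *s ob b) (ob a + t *s ob b) = 1 + t * t"
    using 1(2) by (auto simp: B_simps ob)
  ultimately have "cgroup (ext_one + t *s (ext_vec (ob a) \<star> ext_vec (ob b))) (1 + t * t)"
    by (metis cgroup_pair)
  then show ?case using 1 by (simp add: cgroup_mult)
qed (auto simp: cgroup_one)

lemma torus_elem_iota_step:
  assumes "distinct (a # b # L)" "\<And>c. c \<notin> set L \<Longrightarrow> iota B (ob c) (torus_elem ts L) = 0"
  shows "torus_elem (t # ts) (a # b # L) = torus_elem ts L + t *s eps (ob a) (eps (ob b) (torus_elem ts L))"
proof -
  have z: "iota B (ob a) (torus_elem ts L) = 0" "iota B (ob b) (torus_elem ts L) = 0" "B (ob a) (ob b) = 0" using assms by (auto simp: ob)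
  have "ext_vec (ob a) \<star> (ext_vec (ob b) \<star> torus_elem ts L) = eps (ob a) (eps (ob b) (torus_elem ts L))"
    by (simp add: vec_left z iota_eps eps_simps)
  then show ?thesis by (simp add: cm_simps cmul_one_left cmul_assoc)
qed

lemma torus_elem_iota: "c \<notin> set L \<Longrightarrow> distinct L \<Longrightarrow> iota B (ob c) (torus_elem ts L) = 0"
proof (induction ts L arbitrary: c rule: torus_elem.induct)
  case (1 t ts a b L)
  then have ih: "\<And>c. c \<notin> set L \<Longrightarrow> iota B (ob c) (torus_elem ts L) = 0" by simp
  have "B (ob c) (ob a) = 0" "B (ob c) (ob b) = 0" "iota B (ob c) (torus_elem ts L) = 0" using 1 ih by (auto simp: ob)
  moreover have e: "torus_elem (t # ts) (a # b # L) = torus_elem ts L + t *s eps (ob a) (eps (ob b) (torus_elem ts L))"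
    using 1 ih by (intro torus_elem_iota_step) auto
  ultimately show ?case unfolding e by (simp add: iota_simps iota_eps eps_simps)
qed auto

lemma torus_elem_parts: "distinct L \<Longrightarrow> length L = 2 * length ts \<Longrightarrow> pr0 (torus_elem ts L) = 1 \<and> pr2 (torus_elem ts L) = torus_bivector ts L"
proof (induction ts L rule: torus_elem.induct)
  case (1 t ts a b L)
  have e: "torus_elem (t # ts) (a # b # L) = torus_elem ts L + t *s eps (ob a) (eps (ob b) (torus_elem ts L))"
    using 1(2) by (intro torus_elem_iota_step torus_elem_iota) auto
  have "eps (ob a) (eps (ob b) (prd 0 (torus_elem ts L))) = ext_vec (ob a) \<star> ext_vec (ob b)"
    using 1 by (auto simp: prd_0 eps_simps eps_one vec_left) (simp add: eps_one[symmetric] iota_eps ob eps_simps)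
  moreover have "prd 2 (eps (ob a) (eps (ob b) (torus_elem ts L))) = eps (ob a) (eps (ob b) (prd 0 (torus_elem ts L)))"
    unfolding numeral_2_eq_2 prd_eps ..
  ultimately show ?case unfolding e using 1 by (simp add: pr0_simps pr2_prd clin_rules[OF clin_prd])
next
  case "2_1"
  then show ?case by (simp add: pr0_simps pr2_prd prd_one)
qed (auto simp: pr0_simps pr2_prd prd_one)

lemma torus_bivector_scale: "c \<noteq> 0 \<Longrightarrow> c *s torus_bivector (map (\<lambda>t. t / c) ts) L = torus_bivector ts L"
  by (induction ts L rule: torus_bivector.induct) (auto simp: vec.scale_right_distrib)

lemma torus_bivector_degree: "distinct L \<Longrightarrow> length L = 2 * length ts \<Longrightarrow> torus_bivector ts L \<in> ext_degree 2"
  using torus_elem_parts pr2_degree by metis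

text \<open>If u has torus coordinates t, then c times the torus element with coordinates t / c lies
  over u, and its norm is c^2 times the product of all 1 + t^2 / c^2. Let the squares of the t be -
  r, for the roots r of a monic polynomial R of degree m: norm 1 then means R(c^2) =
  c^(2m-2).\<close>

lemma generic_fibre:
  assumes n: "CARD('n) \<ge> 2"
  shows "\<exists>u\<in>ext_degree 2. \<exists>C. finite C \<and> card C = 2 * half_dim \<and> 0 \<notin> C \<and> (\<forall>c\<in>C. poly (fibre_poly u) c = 0)"
proof -
  have m: "half_dim \<ge> 1" using n by (simp add: half_dim_def)
  obtain L0 :: "'n list" where L0: "distinct L0" "length L0 = CARD('n)" using full_list by metis
  \<comment> \<open>Basis vectors are needed in pairs: for odd n the last one is dropped.\<close>
  define L where "L = take (2 * half_dim) L0"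
  have L: "distinct L" "length L = 2 * half_dim" using L0 by (auto simp: L_def half_dim_def)
  \<comment> \<open>Chosen so that R(z) = z^(m-1) holds exactly for z = 1, ..., m; each such z gives
    the two values c with c^2 = z, hence 2m points.\<close>
  define R where "R = (\<Prod>j\<in>{1..half_dim}. [:- of_nat j, 1:]) + Polynomial.monom (1 :: complex) (half_dim - 1)"
  have dp: "Polynomial.degree (\<Prod>j\<in>{1..half_dim}. [:- of_nat j, 1 :: complex:]) = half_dim"
    by (subst degree_prod_eq_sum_degree) auto
  have lc: "poly.coeff (\<Prod>j\<in>{1..half_dim}. [:- of_nat j, 1 :: complex:]) half_dim = 1"
    using lead_coeff_prod[of "\<lambda>j. [:- of_nat j, 1 :: complex:]" "{1..half_dim}"] unfolding dp by simp
  have "Polynomial.degree (Polynomial.monom (1 :: complex) (half_dim - 1)) < half_dim" using m by (simp add: degree_monom_eq)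
  then have R: "Polynomial.degree R = half_dim" "poly.coeff R half_dim = 1"
    unfolding R_def using lc dp m by (auto simp: degree_add_eq_left)
  then have "R \<noteq> 0" using m by auto
  from alg_closed_imp_factorization[OF this] obtain A where A: "size A = Polynomial.degree R" "R = Polynomial.smult (poly.coeff R (Polynomial.degree R)) (\<Prod>x\<in>#A. [:-x, 1:])"
    by (elim exE conjE) (rule that)
  obtain rs where rs: "mset rs = A" using ex_mset by blast
  have lrs: "length rs = half_dim" using A(1) R(1) rs by (metis size_mset)
  have pR: "poly R z = (\<Prod>r\<leftarrow>rs. z - r)" for z
  proof -
    have "(\<Prod>x\<in>#mset rs. [:-x, 1:]) = (\<Prod>r\<leftarrow>rs. [:-r, 1:])" for rs :: "complex list"
      by (induction rs) auto
    then have "R = (\<Prod>r\<leftarrow>rs. [:-r, 1:])" using A(2) R by (simp add: rs[symmetric])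
    moreover have "poly (\<Prod>r\<leftarrow>rs. [:-r, 1:]) z = (\<Prod>r\<leftarrow>rs. z - r)" for rs
      by (induction rs) (auto simp: left_diff_distrib)
    ultimately show ?thesis by simp
  qed
  define ts where "ts = map (\<lambda>r. csqrt (- r)) rs"
  define u where "u = torus_bivector ts L"
  have u: "u \<in> ext_degree 2" unfolding u_def by (rule torus_bivector_degree[OF L(1)]) (simp add: L ts_def lrs)
  have root: "poly (fibre_poly u) c = 0" if c: "c ^ 2 = of_nat j" and j: "j \<in> {1..half_dim}" for c j
  proof -
    have c0: "c \<noteq> 0" using c j by auto
    let ?ts = "map (\<lambda>t. t / c) ts"
    have len: "length L = 2 * length ?ts" by (simp add: L ts_def lrs)
    have "(\<Prod>t\<leftarrow>?ts. 1 + t * t) = (\<Prod>r\<leftarrow>rs. (c ^ 2 - r) / c ^ 2)"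
    proof -
      have "1 + csqrt (- r) / c * (csqrt (- r) / c) = (c ^ 2 - r) / c ^ 2" for r
        using c0 power2_csqrt[of "- r"] by (simp add: power2_eq_square field_simps)
      then show ?thesis by (simp add: ts_def comp_def)
    qed
    also have "\<dots> = (\<Prod>r\<leftarrow>rs. c ^ 2 - r) / (c ^ 2) ^ length rs"
      by (induction rs) auto
    also have "\<dots> = poly R (c ^ 2) / (c ^ 2) ^ half_dim" by (simp add: pR lrs)
    also have "poly R (c ^ 2) = (c ^ 2) ^ (half_dim - 1)"
      unfolding R_def c using j by (auto simp: poly_prod poly_monom prod_zero_iff)
    also have "(c ^ 2) ^ (half_dim - 1) / (c ^ 2) ^ half_dim = 1 / c ^ 2"
      using m c0 by (cases half_dim) auto
    finally have N: "(\<Prod>t\<leftarrow>?ts. 1 + t * t) = 1 / c ^ 2" .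
    have "cgroup (c *s torus_elem ?ts L) (c * c * (1 / c ^ 2))"
      unfolding N[symmetric] by (intro cgroup_scale cgroup_torus_elem L(1) len)
    then have g: "c *s torus_elem ?ts L \<in> Spin B" using c0 by (intro cgroup_Spin) (simp add: power2_eq_square)
    have "pr0 (c *s torus_elem ?ts L) = c" "pr2 (c *s torus_elem ?ts L) = u"
      using torus_elem_parts[OF L(1) len] torus_bivector_scale[OF c0, of ts L] by (simp_all add: pr0_simps clin_rules[OF clin_pr2] u_def)
    then show ?thesis using fibre_poly_Spin[OF n g] c0 by simp
  qed
  define h where "h j = (of_real (sqrt (real j)) :: complex)" for j :: nat
  have hh: "h j ^ 2 = of_nat j" "(- h j) ^ 2 = of_nat j" for j
    by (simp_all add: h_def flip: of_real_power)
  define C where "C = h ` {1..half_dim} \<union> (\<lambda>j. - h j) ` {1..half_dim}"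
  have "card C = card (h ` {1..half_dim}) + card ((\<lambda>j. - h j) ` {1..half_dim})" unfolding C_def
  proof (rule card_Un_disjoint)
    have "h j \<noteq> - h k" if "j \<in> {1..half_dim}" for j k
    proof
      assume "h j = - h k"
      then have "of_real (sqrt (real j)) = (of_real (- sqrt (real k)) :: complex)" by (simp add: h_def)
      then have "sqrt (real j) = - sqrt (real k)" by (simp only: of_real_eq_iff)
      moreover have "sqrt (real j) > 0" "sqrt (real k) \<ge> 0" using that by auto
      ultimately show False by linarith
    qed
    then show "h ` {1..half_dim} \<inter> (\<lambda>j. - h j) ` {1..half_dim} = {}" by blast
  qed auto
  also have "card (h ` {1..half_dim}) = half_dim" by (subst card_image) (auto simp: inj_on_def h_def)
  also have "card ((\<lambda>j. - h j) ` {1..half_dim}) = half_dim" by (subst card_image) (auto simp: inj_on_def h_def)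
  finally have "card C = 2 * half_dim" by simp
  moreover have "poly (fibre_poly u) c = 0" if "c \<in> C" for c using that root hh unfolding C_def by blast
  moreover have "0 \<notin> C" by (auto simp: C_def h_def)
  moreover have "finite C" by (simp add: C_def)
  ultimately show ?thesis using u by blast
qed

section \<open>Linear independence of the powers of \<open>pr0\<close>\<close>

lemma poly_fun_fibre_poly: "poly_fun (\<lambda>u. poly (fibre_poly u) c)"
proof -
  have "poly_fun (\<lambda>u. pr0 (G u k \<star> ext_rev (G u l)))" for k l
    using poly_map_cm[OF poly_map_G[OF poly_map_id] poly_map_clin[OF clin_ext_rev poly_map_G[OF poly_map_id]], of k l]
    by (simp add: poly_map_def pr0_def)
  then show ?thesis unfolding fibre_poly_def poly_diff poly_sum poly_monom
    by (intro poly_fun_diff poly_fun_sum poly_fun.mult poly_fun.const)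
qed

text \<open>Over a fixed u the relation is a polynomial in c of degree less than 2m, and it vanishes
  at 2m points of the fibre.\<close>

lemma many_roots_zero:
  assumes n: "CARD('n) \<ge> 2" and u: "u \<in> ext_degree 2"
    and rel: "\<And>g. g \<in> Spin B \<Longrightarrow> (\<Sum>j<2 * half_dim. a j (pr2 g) * pr0 g ^ j) = 0"
    and D: "finite D" "card D \<ge> 2 * half_dim" "\<And>c. c \<in> D \<Longrightarrow> c \<noteq> 0 \<and> poly (fibre_poly u) c = 0" and j: "j < 2 * half_dim"
  shows "a j u = 0"
proof -
  define Q where "Q = (\<Sum>j<2 * half_dim. Polynomial.monom (a j u) j)"
  have "poly Q c = 0" if "c \<in> D" for c
  proof -
    have c: "c \<noteq> 0" "poly (fibre_poly u) c = 0" using D(3) that by auto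
    show ?thesis using rel[OF fibre_poly_root[OF n u c]]
      by (simp add: Q_def poly_sum poly_monom pr0_gexp pr2_gexp[OF u c(1) n])
  qed
  have cj: "poly.coeff Q i = (if i < 2 * half_dim then a i u else 0)" for i
    by (simp add: Q_def coeff_sum)
  have "Q = 0"
  proof (rule ccontr)
    assume Q: "Q \<noteq> 0"
    have "D \<subseteq> {x. poly Q x = 0}" using \<open>\<And>c. c \<in> D \<Longrightarrow> poly Q c = 0\<close> by blast
    then have "card D \<le> card {x. poly Q x = 0}" using poly_roots_finite[OF Q] by (rule card_mono[rotated])
    also have "\<dots> \<le> Polynomial.degree Q" by (rule card_poly_roots_bound[OF Q])
    finally have "2 * half_dim \<le> Polynomial.degree Q" using D(2) by simp
    moreover have "Polynomial.degree Q < 2 * half_dim"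
    proof (rule ccontr)
      assume "\<not> Polynomial.degree Q < 2 * half_dim"
      then have "poly.coeff Q (Polynomial.degree Q) = 0" by (simp add: cj)
      then show False using Q by simp
    qed
    ultimately show False by simp
  qed
  then show ?thesis using cj[of j] j by simp
qed

text \<open>If all roots had distance at least e from c, the factorization of the monic polynomial
  would give modulus at least e^(2m) at c. This is continuity of roots with an explicit
  bound.\<close>

lemma root_near:
  assumes n: "CARD('n) \<ge> 2" and e: "e > 0" and small: "norm (poly (fibre_poly u) c) < e ^ (2 * half_dim)"
  shows "\<exists>r. poly (fibre_poly u) r = 0 \<and> dist c r < e"
proof (rule ccontr)
  assume no: "\<nexists>r. poly (fibre_poly u) r = 0 \<and> dist c r < e"
  have "fibre_poly u \<noteq> 0" using fibre_poly_monic(2)[OF n, of u] by auto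
  from alg_closed_imp_factorization[OF this] obtain A where A: "size A = Polynomial.degree (fibre_poly u)"
      "fibre_poly u = Polynomial.smult (poly.coeff (fibre_poly u) (Polynomial.degree (fibre_poly u))) (\<Prod>x\<in>#A. [:-x, 1:])"
    by (elim exE conjE) (rule that)
  then have PA: "fibre_poly u = (\<Prod>x\<in>#A. [:-x, 1:])" "size A = 2 * half_dim" using fibre_poly_monic[OF n, of u] by auto
  have pA: "poly (\<Prod>x\<in>#A. [:-x, 1:]) z = (\<Prod>x\<in>#A. z - x)" for z :: complex and A
    by (induction A) (auto simp: left_diff_distrib)
  have far: "e \<le> norm (c - x)" if "x \<in># A" for x
  proof -
    have "poly (fibre_poly u) x = 0" unfolding PA(1) pA using that by (auto simp: prod_mset_zero_iff)
    then show ?thesis using no by (force simp: dist_norm)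
  qed
  have prd_ge: "(\<forall>x\<in>#M. e \<le> norm (c - x)) \<longrightarrow> e ^ size M \<le> norm (\<Prod>x\<in>#M. c - x)" for M
  proof (induction M)
    case (add x M)
    then show ?case using e by (auto simp: norm_mult intro!: mult_mono)
  qed simp
  have "e ^ size A \<le> norm (\<Prod>x\<in>#A. c - x)" using far prd_ge[of A] by blast
  then have "e ^ (2 * half_dim) \<le> norm (poly (fibre_poly u) c)" unfolding PA(1) pA PA(2) .
  then show False using small by simp
qed

theorem spin_coordinates_independent:
  assumes n: "CARD('n) \<ge> 2" and a: "\<And>j. poly_fun (a j)"
    and rel: "\<And>g. g \<in> Spin B \<Longrightarrow> (\<Sum>j<2 * half_dim. a j (pr2 g) * pr0 g ^ j) = 0"
    and j: "j < 2 * half_dim" and u1: "u1 \<in> ext_degree 2"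
  shows "a j u1 = 0"
proof -
  obtain u0 C where u0: "u0 \<in> ext_degree 2" and C: "finite C" "card C = 2 * half_dim" "0 \<notin> C" "\<And>c. c \<in> C \<Longrightarrow> poly (fibre_poly u0) c = 0"
    using generic_fibre[OF n] by blast
  define \<gamma> where "\<gamma> t = u0 + t *s (u1 - u0)" for t
  have \<gamma>L: "\<gamma> t \<in> ext_degree 2" for t
    unfolding \<gamma>_def using u0 u1 ext_degree_subspace[of 2]
    by (intro vec.subspace_add vec.subspace_scale vec.subspace_diff) auto
  have h\<gamma>: "holo_curve \<gamma>" by (auto simp: holo_curve_def \<gamma>_def intro!: holomorphic_intros)
  \<comment> \<open>The open discs of radius e around the points of C are disjoint and avoid 0, so
    the roots found in them are distinct and nonzero.\<close>
  have "\<exists>e>0. (\<forall>c\<in>C. e \<le> norm c) \<and> (\<forall>c\<in>C. \<forall>d\<in>C. c \<noteq> d \<longrightarrow> 2 * e \<le> dist c d)"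
  proof -
    let ?M = "insert 1 (norm ` C \<union> (\<lambda>(c, d). dist c d / 2) ` {p \<in> C \<times> C. fst p \<noteq> snd p})"
    have fin: "finite ?M" using C(1) by auto
    have "Min ?M > 0" using fin C(3) by (subst Min_gr_iff) auto
    moreover have "Min ?M \<le> norm c" if "c \<in> C" for c using that fin by (intro Min_le) auto
    moreover have "2 * Min ?M \<le> dist c d" if "c \<in> C" "d \<in> C" "c \<noteq> d" for c d
    proof -
      have "dist c d / 2 \<in> ?M" using that by (auto intro!: image_eqI[of _ _ "(c, d)"])
      then have "Min ?M \<le> dist c d / 2" using fin by (intro Min_le)
      then show ?thesis by simp
    qed
    ultimately show ?thesis by blast
  qed
  then obtain e where e: "e > 0" "\<And>c. c \<in> C \<Longrightarrow> e \<le> norm c" "\<And>c d. c \<in> C \<Longrightarrow> d \<in> C \<Longrightarrow> c \<noteq> d \<Longrightarrow> 2 * e \<le> dist c d"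
    by blast
  have "eventually (\<lambda>t. \<forall>c\<in>C. norm (poly (fibre_poly (\<gamma> t)) c) < e ^ (2 * half_dim)) (nhds 0)"
  proof (rule eventually_ball_finite[OF C(1)], rule ballI)
    fix c assume c: "c \<in> C"
    have "(\<lambda>t. poly (fibre_poly (\<gamma> t)) c) holomorphic_on UNIV" by (rule holo_curve_poly[OF poly_fun_fibre_poly h\<gamma>])
    then have "continuous_on UNIV (\<lambda>t. norm (poly (fibre_poly (\<gamma> t)) c))"
      by (intro continuous_on_norm holomorphic_on_imp_continuous_on)
    then have "isCont (\<lambda>t. norm (poly (fibre_poly (\<gamma> t)) c)) 0" by (simp add: continuous_on_eq_continuous_at)
    then have "((\<lambda>t. norm (poly (fibre_poly (\<gamma> t)) c)) \<longlongrightarrow> norm (poly (fibre_poly (\<gamma> 0)) c)) (nhds 0)"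
      unfolding continuous_at by (rule tendsto_at_iff_tendsto_nhds[THEN iffD1])
    then show "eventually (\<lambda>t. norm (poly (fibre_poly (\<gamma> t)) c) < e ^ (2 * half_dim)) (nhds 0)"
      using e(1) C(4)[OF c] by (intro order_tendstoD(2)[where y = "norm (poly (fibre_poly (\<gamma> 0)) c)"]) (auto simp: \<gamma>_def)
  qed
  then have "eventually (\<lambda>t. a j (\<gamma> t) = 0) (nhds 0)"
  proof (rule eventually_mono)
    fix t assume t: "\<forall>c\<in>C. norm (poly (fibre_poly (\<gamma> t)) c) < e ^ (2 * half_dim)"
    have "\<forall>c\<in>C. \<exists>r. poly (fibre_poly (\<gamma> t)) r = 0 \<and> dist c r < e" using t root_near[OF n e(1)] by blast
    then obtain r where r: "\<And>c. c \<in> C \<Longrightarrow> poly (fibre_poly (\<gamma> t)) (r c) = 0 \<and> dist c (r c) < e" by metis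
    have "inj_on r C"
    proof (rule inj_onI, rule ccontr)
      fix c d assume cd: "c \<in> C" "d \<in> C" "r c = r d" "c \<noteq> d"
      have "dist c d \<le> dist c (r c) + dist d (r d)" using dist_triangle2[of c d "r c"] cd(3) by simp
      then show False using r[OF cd(1)] r[OF cd(2)] e(3)[OF cd(1,2,4)] by linarith
    qed
    then have "card (r ` C) = 2 * half_dim" by (simp add: card_image C)
    moreover have "r c \<noteq> 0" if "c \<in> C" for c
      using r[OF that] e(2)[OF that] by (auto simp: dist_norm)
    ultimately show "a j (\<gamma> t) = 0"
      using C(1) r j by (intro many_roots_zero[OF n \<gamma>L rel, of "r ` C"]) auto
  qed
  then obtain S where S: "open S" "0 \<in> S" "\<And>t. t \<in> S \<Longrightarrow> a j (\<gamma> t) = 0" by (auto simp: eventually_nhds)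
  have "a j (\<gamma> 1) = 0"
    using analytic_continuation_open[of S UNIV "\<lambda>t. a j (\<gamma> t)" "\<lambda>_. 0" 1] S holo_curve_poly[OF a h\<gamma>] by auto
  then show ?thesis by (simp add: \<gamma>_def)
qed

end

section \<open>Rings of rational functions\<close>

text \<open>Unlike in \<^const>\<open>regular_funs\<close> and \<^const>\<open>denominators\<close>, the functions are not required to be
  undefined outside \<open>Y\<close>.\<close>

definition reg :: "(complex^'m::finite) set \<Rightarrow> (complex^'m \<Rightarrow> complex) \<Rightarrow> bool" where
  "reg Y f \<longleftrightarrow> (\<exists>p. poly_fun p \<and> (\<forall>x\<in>Y. f x = p x))"

definition den :: "(complex^'m::finite) set \<Rightarrow> (complex^'m \<Rightarrow> complex) \<Rightarrow> bool" where
  "den Y q \<longleftrightarrow> reg Y q \<and> (\<forall>r. reg Y r \<longrightarrow> (\<forall>x\<in>Y. r x * q x = 0) \<longrightarrow> (\<forall>x\<in>Y. r x = 0))"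

lemma reg_poly: "poly_fun f \<Longrightarrow> reg Y f"
  by (auto simp: reg_def)

lemma reg_const: "reg Y (\<lambda>_. c)"
  by (intro reg_poly poly_fun.const)

lemma reg_cong: "reg Y f \<Longrightarrow> (\<And>x. x \<in> Y \<Longrightarrow> g x = f x) \<Longrightarrow> reg Y g"
  by (auto simp: reg_def)

lemma reg_binop:
  assumes h: "\<And>p q :: complex^'m::finite \<Rightarrow> complex. poly_fun p \<Longrightarrow> poly_fun q \<Longrightarrow> poly_fun (\<lambda>x. h (p x) (q x))"
    and f: "reg Y f" and g: "reg Y g"
  shows "reg Y (\<lambda>x :: complex^'m. h (f x) (g x))"
proof -
  obtain p where p: "poly_fun p" "\<forall>x\<in>Y. f x = p x" using f by (auto simp: reg_def)
  obtain q where q: "poly_fun q" "\<forall>x\<in>Y. g x = q x" using g by (auto simp: reg_def)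
  show ?thesis by (rule reg_cong[OF reg_poly[OF h[OF p(1) q(1)]]]) (simp add: p(2) q(2))
qed

lemma reg_add: "reg Y f \<Longrightarrow> reg Y g \<Longrightarrow> reg Y (\<lambda>x. f x + g x)"
  by (rule reg_binop[OF poly_fun.add])

lemma reg_mult: "reg Y f \<Longrightarrow> reg Y g \<Longrightarrow> reg Y (\<lambda>x. f x * g x)"
  by (rule reg_binop[OF poly_fun.mult])

lemma reg_diff: "reg Y f \<Longrightarrow> reg Y g \<Longrightarrow> reg Y (\<lambda>x. f x - g x)"
  by (rule reg_binop[OF poly_fun_diff])

lemma reg_uminus: assumes "reg Y f" shows "reg Y (\<lambda>x. - f x)"
  by (rule reg_cong[OF reg_diff[OF reg_const[of Y 0] assms]]) simp

lemma reg_power: assumes "reg Y f" shows "reg Y (\<lambda>x. f x ^ k)"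
proof (induction k)
  case (Suc k)
  show ?case by (rule reg_cong[OF reg_mult[OF assms Suc]]) simp
qed (simp add: reg_const)

lemma reg_sum: "(\<And>i. i \<in> A \<Longrightarrow> reg Y (f i)) \<Longrightarrow> reg Y (\<lambda>x. \<Sum>i\<in>A. f i x)"
proof (induction A rule: infinite_finite_induct)
  case (insert i A)
  then show ?case using reg_add[of Y "f i" "\<lambda>x. \<Sum>i\<in>A. f i x"] by simp
qed (simp_all add: reg_const)

lemmas reg_intros = reg_const reg_add reg_mult reg_diff reg_power reg_sum

lemma regular_funs_reg: "f \<in> regular_funs Y \<Longrightarrow> reg Y f"
  by (auto simp: regular_funs_def reg_def)

lemma reg_regular_funs: "reg Y f \<Longrightarrow> restrict f Y \<in> regular_funs Y"
proof -
  assume "reg Y f"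
  then obtain p where p: "poly_fun p" "\<forall>x\<in>Y. f x = p x" by (auto simp: reg_def)
  have "restrict f Y = restrict p Y" by (rule restrict_ext) (simp add: p(2))
  then show ?thesis using p(1) by (auto simp: regular_funs_def)
qed

lemma denominators_den: "q \<in> denominators Y \<Longrightarrow> den Y q"
  unfolding den_def
proof (intro conjI allI impI ballI)
  assume q: "q \<in> denominators Y"
  then show "reg Y q" by (simp add: denominators_def regular_funs_reg)
  fix r x assume r: "reg Y r" "\<forall>x\<in>Y. r x * q x = 0" and x: "x \<in> Y"
  have "\<forall>x\<in>Y. restrict r Y x * q x = 0" using r(2) by simp
  then have "\<forall>x\<in>Y. restrict r Y x = 0" using q reg_regular_funs[OF r(1)] unfolding denominators_def by blast
  then show "r x = 0" using x by simp
qed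

lemma den_denominators: "den Y q \<Longrightarrow> restrict q Y \<in> denominators Y"
  unfolding denominators_def
proof (intro CollectI conjI ballI impI)
  assume q: "den Y q"
  then show "restrict q Y \<in> regular_funs Y" by (simp add: den_def reg_regular_funs)
  fix r x assume r: "r \<in> regular_funs Y" "\<forall>x\<in>Y. r x * restrict q Y x = 0" and x: "x \<in> Y"
  have "\<forall>x\<in>Y. r x * q x = 0" using r(2) by simp
  then show "r x = 0" using q regular_funs_reg[OF r(1)] x unfolding den_def by blast
qed

lemma den_reg: "den Y q \<Longrightarrow> reg Y q"
  by (simp add: den_def)

lemma den_one: "den Y (\<lambda>_. 1)"
  by (simp add: den_def reg_const)

lemma den_const: "c \<noteq> 0 \<Longrightarrow> den Y (\<lambda>_. c)"
  by (simp add: den_def reg_const)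

lemma den_cancel: "den Y q \<Longrightarrow> reg Y r \<Longrightarrow> (\<And>x. x \<in> Y \<Longrightarrow> r x * q x = 0) \<Longrightarrow> x \<in> Y \<Longrightarrow> r x = 0"
  unfolding den_def by blast

lemma den_mult: "den Y q \<Longrightarrow> den Y q' \<Longrightarrow> den Y (\<lambda>x. q x * q' x)"
proof -
  assume q: "den Y q" "den Y q'"
  have "r x = 0" if r: "reg Y r" "\<forall>x\<in>Y. r x * (q x * q' x) = 0" and x: "x \<in> Y" for r x
  proof (rule den_cancel[OF q(1) r(1) _ x])
    fix y assume "y \<in> Y"
    then show "r y * q y = 0"
      using r(2) by (intro den_cancel[OF q(2) reg_mult[OF r(1) den_reg[OF q(1)]]]) (simp_all add: mult.assoc)
  qed
  moreover have "reg Y (\<lambda>x. q x * q' x)" by (intro reg_mult den_reg q)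
  ultimately show ?thesis unfolding den_def by blast
qed

lemmas reg_simps = reg_intros reg_uminus den_one den_mult den_reg

lemma frac_mem: "(a, b) \<in> rat_frac Y p q \<Longrightarrow> reg Y a \<and> den Y b \<and> (\<forall>x\<in>Y. a x * q x = p x * b x)"
  by (simp add: rat_frac_def regular_funs_reg denominators_den)

lemma frac_self: "reg Y p \<Longrightarrow> den Y q \<Longrightarrow> (restrict p Y, restrict q Y) \<in> rat_frac Y p q"
  by (simp add: rat_frac_def reg_regular_funs den_denominators)

text \<open>A class consists of all fractions equal to p / q, so two inclusions are needed.
  Cross-multiplied equations compose only after cancelling a denominator, which is possible because
  denominators are not zero divisors.\<close>

lemma frac_eqI:
  assumes p: "reg Y p" "den Y q" and p': "reg Y p'" "den Y q'" and e: "\<And>x. x \<in> Y \<Longrightarrow> p x * q' x = p' x * q x"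
  shows "rat_frac Y p q = rat_frac Y p' q'"
proof -
  have "\<forall>x\<in>Y. a x * q2 x = p2 x * b x"
    if pq: "reg Y p1" "den Y q1" "reg Y p2" "den Y q2" and e: "\<And>x. x \<in> Y \<Longrightarrow> p1 x * q2 x = p2 x * q1 x"
      and ab: "reg Y a" "den Y b" "\<forall>x\<in>Y. a x * q1 x = p1 x * b x" for p1 q1 p2 q2 a b
  proof
    fix x assume x: "x \<in> Y"
    have "a x * q2 x - p2 x * b x = 0"
    proof (rule den_cancel[OF pq(2) _ _ x])
      show "reg Y (\<lambda>x. a x * q2 x - p2 x * b x)" using pq ab by (simp add: reg_simps)
      fix y assume y: "y \<in> Y"
      have "(a y * q2 y - p2 y * b y) * q1 y = (a y * q1 y) * q2 y - (p2 y * q1 y) * b y" by (simp add: algebra_simps)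
      also have "\<dots> = (p1 y * b y) * q2 y - (p1 y * q2 y) * b y" using ab(3) e y by simp
      finally show "(a y * q2 y - p2 y * b y) * q1 y = 0" by simp
    qed
    then show "a x * q2 x = p2 x * b x" by simp
  qed
  from this[OF p p' e] this[OF p' p e[symmetric]] show ?thesis
    unfolding rat_frac_def by (auto simp: regular_funs_reg denominators_den)
qed

lemma frac_eqD:
  assumes "rat_frac Y p q = rat_frac Y p' q'" "reg Y p" "den Y q" "x \<in> Y"
  shows "p x * q' x = p' x * q x"
  using frac_self[OF assms(2,3)] frac_mem[of "restrict p Y" "restrict q Y" Y p' q'] assms by auto

lemma frac_carrier: "reg Y p \<Longrightarrow> den Y q \<Longrightarrow> rat_frac Y p q \<in> carrier (rat_ring Y)"
proof -
  assume "reg Y p" "den Y q"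
  moreover from this have "rat_frac Y p q = rat_frac Y (restrict p Y) (restrict q Y)" by (simp add: rat_frac_def)
  ultimately show ?thesis unfolding rat_ring_def
    using reg_regular_funs[of Y p] den_denominators[of Y q] by auto
qed

lemma frac_cases:
  assumes "F \<in> carrier (rat_ring Y)"
  obtains p q where "F = rat_frac Y p q" "reg Y p" "den Y q"
  using assms by (auto simp: rat_ring_def regular_funs_reg denominators_den)

text \<open>Ring operations and pullbacks of classes are unions over representatives; such a union
  collapses once its members do not depend on the representative, and \<open>frac_self\<close>
  provides a representative.\<close>

lemma frac_Union:
  assumes "reg Y p" "den Y q" "\<And>a b. (a, b) \<in> rat_frac Y p q \<Longrightarrow> H a b = E"
  shows "(\<Union>(a, b)\<in>rat_frac Y p q. H a b) = E"
  using frac_self[OF assms(1,2)] assms(3) by fastforce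

lemma frac_mult:
  assumes p: "reg Y p" "den Y q" and p': "reg Y p'" "den Y q'"
  shows "rat_frac Y p q \<otimes>\<^bsub>rat_ring Y\<^esub> rat_frac Y p' q' = rat_frac Y (\<lambda>x. p x * p' x) (\<lambda>x. q x * q' x)"
proof -
  have "rat_frac Y (\<lambda>x. a x * a' x) (\<lambda>x. b x * b' x) = rat_frac Y (\<lambda>x. p x * p' x) (\<lambda>x. q x * q' x)"
    if "(a, b) \<in> rat_frac Y p q" "(a', b') \<in> rat_frac Y p' q'" for a b a' b'
  proof (rule frac_eqI)
    have 1: "\<forall>x\<in>Y. a x * q x = p x * b x" "\<forall>x\<in>Y. a' x * q' x = p' x * b' x" using that frac_mem by blast+
    fix x assume x: "x \<in> Y"
    have "a x * a' x * (q x * q' x) = (a x * q x) * (a' x * q' x)" by (simp add: mult_ac)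
    also have "\<dots> = p x * p' x * (b x * b' x)" using 1 x by (simp add: mult_ac)
    finally show "a x * a' x * (q x * q' x) = p x * p' x * (b x * b' x)" .
  qed (use that[THEN frac_mem] p p' in \<open>simp_all add: reg_simps\<close>)
  then show ?thesis unfolding rat_ring_def by (simp add: frac_Union[OF p] frac_Union[OF p'])
qed

lemma frac_add:
  assumes p: "reg Y p" "den Y q" and p': "reg Y p'" "den Y q'"
  shows "rat_frac Y p q \<oplus>\<^bsub>rat_ring Y\<^esub> rat_frac Y p' q' = rat_frac Y (\<lambda>x. p x * q' x + p' x * q x) (\<lambda>x. q x * q' x)"
proof -
  have "rat_frac Y (\<lambda>x. a x * b' x + a' x * b x) (\<lambda>x. b x * b' x) = rat_frac Y (\<lambda>x. p x * q' x + p' x * q x) (\<lambda>x. q x * q' x)"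
    if "(a, b) \<in> rat_frac Y p q" "(a', b') \<in> rat_frac Y p' q'" for a b a' b'
  proof (rule frac_eqI)
    have 1: "\<forall>x\<in>Y. a x * q x = p x * b x" "\<forall>x\<in>Y. a' x * q' x = p' x * b' x" using that frac_mem by blast+
    fix x assume x: "x \<in> Y"
    have "(a x * b' x + a' x * b x) * (q x * q' x) = (a x * q x) * (b' x * q' x) + (a' x * q' x) * (b x * q x)" by (simp add: algebra_simps)
    also have "\<dots> = (p x * q' x + p' x * q x) * (b x * b' x)" using 1 x by (simp add: algebra_simps)
    finally show "(a x * b' x + a' x * b x) * (q x * q' x) = (p x * q' x + p' x * q x) * (b x * b' x)" .
  qed (use that[THEN frac_mem] p p' in \<open>simp_all add: reg_simps\<close>)
  then show ?thesis unfolding rat_ring_def by (simp add: frac_Union[OF p] frac_Union[OF p'])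
qed

lemma frac_add_same:
  assumes "reg Y p" "reg Y p'" "den Y q"
  shows "rat_frac Y p q \<oplus>\<^bsub>rat_ring Y\<^esub> rat_frac Y p' q = rat_frac Y (\<lambda>x. p x + p' x) q"
  unfolding frac_add[OF assms(1,3,2,3)]
  by (rule frac_eqI) (use assms in \<open>simp_all add: reg_simps algebra_simps\<close>)

lemma rat_ring_zero: "\<zero>\<^bsub>rat_ring Y\<^esub> = rat_frac Y (\<lambda>_. 0) (\<lambda>_. 1)"
  and rat_ring_one: "\<one>\<^bsub>rat_ring Y\<^esub> = rat_frac Y (\<lambda>_. 1) (\<lambda>_. 1)"
  by (simp_all add: rat_ring_def)

lemma frac_zero_iff:
  assumes "reg Y p" "den Y q"
  shows "rat_frac Y p q = \<zero>\<^bsub>rat_ring Y\<^esub> \<longleftrightarrow> (\<forall>x\<in>Y. p x = 0)"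
proof
  assume "rat_frac Y p q = \<zero>\<^bsub>rat_ring Y\<^esub>"
  then show "\<forall>x\<in>Y. p x = 0" using frac_eqD[of Y p q "\<lambda>_. 0" "\<lambda>_. 1"] assms by (simp add: rat_ring_zero)
next
  assume "\<forall>x\<in>Y. p x = 0"
  then show "rat_frac Y p q = \<zero>\<^bsub>rat_ring Y\<^esub>" unfolding rat_ring_zero
    using assms by (intro frac_eqI) (auto intro: reg_const den_one)
qed

theorem rat_ring_cring: "cring (rat_ring Y)"
proof (rule cringI)
  show "abelian_group (rat_ring Y)"
  proof (rule abelian_groupI)
    fix F G H assume "F \<in> carrier (rat_ring Y)" "G \<in> carrier (rat_ring Y)" "H \<in> carrier (rat_ring Y)"
    then obtain a b c d e f where s: "F = rat_frac Y a b" "G = rat_frac Y c d" "H = rat_frac Y e f"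
        and r: "reg Y a" "den Y b" "reg Y c" "den Y d" "reg Y e" "den Y f"
      by (auto elim!: frac_cases)
    show "F \<oplus>\<^bsub>rat_ring Y\<^esub> G \<oplus>\<^bsub>rat_ring Y\<^esub> H = F \<oplus>\<^bsub>rat_ring Y\<^esub> (G \<oplus>\<^bsub>rat_ring Y\<^esub> H)"
      using r unfolding s by (simp add: frac_add reg_simps algebra_simps)
  next
    fix F G assume "F \<in> carrier (rat_ring Y)" "G \<in> carrier (rat_ring Y)"
    then obtain a b c d where s: "F = rat_frac Y a b" "G = rat_frac Y c d"
        and r: "reg Y a" "den Y b" "reg Y c" "den Y d"
      by (auto elim!: frac_cases)
    show "F \<oplus>\<^bsub>rat_ring Y\<^esub> G \<in> carrier (rat_ring Y)"
      using r unfolding s by (simp add: frac_add reg_simps frac_carrier)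
    show "F \<oplus>\<^bsub>rat_ring Y\<^esub> G = G \<oplus>\<^bsub>rat_ring Y\<^esub> F"
      using r unfolding s by (simp add: frac_add algebra_simps)
  next
    show "\<zero>\<^bsub>rat_ring Y\<^esub> \<in> carrier (rat_ring Y)" by (simp add: rat_ring_zero frac_carrier reg_const den_one)
    fix F assume "F \<in> carrier (rat_ring Y)"
    then obtain a b where s: "F = rat_frac Y a b" and r: "reg Y a" "den Y b" by (auto elim!: frac_cases)
    show "\<zero>\<^bsub>rat_ring Y\<^esub> \<oplus>\<^bsub>rat_ring Y\<^esub> F = F"
      using r unfolding s rat_ring_zero by (simp add: frac_add reg_const den_one)
    have "rat_frac Y (\<lambda>x. - a x) b \<oplus>\<^bsub>rat_ring Y\<^esub> F = \<zero>\<^bsub>rat_ring Y\<^esub>"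
      using r unfolding s by (simp add: frac_add_same reg_uminus) (simp add: frac_zero_iff reg_const)
    then show "\<exists>G\<in>carrier (rat_ring Y). G \<oplus>\<^bsub>rat_ring Y\<^esub> F = \<zero>\<^bsub>rat_ring Y\<^esub>"
      using r by (intro bexI) (auto intro: frac_carrier reg_uminus)
  qed
  show "comm_monoid (rat_ring Y)"
  proof (rule comm_monoidI)
    fix F G H assume "F \<in> carrier (rat_ring Y)" "G \<in> carrier (rat_ring Y)" "H \<in> carrier (rat_ring Y)"
    then obtain a b c d e f where s: "F = rat_frac Y a b" "G = rat_frac Y c d" "H = rat_frac Y e f"
        and r: "reg Y a" "den Y b" "reg Y c" "den Y d" "reg Y e" "den Y f"
      by (auto elim!: frac_cases)
    show "F \<otimes>\<^bsub>rat_ring Y\<^esub> G \<otimes>\<^bsub>rat_ring Y\<^esub> H = F \<otimes>\<^bsub>rat_ring Y\<^esub> (G \<otimes>\<^bsub>rat_ring Y\<^esub> H)"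
      using r unfolding s by (simp add: frac_mult reg_simps mult_ac)
  next
    fix F G assume "F \<in> carrier (rat_ring Y)" "G \<in> carrier (rat_ring Y)"
    then obtain a b c d where s: "F = rat_frac Y a b" "G = rat_frac Y c d"
        and r: "reg Y a" "den Y b" "reg Y c" "den Y d"
      by (auto elim!: frac_cases)
    show "F \<otimes>\<^bsub>rat_ring Y\<^esub> G \<in> carrier (rat_ring Y)"
      using r unfolding s by (simp add: frac_mult reg_intros den_mult frac_carrier)
    show "F \<otimes>\<^bsub>rat_ring Y\<^esub> G = G \<otimes>\<^bsub>rat_ring Y\<^esub> F"
      using r unfolding s by (simp add: frac_mult mult.commute)
  next
    show "\<one>\<^bsub>rat_ring Y\<^esub> \<in> carrier (rat_ring Y)" by (simp add: rat_ring_one frac_carrier reg_const den_one)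
    fix F assume "F \<in> carrier (rat_ring Y)"
    then obtain a b where s: "F = rat_frac Y a b" and r: "reg Y a" "den Y b" by (auto elim!: frac_cases)
    show "\<one>\<^bsub>rat_ring Y\<^esub> \<otimes>\<^bsub>rat_ring Y\<^esub> F = F"
      using r unfolding s rat_ring_one by (simp add: frac_mult reg_const den_one)
  qed
  fix F G H assume "F \<in> carrier (rat_ring Y)" "G \<in> carrier (rat_ring Y)" "H \<in> carrier (rat_ring Y)"
  then obtain a b c d e f where s: "F = rat_frac Y a b" "G = rat_frac Y c d" "H = rat_frac Y e f"
      and r: "reg Y a" "den Y b" "reg Y c" "den Y d" "reg Y e" "den Y f"
    by (auto elim!: frac_cases)
  have "rat_frac Y (\<lambda>x. (a x * d x + c x * b x) * e x) (\<lambda>x. (b x * d x) * f x) =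
      rat_frac Y (\<lambda>x. (a x * e x) * (d x * f x) + (c x * e x) * (b x * f x)) (\<lambda>x. (b x * f x) * (d x * f x))"
    by (rule frac_eqI) (use r in \<open>simp_all add: reg_simps algebra_simps\<close>)
  then show "(F \<oplus>\<^bsub>rat_ring Y\<^esub> G) \<otimes>\<^bsub>rat_ring Y\<^esub> H = F \<otimes>\<^bsub>rat_ring Y\<^esub> H \<oplus>\<^bsub>rat_ring Y\<^esub> G \<otimes>\<^bsub>rat_ring Y\<^esub> H"
    using r unfolding s by (simp add: frac_add frac_mult reg_simps)
qed

lemma irred_den:
  assumes Y: "irred_set Y" and q: "reg Y q" and x: "x \<in> Y" "q x \<noteq> 0"
  shows "den Y q"
  unfolding den_def
proof (intro conjI q allI impI)
  fix r assume r: "reg Y r" "\<forall>x\<in>Y. r x * q x = 0"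
  obtain f g where f: "poly_fun f" "\<forall>x\<in>Y. r x = f x" and g: "poly_fun g" "\<forall>x\<in>Y. q x = g x" using q r(1) by (auto simp: reg_def)
  then have "\<forall>x\<in>Y. f x * g x = 0" using r by simp
  then have "(\<forall>x\<in>Y. f x = 0) \<or> (\<forall>x\<in>Y. g x = 0)" using Y f g unfolding irred_set_def by blast
  then show "\<forall>x\<in>Y. r x = 0" using f g x by auto
qed

lemma den_nonzero:
  assumes "den Y q" "Y \<noteq> {}" obtains x where "x \<in> Y" "q x \<noteq> 0"
  using assms reg_const[of Y 1] unfolding den_def by (metis all_not_in_conv mult_zero_right one_neq_zero)

theorem rat_ring_field:
  assumes Y: "irred_set Y" "Y \<noteq> {}" shows "field (rat_ring Y)"
proof -
  interpret cring "rat_ring Y" by (rule rat_ring_cring)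
  show ?thesis
  proof (rule cring_fieldI2)
    show "\<zero>\<^bsub>rat_ring Y\<^esub> \<noteq> \<one>\<^bsub>rat_ring Y\<^esub>"
      using frac_zero_iff[OF reg_const[of Y 1] den_one] Y(2) by (auto simp: rat_ring_one)
    fix F assume F: "F \<in> carrier (rat_ring Y)" "F \<noteq> \<zero>\<^bsub>rat_ring Y\<^esub>"
    then obtain a b where s: "F = rat_frac Y a b" and r: "reg Y a" "den Y b" by (auto elim!: frac_cases)
    then obtain x where "x \<in> Y" "a x \<noteq> 0" using F frac_zero_iff by blast
    then have a: "den Y a" by (rule irred_den[OF Y(1) r(1)])
    have "F \<otimes>\<^bsub>rat_ring Y\<^esub> rat_frac Y b a = rat_frac Y (\<lambda>x. a x * b x) (\<lambda>x. b x * a x)"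
      using r a unfolding s by (intro frac_mult den_reg)
    also have "\<dots> = \<one>\<^bsub>rat_ring Y\<^esub>" unfolding rat_ring_one
      by (rule frac_eqI) (use r a in \<open>simp_all add: reg_simps\<close>)
    finally show "\<exists>G\<in>carrier (rat_ring Y). F \<otimes>\<^bsub>rat_ring Y\<^esub> G = \<one>\<^bsub>rat_ring Y\<^esub>"
      using r a by (intro bexI) (auto intro: frac_carrier den_reg)
  qed
qed

text \<open>What the pullback of fractions needs: functions stay regular and denominators do not
  become zero divisors. Injectivity is a separate condition, see
  \<open>pullback_inj\<close>.\<close>

definition dominant_map :: "(complex^'m::finite) set \<Rightarrow> (complex^'m \<Rightarrow> complex^'k::finite) \<Rightarrow> (complex^'k) set \<Rightarrow> bool" where
  "dominant_map Y \<phi> Y' \<longleftrightarrow> \<phi> ` Y \<subseteq> Y' \<and> (\<forall>f. reg Y' f \<longrightarrow> reg Y (f \<circ> \<phi>)) \<and> (\<forall>q. den Y' q \<longrightarrow> den Y (q \<circ> \<phi>))"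

lemma pullback_frac:
  assumes d: "dominant_map Y \<phi> Y'" and p: "reg Y' p" "den Y' q"
  shows "rat_pullback Y \<phi> (rat_frac Y' p q) = rat_frac Y (p \<circ> \<phi>) (q \<circ> \<phi>)"
  unfolding rat_pullback_def
proof (rule frac_Union[OF p])
  fix a b assume "(a, b) \<in> rat_frac Y' p q"
  then have "reg Y' a" "den Y' b" "\<forall>x\<in>Y'. a x * q x = p x * b x" using frac_mem by blast+
  then show "rat_frac Y (a \<circ> \<phi>) (b \<circ> \<phi>) = rat_frac Y (p \<circ> \<phi>) (q \<circ> \<phi>)"
    using d p unfolding dominant_map_def by (intro frac_eqI) auto
qed

lemma dominantD: "dominant_map Y \<phi> Y' \<Longrightarrow> reg Y' f \<Longrightarrow> reg Y (f \<circ> \<phi>)"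
  "dominant_map Y \<phi> Y' \<Longrightarrow> den Y' f \<Longrightarrow> den Y (f \<circ> \<phi>)"
  by (simp_all add: dominant_map_def)

lemma pullback_hom:
  assumes d: "dominant_map Y \<phi> Y'"
  shows "rat_pullback Y \<phi> \<in> ring_hom (rat_ring Y') (rat_ring Y)"
proof (rule ring_hom_memI)
  fix F assume "F \<in> carrier (rat_ring Y')"
  then obtain a b where s: "F = rat_frac Y' a b" and r: "reg Y' a" "den Y' b" by (auto elim!: frac_cases)
  then show "rat_pullback Y \<phi> F \<in> carrier (rat_ring Y)" by (simp add: pullback_frac[OF d] frac_carrier dominantD[OF d])
next
  fix F G assume "F \<in> carrier (rat_ring Y')" "G \<in> carrier (rat_ring Y')"
  then obtain a b c e where s: "F = rat_frac Y' a b" "G = rat_frac Y' c e"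
      and r: "reg Y' a" "den Y' b" "reg Y' c" "den Y' e"
    by (auto elim!: frac_cases)
  show "rat_pullback Y \<phi> (F \<otimes>\<^bsub>rat_ring Y'\<^esub> G) = rat_pullback Y \<phi> F \<otimes>\<^bsub>rat_ring Y\<^esub> rat_pullback Y \<phi> G"
    using r unfolding s by (simp add: frac_mult pullback_frac[OF d] reg_intros den_mult dominantD[OF d]) (simp add: comp_def)
  show "rat_pullback Y \<phi> (F \<oplus>\<^bsub>rat_ring Y'\<^esub> G) = rat_pullback Y \<phi> F \<oplus>\<^bsub>rat_ring Y\<^esub> rat_pullback Y \<phi> G"
    using r unfolding s by (simp add: frac_add pullback_frac[OF d] reg_simps dominantD[OF d]) (simp add: comp_def)
next
  show "rat_pullback Y \<phi> \<one>\<^bsub>rat_ring Y'\<^esub> = \<one>\<^bsub>rat_ring Y\<^esub>"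
    by (simp add: rat_ring_one pullback_frac[OF d] reg_const den_one comp_def)
qed

lemma pullback_inj:
  assumes d: "dominant_map Y \<phi> Y'" and i: "\<And>f. reg Y' f \<Longrightarrow> \<forall>x\<in>Y. f (\<phi> x) = 0 \<Longrightarrow> \<forall>x\<in>Y'. f x = 0"
  shows "inj_on (rat_pullback Y \<phi>) (carrier (rat_ring Y'))"
proof (rule inj_onI)
  fix F G assume "F \<in> carrier (rat_ring Y')" "G \<in> carrier (rat_ring Y')" and e: "rat_pullback Y \<phi> F = rat_pullback Y \<phi> G"
  then obtain a b c q where s: "F = rat_frac Y' a b" "G = rat_frac Y' c q"
      and r: "reg Y' a" "den Y' b" "reg Y' c" "den Y' q"
    by (auto elim!: frac_cases)
  have "rat_frac Y (a \<circ> \<phi>) (b \<circ> \<phi>) = rat_frac Y (c \<circ> \<phi>) (q \<circ> \<phi>)" using e r unfolding s by (simp add: pullback_frac[OF d])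
  then have "\<forall>x\<in>Y. a (\<phi> x) * q (\<phi> x) - c (\<phi> x) * b (\<phi> x) = 0"
    using frac_eqD[of Y "a \<circ> \<phi>" "b \<circ> \<phi>" "c \<circ> \<phi>" "q \<circ> \<phi>"] r dominantD[OF d] by simp
  then have "\<forall>x\<in>Y'. a x * q x - c x * b x = 0"
    using r by (intro i[of "\<lambda>u. a u * q u - c u * b u"]) (simp_all add: reg_simps)
  then show "F = G" using r unfolding s by (intro frac_eqI) auto
qed

lemma dominant_poly_map:
  assumes "poly_map \<phi>" "\<phi> ` Y \<subseteq> Y'" "reg Y' f" shows "reg Y (f \<circ> \<phi>)"
proof -
  obtain p where p: "poly_fun p" "\<forall>x\<in>Y'. f x = p x" using assms(3) by (auto simp: reg_def)
  have "reg Y (\<lambda>x. p (\<phi> x))" by (rule reg_poly[OF poly_fun_comp[OF p(1) assms(1)]])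
  then show ?thesis by (rule reg_cong) (use p assms in auto)
qed

text \<open>An invertible polynomial map of Y preserves denominators: transport the test function r
  by the inverse.\<close>

lemma dominant_inverse:
  assumes "poly_map \<phi>" "poly_map \<psi>" "\<phi> ` Y \<subseteq> Y" "\<psi> ` Y \<subseteq> Y" "\<And>x. x \<in> Y \<Longrightarrow> \<psi> (\<phi> x) = x" "\<And>x. x \<in> Y \<Longrightarrow> \<phi> (\<psi> x) = x"
  shows "dominant_map Y \<phi> Y"
  unfolding dominant_map_def
proof (intro conjI allI impI assms(3))
  fix f assume "reg Y f" then show "reg Y (f \<circ> \<phi>)" by (rule dominant_poly_map[OF assms(1,3)])
next
  fix q assume q: "den Y q"
  show "den Y (q \<circ> \<phi>)" unfolding den_def
  proof (intro conjI allI impI ballI)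
    show "reg Y (q \<circ> \<phi>)" by (rule dominant_poly_map[OF assms(1,3) den_reg[OF q]])
    fix r x assume r: "reg Y r" "\<forall>x\<in>Y. r x * (q \<circ> \<phi>) x = 0" and x: "x \<in> Y"
    have "(r \<circ> \<psi>) y * q y = 0" if "y \<in> Y" for y
      using r(2) that assms(4,6) by (metis comp_apply image_subset_iff)
    then have "(r \<circ> \<psi>) (\<phi> x) = 0"
      using assms x by (intro den_cancel[OF q dominant_poly_map[OF assms(2,4) r(1)]]) auto
    then show "r x = 0" using assms x by simp
  qed
qed

text \<open>The indices run backwards because coefficient lists of \<open>univ_poly\<close> start
  with the leading coefficient. With a common denominator, evaluation becomes a single fraction
  (\<open>frac_eval\<close>).\<close>

lemma common_denominator:
  "set Fs \<subseteq> carrier (rat_ring Y) \<Longrightarrow>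
    \<exists>c d. (\<forall>i. reg Y (c i)) \<and> den Y d \<and> Fs = map (\<lambda>i. rat_frac Y (c i) d) (rev [0..<length Fs])"
proof (induction Fs)
  case Nil
  show ?case by (rule exI[of _ "\<lambda>_ _. 0"], rule exI[of _ "\<lambda>_. 1"]) (simp add: reg_const den_one)
next
  case (Cons F Fs)
  then obtain c d where c: "\<And>i. reg Y (c i)" "den Y d" and Fs: "Fs = map (\<lambda>i. rat_frac Y (c i) d) (rev [0..<length Fs])"
    by auto
  obtain a b where F: "F = rat_frac Y a b" "reg Y a" "den Y b" using Cons.prems by (auto elim: frac_cases)
  let ?n = "length Fs"
  define c' where "c' i = (\<lambda>x. if i = ?n then a x * d x else c i x * b x)" for i
  define e where "e = (\<lambda>x. b x * d x)"
  have 1: "reg Y (c' i)" for i unfolding c'_def using c F by (cases "i = ?n") (auto intro: reg_mult den_reg)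
  have 2: "den Y e" unfolding e_def by (rule den_mult[OF F(3) c(2)])
  have "F = rat_frac Y (c' ?n) e" unfolding F(1)
    by (rule frac_eqI[OF F(2,3) 1 2]) (simp add: c'_def e_def mult_ac)
  moreover have "rat_frac Y (c i) d = rat_frac Y (c' i) e" if "i < ?n" for i
    by (rule frac_eqI[OF c 1 2]) (use that in \<open>simp add: c'_def e_def mult_ac\<close>)
  then have "map (\<lambda>i. rat_frac Y (c i) d) (rev [0..<?n]) = map (\<lambda>i. rat_frac Y (c' i) e) (rev [0..<?n])" by simp
  ultimately have "F # Fs = map (\<lambda>i. rat_frac Y (c' i) e) (rev [0..<length (F # Fs)])" using Fs by simp
  then show ?case by (intro exI[of _ c'] exI[of _ e]) (simp add: 1 2)
qed

lemma frac_pow: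
  assumes "reg Y x"
  shows "rat_frac Y x (\<lambda>_. 1) [^]\<^bsub>rat_ring Y\<^esub> (k::nat) = rat_frac Y (\<lambda>y. x y ^ k) (\<lambda>_. 1)"
proof -
  interpret cring "rat_ring Y" by (rule rat_ring_cring)
  show ?thesis
  proof (induction k)
    case 0
    then show ?case by (simp add: rat_ring_one)
  next
    case (Suc k)
    then show ?case using assms by (simp add: frac_mult reg_power den_one mult.commute)
  qed
qed

lemma frac_eval:
  assumes c: "\<And>i. reg Y (c i)" and d: "den Y d" and x: "reg Y x"
  shows "ring.eval (rat_ring Y) (map (\<lambda>i. rat_frac Y (c i) d) (rev [0..<k])) (rat_frac Y x (\<lambda>_. 1)) =
    rat_frac Y (\<lambda>y. \<Sum>i<k. c i y * x y ^ i) d"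
proof -
  interpret cring "rat_ring Y" by (rule rat_ring_cring)
  show ?thesis
  proof (induction k)
    case 0
    then show ?case using frac_zero_iff[OF reg_const[of Y 0] d] by simp
  next
    case (Suc k)
    have "rat_frac Y (c k) d \<otimes>\<^bsub>rat_ring Y\<^esub> rat_frac Y x (\<lambda>_. 1) [^]\<^bsub>rat_ring Y\<^esub> k = rat_frac Y (\<lambda>y. c k y * x y ^ k) d"
      using assms by (simp add: frac_pow frac_mult reg_power den_one)
    then show ?case using Suc assms by (simp add: frac_add_same reg_intros add.commute)
  qed
qed

section \<open>The field extension\<close>

lemma rat_frac_cong: "(\<And>x. x \<in> Y \<Longrightarrow> p x = p' x) \<Longrightarrow> (\<And>x. x \<in> Y \<Longrightarrow> q x = q' x) \<Longrightarrow> rat_frac Y p q = rat_frac Y p' q'"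
  by (simp add: rat_frac_def)

lemma rat_pullback_cong:
  assumes "\<And>x. x \<in> Y \<Longrightarrow> \<phi> x = \<psi> x" shows "rat_pullback Y \<phi> = rat_pullback Y \<psi>"
proof -
  have "rat_frac Y (p \<circ> \<phi>) (q \<circ> \<phi>) = rat_frac Y (p \<circ> \<psi>) (q \<circ> \<psi>)" for p q
    by (rule rat_frac_cong) (simp_all add: assms)
  then show ?thesis by (intro ext) (simp add: rat_pullback_def)
qed

lemma prd_ext_map: "prd k (ext_map A u) = ext_map A (prd k u)"
proof -
  have "u \<in> {u. \<forall>k. prd k (ext_map A u) = ext_map A (prd k u)}"
  proof (rule ext_gen_eps)
    show "vec.subspace {u. \<forall>k. prd k (ext_map A u) = ext_map A (prd k u)}"
      by (auto simp: vec.subspace_def clin_rules[OF clin_prd] clin_rules[OF clin_ext_map])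
    have "prd k ext_one = (if k = 0 then ext_one else (0 :: 'a ext))" for k
      by (auto simp: prd_def vec_eq_iff ext_one_def ax_nth)
    then show "ext_one \<in> {u. \<forall>k. prd k (ext_map A u) = ext_map A (prd k u)}"
      by (simp add: ext_map_one clin_rules[OF clin_ext_map])
    fix i u assume u: "u \<in> {u. \<forall>k. prd k (ext_map A u) = ext_map A (prd k u)}"
    have 0: "prd 0 (eps x v) = 0" for x :: "'a cvec" and v
      by (simp add: prd_def vec_eq_iff eps_nth)
    have "prd k (ext_map A (eps (ax i) u)) = ext_map A (prd k (eps (ax i) u))" for k
      using u by (cases k) (simp_all add: ext_map_eps 0 prd_eps clin_rules[OF clin_ext_map])
    then show "eps (ax i) u \<in> {u. \<forall>k. prd k (ext_map A u) = ext_map A (prd k u)}" by simp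
  qed
  then show ?thesis by blast
qed

context nondeg_form
begin

text \<open>Needed for the equivariance of \<open>pr2\<close>: exterior powers of T(h) preserve
  degrees, which is not visible from the Clifford product.\<close>

lemma spin_conj_ext_map:
  assumes "h \<in> Spin B" shows "spin_conj B h u = ext_map (spin_T B h) u"
proof -
  have "h \<star> u = ext_map (spin_T B h) u \<star> h" by (rule twists_ext_map[OF Spin_twists[OF assms] spin_T_B[OF assms]])
  then have "spin_conj B h u = ext_map (spin_T B h) u \<star> (h \<star> ext_rev h)" by (simp add: spin_conj_def cmul_assoc)
  then show ?thesis using assms by (simp add: Spin_iff cmul_one_right)
qed

lemma pr2_spin_conj: "h \<in> Spin B \<Longrightarrow> pr2 (spin_conj B h u) = spin_conj B h (pr2 u)"
  by (simp add: spin_conj_ext_map pr2_prd prd_ext_map)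

lemma spin_conj_degree2: "h \<in> Spin B \<Longrightarrow> u \<in> ext_degree 2 \<Longrightarrow> spin_conj B h u \<in> ext_degree 2"
  using pr2_spin_conj[of h u] pr2_degree[of "spin_conj B h u"] by (simp add: pr2_id)

lemma pr0_spin_conj: "h \<in> Spin B \<Longrightarrow> pr0 (spin_conj B h u) = pr0 u"
proof -
  assume h: "h \<in> Spin B"
  have "pr0 (spin_conj B h u) = pr0 (ext_rev h \<star> (h \<star> u))" unfolding spin_conj_def by (rule pr0_cyclic)
  then show ?thesis using Spin_rev[OF h] by (simp add: cmul_assoc[symmetric] cmul_one_left)
qed

lemma spin_conj_Spin: "h \<in> Spin B \<Longrightarrow> g \<in> Spin B \<Longrightarrow> spin_conj B h g \<in> Spin B"
  unfolding spin_conj_def by (intro Spin_cm Spin_ext_rev)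

lemma spin_conj_inverse: "h \<in> Spin B \<Longrightarrow> spin_conj B (ext_rev h) (spin_conj B h u) = u"
proof -
  assume h: "h \<in> Spin B"
  have "spin_conj B (ext_rev h) (spin_conj B h u) = (ext_rev h \<star> h) \<star> u \<star> (ext_rev h \<star> h)"
    by (simp add: spin_conj_def cmul_assoc ext_rev_rev)
  then show ?thesis by (simp add: Spin_rev[OF h] cmul_one_left cmul_one_right)
qed

lemma spin_conj_dominant:
  assumes h: "h \<in> Spin B" and Y: "\<And>h u. h \<in> Spin B \<Longrightarrow> u \<in> Y \<Longrightarrow> spin_conj B h u \<in> Y"
  shows "dominant_map Y (spin_conj B h) Y"
proof (rule dominant_inverse[where \<psi> = "spin_conj B (ext_rev h)"])
  show "poly_map (spin_conj B h)" "poly_map (spin_conj B (ext_rev h))"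
    by (rule poly_map_clin[OF clin_spin_conj poly_map_id])+
  show "spin_conj B h (spin_conj B (ext_rev h) u) = u" for u
    using spin_conj_inverse[OF Spin_ext_rev[OF h], of u] by (simp add: ext_rev_rev)
qed (use Y h Spin_ext_rev[OF h] spin_conj_inverse[OF h] in auto)

lemma Spin_conj_dominant: "h \<in> Spin B \<Longrightarrow> dominant_map (Spin B) (spin_conj B h) (Spin B)"
  by (rule spin_conj_dominant) (auto intro: spin_conj_Spin)

lemma L_conj_dominant: "h \<in> Spin B \<Longrightarrow> dominant_map (ext_degree 2) (spin_conj B h) (ext_degree 2)"
  by (rule spin_conj_dominant) (auto intro: spin_conj_degree2)

lemma one_dim:
  assumes n: "CARD('n) = 1" shows "Spin B = {ext_one, - ext_one}" "ext_degree 2 = {0 :: 'n ext}"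
proof -
  show "ext_degree 2 = {0 :: 'n ext}" using ext_degree_large[of "_ :: 'n ext" 2] n vec.subspace_0[OF ext_degree_subspace[of 2]] by auto
  have "g = ext_one \<or> g = - ext_one" if g: "g \<in> Spin B" for g
  proof -
    have I: "I = {} \<or> odd (card I)" for I :: "'n set"
    proof -
      have "card I \<le> 1" using card_mono[of "UNIV :: 'n set" I] n by simp
      then have "card I = 0 \<or> card I = 1" by linarith
      then show ?thesis by auto
    qed
    have "g $ I = (pr0 g *s ext_one) $ I" for I
      using I[of I] g by (auto simp: Spin_iff ext_even_def pr0_def ext_one_def ax_nth)
    then have e: "g = pr0 g *s ext_one" by (simp add: vec_eq_iff)
    have r: "ext_rev g = pr0 g *s ext_one" using even_one by (subst e) (simp add: clin_rules[OF clin_ext_rev])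
    have "g \<star> ext_rev g = (pr0 g *s ext_one) \<star> (pr0 g *s ext_one)" by (rule arg_cong2[OF e r])
    also have "\<dots> = (pr0 g * pr0 g) *s ext_one" by (simp add: cm_simps cmul_one_left)
    finally have q: "g \<star> ext_rev g = (pr0 g * pr0 g) *s ext_one" .
    have gg: "g \<star> ext_rev g = ext_one" using g Spin_iff by blast
    have "pr0 ((pr0 g * pr0 g) *s (ext_one :: 'n ext)) = pr0 (ext_one :: 'n ext)"
      by (rule arg_cong[OF trans[OF q[symmetric] gg]])
    then have "pr0 g = 1 \<or> pr0 g = - 1" by (simp add: pr0_simps square_eq_1_iff)
    then show ?thesis
    proof
      assume p: "pr0 g = 1"
      show ?thesis using e unfolding p by simp
    next
      assume p: "pr0 g = - 1"
      show ?thesis using e unfolding p by (simp add: vec_eq_iff)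
    qed
  qed
  then show "Spin B = {ext_one, - ext_one}" using Spin_one Spin_neg_one by blast
qed

lemma card_cases: "CARD('n) = 1 \<or> CARD('n) \<ge> 2"
  using zero_less_card_finite[where 'a = 'n] by linarith

lemma half_dim_pos: "CARD('n) \<ge> 2 \<Longrightarrow> half_dim \<ge> 1"
  by (simp add: half_dim_def)

text \<open>The case of \<open>spin_coordinates_independent\<close> in which only the coefficient of
  the zeroth power occurs. For n = 1 the only bivector is 0.\<close>

lemma pr2_dense:
  assumes f: "reg (ext_degree 2) f" and z: "\<And>g. g \<in> Spin B \<Longrightarrow> f (pr2 g) = 0" and u: "u \<in> ext_degree 2"
  shows "f u = 0"
proof (cases "CARD('n) \<ge> 2")
  case True
  obtain p where p: "poly_fun p" "\<forall>u\<in>ext_degree 2. f u = p u" using f by (auto simp: reg_def)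
  define a where "a j = (\<lambda>u. if j = 0 then p u else 0)" for j :: nat
  have "a 0 u = 0"
  proof (rule spin_coordinates_independent[OF True _ _ _ u])
    show "poly_fun (a j)" for j by (cases "j = 0") (simp_all add: a_def p poly_fun.const)
    show "0 < 2 * half_dim" using half_dim_pos[OF True] by simp
    fix g assume g: "g \<in> Spin B"
    have "(\<Sum>j<2 * half_dim. a j (pr2 g) * pr0 g ^ j) = (\<Sum>j<2 * half_dim. if j = 0 then p (pr2 g) else 0)"
      by (rule sum.cong) (auto simp: a_def)
    also have "p (pr2 g) = 0" using z[OF g] p(2) pr2_degree[of g] by auto
    also have "(\<Sum>j<2 * half_dim. if j = 0 then 0 else 0) = (0 :: complex)" by simp
    finally show "(\<Sum>j<2 * half_dim. a j (pr2 g) * pr0 g ^ j) = 0" .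
  qed
  then show ?thesis using p u by (simp add: a_def)
next
  case False
  then have "u = pr2 ext_one" using card_cases one_dim(2) u pr2_degree[of ext_one] by auto
  then show ?thesis using z Spin_one by blast
qed

lemma pr2_dominant: "dominant_map (Spin B) pr2 (ext_degree 2)"
  unfolding dominant_map_def
proof (intro conjI allI impI)
  show "pr2 ` Spin B \<subseteq> ext_degree 2" using pr2_degree by blast
  show r: "reg (Spin B) (f \<circ> pr2)" if "reg (ext_degree 2) f" for f
    by (rule dominant_poly_map[OF poly_map_clin[OF clin_pr2 poly_map_id] _ that]) (use pr2_degree in blast)
  fix q :: "'n ext \<Rightarrow> complex" assume q: "den (ext_degree 2) q"
  show "den (Spin B) (q \<circ> pr2)"
  proof (cases "CARD('n) \<ge> 2")
    case True
    obtain u where "u \<in> ext_degree 2" "q u \<noteq> 0"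
      using q vec.subspace_0[OF ext_degree_subspace[of 2]] by (elim den_nonzero) auto
    then obtain g where "g \<in> Spin B" "q (pr2 g) \<noteq> 0" using pr2_dense[OF den_reg[OF q]] by blast
    then show ?thesis using irred_den[OF Spin_irred[OF True] r[OF den_reg[OF q]]] by simp
  next
    case False
    then have L: "ext_degree 2 = {0 :: 'n ext}" using card_cases one_dim(2) by auto
    have "q 0 \<noteq> 0" using q L by (elim den_nonzero) auto
    moreover have "pr2 g = 0" for g :: "'n ext" using pr2_degree[of g] L by auto
    ultimately show ?thesis using den_const[of "q 0" "Spin B"] by (simp add: comp_def)
  qed
qed

section \<open>The extension generated by chi\<close>

abbreviation "QS \<equiv> rat_ring (Spin B)"
abbreviation "QL \<equiv> rat_ring (ext_degree 2 :: 'n ext set)"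
text \<open>\<open>gen_cayley\<close> equals \<open>pr2\<close> on the spin group, so the pullback
  can be taken along this linear map.\<close>

abbreviation "pull \<equiv> rat_pullback (Spin B) (pr2 :: 'n ext \<Rightarrow> 'n ext)"
abbreviation "chi \<equiv> rat_frac (Spin B) (spin_chi :: 'n ext \<Rightarrow> complex) (\<lambda>_. 1)"
definition chi_scale :: complex where "chi_scale = of_real (2 powr (real CARD('n) / 2))"

lemma chi_scale: "chi_scale \<noteq> 0" by (simp add: chi_scale_def)

lemma spin_chi_pr0: "spin_chi g = chi_scale * pr0 (g :: 'n ext)"
  by (simp add: spin_chi_def chi_scale_def)

lemma poly_fun_pr0: "poly_fun (pr0 :: 'n ext \<Rightarrow> complex)"
  unfolding pr0_def[abs_def] by (rule poly_fun.coord)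

lemma reg_chi: "reg Y (spin_chi :: 'n ext \<Rightarrow> complex)"
  by (rule reg_cong[OF reg_poly[OF poly_fun.mult[OF poly_fun.const poly_fun_pr0]]]) (rule spin_chi_pr0)

lemma chi_carrier: "chi \<in> carrier QS"
  by (intro frac_carrier reg_chi den_one)

lemma pull_frac: "reg (ext_degree 2) p \<Longrightarrow> den (ext_degree 2) q \<Longrightarrow>
    pull (rat_frac (ext_degree 2) p q) = rat_frac (Spin B) (p \<circ> pr2) (q \<circ> pr2)"
  by (rule pullback_frac[OF pr2_dominant])

lemma pull_inj: "inj_on pull (carrier QL)"
  by (rule pullback_inj[OF pr2_dominant]) (use pr2_dense in blast)

lemma pull_carrier: "pull ` carrier QL \<subseteq> carrier QS"
  using ring_hom_memE(1)[OF pullback_hom[OF pr2_dominant]] by blast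

lemma pull_list:
  assumes "set p \<subseteq> pull ` carrier QL"
  obtains c d where "\<And>i. reg (ext_degree 2) (c i)" "den (ext_degree 2) d"
    "p = map (\<lambda>i. rat_frac (Spin B) (c i \<circ> pr2) (d \<circ> pr2)) (rev [0..<length p])"
proof -
  have "p \<in> lists (pull ` carrier QL)" using assms by auto
  then obtain ps where ps: "p = map pull ps" "set ps \<subseteq> carrier QL" unfolding lists_image by auto
  obtain c d where c: "\<forall>i. reg (ext_degree 2) (c i)" "den (ext_degree 2) d"
      and e: "ps = map (\<lambda>i. rat_frac (ext_degree 2) (c i) d) (rev [0..<length ps])"
    using common_denominator[OF ps(2)] by (elim exE conjE)
  have "p = map (\<lambda>i. rat_frac (Spin B) (c i \<circ> pr2) (d \<circ> pr2)) (rev [0..<length p])"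
    using c by (subst ps(1), subst e) (simp add: pull_frac ps(1))
  then show ?thesis using that c by blast
qed

lemma eval_chi:
  assumes "\<And>i. reg (ext_degree 2) (c i)" "den (ext_degree 2) d"
  shows "ring.eval QS (map (\<lambda>i. rat_frac (Spin B) (c i \<circ> pr2) (d \<circ> pr2)) (rev [0..<k])) chi =
    rat_frac (Spin B) (\<lambda>g. \<Sum>i<k. c i (pr2 g) * spin_chi g ^ i) (d \<circ> pr2)"
  using frac_eval[of "Spin B" "\<lambda>i. c i \<circ> pr2" "d \<circ> pr2" spin_chi k] assms dominantD[OF pr2_dominant] reg_chi by simp

lemma chi_independent:
  assumes n: "CARD('n) \<ge> 2" and c: "\<And>i. reg (ext_degree 2) (c i)" and k: "k \<le> 2 * half_dim"
    and z: "\<And>g. g \<in> Spin B \<Longrightarrow> (\<Sum>i<k. c i (pr2 g) * spin_chi g ^ i) = 0" and i: "i < k" and u: "u \<in> ext_degree 2"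
  shows "c i u = 0"
proof -
  have "\<forall>i. \<exists>p. poly_fun p \<and> (\<forall>u\<in>ext_degree 2. c i u = p u)" using c by (simp add: reg_def)
  then obtain p where p: "\<And>i. poly_fun (p i)" "\<And>i u. u \<in> ext_degree 2 \<Longrightarrow> c i u = p i u" by metis
  define a where "a i = (\<lambda>u. if i < k then p i u * chi_scale ^ i else 0)" for i
  have "a i u = 0"
  proof (rule spin_coordinates_independent[OF n _ _ _ u])
    show "poly_fun (a j)" for j by (cases "j < k") (simp_all add: a_def p poly_fun.const poly_fun.mult)
    show "i < 2 * half_dim" using i k by simp
    fix g assume g: "g \<in> Spin B"
    have "(\<Sum>j<2 * half_dim. a j (pr2 g) * pr0 g ^ j) = (\<Sum>j<k. a j (pr2 g) * pr0 g ^ j)"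
      by (rule sum.mono_neutral_right) (use k in \<open>auto simp: a_def\<close>)
    also have "\<dots> = (\<Sum>j<k. c j (pr2 g) * spin_chi g ^ j)"
      by (rule sum.cong) (simp_all add: a_def p(2)[OF pr2_degree] spin_chi_pr0 power_mult_distrib)
    finally show "(\<Sum>j<2 * half_dim. a j (pr2 g) * pr0 g ^ j) = 0" using z[OF g] by simp
  qed
  then show ?thesis using i p(2)[OF u] chi_scale by (simp add: a_def)
qed

lemma poly_fun_if: "(b \<Longrightarrow> poly_fun f) \<Longrightarrow> poly_fun (\<lambda>x. if b then f x else 0)"
  by (cases b) (simp_all add: poly_fun.const)

lemma poly_fun_coeff_fibre_poly: "poly_fun (\<lambda>u. poly.coeff (fibre_poly u) j)"
proof -
  have "poly_fun (\<lambda>u. pr0 (G u k \<star> ext_rev (G u l)))" for k l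
    using poly_map_cm[OF poly_map_G[OF poly_map_id] poly_map_clin[OF clin_ext_rev poly_map_G[OF poly_map_id]], of k l]
    by (simp add: poly_map_def pr0_def)
  then show ?thesis unfolding coeff_fibre_poly
    by (intro poly_fun_diff poly_fun_sum poly_fun_if poly_fun.const)
qed

lemma fibre_poly_sum: "CARD('n) \<ge> 2 \<Longrightarrow> poly (fibre_poly u) c = (\<Sum>i<Suc (2 * half_dim). poly.coeff (fibre_poly u) i * c ^ i)"
  using fibre_poly_monic(1)[of u] by (simp add: poly_altdef lessThan_Suc_atMost)

text \<open>Multiplying by \<open>pr0\<close> gives an identity on the whole group, and
  \<open>pr0\<close>, nonzero at 1, is cancelled by irreducibility. This extends the fibre
  identities to the points with \<open>pr0 g = 0\<close>.\<close>

lemma Spin_zero: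
  assumes n: "CARD('n) \<ge> 2" and f: "poly_fun f" and z: "\<And>g. g \<in> Spin B \<Longrightarrow> pr0 g \<noteq> 0 \<Longrightarrow> f g = 0" and g: "g \<in> Spin B"
  shows "f g = 0"
proof -
  have "\<forall>g\<in>Spin B. pr0 g * f g = 0" using z by auto
  then have "(\<forall>g\<in>Spin B. pr0 g = 0) \<or> (\<forall>g\<in>Spin B. f g = 0)"
    using Spin_irred[OF n] f poly_fun_pr0 unfolding irred_set_def by blast
  moreover have "pr0 ext_one \<noteq> 0" by (simp add: pr0_simps)
  ultimately show ?thesis using g Spin_one by blast
qed

lemma fibre_poly_Spin_all:
  assumes n: "CARD('n) \<ge> 2" and g: "g \<in> Spin B" shows "poly (fibre_poly (pr2 g)) (pr0 g) = 0"
proof (rule Spin_zero[OF n _ _ g, of "\<lambda>g. poly (fibre_poly (pr2 g)) (pr0 g)"])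
  have "poly_fun (\<lambda>g. poly.coeff (fibre_poly (pr2 g)) i)" for i
    by (rule poly_fun_comp[OF poly_fun_coeff_fibre_poly poly_map_clin[OF clin_pr2 poly_map_id]])
  then show "poly_fun (\<lambda>g. poly (fibre_poly (pr2 g)) (pr0 g))" unfolding fibre_poly_sum[OF n]
    by (intro poly_fun_sum poly_fun.mult poly_fun_power poly_fun_pr0)
qed (rule fibre_poly_Spin[OF n])

lemma Spin_parts_all:
  assumes n: "CARD('n) \<ge> 2" and g: "g \<in> Spin B" and I: "card I = 2 * k"
  shows "pr0 g ^ k * g $ I = pr0 g * G (pr2 g) k $ I"
proof -
  have "pr0 g ^ k * g $ I - pr0 g * G (pr2 g) k $ I = 0"
  proof (rule Spin_zero[OF n _ _ g, of "\<lambda>g. pr0 g ^ k * g $ I - pr0 g * G (pr2 g) k $ I"])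
    have "poly_fun (\<lambda>g. G (pr2 g) k $ I)"
      using poly_map_G[OF poly_map_clin[OF clin_pr2 poly_map_id]] by (simp add: poly_map_def)
    then show "poly_fun (\<lambda>g. pr0 g ^ k * g $ I - pr0 g * G (pr2 g) k $ I)"
      by (intro poly_fun_diff poly_fun.mult poly_fun_power poly_fun_pr0 poly_fun.coord)
    show "pr0 g ^ k * g $ I - pr0 g * G (pr2 g) k $ I = 0" if "g \<in> Spin B" "pr0 g \<noteq> 0" for g
      using arg_cong[OF Spin_parts[OF that, of k], of "\<lambda>u. u $ I"] I by (simp add: prd_def)
  qed
  then show ?thesis by simp
qed

lemma pull_const: "rat_frac (Spin B) (\<lambda>_. c) (\<lambda>_. 1) \<in> pull ` carrier QL"
  using pull_frac[OF reg_const den_one, of c] frac_carrier[OF reg_const den_one, of "ext_degree 2" c]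
  by (auto simp: comp_def intro!: image_eqI)

lemma L_field: "field QL"
  using irred_subspace[OF ext_degree_subspace[of 2]] vec.subspace_0[OF ext_degree_subspace[of 2]]
  by (intro rat_ring_field) auto

lemma Spin_field: "CARD('n) \<ge> 2 \<Longrightarrow> field QS"
  using Spin_irred Spin_one by (intro rat_ring_field) auto

lemma pull_subfield:
  assumes n: "CARD('n) \<ge> 2" shows "subfield (pull ` carrier QL) QS"
proof -
  interpret S: field QS by (rule Spin_field[OF n])
  interpret L: field QL by (rule L_field)
  interpret h: ring_hom_ring QL QS pull
    by (rule ring_hom_ringI2[OF L.is_ring S.is_ring pullback_hom[OF pr2_dominant]])
  show ?thesis by (rule h.img_is_subfield(2)[OF L.carrier_is_subfield S.one_not_zero])
qed

text \<open>Bounds the degree of the minimal polynomial of chi from below: independence makes all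
  coefficients vanish, whereas a nonempty coefficient list must have a nonzero head.\<close>

lemma chi_eval_zero:
  assumes n: "CARD('n) \<ge> 2" and p: "p \<in> carrier ((pull ` carrier QL)[X]\<^bsub>QS\<^esub>)" and l: "length p \<le> 2 * half_dim"
    and z: "ring.eval QS p chi = \<zero>\<^bsub>QS\<^esub>"
  shows "p = []"
proof (rule ccontr)
  assume ne: "p \<noteq> []"
  have K: "set p \<subseteq> pull ` carrier QL" "hd p \<noteq> \<zero>\<^bsub>QS\<^esub>"
    using p ne by (auto simp: univ_poly_carrier[symmetric] polynomial_def)
  obtain c d where c: "\<And>i. reg (ext_degree 2) (c i)" "den (ext_degree 2) d"
    and e: "p = map (\<lambda>i. rat_frac (Spin B) (c i \<circ> pr2) (d \<circ> pr2)) (rev [0..<length p])" (is "p = map ?f _")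
    using pull_list[OF K(1)] by metis
  have "ring.eval QS (map ?f (rev [0..<length p])) chi = \<zero>\<^bsub>QS\<^esub>" using z e by simp
  then have "rat_frac (Spin B) (\<lambda>g. \<Sum>i<length p. c i (pr2 g) * spin_chi g ^ i) (d \<circ> pr2) = \<zero>\<^bsub>QS\<^esub>"
    unfolding eval_chi[OF c] .
  moreover have "reg (Spin B) (\<lambda>g. c i (pr2 g))" for i
    using dominantD(1)[OF pr2_dominant c(1)[of i]] by (simp add: comp_def)
  then have "reg (Spin B) (\<lambda>g. \<Sum>i<length p. c i (pr2 g) * spin_chi g ^ i)"
    by (intro reg_sum reg_mult reg_power reg_chi)
  ultimately have "\<forall>g\<in>Spin B. (\<Sum>i<length p. c i (pr2 g) * spin_chi g ^ i) = 0"
    using frac_zero_iff[OF _ dominantD(2)[OF pr2_dominant c(2)]] by blast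
  then have c0: "c i u = 0" if "i < length p" "u \<in> ext_degree 2" for i u
    using that by (intro chi_independent[OF n c(1) l]) auto
  define N where "N = length p"
  have e': "p = map ?f (rev [0..<N])" using e unfolding N_def .
  have "N \<ge> 1" using ne by (cases p) (auto simp: N_def)
  then have lt: "N - 1 < length p" unfolding N_def by linarith
  have "rev [0..<N] = (N - 1) # rev [0..<N - 1]" using \<open>N \<ge> 1\<close> by (cases N) auto
  then have "hd p = ?f (N - 1)" by (subst e') simp
  also have "\<dots> = \<zero>\<^bsub>QS\<^esub>"
    using frac_zero_iff[OF dominantD(1)[OF pr2_dominant c(1)] dominantD(2)[OF pr2_dominant c(2)]]
      c0[OF lt] by (simp add: pr2_degree)
  finally show False using K(2) by simp
qed

text \<open>\<open>fibre_poly\<close> rescaled from \<open>pr0\<close> to chi: the powers of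
  \<open>chi_scale\<close> move the root while keeping the polynomial monic.\<close>

definition chi_poly :: "('n set) rat_fun list" where
  "chi_poly = map (\<lambda>i. rat_frac (Spin B) ((\<lambda>u. poly.coeff (fibre_poly u) i * chi_scale ^ (2 * half_dim - i)) \<circ> pr2) ((\<lambda>_. 1) \<circ> pr2))
     (rev [0..<Suc (2 * half_dim)])"

lemma chi_poly:
  assumes n: "CARD('n) \<ge> 2"
  shows "chi_poly \<in> carrier ((pull ` carrier QL)[X]\<^bsub>QS\<^esub>)" "length chi_poly = Suc (2 * half_dim)"
    "ring.eval QS chi_poly chi = \<zero>\<^bsub>QS\<^esub>"
proof -
  interpret S: field QS by (rule Spin_field[OF n])
  let ?e = "\<lambda>i u. poly.coeff (fibre_poly u) i * chi_scale ^ (2 * half_dim - i)"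
  have r: "reg (ext_degree 2) (?e i)" for i
    by (intro reg_mult reg_const reg_poly poly_fun_coeff_fibre_poly)
  have "rat_frac (Spin B) (?e i \<circ> pr2) ((\<lambda>_. 1) \<circ> pr2) \<in> pull ` carrier QL" for i
    unfolding pull_frac[OF r[of i] den_one, symmetric] by (rule imageI[OF frac_carrier[OF r den_one]])
  then have "set chi_poly \<subseteq> pull ` carrier QL" unfolding chi_poly_def set_map by (rule image_subsetI)
  moreover have "hd chi_poly = \<one>\<^bsub>QS\<^esub>"
    unfolding chi_poly_def using fibre_poly_monic(2)[OF n] by (simp add: rat_ring_one comp_def)
  ultimately show "chi_poly \<in> carrier ((pull ` carrier QL)[X]\<^bsub>QS\<^esub>)"
    by (simp add: univ_poly_carrier[symmetric] polynomial_def)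
  show "length chi_poly = Suc (2 * half_dim)" by (simp add: chi_poly_def)
  have z: "(\<Sum>i<Suc (2 * half_dim). ?e i (pr2 g) * spin_chi g ^ i) = 0" if g: "g \<in> Spin B" for g
  proof -
    have "?e i (pr2 g) * spin_chi g ^ i = chi_scale ^ (2 * half_dim) * (poly.coeff (fibre_poly (pr2 g)) i * pr0 g ^ i)" if "i < Suc (2 * half_dim)" for i
    proof -
      have "chi_scale ^ (2 * half_dim) = chi_scale ^ (2 * half_dim - i) * chi_scale ^ i" using that by (simp flip: power_add)
      then show ?thesis by (simp only: spin_chi_pr0 power_mult_distrib mult_ac)
    qed
    then have "(\<Sum>i<Suc (2 * half_dim). ?e i (pr2 g) * spin_chi g ^ i) = chi_scale ^ (2 * half_dim) * poly (fibre_poly (pr2 g)) (pr0 g)"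
      unfolding fibre_poly_sum[OF n] sum_distrib_left by (intro sum.cong refl) (simp only: lessThan_iff)
    then show ?thesis by (simp only: fibre_poly_Spin_all[OF n g] mult_zero_right)
  qed
  show "ring.eval QS chi_poly chi = \<zero>\<^bsub>QS\<^esub>"
    unfolding chi_poly_def eval_chi[OF r den_one] rat_ring_zero
  proof (rule rat_frac_cong)
    fix g assume "g \<in> Spin B"
    then show "(\<Sum>i<Suc (2 * half_dim). ?e i (pr2 g) * spin_chi g ^ i) = 0" by (rule z)
  qed (simp only: comp_def)
qed

text \<open>\<open>chi_poly\<close> bounds the degree of the minimal polynomial from above and
  \<open>chi_eval_zero\<close> from below; a list of length 2m + 1 is a polynomial of degree
  2m.\<close>

lemma chi_algebraic:
  assumes n: "CARD('n) \<ge> 2"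
  shows "(ring.algebraic QS over (pull ` carrier QL)) chi"
    "length (ring.Irr QS (pull ` carrier QL) chi) = Suc (2 * half_dim)"
proof -
  interpret S: field QS by (rule Spin_field[OF n])
  note K = pull_subfield[OF n]
  note cp = chi_poly[OF n]
  have "chi_poly \<noteq> []" using cp(2) by auto
  then show alg: "(ring.algebraic QS over (pull ` carrier QL)) chi" by (rule S.algebraicI[OF cp(1) _ cp(3)])
  note I = S.IrrE[OF K chi_carrier alg]
  let ?I = "ring.Irr QS (pull ` carrier QL) chi"
  have ne: "?I \<noteq> []" using S.pirreducibleE(1)[OF subfieldE(1)[OF K] I(1,2)] .
  have "length ?I - 1 \<le> length chi_poly - 1"
    by (rule S.pdivides_imp_degree_le[OF subfieldE(1)[OF K] I(1) cp(1) \<open>chi_poly \<noteq> []\<close> S.Irr_minimal[OF K chi_carrier alg cp(1,3)]])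
  moreover have "\<not> length ?I \<le> 2 * half_dim" using chi_eval_zero[OF n I(1) _ I(4)] ne by blast
  ultimately show "length ?I = Suc (2 * half_dim)" using cp(2) by simp
qed

text \<open>With c = \<open>pr0 g\<close> and u = \<open>pr2 g\<close>, a coordinate g_I of degree
  2k satisfies c^k g_I = c G(u, k)_I. Since c^k is a nonzero element of the extension, g_I lies in
  it. Polynomials in the coordinates follow, and then their quotients.\<close>

lemma chi_generates:
  assumes n: "CARD('n) \<ge> 2"
  shows "ring.simple_extension QS (pull ` carrier QL) chi = carrier QS"
proof -
  interpret S: field QS by (rule Spin_field[OF n])
  note K = pull_subfield[OF n]
  let ?E = "ring.simple_extension QS (pull ` carrier QL) chi"
  have E: "subfield ?E QS" using S.simple_extension_is_subfield[OF K chi_carrier] chi_algebraic(1)[OF n] by blast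
  note Er = subringE[OF subfieldE(1)[OF E]]
  have KE: "pull ` carrier QL \<subseteq> ?E" by (rule S.simple_extension_incl[OF pull_carrier chi_carrier])
  have const: "rat_frac (Spin B) (\<lambda>_. c) (\<lambda>_. 1) \<in> ?E" for c using pull_const KE by blast
  have mult: "rat_frac (Spin B) (\<lambda>g. f g * f' g) (\<lambda>_. 1) \<in> ?E"
    if "rat_frac (Spin B) f (\<lambda>_. 1) \<in> ?E" "rat_frac (Spin B) f' (\<lambda>_. 1) \<in> ?E" "reg (Spin B) f" "reg (Spin B) f'" for f f'
    using Er(6)[OF that(1,2)] frac_mult[OF that(3) den_one that(4) den_one] by simp
  have p0: "rat_frac (Spin B) pr0 (\<lambda>_. 1) \<in> ?E"
  proof -
    have "rat_frac (Spin B) (\<lambda>g. (1 / chi_scale) * spin_chi g) (\<lambda>_. 1) \<in> ?E"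
      by (intro mult const S.simple_extension_mem[OF subfieldE(1)[OF K] chi_carrier] reg_const reg_chi)
    moreover have "(\<lambda>g :: 'n ext. (1 / chi_scale) * spin_chi g) = pr0" using chi_scale by (simp add: fun_eq_iff spin_chi_pr0)
    ultimately show ?thesis by simp
  qed
  have r0: "reg (Spin B) pr0" by (rule reg_poly[OF poly_fun_pr0])
  have p0k: "rat_frac (Spin B) (\<lambda>g. pr0 g ^ k) (\<lambda>_. 1) \<in> ?E" for k
  proof (induction k)
    case (Suc k)
    show ?case using mult[OF p0 Suc r0 reg_power[OF r0]] by simp
  qed (simp add: const)
  have co: "rat_frac (Spin B) (\<lambda>g. g $ I) (\<lambda>_. 1) \<in> ?E" for I
  proof (cases "even (card I)")
    case True
    then obtain k where k: "card I = 2 * k" by blast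
    let ?p = "rat_frac (Spin B) (\<lambda>g. pr0 g ^ k) (\<lambda>_. 1)" and ?c = "rat_frac (Spin B) (\<lambda>g. g $ I) (\<lambda>_. 1)"
    have rG: "reg (ext_degree 2) (\<lambda>u. G u k $ I)"
      using poly_map_G[OF poly_map_id, of k] by (intro reg_poly) (simp add: poly_map_def)
    have "rat_frac (Spin B) (\<lambda>g. G (pr2 g) k $ I) (\<lambda>_. 1) \<in> ?E"
      using pull_frac[OF rG den_one] frac_carrier[OF rG den_one] KE by (auto simp: comp_def)
    moreover have rG': "reg (Spin B) (\<lambda>g. G (pr2 g) k $ I)"
      using dominantD(1)[OF pr2_dominant rG] by (simp add: comp_def)
    ultimately have 1: "rat_frac (Spin B) (\<lambda>g. pr0 g * G (pr2 g) k $ I) (\<lambda>_. 1) \<in> ?E" by (intro mult p0 r0)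
    have rc: "reg (Spin B) (\<lambda>g. g $ I)" by (rule reg_poly[OF poly_fun.coord])
    have "?p \<otimes>\<^bsub>QS\<^esub> ?c = rat_frac (Spin B) (\<lambda>g. pr0 g ^ k * g $ I) (\<lambda>_. 1)"
      using frac_mult[OF reg_power[OF r0] den_one rc den_one] by simp
    also have "\<dots> = rat_frac (Spin B) (\<lambda>g. pr0 g * G (pr2 g) k $ I) (\<lambda>_. 1)"
      by (rule rat_frac_cong) (simp_all add: Spin_parts_all[OF n _ k])
    finally have 2: "?p \<otimes>\<^bsub>QS\<^esub> ?c \<in> ?E" using 1 by simp
    have "?p \<noteq> \<zero>\<^bsub>QS\<^esub>" using frac_zero_iff[OF reg_power[OF r0, of k] den_one] Spin_one by (auto simp: pr0_simps)
    then show ?thesis using S.subfield_m_inv_simprule[OF E _ frac_carrier[OF rc den_one] 2] p0k by blast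
  next
    case False
    have "rat_frac (Spin B) (\<lambda>g. g $ I) (\<lambda>_. 1) = rat_frac (Spin B) (\<lambda>_. 0) (\<lambda>_. 1)"
      by (rule rat_frac_cong) (use False in \<open>auto simp: Spin_iff ext_even_def\<close>)
    then show ?thesis using const by simp
  qed
  have fE: "rat_frac (Spin B) f (\<lambda>_. 1) \<in> ?E" if "poly_fun f" for f
    using that
  proof (induction f rule: poly_fun.induct)
    case (add f g)
    have "rat_frac (Spin B) f (\<lambda>_. 1) \<oplus>\<^bsub>QS\<^esub> rat_frac (Spin B) g (\<lambda>_. 1) = rat_frac (Spin B) (\<lambda>x. f x + g x) (\<lambda>_. 1)"
      using add by (intro frac_add_same reg_poly den_one)
    then show ?case using Er(7)[OF add.IH] by simp
  next
    case (mult f g)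
    \<comment> \<open>The case name shadows the fact \<open>mult\<close> proved above, which is
      therefore cited by its statement.\<close>
    then show ?case using \<open>\<And>f f'. _ \<Longrightarrow> _ \<Longrightarrow> _ \<Longrightarrow> _ \<Longrightarrow> rat_frac (Spin B) (\<lambda>g. f g * f' g) (\<lambda>_. 1) \<in> ?E\<close> reg_poly by blast
  qed (rule const co)+
  have rE: "rat_frac (Spin B) f (\<lambda>_. 1) \<in> ?E" if rf: "reg (Spin B) f" for f
  proof -
    obtain p where p: "poly_fun p" "\<forall>g\<in>Spin B. f g = p g" using rf by (auto simp: reg_def)
    have "rat_frac (Spin B) f (\<lambda>_. 1) = rat_frac (Spin B) p (\<lambda>_. 1)" by (rule rat_frac_cong) (simp_all add: p)
    then show ?thesis using fE[OF p(1)] by simp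
  qed
  have "F \<in> ?E" if F: "F \<in> carrier QS" for F
  proof -
    obtain p q where F': "F = rat_frac (Spin B) p q" and r: "reg (Spin B) p" "den (Spin B) q"
      using F by (rule frac_cases)
    have "rat_frac (Spin B) q (\<lambda>_. 1) \<otimes>\<^bsub>QS\<^esub> F = rat_frac (Spin B) (\<lambda>g. q g * p g) (\<lambda>g. 1 * q g)"
      unfolding F' by (rule frac_mult[OF den_reg[OF r(2)] den_one r])
    also have "\<dots> = rat_frac (Spin B) p (\<lambda>_. 1)"
      by (rule frac_eqI) (use r in \<open>simp_all add: reg_simps\<close>)
    finally have 1: "rat_frac (Spin B) q (\<lambda>_. 1) \<otimes>\<^bsub>QS\<^esub> F \<in> ?E" using rE[OF r(1)] by simp
    obtain g where "g \<in> Spin B" "q g \<noteq> 0" using r(2) Spin_one by (elim den_nonzero) auto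
    then have "rat_frac (Spin B) q (\<lambda>_. 1) \<noteq> \<zero>\<^bsub>QS\<^esub>" using frac_zero_iff[OF den_reg[OF r(2)] den_one] by blast
    then show ?thesis using S.subfield_m_inv_simprule[OF E _ F 1] rE[OF den_reg[OF r(2)]] by blast
  qed
  then show ?thesis using S.simple_extension_in_carrier[OF pull_carrier chi_carrier] by blast
qed

end

section \<open>Invariants\<close>

context nondeg_form
begin

lemma two_half_dim: "2 * half_dim = (if even CARD('n) then CARD('n) else CARD('n) - 1)"
  by (auto simp: half_dim_def elim!: evenE oddE)

lemma chi_dimension:
  assumes n: "CARD('n) \<ge> 2"
  shows "ring.dimension QS (2 * half_dim) (pull ` carrier QL) (carrier QS)"
proof -
  interpret S: field QS by (rule Spin_field[OF n])
  show ?thesis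
    using S.dimension_simple_extension[OF pull_subfield[OF n] chi_carrier chi_algebraic(1)[OF n]]
    unfolding chi_generates[OF n] chi_algebraic(2)[OF n] by simp
qed

text \<open>On the two points 1 and -1 chi takes opposite nonzero values, so every function is a + b
  chi by interpolation. The ring is a product of two copies of the complex numbers here, not a
  field.\<close>

lemma one_dim_generates:
  assumes n: "CARD('n) = 1"
  shows "ring.simple_extension QS (pull ` carrier QL) chi = carrier QS"
proof -
  interpret S: cring QS by (rule rat_ring_cring)
  note Spin = one_dim(1)[OF n]
  let ?E = "ring.simple_extension QS (pull ` carrier QL) chi"
  have "F \<in> ?E" if F: "F \<in> carrier QS" for F
  proof -
    obtain p q where F': "F = rat_frac (Spin B) p q" and r: "reg (Spin B) p" "den (Spin B) q"
      using F by (rule frac_cases)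
    have q0: "q (s *s ext_one) \<noteq> 0" if s: "s = 1 \<or> s = - 1" for s
    proof
      assume z: "q (s *s ext_one) = 0"
      \<comment> \<open>This function vanishes at -s but not at s. If q vanished at s, their product
        would be zero everywhere and q would be a zero divisor.\<close>
      have "reg (Spin B) (\<lambda>g. 1 + s * pr0 g)" by (intro reg_add reg_const reg_mult reg_poly poly_fun_pr0)
      moreover have "(1 + s * pr0 g) * q g = 0" if "g \<in> Spin B" for g
        using that s z unfolding Spin by (auto simp: pr0_simps)
      moreover have "s *s ext_one \<in> Spin B" using s by (auto simp: Spin)
      ultimately have "1 + s * pr0 (s *s (ext_one :: 'n ext)) = 0" by (rule den_cancel[OF r(2)])
      then show False using s by (auto simp: pr0_simps)
    qed
    have q: "q ext_one \<noteq> 0" "q (- ext_one) \<noteq> 0" using q0[of 1] q0[of "- 1"] by simp_all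
    define a where "a = (p ext_one / q ext_one + p (- ext_one) / q (- ext_one)) / 2"
    define b where "b = (p ext_one / q ext_one - p (- ext_one) / q (- ext_one)) / 2"
    have ab: "a + b = p ext_one / q ext_one" "a - b = p (- ext_one) / q (- ext_one)"
      by (simp_all add: a_def b_def field_simps)
    let ?b = "rat_frac (Spin B) (\<lambda>_. b / chi_scale) (\<lambda>_. 1)" and ?a = "rat_frac (Spin B) (\<lambda>_. a) (\<lambda>_. 1)"
    have "?b \<otimes>\<^bsub>QS\<^esub> chi = rat_frac (Spin B) (\<lambda>g. (b / chi_scale) * spin_chi g) (\<lambda>_. 1)"
      using frac_mult[OF reg_const den_one reg_chi den_one, of "Spin B" "b / chi_scale"] by simp
    moreover have rb: "reg (Spin B) (\<lambda>g. (b / chi_scale) * spin_chi g)" by (intro reg_mult reg_const reg_chi)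
    ultimately have "?b \<otimes>\<^bsub>QS\<^esub> chi \<oplus>\<^bsub>QS\<^esub> ?a = rat_frac (Spin B) (\<lambda>g. (b / chi_scale) * spin_chi g + a) (\<lambda>_. 1)"
      using frac_add_same[OF _ reg_const den_one, of "Spin B" "\<lambda>g. (b / chi_scale) * spin_chi g" a] by simp
    also have "\<dots> = F" unfolding F'
    proof (rule frac_eqI[OF reg_add[OF rb reg_const] den_one r])
      fix g assume "g \<in> Spin B"
      then consider "g = ext_one" | "g = - ext_one" unfolding Spin by blast
      then show "((b / chi_scale) * spin_chi g + a) * q g = p g * 1"
      proof cases
        case 1
        have "(b / chi_scale) * spin_chi g + a = a + b" using chi_scale by (simp add: 1 spin_chi_pr0 pr0_simps)
        then show ?thesis unfolding ab using q by (simp add: 1)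
      next
        case 2
        have "(b / chi_scale) * spin_chi g + a = a - b" using chi_scale by (simp add: 2 spin_chi_pr0 pr0_simps)
        then show ?thesis unfolding ab using q by (simp add: 2)
      qed
    qed
    finally have e: "?b \<otimes>\<^bsub>QS\<^esub> chi \<oplus>\<^bsub>QS\<^esub> ?a = F" .
    have "?b \<in> ?E" using S.simple_extension_incl[OF pull_carrier chi_carrier] pull_const by blast
    then have "?b \<otimes>\<^bsub>QS\<^esub> chi \<oplus>\<^bsub>QS\<^esub> ?a \<in> ?E" using pull_const by (rule S.simple_extension.lin)
    then show ?thesis unfolding e .
  qed
  then show ?thesis using S.simple_extension_in_carrier[OF pull_carrier chi_carrier] by blast
qed

lemma generates: "ring.simple_extension QS (pull ` carrier QL) chi = carrier QS"
  using one_dim_generates chi_generates card_cases by blast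

lemma conj_frac:
  assumes h: "h \<in> Spin B" and r: "reg (Spin B) p" "den (Spin B) q"
  shows "rat_pullback (Spin B) (spin_conj B h) (rat_frac (Spin B) p q) = rat_frac (Spin B) (p \<circ> spin_conj B h) (q \<circ> spin_conj B h)"
  by (rule pullback_frac[OF Spin_conj_dominant[OF h] r])

lemma conj_chi: "h \<in> Spin B \<Longrightarrow> rat_pullback (Spin B) (spin_conj B h) chi = chi"
  unfolding conj_frac[OF _ reg_chi den_one]
  by (rule rat_frac_cong) (simp_all add: spin_chi_pr0 pr0_spin_conj)

lemma conj_pull:
  assumes h: "h \<in> Spin B" and F: "F \<in> carrier QL"
  shows "rat_pullback (Spin B) (spin_conj B h) (pull F) = pull (rat_pullback (ext_degree 2) (spin_conj B h) F)"
proof -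
  obtain p q where F': "F = rat_frac (ext_degree 2) p q" and r: "reg (ext_degree 2) p" "den (ext_degree 2) q"
    using F by (rule frac_cases)
  note d = dominantD[OF pr2_dominant] and d' = dominantD[OF L_conj_dominant[OF h]]
  show ?thesis
    unfolding F' pull_frac[OF r] conj_frac[OF h d(1)[OF r(1)] d(2)[OF r(2)]] pullback_frac[OF L_conj_dominant[OF h] r]
      pull_frac[OF d'(1)[OF r(1)] d'(2)[OF r(2)]]
    by (rule rat_frac_cong) (simp_all add: pr2_spin_conj[OF h])
qed

lemma invariants_carrier: "rat_invariants B Y \<subseteq> carrier (rat_ring Y)"
  by (auto simp: rat_invariants_def)

lemma invariants_extension:
  "ring.simple_extension QS (pull ` rat_invariants B (ext_degree 2)) chi \<subseteq> rat_invariants B (Spin B)"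
proof
  interpret S: cring QS by (rule rat_ring_cring)
  interpret L: cring QL by (rule rat_ring_cring)
  fix F assume "F \<in> ring.simple_extension QS (pull ` rat_invariants B (ext_degree 2)) chi"
  then show "F \<in> rat_invariants B (Spin B)"
  proof (induction rule: S.simple_extension.induct)
    case zero
    have "rat_pullback (Spin B) (spin_conj B h) \<zero>\<^bsub>QS\<^esub> = \<zero>\<^bsub>QS\<^esub>" if "h \<in> Spin B" for h
      unfolding rat_ring_zero conj_frac[OF that reg_const den_one] by (simp add: comp_def)
    then show ?case by (simp add: rat_invariants_def)
  next
    case (lin F1 F2)
    then obtain G2 where G2: "F2 = pull G2" "G2 \<in> rat_invariants B (ext_degree 2)" by blast
    have c: "F1 \<in> carrier QS" "G2 \<in> carrier QL" using lin G2 invariants_carrier by blast+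
    then have c2: "F2 \<in> carrier QS" using pull_carrier G2(1) by blast
    have "rat_pullback (Spin B) (spin_conj B h) (F1 \<otimes>\<^bsub>QS\<^esub> chi \<oplus>\<^bsub>QS\<^esub> F2) = F1 \<otimes>\<^bsub>QS\<^esub> chi \<oplus>\<^bsub>QS\<^esub> F2" if h: "h \<in> Spin B" for h
    proof -
      note m = ring_hom_memE[OF pullback_hom[OF Spin_conj_dominant[OF h]]]
      have "rat_pullback (Spin B) (spin_conj B h) F2 = F2"
        unfolding G2(1) conj_pull[OF h c(2)] using G2(2) h by (simp add: rat_invariants_def)
      moreover have "rat_pullback (Spin B) (spin_conj B h) F1 = F1" using lin h by (simp add: rat_invariants_def)
      ultimately show ?thesis using c c2 chi_carrier conj_chi[OF h] by (simp add: m)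
    qed
    then show ?case using c c2 chi_carrier by (simp add: rat_invariants_def)
  qed
qed

text \<open>Membership is shown through an explicit coefficient list of F over the pulled back
  field, of length at most 2m, each entry of which turns out to come from an invariant.\<close>

lemma extension_invariants:
  assumes n: "CARD('n) \<ge> 2"
  shows "rat_invariants B (Spin B) \<subseteq> ring.simple_extension QS (pull ` rat_invariants B (ext_degree 2)) chi"
proof
  interpret S: field QS by (rule Spin_field[OF n])
  note K = pull_subfield[OF n] and alg = chi_algebraic[OF n]
  fix F assume F: "F \<in> rat_invariants B (Spin B)"
  then have "F \<in> S.Span (pull ` carrier QL) (S.exp_base chi (length (S.Irr (pull ` carrier QL) chi) - 1))"
    unfolding S.Span_exp_base[OF K chi_carrier alg(1)] chi_generates[OF n] using invariants_carrier by blast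
  then have "\<exists>p. p \<in> carrier ((pull ` carrier QL)[X]\<^bsub>QS\<^esub>) \<and> length p \<le> 2 * half_dim \<and> F = S.eval p chi"
    unfolding S.Span_eq_eval_img[OF K chi_carrier] alg(2) by auto
  then obtain p where p: "p \<in> carrier ((pull ` carrier QL)[X]\<^bsub>QS\<^esub>)" "length p \<le> 2 * half_dim" "F = S.eval p chi"
    by blast
  have pK: "set p \<subseteq> pull ` carrier QL" using p(1) by (auto simp: univ_poly_carrier[symmetric] polynomial_def)
  define k where "k = length p"
  obtain c d where c: "\<And>i. reg (ext_degree 2) (c i)" and d: "den (ext_degree 2) d"
      and e: "p = map (\<lambda>i. rat_frac (Spin B) (c i \<circ> pr2) (d \<circ> pr2)) (rev [0..<k])"
    using pull_list[OF pK] unfolding k_def by metis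
  have Fe: "F = rat_frac (Spin B) (\<lambda>g. \<Sum>i<k. c i (pr2 g) * spin_chi g ^ i) (d \<circ> pr2)"
    unfolding p(3) e by (rule eval_chi[OF c d])
  have rF: "reg (Spin B) (\<lambda>g. \<Sum>i<k. c i (pr2 g) * spin_chi g ^ i)"
    using dominantD(1)[OF pr2_dominant c] by (intro reg_sum reg_mult reg_power reg_chi) (simp add: comp_def)
  note dF = dominantD(2)[OF pr2_dominant d]
  \<comment> \<open>This is the invariance of c_i / d with denominators cleared. As chi is constant
    on conjugacy classes, F and its conjugate are both expanded in powers of chi below 2m, and such
    expansions are unique.\<close>
  have inv: "c i u * d (spin_conj B h u) = c i (spin_conj B h u) * d u" if h: "h \<in> Spin B" and i: "i < k" and u: "u \<in> ext_degree 2" for h i u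
  proof -
    let ?c = "\<lambda>i u. c i u * d (spin_conj B h u) - c i (spin_conj B h u) * d u"
    have "F = rat_frac (Spin B) ((\<lambda>g. \<Sum>i<k. c i (pr2 g) * spin_chi g ^ i) \<circ> spin_conj B h) (d \<circ> pr2 \<circ> spin_conj B h)"
      using F h conj_frac[OF h rF dF] unfolding Fe by (simp add: rat_invariants_def)
    then have fe: "rat_frac (Spin B) (\<lambda>g. \<Sum>i<k. c i (pr2 g) * spin_chi g ^ i) (d \<circ> pr2) =
        rat_frac (Spin B) ((\<lambda>g. \<Sum>i<k. c i (pr2 g) * spin_chi g ^ i) \<circ> spin_conj B h) (d \<circ> pr2 \<circ> spin_conj B h)"
      unfolding Fe .
    have hc: "spin_chi (spin_conj B h g) = spin_chi g" for g
      by (simp add: spin_chi_pr0 pr0_spin_conj[OF h])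
    have "?c i u = 0"
    proof (rule chi_independent[OF n _ _ _ i u])
      have "reg (ext_degree 2) (\<lambda>u. c j (spin_conj B h u))" "reg (ext_degree 2) (\<lambda>u. d (spin_conj B h u))" for j
        using dominantD(1)[OF L_conj_dominant[OF h] c[of j]] dominantD(1)[OF L_conj_dominant[OF h] den_reg[OF d]]
        by (simp_all add: comp_def)
      then show "reg (ext_degree 2) (?c j)" for j by (intro reg_diff reg_mult c den_reg[OF d])
      show "k \<le> 2 * half_dim" using p(2) by (simp add: k_def)
      fix g assume g: "g \<in> Spin B"
      have "(\<Sum>i<k. c i (pr2 g) * spin_chi g ^ i) * d (spin_conj B h (pr2 g)) =
          (\<Sum>i<k. c i (spin_conj B h (pr2 g)) * spin_chi g ^ i) * d (pr2 g)"
        using frac_eqD[OF fe rF dF g] by (simp add: pr2_spin_conj[OF h] hc)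
      moreover have "(\<Sum>i<k. ?c i (pr2 g) * spin_chi g ^ i) = (\<Sum>i<k. c i (pr2 g) * spin_chi g ^ i) * d (spin_conj B h (pr2 g)) -
          (\<Sum>i<k. c i (spin_conj B h (pr2 g)) * spin_chi g ^ i) * d (pr2 g)"
        unfolding sum_distrib_right sum_subtractf[symmetric]
        by (rule sum.cong[OF refl], simp only: left_diff_distrib) (simp only: mult_ac)
      ultimately show "(\<Sum>i<k. ?c i (pr2 g) * spin_chi g ^ i) = 0" by simp
    qed
    then show ?thesis by simp
  qed
  have "rat_frac (ext_degree 2) (c i) d \<in> rat_invariants B (ext_degree 2)" if i: "i < k" for i
    unfolding rat_invariants_def
  proof (intro CollectI conjI ballI frac_carrier c d)
    fix h assume h: "h \<in> Spin B"
    note d' = dominantD[OF L_conj_dominant[OF h]]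
    show "rat_pullback (ext_degree 2) (spin_conj B h) (rat_frac (ext_degree 2) (c i) d) = rat_frac (ext_degree 2) (c i) d"
      unfolding pullback_frac[OF L_conj_dominant[OF h] c d]
      by (rule frac_eqI[OF d'(1)[OF c] d'(2)[OF d] c d]) (simp add: inv[OF h i])
  qed
  then have "rat_frac (Spin B) (c i \<circ> pr2) (d \<circ> pr2) \<in> pull ` rat_invariants B (ext_degree 2)" if "i < k" for i
    using that unfolding pull_frac[OF c[of i] d, symmetric] by blast
  then have "set p \<subseteq> pull ` rat_invariants B (ext_degree 2)" unfolding e by auto
  then have "p \<in> carrier ((pull ` rat_invariants B (ext_degree 2))[X]\<^bsub>QS\<^esub>)"
    using p(1) by (auto simp: univ_poly_carrier[symmetric] polynomial_def)
  moreover have "pull ` rat_invariants B (ext_degree 2) \<subseteq> carrier QS"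
    using invariants_carrier pull_carrier by blast
  ultimately show "F \<in> S.simple_extension (pull ` rat_invariants B (ext_degree 2)) chi"
    unfolding p(3) using S.simple_extension_as_eval_img[OF _ chi_carrier] by blast
qed

text \<open>Conjugation by 1 or -1 is trivial, and the only bivector is 0.\<close>

lemma one_dim_invariants:
  assumes n: "CARD('n) = 1"
  shows "rat_invariants B (Spin B) = carrier QS" "rat_invariants B (ext_degree 2) = carrier QL"
proof -
  have 1: "spin_conj B h g = g" if "h \<in> Spin B" "g \<in> Spin B" for h g
    using that unfolding one_dim(1)[OF n] spin_conj_def
    by (auto simp: cm_simps cmul_one_left cmul_one_right clin_rules[OF clin_ext_rev])
  have 2: "spin_conj B h u = u" if "u \<in> ext_degree 2" for h u
    using that unfolding one_dim(2)[OF n] by (auto simp: clin_rules[OF clin_spin_conj])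
  have triv: "rat_invariants B Y = carrier (rat_ring Y)"
    if d: "\<And>h. h \<in> Spin B \<Longrightarrow> dominant_map Y (spin_conj B h) Y" and i: "\<And>h g. h \<in> Spin B \<Longrightarrow> g \<in> Y \<Longrightarrow> spin_conj B h g = g" for Y
  proof -
    have "rat_pullback Y (spin_conj B h) F = F" if h: "h \<in> Spin B" and F: "F \<in> carrier (rat_ring Y)" for h F
    proof -
      obtain p q where F': "F = rat_frac Y p q" and r: "reg Y p" "den Y q" using F by (rule frac_cases)
      show ?thesis unfolding F' pullback_frac[OF d[OF h] r]
        by (rule rat_frac_cong) (simp_all add: i[OF h])
    qed
    then show ?thesis by (auto simp: rat_invariants_def)
  qed
  show "rat_invariants B (Spin B) = carrier QS" by (rule triv[OF Spin_conj_dominant 1])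
  show "rat_invariants B (ext_degree 2) = carrier QL" by (rule triv[OF L_conj_dominant 2])
qed

lemma invariants_generated:
  "rat_invariants B (Spin B) = ring.simple_extension QS (pull ` rat_invariants B (ext_degree 2)) chi"
proof (cases "CARD('n) \<ge> 2")
  case True
  then show ?thesis using invariants_extension extension_invariants by blast
next
  case False
  then have "CARD('n) = 1" using card_cases by blast
  then show ?thesis by (simp only: one_dim_invariants one_dim_generates)
qed

lemma chi_scale_square: "chi_scale ^ 2 = 2 ^ CARD('n)"
proof -
  have "(2 powr (real CARD('n) / 2)) ^ 2 = 2 powr real CARD('n)"
    by (simp add: power2_eq_square flip: powr_add)
  also have "\<dots> = 2 ^ CARD('n)" by (simp add: powr_realpow)
  finally have "of_real ((2 powr (real CARD('n) / 2)) ^ 2) = (of_real (2 ^ CARD('n)) :: complex)" by (rule arg_cong)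
  then show ?thesis by (simp add: chi_scale_def)
qed

lemma spin_chi_square: "a \<in> Spin B \<Longrightarrow> spin_chi a ^ 2 = det (mat 1 + spin_T B a)"
  using pr0_det[of a] by (simp add: spin_chi_pr0 power_mult_distrib chi_scale_square)

lemma pr0_spin_chi: "pr0 g = of_real (2 powr (- real CARD('n) / 2)) * spin_chi (g :: 'n ext)"
proof -
  have "(2 powr (- real CARD('n) / 2)) * (2 powr (real CARD('n) / 2)) = (1 :: real)"
    by (simp flip: powr_add)
  then have "of_real ((2 powr (- real CARD('n) / 2)) * (2 powr (real CARD('n) / 2))) = (1 :: complex)" by simp
  then have 1: "of_real (2 powr (- real CARD('n) / 2)) * chi_scale = 1" unfolding chi_scale_def of_real_mult .
  have "of_real (2 powr (- real CARD('n) / 2)) * spin_chi g = (of_real (2 powr (- real CARD('n) / 2)) * chi_scale) * pr0 g"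
    by (simp only: spin_chi_pr0 mult.assoc)
  then show ?thesis unfolding 1 by simp
qed

end

theorem theorem7p15:
  fixes B :: "'n::{finite,linorder} form"
    and \<mu> :: "'n ext"
    and \<sigma> :: "'n ext \<Rightarrow> complex^'s::finite \<Rightarrow> complex^'s"
  assumes B: "nonsingular_symmetric_form B"
    and \<mu>: "\<mu> \<in> ext_degree CARD('n)" "cmul B \<mu> \<mu> = ext_one"
    and \<sigma>: "spin_module B \<mu> \<sigma>"
  shows
    "let \<Phi> = gen_cayley \<sigma>;
         L = (ext_degree 2 :: 'n ext set);
         QSpin = rat_ring (Spin B);
         QL = rat_ring L;
         pull = rat_pullback (Spin B) \<Phi>;
         chi = rat_frac (Spin B) spin_chi (\<lambda>_. 1)
     in
       \<comment> \<open>the formula for the generalized Cayley mapping\<close>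
       \<Phi> \<in> Spin B \<rightarrow> L \<and>
       (\<forall>g\<in>Spin_star B.
          (\<exists>r. r ^ 2 = det (mat 1 + spin_T B g) \<and>
               pr0 g = of_real (2 powr (- real CARD('n) / 2)) * r) \<and>
          \<Phi> g = (- 2 * pr0 g) *s the_inv_into L (tau B) (cayley (spin_T B g))) \<and>
       \<comment> \<open>factorization through the classical Cayley transform\<close>
       Spin_star B = {g \<in> Spin B. spin_T B g \<in> SO_star B} \<and>
       cayley \<in> SO_star B \<rightarrow> Lie_SO_star B \<and>
       bij_betw (tau B) L (Lie_SO B) \<and>
       (\<exists>f\<in>regular_funs (Spin B). \<forall>g\<in>Spin_star B.
          \<Phi> g = f g *s the_inv_into L (tau B) (cayley (spin_T B g))) \<and>
       \<comment> \<open>the field extension and its degree\<close>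
       pull \<in> ring_hom QL QSpin \<and> inj_on pull (carrier QL) \<and>
       (CARD('n) \<ge> 2 \<longrightarrow>
          field QSpin \<and> subfield (pull ` carrier QL) QSpin \<and>
          ring.dimension QSpin (if even CARD('n) then CARD('n) else CARD('n) - 1)
            (pull ` carrier QL) (carrier QSpin)) \<and>
       \<comment> \<open>generation by the function \<open>\<chi>\<close>\<close>
       restrict spin_chi (Spin B) \<in> regular_funs (Spin B) \<and>
       (\<forall>a\<in>Spin B. spin_chi a ^ 2 = det (mat 1 + spin_T B a)) \<and>
       rat_invariants B (Spin B) = ring.simple_extension QSpin (pull ` rat_invariants B L) chi \<and>
       carrier QSpin = ring.simple_extension QSpin (pull ` carrier QL) chi"
proof -
  interpret nondeg_form B by (rule nonsingular_nondeg[OF B])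
  interpret spin_rep B \<mu> \<sigma> by unfold_locales (rule \<mu> \<sigma>)+
  let ?L = "ext_degree 2 :: 'n ext set"
  have \<Phi>: "gen_cayley \<sigma> g = pr2 g" if "g \<in> Spin B" for g
    using that by (intro gen_cayley_eq) (simp add: Spin_iff)
  have pull: "rat_pullback (Spin B) (gen_cayley \<sigma>) = pull" by (rule rat_pullback_cong) (rule \<Phi>)
  have formula: "gen_cayley \<sigma> g = (- 2 * pr0 g) *s the_inv_into ?L (tau B) (cayley (spin_T B g))" if "g \<in> Spin_star B" for g
    using that spin_cayley[of g] \<Phi>[of g] by (simp add: Spin_star_def)
  show ?thesis
    unfolding Let_def pull
  proof (intro conjI ballI impI)
    show "gen_cayley \<sigma> \<in> Spin B \<rightarrow> ?L" using \<Phi> by (simp add: pr2_degree)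
    show "Spin_star B = {g \<in> Spin B. spin_T B g \<in> SO_star B}"
      by (auto simp: Spin_star_def SO_star_def spin_T_SO)
    show "cayley \<in> SO_star B \<rightarrow> Lie_SO_star B" using cayley_Lie by blast
    show "bij_betw (tau B) ?L (Lie_SO B)" by (rule tau_bij)
    show "\<exists>f\<in>regular_funs (Spin B). \<forall>g\<in>Spin_star B.
        gen_cayley \<sigma> g = f g *s the_inv_into ?L (tau B) (cayley (spin_T B g))"
    proof (rule bexI[of _ "restrict (\<lambda>g. - 2 * pr0 g) (Spin B)"])
      show "\<forall>g\<in>Spin_star B. gen_cayley \<sigma> g =
          restrict (\<lambda>g. - 2 * pr0 g) (Spin B) g *s the_inv_into ?L (tau B) (cayley (spin_T B g))"
        using formula by (simp add: Spin_star_def)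
      show "restrict (\<lambda>g. - 2 * pr0 g) (Spin B) \<in> regular_funs (Spin B)"
        by (intro reg_regular_funs reg_mult reg_const reg_poly poly_fun_pr0)
    qed
    show "pull \<in> ring_hom QL QS" by (rule pullback_hom[OF pr2_dominant])
    show "inj_on pull (carrier QL)" by (rule pull_inj)
    show "restrict spin_chi (Spin B) \<in> regular_funs (Spin B)" by (intro reg_regular_funs reg_chi)
    show "rat_invariants B (Spin B) = ring.simple_extension QS (pull ` rat_invariants B ?L) chi"
      by (rule invariants_generated)
    show "carrier QS = ring.simple_extension QS (pull ` carrier QL) chi" by (rule generates[symmetric])
  next
    fix g assume g: "g \<in> Spin_star B"
    show "gen_cayley \<sigma> g = (- 2 * pr0 g) *s the_inv_into ?L (tau B) (cayley (spin_T B g))" by (rule formula[OF g])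
    \<comment> \<open>The square root with the prescribed sign is chi(g) itself.\<close>
    show "\<exists>r. r ^ 2 = det (mat 1 + spin_T B g) \<and> pr0 g = of_real (2 powr (- real CARD('n) / 2)) * r"
      using g spin_chi_square pr0_spin_chi[of g] by (intro exI[of _ "spin_chi g"]) (simp add: Spin_star_def)
  next
    fix a assume "a \<in> Spin B"
    then show "spin_chi a ^ 2 = det (mat 1 + spin_T B a)" by (rule spin_chi_square)
  next
    assume n: "2 \<le> CARD('n)"
    show "field QS" by (rule Spin_field[OF n])
    show "subfield (pull ` carrier QL) QS" by (rule pull_subfield[OF n])
    show "ring.dimension QS (if even CARD('n) then CARD('n) else CARD('n) - 1) (pull ` carrier QL) (carrier QS)"
      using chi_dimension[OF n] unfolding two_half_dim .
  qed
qed

end
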